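(* Let $f\in L^p(\mathbb{R}^n_x\times\mathbb{R}^n_v)$, with $p\in(1,\infty)$, be compactly supported in $v$ and such that $v\cdot\nabla_x f\in L^{p'}(\mathbb{R}^n_x\times\mathbb{R}^n_v)$. Then $\tilde f$ belongs to $\dot H^{\frac 12}(\mathbb{R}^n_x)$. More precisely, for any $p\in(1,\infty)$ and any compact set $K\subset\mathbb{R}^n_v$, there exists $C_{p,K}>0$ such that, for all $f\in L^p(\mathbb{R}^n_x\times\mathbb{R}^n_v)$ with $v\cdot\nabla_x f\in L^{p'}(\mathbb{R}^n_x\times\mathbb{R}^n_v)$ and $f(x,v)$ vanishing for $v$ outside $K$, $$\|\tilde f\|_{\dot H^{\frac 12}(\mathbb{R}^n_x)}^2\leq C_{p,K}\|f\|_{L^p(\mathbb{R}^n_x\times\mathbb{R}^n_v)}\|v\cdot\nabla_x f\|_{L^{p'}(\mathbb{R}^n_x\times\mathbb{R}^n_v)}.$$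
   Context: Here $n\geq 1$ and $p'$ denotes the conjugate exponent, $\frac1p+\frac1{p'}=1$. Functions $f(x,v)$ are defined on $\mathbb{R}^n_x\times\mathbb{R}^n_v$, and $v\cdot\nabla_x f$ is understood in the sense of distributions. For a locally integrable $f(x,v)$ compactly supported in $v$, the velocity average is $\tilde f(x)=\int_{\mathbb{R}^n}f(x,v)\,dv$. A function $h$ on $\mathbb{R}^n$ belongs to the homogeneous Sobolev space $\dot H^s(\mathbb{R}^n)$ if $(-\Delta)^{\frac s2}h\in L^2(\mathbb{R}^n)$, and one sets $\|h\|_{\dot H^s}=\|(-\Delta)^{\frac s2}h\|_{L^2}$ (a semi-norm). *)

theory Defs
  imports "HOL-Analysis.Analysis"
begin

text \<open>Functions are complex-valued, which includes the real-valued case. Elements of \<open>L\<^sup>p\<close> are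
  represented by Lebesgue measurable functions; every notion below is invariant under changes on
  null sets.\<close>

definition Lp :: "real \<Rightarrow> ('a::euclidean_space \<Rightarrow> complex) set" where
  "Lp p = {f. f \<in> borel_measurable lebesgue \<and> integrable lebesgue (\<lambda>x. norm (f x) powr p)}"

definition Lp_norm :: "real \<Rightarrow> ('a::euclidean_space \<Rightarrow> complex) \<Rightarrow> real" where
  "Lp_norm p f = (\<integral>x. norm (f x) powr p \<partial>lebesgue) powr (1 / p)"

primrec Ck :: "nat \<Rightarrow> ('a::euclidean_space \<Rightarrow> complex) \<Rightarrow> bool" where
  "Ck 0 f \<longleftrightarrow> continuous_on UNIV f"
| "Ck (Suc k) f \<longleftrightarrow> (\<forall>x. f differentiable (at x)) \<and>
     (\<forall>b\<in>Basis. Ck k (\<lambda>x. frechet_derivative f (at x) b))"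

definition test_functions :: "('a::euclidean_space \<Rightarrow> complex) set" where
  "test_functions = {\<phi>. (\<forall>k. Ck k \<phi>) \<and> compact (closure {x. \<phi> x \<noteq> 0})}"

text \<open>The distribution \<open>v \<cdot> \<nabla>\<^sub>x f\<close> is represented by the function \<open>g\<close>, for locally integrable
  \<open>f\<close> and \<open>g\<close>. The derivative of \<open>\<phi>\<close> at \<open>(x, v)\<close> in the direction \<open>(v, 0)\<close> is \<open>v \<cdot> \<nabla>\<^sub>x \<phi> (x, v)\<close>,
  and \<open>v \<cdot> \<nabla>\<^sub>x\<close> is formally skew-adjoint since \<open>v\<close> does not depend on \<open>x\<close>.\<close>

definition has_transport_derivative ::
    "((real^'n) \<times> (real^'n) \<Rightarrow> complex) \<Rightarrow> ((real^'n) \<times> (real^'n) \<Rightarrow> complex) \<Rightarrow> bool" where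
  "has_transport_derivative f g \<longleftrightarrow>
     (\<forall>\<phi>\<in>test_functions.
        (\<integral>z. f z * frechet_derivative \<phi> (at z) (snd z, 0) \<partial>lebesgue)
          = - (\<integral>z. g z * \<phi> z \<partial>lebesgue))"

definition vanishes_outside :: "(real^'n) set \<Rightarrow> ((real^'n) \<times> (real^'n) \<Rightarrow> complex) \<Rightarrow> bool" where
  "vanishes_outside K f \<longleftrightarrow> (AE z in lebesgue. snd z \<notin> K \<longrightarrow> f z = 0)"

definition velocity_average :: "((real^'n) \<times> (real^'n) \<Rightarrow> complex) \<Rightarrow> real^'n \<Rightarrow> complex" where
  "velocity_average f x = (\<integral>v. f (x, v) \<partial>lebesgue)"

definition fourier :: "('a::euclidean_space \<Rightarrow> complex) \<Rightarrow> 'a \<Rightarrow> complex" where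
  "fourier \<phi> \<xi> = (\<integral>x. cis (- (x \<bullet> \<xi>)) * \<phi> x \<partial>lebesgue)"

text \<open>\<open>(- \<Delta>)\<^sup>a\<close> on test functions: the Fourier multiplier with symbol \<open>|\<xi>|\<^bsup>2 a\<^esup>\<close>.\<close>

definition frac_laplacian :: "real \<Rightarrow> ('a::euclidean_space \<Rightarrow> complex) \<Rightarrow> 'a \<Rightarrow> complex" where
  "frac_laplacian a \<phi> x =
     (\<integral>\<xi>. cis (x \<bullet> \<xi>) * of_real (norm \<xi> powr (2 * a)) * fourier \<phi> \<xi> \<partial>lebesgue)
       / of_real ((2 * pi) ^ DIM('a))"

text \<open>\<open>(- \<Delta>)\<^sup>a h = w\<close> in the sense of distributions. Going through the dual pairing is needed because
  \<open>h\<close> is typically in some \<open>L\<^sup>p\<close> with \<open>p \<noteq> 2\<close>: its Fourier transform is then only a distribution,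
  which cannot be multiplied directly by a symbol that is not smooth at the origin.\<close>

definition has_frac_laplacian ::
    "real \<Rightarrow> ('a::euclidean_space \<Rightarrow> complex) \<Rightarrow> ('a \<Rightarrow> complex) \<Rightarrow> bool" where
  "has_frac_laplacian a h w \<longleftrightarrow>
     (\<forall>\<phi>\<in>test_functions.
        integrable lebesgue (\<lambda>x. h x * frac_laplacian a \<phi> x) \<and>
        integrable lebesgue (\<lambda>x. w x * \<phi> x) \<and>
        (\<integral>x. h x * frac_laplacian a \<phi> x \<partial>lebesgue) = (\<integral>x. w x * \<phi> x \<partial>lebesgue))"

definition Hdot :: "real \<Rightarrow> ('a::euclidean_space \<Rightarrow> complex) set" where
  "Hdot s = {h. \<exists>w\<in>Lp 2. has_frac_laplacian (s / 2) h w}"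

text \<open>Meaningful for \<open>h \<in> Hdot s\<close>; the function chosen is then unique up to null sets.\<close>

definition Hdot_norm :: "real \<Rightarrow> ('a::euclidean_space \<Rightarrow> complex) \<Rightarrow> real" where
  "Hdot_norm s h = Lp_norm 2 (SOME w. w \<in> Lp 2 \<and> has_frac_laplacian (s / 2) h w)"

end

theory Submission
 imports Defs "HOL-Probability.Probability" "HOL-Complex_Analysis.Complex_Analysis"
begin

text \<open>Let \<open>h\<close> be the velocity average of \<open>f\<close> and \<open>g = v \<cdot> \<nabla>\<^sub>x f\<close>. It suffices to bound
 \<open>\<integral> |\<xi> \<cdot> b| |h^(\<xi>)|\<^sup>2 d\<xi>\<close> by \<open>C \<parallel>f\<parallel>\<^sub>p \<parallel>g\<parallel>\<^sub>q\<close> for each vector \<open>b\<close> of the standard basis, where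
 \<open>q\<close> is the conjugate exponent, since \<open>|\<xi>|\<close> is at most the sum of the \<open>|\<xi> \<cdot> b|\<close>. For this, pair
 \<open>f\<close> with its image under two directional Hilbert transforms, one in the position direction \<open>(b, 0)\<close>
 and one in the velocity direction \<open>(0, b)\<close>, and look at how this pairing changes along the free flow
 \<open>S\<^sub>t (x, v) = (x + t v, v)\<close>.

 Write \<open>f^(\<xi>, v)\<close> for the Fourier transform in \<open>x\<close>. The pairing is the integral over \<open>\<xi>\<close> and
 \<open>z\<close> of \<open>i sgn (\<xi> \<cdot> b) / (\<pi> z)\<close> times the correlation \<open>\<integral> f^(\<xi>, v) cnj f^(\<xi>, v - z b) dv\<close>, and the
 flow multiplies the correlation by \<open>exp (i t z \<xi> \<cdot> b)\<close>. Differentiation at \<open>t = 0\<close> produces a factor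
 \<open>i z \<xi> \<cdot> b\<close> which cancels the singular kernel \<open>1 / z\<close> and leaves \<open>-1/\<pi>\<close> times the integral of
 \<open>|\<xi> \<cdot> b|\<close> against \<open>\<integral>\<integral> f^(\<xi>, v) cnj f^(\<xi>, v - z b) dv dz\<close>. The latter is the sum, over all
 lines parallel to \<open>b\<close>, of the squared modulus of the integral of \<open>f^(\<xi>, _)\<close> over the line, hence by
 the Cauchy-Schwarz inequality it controls \<open>|h^(\<xi>)|\<^sup>2\<close>, because \<open>f\<close> is supported in a bounded set of
 velocities. Thus the integral to be bounded is dominated by the derivative of the pairing
 (\<open>line_mass_inequality\<close>, \<open>energy_form_difference\<close>, \<open>regularized_energy_bound\<close>).

 From above, the same derivative is the limit of \<open>1/t\<close> times a sum of two pairings in which one of the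
 functions is \<open>f \<circ> S\<^sub>t - f\<close>. Hilbert transforms are bounded on \<open>L\<^sup>p\<close> by the theorem of M. Riesz, and
 \<open>\<parallel>f \<circ> S\<^sub>t - f\<parallel>\<^sub>q \<le> t \<parallel>g\<parallel>\<^sub>q\<close> since \<open>f \<circ> S\<^sub>t - f\<close> is the integral of \<open>g\<close> along the flow. This is where
 the product \<open>\<parallel>f\<parallel>\<^sub>p \<parallel>g\<parallel>\<^sub>q\<close> comes from (\<open>Riesz_conj_poisson\<close>, \<open>energy_form_bound\<close>,
 \<open>transport_difference_bound\<close>, \<open>velocity_average_energy\<close>).

 All of this is done with kernels made smooth and integrable (conjugate Poisson kernels and a Gaussian
 average) and with \<open>f\<close> truncated to a bounded integrable function; the truncation commutes with the flow
 because it acts on values and on velocities only. The untruncated \<open>h\<close> is merely in \<open>L\<^sup>p\<close>, so the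
 limit is taken in the dual form \<open>|\<integral> h |D|\<^sup>1\<^sup>/\<^sup>2 \<phi>|\<^sup>2 \<le> C \<parallel>f\<parallel>\<^sub>p \<parallel>g\<parallel>\<^sub>q \<parallel>\<phi>\<parallel>\<^sub>2\<^sup>2\<close> for test functions \<open>\<phi>\<close>, which
 makes sense since \<open>|D|\<^sup>1\<^sup>/\<^sup>2 \<phi>\<close> is bounded and integrable (\<open>Lambda_integrable\<close>,
 \<open>velocity_average_pairing\<close>). The Riesz representation theorem turns it into a function \<open>w\<close> in
 \<open>L\<^sup>2\<close> with \<open>(-\<Delta>)\<^sup>1\<^sup>/\<^sup>4 h = w\<close>.\<close>

section \<open>Lebesgue integrals\<close>

text \<open>\<open>NBINT\<close> is to nonnegative integrals what the standard \<open>LBINT\<close> is to Bochner integrals. Several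
 integration facts exist both for the gauge and for the Bochner integral; the short names below refer to
 the latter.\<close>

hide_fact (open) Henstock_Kurzweil_Integration.integrable_bound Henstock_Kurzweil_Integration.integral_cong
 Henstock_Kurzweil_Integration.integral_cnj Henstock_Kurzweil_Integration.integral_diff Henstock_Kurzweil_Integration.integral_norm_bound_integral
 Henstock_Kurzweil_Integration.integral_add Henstock_Kurzweil_Integration.integrable_diff Henstock_Kurzweil_Integration.integral_nonneg
 Henstock_Kurzweil_Integration.integrable_add Henstock_Kurzweil_Integration.integrable_sum

syntax "_nn_lborel" :: "pttrn => logic => logic" ("(2NBINT _./ _)" [0,10] 10)
translations "NBINT x. f" == "CONST nn_integral CONST lborel (\<lambda>x. f)"

abbreviation borel_fun :: "('a::topological_space => 'b::topological_space) set" where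
 "borel_fun \<equiv> borel_measurable borel"

abbreviation L1 :: "('a::euclidean_space => 'b::{banach, second_countable_topology}) => bool" where
 "L1 \<equiv> integrable lborel"

abbreviation ecmod :: "complex => ennreal" where
 "ecmod z \<equiv> ennreal (cmod z)"

lemma integrable_dominated:
 fixes f :: "'a => 'b::{banach, second_countable_topology}" and g :: "'a => real"
 assumes "integrable M g" "f \<in> borel_measurable M" "\<And>x. norm (f x) \<le> g x"
 shows "integrable M f"
 by (rule integrable_bound[OF assms(1,2)]) (use assms(3) in \<open>auto intro!: AE_I2 order_trans[OF _ abs_ge_self]\<close>)

lemma nn_integral_translate:
 fixes f :: "'a::euclidean_space => ennreal"
 assumes [measurable]: "f \<in> borel_fun"
 shows "(NBINT x. f (x + a)) = (NBINT x. f x)"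
proof -
 have "(NBINT x. f x) = (\<integral>\<^sup>+x. f x \<partial>(distr lborel borel ((+) a)))"
  by (simp add: lborel_distr_plus)
 also have "... = (NBINT x. f (a + x))"
  by (subst nn_integral_distr) auto
 finally show ?thesis by (simp add: add.commute)
qed

lemma integral_translate:
 fixes f :: "'a::euclidean_space => 'b::{banach, second_countable_topology}"
 assumes [measurable]: "f \<in> borel_fun"
 shows "(LBINT x. f (x + a)) = (LBINT x. f x)"
proof -
 have "(LBINT x. f x) = (\<integral>x. f x \<partial>(distr lborel borel ((+) a)))"
  by (simp add: lborel_distr_plus)
 also have "... = (LBINT x. f (a + x))"
  by (subst integral_distr) auto
 finally show ?thesis by (simp add: add.commute)
qed

lemma integrable_translate:
 fixes f :: "'a::euclidean_space => 'b::{banach, second_countable_topology}"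
 assumes f: "L1 f"
 shows "L1 (\<lambda>x. f (x + a))"
proof -
 have "integrable (distr lborel borel ((+) a)) f"
  using f by (simp add: lborel_distr_plus)
 then have "L1 (\<lambda>x. f (a + x))"
  by (rule integrable_distr[rotated]) auto
 then show ?thesis by (simp add: add.commute)
qed

lemma lborel_distr_uminus: "distr lborel borel uminus = (lborel :: 'a::euclidean_space measure)"
proof -
 have "(lborel :: 'a measure) = density (distr lborel borel (\<lambda>x. 0 + (-1::real) *\<^sub>R x)) (\<lambda>_. ennreal (\<bar>-1\<bar> ^ DIM('a)))"
  by (rule lborel_affine) simp
 then show ?thesis by (simp add: density_1 uminus_add_conv_diff[symmetric] cong: if_cong)
qed

lemma nn_integral_reflect:
 fixes f :: "'a::euclidean_space => ennreal"
 assumes [measurable]: "f \<in> borel_fun"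
 shows "(NBINT x. f (- x)) = (NBINT x. f x)"
proof -
 have "(NBINT x. f x) = (\<integral>\<^sup>+x. f x \<partial>(distr lborel borel uminus))"
  by (simp add: lborel_distr_uminus)
 also have "... = (NBINT x. f (- x))"
  by (subst nn_integral_distr) auto
 finally show ?thesis by simp
qed

lemma integral_reflect:
 fixes f :: "'a::euclidean_space => 'b::{banach, second_countable_topology}"
 assumes [measurable]: "f \<in> borel_fun"
 shows "(LBINT x. f (- x)) = (LBINT x. f x)"
proof -
 have "(LBINT x. f x) = (\<integral>x. f x \<partial>(distr lborel borel uminus))"
  by (simp add: lborel_distr_uminus)
 also have "... = (LBINT x. f (- x))"
  by (subst integral_distr) auto
 finally show ?thesis by simp
qed

text \<open>Fubini along the lines parallel to \<open>a\<close>, without a change of coordinates: every line meets the slab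
 selected by the indicator in a segment of length one, so averaging \<open>G\<close> over its line before
 restricting to the slab loses nothing.\<close>

lemma nn_integral_by_lines:
 fixes G :: "'a::euclidean_space => ennreal"
 assumes [measurable]: "G \<in> borel_fun" and "a \<noteq> 0"
 shows "(NBINT u. G u)
  = (NBINT u. indicator {0..1} (u \<bullet> a / (a \<bullet> a)) * (NBINT s. G (u + s *\<^sub>R a)))"
proof -
 define w :: "'a => ennreal" where "w u = indicator {0..1} (u \<bullet> a / (a \<bullet> a))" for u
 have w[measurable]: "w \<in> borel_fun" unfolding w_def by measurable
 have aa: "a \<bullet> a \<noteq> 0" using assms by simp
 have one: "(NBINT s. w (u - s *\<^sub>R a)) = 1" for u
 proof -
  define c where "c = u \<bullet> a / (a \<bullet> a)"
  have "w (u - s *\<^sub>R a) = indicator {c - 1..c} s" for s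
   using aa unfolding w_def c_def
   by (auto simp: inner_diff_left diff_divide_distrib indicator_def)
  then show ?thesis by simp
 qed
 have "(NBINT u. G u) = (NBINT u. G u * (NBINT s. w (u - s *\<^sub>R a)))"
  by (simp add: one)
 also have "... = (NBINT u. NBINT s. G u * w (u - s *\<^sub>R a))"
  by (simp add: nn_integral_cmult)
 also have "... = (NBINT s. NBINT u. G u * w (u - s *\<^sub>R a))"
  by (rule lborel_pair.Fubini') measurable
 also have "... = (NBINT s. NBINT u. G (u + s *\<^sub>R a) * w u)"
 proof (rule nn_integral_cong, goal_cases)
  case (1 s)
  show ?case
   using nn_integral_translate[of "\<lambda>u. G u * w (u - s *\<^sub>R a)" "s *\<^sub>R a"] by simp
 qed
 also have "... = (NBINT u. NBINT s. G (u + s *\<^sub>R a) * w u)"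
  by (rule lborel_pair.Fubini') measurable
 also have "... = (NBINT u. w u * (NBINT s. G (u + s *\<^sub>R a)))"
  by (subst nn_integral_multc) (auto simp: mult.commute)
 finally show ?thesis unfolding w_def .
qed

lemma nn_integral_mono_by_lines:
 fixes G H :: "'a::euclidean_space => ennreal"
 assumes [measurable]: "G \<in> borel_fun" "H \<in> borel_fun" and a: "a \<noteq> 0"
  and le: "\<And>u. (NBINT s. G (u + s *\<^sub>R a)) \<le> (NBINT s. H (u + s *\<^sub>R a))"
 shows "(NBINT u. G u) \<le> (NBINT u. H u)"
 by (simp only: nn_integral_by_lines[OF assms(1) a] nn_integral_by_lines[OF assms(2) a])
   (intro nn_integral_mono mult_left_mono le; simp)

text \<open>The free flow \<open>S\<^sub>t\<close> of the transport equation. It preserves Lebesgue measure.\<close>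

definition shear :: "real => 'a::euclidean_space \<times> 'a => 'a \<times> 'a" where
 "shear t z = (fst z + t *\<^sub>R snd z, snd z)"

lemma shear_measurable [measurable]: "shear t \<in> borel_fun"
 unfolding shear_def[abs_def] by (intro borel_measurable_continuous_onI continuous_intros)

lemma shear_measurable_comp [measurable (raw)]:
 assumes [measurable]: "f \<in> borel_measurable M" "g \<in> borel_measurable M"
 shows "(\<lambda>w. shear (f w) (g w :: 'a::euclidean_space \<times> 'a)) \<in> borel_measurable M"
proof -
 have [measurable]: "fst \<in> borel_measurable (borel :: ('a \<times> 'a) measure)" "snd \<in> borel_measurable (borel :: ('a \<times> 'a) measure)"
  by (intro borel_measurable_continuous_onI continuous_intros)+
 show ?thesis unfolding shear_def by measurable
qed

lemma nn_integral_shear: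
 fixes f :: "'a::euclidean_space \<times> 'a => ennreal"
 assumes [measurable]: "f \<in> borel_fun"
 shows "(NBINT z. f (shear t z)) = (NBINT z. f z)"
proof -
 have m: "f \<in> borel_measurable (lborel \<Otimes>\<^sub>M lborel)" by (simp add: lborel_prod)
 have m': "(\<lambda>z. f (shear t z)) \<in> borel_measurable (lborel \<Otimes>\<^sub>M lborel)" by (simp add: lborel_prod)
 have "(NBINT z. f (shear t z)) = (NBINT v. NBINT x. f (x + t *\<^sub>R v, v))"
  using lborel_pair.nn_integral_snd[OF m'] by (simp add: lborel_prod shear_def)
 also have "... = (NBINT v. NBINT x. f (x, v))"
 proof (rule nn_integral_cong, goal_cases)
  case (1 v)
  show ?case
   by (rule nn_integral_translate[of "\<lambda>x. f (x, v)"]) simp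
 qed
 also have "... = (NBINT z. f z)"
  using lborel_pair.nn_integral_snd[OF m] by (simp add: lborel_prod)
 finally show ?thesis .
qed

lemma lborel_distr_shear: "distr lborel borel (shear t) = (lborel :: ('a::euclidean_space \<times> 'a) measure)"
proof (rule measure_eqI)
 fix A :: "('a \<times> 'a) set" assume "A \<in> sets (distr lborel borel (shear t))"
 then have A[measurable]: "A \<in> sets borel" by simp
 show "emeasure (distr lborel borel (shear t)) A = emeasure lborel A"
  using nn_integral_shear[of "indicator A" t] 
  by (subst nn_integral_indicator[symmetric], simp) (subst nn_integral_distr, auto)
qed simp

lemma integral_shear:
 fixes f :: "'a::euclidean_space \<times> 'a => 'b::{banach, second_countable_topology}"
 assumes [measurable]: "f \<in> borel_fun"
 shows "(LBINT z. f (shear t z)) = (LBINT z. f z)"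
proof -
 have "(LBINT x. f x) = (\<integral>x. f x \<partial>(distr lborel borel (shear t)))"
  by (simp add: lborel_distr_shear)
 also have "... = (LBINT x. f (shear t x))"
  by (subst integral_distr) auto
 finally show ?thesis by simp
qed

lemma integrable_shear:
 fixes f :: "'a::euclidean_space \<times> 'a => 'b::{banach, second_countable_topology}"
 assumes f: "L1 f"
 shows "L1 (\<lambda>z. f (shear t z))"
proof -
 have "integrable (distr lborel borel (shear t)) f"
  using f by (simp add: lborel_distr_shear)
 then show ?thesis
  by (rule integrable_distr[rotated]) auto
qed

lemma Holder_inequality:
 fixes f g :: "'a => real" and p q :: real
 assumes p: "1 < p" and pq: "1 / p + 1 / q = 1"
  and [measurable]: "f \<in> borel_measurable M" "g \<in> borel_measurable M"
  and f0: "\<And>x. 0 \<le> f x" and g0: "\<And>x. 0 \<le> g x"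
  and fi: "integrable M (\<lambda>x. f x powr p)" and gi: "integrable M (\<lambda>x. g x powr q)"
 shows "integrable M (\<lambda>x. f x * g x)"
  and "(\<integral>x. f x * g x \<partial>M) \<le> (\<integral>x. f x powr p \<partial>M) powr (1 / p) * (\<integral>x. g x powr q \<partial>M) powr (1 / q)"
proof -
 have "1 / p < 1" using p by simp
 then have "1 / q > 0" using pq by linarith
 then have q0: "q > 0" by simp
 have "1 / q < 1" using p pq by (smt (verit) divide_pos_pos)
 then have q: "1 < q" using q0 by (simp add: field_simps)
 have Y: "f x * g x \<le> f x powr p / p + g x powr q / q" for x
  using Youngs_inequality[of p q "f x" "g x"] p q pq f0 g0 by auto
 show int: "integrable M (\<lambda>x. f x * g x)"
  by (rule integrable_bound[where f="\<lambda>x. f x powr p / p + g x powr q / q"])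
    (use fi gi Y f0 g0 in \<open>auto intro!: AE_I2 order_trans[OF _ abs_ge_self]\<close>)
 define A where "A = (\<integral>x. f x powr p \<partial>M)"
 define B where "B = (\<integral>x. g x powr q \<partial>M)"
 have A0: "A \<ge> 0" and B0: "B \<ge> 0" unfolding A_def B_def by simp_all
 show "(\<integral>x. f x * g x \<partial>M) \<le> A powr (1 / p) * B powr (1 / q)"
 proof (cases "A = 0 \<or> B = 0")
  case True
  then have "AE x in M. f x * g x = 0"
  proof
   assume "A = 0"
   then have "AE x in M. f x powr p = 0"
    unfolding A_def using integral_nonneg_eq_0_iff_AE[OF fi] by simp
   then show ?thesis by eventually_elim simp
  next
   assume "B = 0"
   then have "AE x in M. g x powr q = 0"
    unfolding B_def using integral_nonneg_eq_0_iff_AE[OF gi] by simp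
   then show ?thesis by eventually_elim simp
  qed
  then have "(\<integral>x. f x * g x \<partial>M) = (\<integral>x. 0 \<partial>M)" by (intro integral_cong_AE) auto
  then show ?thesis by simp
 next
  case False
  then have A: "A > 0" and B: "B > 0" using A0 B0 by auto
  define a where "a = A powr (1/p)"
  define b where "b = B powr (1/q)"
  have a: "a > 0" and b: "b > 0" unfolding a_def b_def using A B by auto
  have ap: "a powr p = A" unfolding a_def using A p by (simp add: powr_powr)
  have bq: "b powr q = B" unfolding b_def using B q by (simp add: powr_powr)
  have "f x * g x \<le> a * b * (f x powr p / (p * A) + g x powr q / (q * B))" for x
  proof -
   have "(f x / a) * (g x / b) \<le> (f x / a) powr p / p + (g x / b) powr q / q"
    using Youngs_inequality[of p q "f x / a" "g x / b"] p q pq f0 g0 a b by auto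
   also have "... = f x powr p / (p * A) + g x powr q / (q * B)"
    using a b f0 g0 by (simp add: powr_divide ap bq mult.commute)
   finally show ?thesis using a b by (simp add: field_simps)
  qed
  then have "(\<integral>x. f x * g x \<partial>M) \<le> (\<integral>x. a * b * (f x powr p / (p * A) + g x powr q / (q * B)) \<partial>M)"
   by (intro integral_mono int) (use fi gi in auto)
  also have "... = a * b * ((\<integral>x. f x powr p \<partial>M) / (p * A) + (\<integral>x. g x powr q \<partial>M) / (q * B))"
   using fi gi by simp
  also have "... = a * b * (1/p + 1/q)"
   using A B unfolding A_def[symmetric] B_def[symmetric] by simp
  also have "... = a * b" using pq by simp
  finally show ?thesis unfolding a_def b_def .
 qed
qed

text \<open>Hoelder's inequality with the constant function 1; the right-hand side may be infinite.\<close>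

lemma Jensen_powr:
 fixes u :: "'a => real" and p :: real
 assumes p: "1 < p" and fin: "finite_measure M" and [measurable]: "u \<in> borel_measurable M"
  and u0: "\<And>x. 0 \<le> u x"
 shows "ennreal ((\<integral>x. u x \<partial>M) powr p)
  \<le> ennreal (measure M (space M) powr (p - 1)) * (\<integral>\<^sup>+x. ennreal (u x powr p) \<partial>M)"
proof (cases "(\<integral>\<^sup>+x. ennreal (u x powr p) \<partial>M) = \<infinity>")
 case True
 show ?thesis
 proof (cases "measure M (space M) = 0")
  case True
  then have "emeasure M (space M) = 0" by (simp add: finite_measure.emeasure_eq_measure[OF fin])
  then have "AE x in M. False" using AE_I[of M "\<lambda>x. False" "space M"] by auto
  then have "(\<integral>x. u x \<partial>M) = (\<integral>x. 0 \<partial>M)" by (intro integral_cong_AE) auto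
  then show ?thesis by simp
 next
  case False
  then show ?thesis using True by (simp add: ennreal_mult_top)
 qed
next
 case False
 define q where "q = p / (p - 1)"
 have pq: "1 / p + 1 / q = 1" unfolding q_def using p by (simp add: field_simps)
 have i: "integrable M (\<lambda>x. u x powr p)"
  using False by (intro integrableI_nonneg) (auto simp: top.not_eq_extremum)
 have i1: "integrable M (\<lambda>x. 1 powr q :: real)" using finite_measure.integrable_const[OF fin] by simp
 have "(\<integral>x. u x * 1 \<partial>M) \<le> (\<integral>x. u x powr p \<partial>M) powr (1 / p) * (\<integral>x. 1 powr q \<partial>M) powr (1 / q)"
  by (rule Holder_inequality(2)[OF p pq _ _ _ _ i i1]) (use u0 in auto)
 then have "(\<integral>x. u x \<partial>M) powr p \<le> ((\<integral>x. u x powr p \<partial>M) powr (1 / p) * measure M (space M) powr (1 / q)) powr p"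
  using p u0 by (intro powr_mono2) (auto intro!: integral_nonneg)
 also have "... = (\<integral>x. u x powr p \<partial>M) * measure M (space M) powr (p - 1)"
 proof -
  have "1 / q * p = p - 1" using p unfolding q_def by (simp add: field_simps)
  then show ?thesis using p by (simp add: powr_mult powr_powr)
 qed
 finally have "ennreal ((\<integral>x. u x \<partial>M) powr p) \<le> ennreal ((\<integral>x. u x powr p \<partial>M) * measure M (space M) powr (p - 1))"
  by (rule ennreal_leI)
 also have "... = ennreal (measure M (space M) powr (p - 1)) * ennreal (\<integral>x. u x powr p \<partial>M)"
  by (subst mult.commute) (simp add: ennreal_mult)
 also have "ennreal (\<integral>x. u x powr p \<partial>M) = (\<integral>\<^sup>+x. ennreal (u x powr p) \<partial>M)"
  using i by (simp add: nn_integral_eq_integral)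
 finally show ?thesis .
qed

section \<open>The theorem of M. Riesz for conjugate Poisson kernels\<close>

definition poisson_kernel :: "real => real => real" where
 "poisson_kernel y s = y / (pi * (s\<^sup>2 + y\<^sup>2))"

text \<open>The Hilbert kernel \<open>1 / (\<pi> s)\<close> regularised at height \<open>y\<close>: the Poisson integral of a Hilbert transform
 is convolution with this kernel.\<close>

definition conj_poisson :: "real => real => real" where
 "conj_poisson y s = s / (pi * (s\<^sup>2 + y\<^sup>2))"

lemma kernel_measurable [measurable]:
 "poisson_kernel y \<in> borel_fun" "conj_poisson y \<in> borel_fun"
 unfolding poisson_kernel_def[abs_def] conj_poisson_def[abs_def] by measurable

lemma poisson_kernel_pos: "y > 0 ==> poisson_kernel y s > 0"
 unfolding poisson_kernel_def
 by (intro divide_pos_pos mult_pos_pos add_nonneg_pos) auto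

lemma conj_poisson_minus: "conj_poisson y (- s) = - conj_poisson y s"
 by (simp add: conj_poisson_def)

lemma nn_integral_poisson_kernel:
 assumes y: "y > 0"
 shows "(NBINT s. ennreal (poisson_kernel y s)) = 1"
proof -
 have I: "L1 (\<lambda>x::real. inverse (1 + x\<^sup>2))"
  using integrable_inverse_1_plus_square by (simp add: set_integrable_def einterval_def)
 have "(LBINT x. inverse (1 + x\<^sup>2)) = pi"
  using LBINT_inverse_1_plus_square
  by (simp add: interval_lebesgue_integral_def set_lebesgue_integral_def einterval_def)
 then have 1: "(NBINT x. ennreal (inverse (1 + x\<^sup>2))) = ennreal pi"
  using I by (subst nn_integral_eq_integral) auto
 have "(NBINT s. ennreal (poisson_kernel y s))
   = ennreal \<bar>y\<bar> * (NBINT s. ennreal (poisson_kernel y (0 + y * s)))"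
  by (rule nn_integral_real_affine) (use y in auto)
 also have "... = ennreal y * (NBINT s. ennreal (1 / (pi * y)) * ennreal (inverse (1 + s\<^sup>2)))"
 proof -
  have "poisson_kernel y (0 + y * s) = (1 / (pi * y)) * inverse (1 + s\<^sup>2)" for s
  proof -
   have "(y * s)\<^sup>2 + y\<^sup>2 = y\<^sup>2 * (1 + s\<^sup>2)" by (simp add: power_mult_distrib algebra_simps)
   then show ?thesis using y by (simp add: poisson_kernel_def inverse_eq_divide power2_eq_square)
  qed
  then show ?thesis using y by (simp add: ennreal_mult'[symmetric])
 qed
 also have "... = ennreal y * (ennreal (1 / (pi * y)) * ennreal pi)"
  by (subst nn_integral_cmult) (auto simp: 1)
 also have "... = 1" using y by (simp add: ennreal_mult'[symmetric])
 finally show ?thesis .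
qed

lemma integral_poisson_kernel:
 assumes y: "y > 0"
 shows "L1 (poisson_kernel y)" "(LBINT s. poisson_kernel y s) = 1"
 using nn_integral_poisson_kernel[OF y] poisson_kernel_pos[OF y]
 by (auto intro!: integrableI_nonneg AE_I2 integral_eq_nn_integral[THEN trans] simp: less_imp_le)

lemma exp_Ln_polar:
 assumes "w \<noteq> 0"
 shows "Re w = cmod w * cos (Im (Ln w))" "Im w = cmod w * sin (Im (Ln w))"
  "w powr of_real p = of_real (cmod w powr p) * cis (p * Im (Ln w))"
proof -
 have e: "w = exp (Ln w)" using assms by simp
 have c: "exp (Re (Ln w)) = cmod w" using assms by (simp add: Re_Ln)
 show "Re w = cmod w * cos (Im (Ln w))"
  using c by (subst e) (simp add: Re_exp)
 show "Im w = cmod w * sin (Im (Ln w))"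
  using c by (subst e) (simp add: Im_exp)
 have "w powr of_real p = exp (of_real p * Ln w)" using assms by (simp add: powr_def)
 also have "... = of_real (exp (p * Re (Ln w))) * cis (p * Im (Ln w))"
  by (simp add: exp_eq_polar)
 also have "exp (p * Re (Ln w)) = cmod w powr p" using assms by (simp add: powr_def Re_Ln)
 finally show "w powr of_real p = of_real (cmod w powr p) * cis (p * Im (Ln w))" .
qed

text \<open>The pointwise inequality behind M. Riesz's theorem. With \<open>w = r exp (i \<theta>)\<close>, \<open>|\<theta>| < \<pi>/2\<close>, it reads
 \<open>|sin \<theta>|\<^sup>p \<le> A (cos \<theta>)\<^sup>p - B cos (p \<theta>)\<close>. Near \<open>\<theta> = \<pi>/2\<close> the first term degenerates, but there
 \<open>p \<theta>\<close> lies between \<open>\<pi>/2\<close> and \<open>\<pi>\<close> as \<open>1 < p \<le> 2\<close>, so that \<open>- cos (p \<theta>)\<close> is bounded below; away from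
 \<open>\<pi>/2\<close> the cosine is bounded below and a large \<open>A\<close> suffices.\<close>

lemma half_plane_powr_inequality:
 fixes p :: real
 assumes p: "1 < p" "p \<le> 2"
 obtains A B where "A > 0" "B > 0"
  "\<And>w. Re w > 0 ==> \<bar>Im w\<bar> powr p \<le> A * Re w powr p - B * Re (w powr of_real p)"
proof -
 \<comment> \<open>The midpoint of \<open>\<pi>/(2p)\<close> and \<open>\<pi>/2\<close>, so that \<open>\<pi>/2 < p \<theta>0 < \<pi>\<close>.\<close>
 define \<theta>0 where "\<theta>0 = (pi / 2) * ((1 / p + 1) / 2)"
 have p1: "1 / p < 1" "1 / p > 0" using p by auto
 have t0: "0 < \<theta>0" unfolding \<theta>0_def using p1 by (intro mult_pos_pos divide_pos_pos add_pos_pos) auto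
 have "\<theta>0 < pi / 2 * 1" unfolding \<theta>0_def using p1 by (intro mult_strict_left_mono) auto
 note t0 = t0 this[simplified]
 have pt: "p * \<theta>0 = (pi / 2) * ((1 + p) / 2)" unfolding \<theta>0_def using p by (simp add: field_simps)
 have "(pi / 2) * ((1 + p) / 2) > pi / 2 * 1" using p by (intro mult_strict_left_mono) auto
 then have pt1: "p * \<theta>0 > pi / 2" unfolding pt mult_1_right .
 have "p * \<theta>0 < p * (pi / 2)" using t0 p by (intro mult_strict_left_mono) auto
 also have "... \<le> 2 * (pi / 2)" using p by (intro mult_right_mono) auto
 finally have pt2: "p * \<theta>0 < pi" by simp
 define c where "c = - cos (p * \<theta>0)"
 have c: "c > 0" unfolding c_def
  using cos_monotone_0_pi[of "pi/2" "p * \<theta>0"] pt1 pt2 by simp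
 define B where "B = 1 / c"
 define A where "A = (1 + B) / cos \<theta>0 powr p"
 have B: "B > 0" using c by (simp add: B_def)
 have ct: "cos \<theta>0 > 0" using t0 by (intro cos_gt_zero_pi) auto
 have A: "A > 0" unfolding A_def using B ct by auto
 have main: "\<bar>Im w\<bar> powr p \<le> A * Re w powr p - B * Re (w powr of_real p)" if w: "Re w > 0" for w
 proof -
  have w0: "w \<noteq> 0" using w by auto
  define \<theta> where "\<theta> = \<bar>Im (Ln w)\<bar>"
  have th: "\<theta> < pi / 2" "\<theta> \<ge> 0" unfolding \<theta>_def using Re_Ln_pos_lt[OF w0] w by auto
  have ctp: "cos \<theta> > 0" using th by (intro cos_gt_zero_pi) auto
  have re: "Re w = cmod w * cos \<theta>"
   using exp_Ln_polar(1)[OF w0] unfolding \<theta>_def by (simp add: abs_if)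
  have im: "\<bar>Im w\<bar> = cmod w * \<bar>sin \<theta>\<bar>"
  proof -
   have "\<bar>sin \<bar>x\<bar>\<bar> = \<bar>sin x\<bar>" for x :: real by (cases "x \<ge> 0") auto
   moreover have "\<bar>Im w\<bar> = \<bar>cmod w * sin (Im (Ln w))\<bar>" using exp_Ln_polar(2)[OF w0] by simp
   ultimately show ?thesis unfolding \<theta>_def by (simp add: abs_mult)
  qed
  have rp: "Re (w powr of_real p) = cmod w powr p * cos (p * \<theta>)"
   using exp_Ln_polar(3)[OF w0, of p] unfolding \<theta>_def
   by (simp add: abs_if)
  have trig: "\<bar>sin \<theta>\<bar> powr p \<le> A * cos \<theta> powr p - B * cos (p * \<theta>)"
  proof (cases "\<theta> < \<theta>0")
   case True
   have "\<bar>sin \<theta>\<bar> powr p \<le> 1" using powr_mono2[of p "\<bar>sin \<theta>\<bar>" 1] p by auto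
   moreover have "- B \<le> - (B * cos (p * \<theta>))" using B by (simp add: mult_left_le)
   moreover have "1 + B \<le> A * cos \<theta> powr p"
   proof -
    have "cos \<theta>0 \<le> cos \<theta>" using True th t0 by (intro cos_monotone_0_pi_le) auto
    then have "cos \<theta>0 powr p \<le> cos \<theta> powr p" using ct p by (intro powr_mono2) auto
    then have "A * cos \<theta>0 powr p \<le> A * cos \<theta> powr p" using A by simp
    then show ?thesis unfolding A_def using ct by simp
   qed
   ultimately show ?thesis by linarith
  next
   case False
   have "\<bar>sin \<theta>\<bar> powr p \<le> 1" using powr_mono2[of p "\<bar>sin \<theta>\<bar>" 1] p by auto
   moreover have "cos (p * \<theta>) \<le> - c"
   proof -
    have "p * \<theta> \<le> p * (pi / 2)" using th p by (intro mult_left_mono) auto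
    also have "... \<le> 2 * (pi / 2)" using p by (intro mult_right_mono) auto
    finally have "cos (p * \<theta>) \<le> cos (p * \<theta>0)" using False p t0
     by (intro cos_monotone_0_pi_le) auto
    then show ?thesis by (simp add: c_def)
   qed
   then have "B * cos (p * \<theta>) \<le> B * (- c)" using B by (intro mult_left_mono) auto
   moreover have "B * (- c) = -1" using c by (simp add: B_def)
   moreover have "0 \<le> A * cos \<theta> powr p" using A by simp
   ultimately show ?thesis by linarith
  qed
  have "\<bar>Im w\<bar> powr p = cmod w powr p * \<bar>sin \<theta>\<bar> powr p" by (simp add: im powr_mult)
  also have "... \<le> cmod w powr p * (A * cos \<theta> powr p - B * cos (p * \<theta>))"
   by (rule mult_left_mono[OF trig]) simp
  also have "... = A * Re w powr p - B * Re (w powr of_real p)"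
   using ctp by (simp add: re rp powr_mult algebra_simps)
  finally show ?thesis .
 qed
 show ?thesis by (rule that[OF A B main])
qed

text \<open>The holomorphic function on the upper half-plane whose real and imaginary parts at height \<open>y\<close> are the
 Poisson and the conjugate Poisson integral of \<open>f\<close>.\<close>

definition cauchy_transform :: "(real => real) => complex => complex" where
 "cauchy_transform f z = \<i> / of_real pi * (LBINT t. of_real (f t) / (z - of_real t))"

lemma cmod_diff_of_real_ge: "\<bar>Im z\<bar> \<le> cmod (z - of_real t)"
 using abs_Im_le_cmod[of "z - of_real t"] by simp

lemma cauchy_transform_integrable:
 assumes f: "L1 f" and z: "Im z > 0"
 shows "L1 (\<lambda>t. of_real (f t) / (z - of_real t) :: complex)"
proof -
 have [measurable]: "f \<in> borel_measurable lborel" using f by auto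
 show ?thesis
 proof (rule integrable_bound[where f="\<lambda>t. f t / Im z"])
  show "L1 (\<lambda>t. f t / Im z)" using f by simp
  show "AE t in lborel. cmod (of_real (f t) / (z - of_real t)) \<le> norm (f t / Im z)"
  proof (rule AE_I2, goal_cases)
   case (1 t)
   show ?case
    using cmod_diff_of_real_ge[of z t] z by (auto simp: norm_divide intro!: divide_left_mono mult_pos_pos)
  qed
 qed measurable
qed

lemma cauchy_transform_Re_Im:
 assumes f: "L1 f" and y: "y > 0"
 shows "Re (cauchy_transform f (Complex x y)) = (LBINT t. poisson_kernel y (x - t) * f t)"
  and "Im (cauchy_transform f (Complex x y)) = (LBINT t. conj_poisson y (x - t) * f t)"
proof -
 have i: "L1 (\<lambda>t. of_real (f t) / (Complex x y - of_real t) :: complex)"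
  by (rule cauchy_transform_integrable) (use f y in auto)
 have e: "\<i> / of_real pi * (of_real (f t) / (Complex x y - of_real t))
   = Complex (poisson_kernel y (x - t) * f t) (conj_poisson y (x - t) * f t)" for t
 proof -
  define D where "D = (x - t)\<^sup>2 + y\<^sup>2"
  have nz: "D \<noteq> 0" unfolding D_def using y by (simp add: sum_power2_eq_zero_iff)
  have "Complex x y - of_real t = Complex (x - t) y" by (simp add: complex_eq_iff)
  then have "of_real (f t) / (Complex x y - of_real t) = Complex (f t * (x - t) / D) (- f t * y / D)"
   by (simp add: complex_eq_iff Re_divide Im_divide D_def)
  then have "\<i> / of_real pi * (of_real (f t) / (Complex x y - of_real t))
    = Complex (f t * y / (pi * D)) (f t * (x - t) / (pi * D))"
   by (simp only:) (simp add: complex_eq_iff Re_divide_of_real Im_divide_of_real)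
  then show ?thesis
   by (simp add: poisson_kernel_def conj_poisson_def mult.commute flip: D_def)
 qed
 have E: "cauchy_transform f (Complex x y)
   = (LBINT t. Complex (poisson_kernel y (x - t) * f t) (conj_poisson y (x - t) * f t))"
  unfolding cauchy_transform_def e[symmetric] using i by (subst integral_mult_right_zero) simp
 have i2: "L1 (\<lambda>t. Complex (poisson_kernel y (x - t) * f t) (conj_poisson y (x - t) * f t))"
  unfolding e[symmetric] using i by (rule integrable_mult_right)
 show "Re (cauchy_transform f (Complex x y)) = (LBINT t. poisson_kernel y (x - t) * f t)"
  unfolding E using i2 by (simp flip: integral_Re)
 show "Im (cauchy_transform f (Complex x y)) = (LBINT t. conj_poisson y (x - t) * f t)"
  unfolding E using i2 by (simp flip: integral_Im)
qed

lemma cauchy_transform_holomorphic: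
 assumes f: "L1 f"
 shows "cauchy_transform f holomorphic_on {z. Im z > 0}"
proof (rule holomorphic_onI)
 have [measurable]: "f \<in> borel_measurable lborel" using f by auto
 fix z assume "z \<in> {z. Im z > 0}"
 then have z: "Im z > 0" by simp
 define d where "d = Im z"
 define g where "g w = (LBINT t. of_real (f t) / (w - of_real t))" for w :: complex
 define g' where "g' = (LBINT t. - of_real (f t) / (z - of_real t)\<^sup>2)"
 define K where "K = (LBINT t. \<bar>f t\<bar> * (2 / d ^ 3))"
 have d: "d > 0" using z by (simp add: d_def)
 have ig': "L1 (\<lambda>t. - of_real (f t) / (z - of_real t)\<^sup>2 :: complex)"
 proof (rule integrable_bound[where f="\<lambda>t. f t / d\<^sup>2"])
  show "AE t in lborel. cmod (- of_real (f t) / (z - of_real t)\<^sup>2) \<le> norm (f t / d\<^sup>2)"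
  proof (rule AE_I2, goal_cases)
   case (1 t)
   have "d\<^sup>2 \<le> cmod (z - of_real t) ^ 2" using cmod_diff_of_real_ge[of z t] d by (intro power_mono) (auto simp: d_def)
   moreover have "cmod (z - of_real t) > 0" using cmod_diff_of_real_ge[of z t] d by (auto simp: d_def)
   ultimately show ?case
    using d by (auto simp: norm_divide norm_power intro!: divide_left_mono mult_pos_pos)
  qed
 qed (use f in auto)
 have bound: "cmod ((g (z + h) - g z) / h - g') \<le> K * cmod h" if h: "h \<noteq> 0" "cmod h < d / 2" for h
 proof -
  have zh: "Im (z + h) > d / 2" using h abs_Im_le_cmod[of h] by (simp add: d_def)
  have i1: "L1 (\<lambda>t. of_real (f t) / (z + h - of_real t) :: complex)"
   by (rule cauchy_transform_integrable) (use f zh d in auto)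
  have i2: "L1 (\<lambda>t. of_real (f t) / (z - of_real t) :: complex)"
   by (rule cauchy_transform_integrable) (use f z in auto)
  have "(g (z + h) - g z) / h - g'
   = (LBINT t. (of_real (f t) / (z + h - of_real t) - of_real (f t) / (z - of_real t)) / h
      - (- of_real (f t) / (z - of_real t)\<^sup>2))"
   unfolding g_def g'_def using i1 i2 ig' by simp
  also have "cmod \<dots> \<le> (LBINT t. cmod h * (\<bar>f t\<bar> * (2 / d ^ 3)))"
  proof (rule integral_norm_bound_integral)
   show "L1 (\<lambda>t. (of_real (f t) / (z + h - of_real t) - of_real (f t) / (z - of_real t)) / h
      - (- of_real (f t) / (z - of_real t)\<^sup>2))" using i1 i2 ig' by simp
   show "L1 (\<lambda>t. cmod h * (\<bar>f t\<bar> * (2 / d ^ 3)))" using f by simp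
   fix t
   define u where "u = z - of_real t"
   have u: "cmod u \<ge> d" using cmod_diff_of_real_ge[of z t] d by (auto simp: d_def u_def)
   have uh: "cmod (u + h) \<ge> d / 2"
    using cmod_diff_of_real_ge[of "z + h" t] zh d by (auto simp: u_def algebra_simps)
   have u0: "u \<noteq> 0" "u + h \<noteq> 0" using u uh d by auto
   have e1: "z + h - of_real t = u + h" "z - of_real t = u" by (auto simp: u_def)
   have "(of_real (f t) / (u + h) - of_real (f t) / u) / h - (- of_real (f t) / u\<^sup>2)
     = of_real (f t) * h / (u\<^sup>2 * (u + h))"
    using u0 h by (simp add: divide_simps) (simp add: power2_eq_square algebra_simps)
   also have "cmod \<dots> = \<bar>f t\<bar> * cmod h / (cmod u ^ 2 * cmod (u + h))"
    by (simp add: norm_divide norm_mult norm_power)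
   also have "... \<le> \<bar>f t\<bar> * cmod h / (d\<^sup>2 * (d / 2))"
    using u uh d by (intro divide_left_mono mult_mono power_mono mult_pos_pos mult_nonneg_nonneg) auto
   also have "... = cmod h * (\<bar>f t\<bar> * (2 / d ^ 3))"
    using d by (simp add: field_simps power2_eq_square power3_eq_cube)
   finally show "cmod ((of_real (f t) / (z + h - of_real t) - of_real (f t) / (z - of_real t)) / h
      - (- of_real (f t) / (z - of_real t)\<^sup>2)) \<le> cmod h * (\<bar>f t\<bar> * (2 / d ^ 3))"
    unfolding e1 .
  qed
  also have "... = K * cmod h" unfolding K_def by simp
  finally show ?thesis .
 qed
 have "((\<lambda>h. (g (z + h) - g z) / h) \<longlongrightarrow> g') (at 0)"
 proof (rule LIM_zero_cancel, rule Lim_null_comparison)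
  show "\<forall>\<^sub>F h in at 0. norm ((g (z + h) - g z) / h - g') \<le> K * cmod h"
  proof -
   have "\<forall>\<^sub>F h in at (0::complex). h \<noteq> 0 \<and> cmod h < d / 2"
    using d unfolding eventually_at by (intro exI[of _ "d/2"]) auto
   then show ?thesis
    by eventually_elim (use bound in blast)
  qed
  show "((\<lambda>h. K * cmod h) \<longlongrightarrow> 0) (at 0)"
   by (rule tendsto_eq_intros refl | simp)+
 qed
 then have "(g has_field_derivative g') (at z)" unfolding DERIV_def .
 then have "((\<lambda>w. \<i> / of_real pi * g w) has_field_derivative (\<i> / of_real pi * g')) (at z)"
  by (rule DERIV_cmult)
 then show "cauchy_transform f field_differentiable at z within {z. Im z > 0}"
  unfolding cauchy_transform_def[abs_def] g_def field_differentiable_def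
  using has_field_derivative_at_within by blast
qed

lemma cauchy_transform_decay:
 assumes f: "L1 f" and supp: "\<And>t. \<bar>t\<bar> > L ==> f t = 0" and z: "Im z > 0" "cmod z > L"
 shows "cmod (cauchy_transform f z) \<le> (LBINT t. \<bar>f t\<bar>) / (pi * (cmod z - L))"
proof -
 have "cmod (LBINT t. of_real (f t) / (z - of_real t)) \<le> (LBINT t. \<bar>f t\<bar> / (cmod z - L))"
 proof (rule integral_norm_bound_integral)
  show "L1 (\<lambda>t. of_real (f t) / (z - of_real t) :: complex)"
   by (rule cauchy_transform_integrable) (use f z in auto)
  show "L1 (\<lambda>t. \<bar>f t\<bar> / (cmod z - L))" using f by simp
  fix t
  show "cmod (of_real (f t) / (z - of_real t)) \<le> \<bar>f t\<bar> / (cmod z - L)"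
  proof (cases "\<bar>t\<bar> > L")
   case False
   have "cmod (z - of_real t) \<ge> cmod z - L" using norm_triangle_ineq2[of z "of_real t"] False by simp
   then show ?thesis using z by (auto simp: norm_divide intro!: divide_left_mono mult_pos_pos)
  qed (use supp in simp)
 qed
 then have "1 / pi * cmod (LBINT t. of_real (f t) / (z - of_real t))
   \<le> 1 / pi * ((LBINT t. \<bar>f t\<bar>) / (cmod z - L))"
  by (intro mult_left_mono) auto
 then show ?thesis unfolding cauchy_transform_def by (simp add: norm_mult norm_divide)
qed

lemma powr_decay_tendsto_0:
 fixes p K L :: real
 assumes p: "p > 1" and K: "K \<ge> 0"
 shows "(\<lambda>n. 4 * real n * (K / (real n / 2 - L)) powr p) \<longlonglongrightarrow> 0"
proof (cases "K = 0")
 case False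
 then have "K > 0" using K by simp
 then show ?thesis using p by real_asymp
qed simp

text \<open>The \<open>p\<close>-th power of the Cauchy transform is holomorphic and decays like \<open>|z|\<^sup>-\<^sup>p\<close> with \<open>p > 1\<close>. By
 Cauchy's theorem for a large triangle, the integral over a long horizontal segment equals an integral
 over the two other sides, which the decay makes small.\<close>

lemma cauchy_transform_powr_integral_tendsto_0:
 fixes f :: "real => real"
 assumes p: "1 < p" and f: "L1 f" and supp: "\<And>t. \<bar>t\<bar> > L ==> f t = 0" and L: "L \<ge> 0"
  and pos: "\<And>z. Im z > 0 ==> Re (cauchy_transform f z) > 0" and y: "y > 0"
 shows "(\<lambda>n. integral {- real n..real n} (\<lambda>x. cauchy_transform f (Complex x y) powr of_real p)) \<longlonglongrightarrow> 0"
proof -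
 define g where "g z = cauchy_transform f (z + \<i> * of_real y) powr of_real p" for z
 define K where "K = (LBINT t. \<bar>f t\<bar>) / pi"
 have K: "K \<ge> 0" unfolding K_def by simp
 have hol: "g holomorphic_on {z. Im z > - y}"
 proof -
  have "(\<lambda>z. cauchy_transform f (z + \<i> * of_real y)) holomorphic_on {z. Im z > - y}"
   by (rule holomorphic_on_compose_gen[of "\<lambda>z. z + \<i> * of_real y" _ "cauchy_transform f" "{z. Im z > 0}", unfolded o_def])
     (use cauchy_transform_holomorphic[OF f] in \<open>auto intro!: holomorphic_intros\<close>)
  then show ?thesis unfolding g_def[abs_def]
  proof (rule holomorphic_on_powr)
   fix z assume "z \<in> {z. Im z > - y}"
   then have "Re (cauchy_transform f (z + \<i> * of_real y)) > 0" by (intro pos) auto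
   then show "cauchy_transform f (z + \<i> * of_real y) \<notin> \<real>\<^sub>\<le>\<^sub>0"
    by (auto simp: complex_nonpos_Reals_iff)
  qed auto
 qed
 have bnd: "cmod (g z) \<le> (K / (R / 2 - L)) powr p" if z: "Im z \<ge> 0" "cmod z \<ge> R / 2" "R / 2 > L" for z R
 proof -
  define u where "u = z + \<i> * of_real y"
  have "cmod z \<le> cmod u"
   unfolding u_def cmod_def using z y power_mono[of "Im z" "Im z + y" 2] by (intro real_sqrt_le_mono) simp
  then have u: "Im u > 0" "cmod u \<ge> R / 2" using z y by (auto simp: u_def)
  have n0: "cauchy_transform f u \<noteq> 0" using pos[OF u(1)] by auto
  have "cmod (cauchy_transform f u) \<le> K / (cmod u - L)"
   using cauchy_transform_decay[OF f supp u(1)] u z unfolding K_def by simp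
  also have "... \<le> K / (R / 2 - L)" using u z K by (intro divide_left_mono mult_pos_pos) auto
  finally have "cmod (cauchy_transform f u) powr p \<le> (K / (R / 2 - L)) powr p"
   using p by (intro powr_mono2) auto
  moreover have "cmod (g z) = cmod (cauchy_transform f u) powr p"
   using exp_Ln_polar(3)[OF n0, of p] unfolding g_def u_def by (simp add: norm_mult)
  ultimately show ?thesis by simp
 qed
 have est: "cmod (integral {- R..R} (\<lambda>x. cauchy_transform f (Complex x y) powr of_real p))
   \<le> 4 * R * (K / (R / 2 - L)) powr p" if R: "R / 2 > L" for R
 proof -
  have R0: "R > 0" using R L by simp
  \<comment> \<open>Every point of the two slanted sides has modulus at least \<open>R / 2\<close>.\<close>
  define a b c where "a = complex_of_real (- R)" and "b = complex_of_real R" and "c = \<i> * complex_of_real R"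
  define B where "B = (K / (R / 2 - L)) powr p"
  have sub: "convex hull {a, b, c} \<subseteq> {z. Im z > - y}"
   using y R0 by (intro hull_minimal convex_halfspace_Im_gt) (auto simp: a_def b_def c_def)
  have holh: "g holomorphic_on convex hull {a, b, c}" using holomorphic_on_subset[OF hol sub] .
  have H: "(g has_contour_integral 0) (linepath a b +++ linepath b c +++ linepath c a)"
   by (rule Cauchy_theorem_triangle[OF holh])
  have cont: "continuous_on (convex hull {a, b, c}) g"
   using holh by (rule holomorphic_on_imp_continuous_on)
  have sg: "closed_segment a b \<subseteq> convex hull {a, b, c}" "closed_segment b c \<subseteq> convex hull {a, b, c}"
    "closed_segment c a \<subseteq> convex hull {a, b, c}"
   unfolding segment_convex_hull by (intro hull_mono; simp)+
  have ci: "g contour_integrable_on linepath a b" "g contour_integrable_on linepath b c"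
    "g contour_integrable_on linepath c a"
   using cont sg by (auto intro!: contour_integrable_continuous_linepath intro: continuous_on_subset)
  have "contour_integral (linepath a b) g + (contour_integral (linepath b c) g + contour_integral (linepath c a) g) = 0"
   using contour_integral_unique[OF H] ci by (simp add: contour_integral_join valid_path_join contour_integrable_join)
  then have "contour_integral (linepath a b) g = - (contour_integral (linepath b c) g + contour_integral (linepath c a) g)"
   by (rule eq_neg_iff_add_eq_0[THEN iffD2])
  then have "cmod (contour_integral (linepath a b) g)
    \<le> cmod (contour_integral (linepath b c) g) + cmod (contour_integral (linepath c a) g)"
   by (metis norm_minus_cancel norm_triangle_ineq)
  also have "... \<le> B * cmod (c - b) + B * cmod (a - c)"
  proof (intro add_mono contour_integral_bound_linepath ci)
   fix x assume "x \<in> closed_segment b c"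
   then obtain u where u: "0 \<le> u" "u \<le> 1" "x = (1 - u) *\<^sub>R b + u *\<^sub>R c" by (auto simp: closed_segment_def)
   have x: "Re x = (1 - u) * R" "Im x = u * R" using u by (auto simp: b_def c_def)
   have "(1 - u) * R + u * R = R" by (simp add: algebra_simps)
   then have "R / 2 \<le> Re x \<or> R / 2 \<le> Im x" unfolding x by linarith
   then have "R / 2 \<le> cmod x" using abs_Re_le_cmod[of x] abs_Im_le_cmod[of x] by linarith
   then show "cmod (g x) \<le> B" unfolding B_def using bnd[of x R] R u x R0 by simp
  next
   fix x assume "x \<in> closed_segment c a"
   then obtain u where u: "0 \<le> u" "u \<le> 1" "x = (1 - u) *\<^sub>R c + u *\<^sub>R a" by (auto simp: closed_segment_def)
   have x: "Re x = - (u * R)" "Im x = (1 - u) * R" using u by (auto simp: a_def c_def)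
   have "(1 - u) * R + u * R = R" by (simp add: algebra_simps)
   then have "R / 2 \<le> - Re x \<or> R / 2 \<le> Im x" unfolding x by linarith
   then have "R / 2 \<le> cmod x" using abs_Re_le_cmod[of x] abs_Im_le_cmod[of x] by linarith
   then show "cmod (g x) \<le> B" unfolding B_def using bnd[of x R] R u x R0 by simp
  qed (auto simp: B_def)
  also have "... \<le> B * (R + R) + B * (R + R)"
   using R0 norm_triangle_ineq4[of c b] norm_triangle_ineq4[of a c]
   by (intro add_mono mult_left_mono) (auto simp: a_def b_def c_def norm_mult B_def)
  finally have "cmod (contour_integral (linepath a b) g) \<le> 4 * R * B" by (simp add: algebra_simps)
  moreover have "contour_integral (linepath a b) g = integral {- R..R} (\<lambda>x. g (of_real x))"
   using R0 by (subst contour_integral_linepath_Reals_eq) (auto simp: a_def b_def)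
  moreover have "g (of_real x) = cauchy_transform f (Complex x y) powr of_real p" for x
   unfolding g_def by (simp add: complex_eq_iff arg_cong[where f="\<lambda>z. cauchy_transform f z powr of_real p"] Complex_eq)
  ultimately show ?thesis unfolding B_def by simp
 qed
 show ?thesis
 proof (rule Lim_null_comparison)
  show "(\<lambda>n. 4 * real n * (K / (real n / 2 - L)) powr p) \<longlonglongrightarrow> 0"
   using powr_decay_tendsto_0[OF p K, of L] .
  show "\<forall>\<^sub>F n in sequentially. norm (integral {- real n..real n} (\<lambda>x. cauchy_transform f (Complex x y) powr of_real p))
    \<le> 4 * real n * (K / (real n / 2 - L)) powr p"
  proof -
   have "\<forall>\<^sub>F n in sequentially. real n > 2 * L" by real_asymp
   then show ?thesis by eventually_elim (rule est, simp)
  qed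
 qed
qed

text \<open>Jensen's inequality for the Poisson kernel, which is a probability density.\<close>

lemma poisson_average_powr_le:
 fixes f :: "real => real"
 assumes p: "1 < p" and y: "y > 0" and [measurable]: "f \<in> borel_fun" and f0: "\<And>t. 0 \<le> f t"
 shows "(NBINT x. ennreal ((LBINT t. poisson_kernel y (x - t) * f t) powr p))
  \<le> (NBINT t. ennreal (f t powr p))"
proof -
 have nn: "(NBINT t. ennreal (poisson_kernel y (t - x))) = 1" for x
  using nn_integral_translate[of "\<lambda>t. ennreal (poisson_kernel y t)" "- x"] nn_integral_poisson_kernel[OF y] by simp
 have sym: "poisson_kernel y (x - t) = poisson_kernel y (t - x)" for x t
  by (simp add: poisson_kernel_def power2_commute)
 have 1: "ennreal ((LBINT t. poisson_kernel y (x - t) * f t) powr p)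
   \<le> (NBINT t. ennreal (poisson_kernel y (x - t)) * ennreal (f t powr p))" for x
 proof -
  define M where "M = density lborel (\<lambda>t. ennreal (poisson_kernel y (x - t)))"
  have pr: "prob_space M"
   by (rule prob_spaceI) (simp add: M_def emeasure_density sym nn)
  have fm: "finite_measure M" using pr by (rule prob_space.finite_measure)
  have "ennreal ((\<integral>t. f t \<partial>M) powr p)
    \<le> ennreal (measure M (space M) powr (p - 1)) * (\<integral>\<^sup>+t. ennreal (f t powr p) \<partial>M)"
   by (rule Jensen_powr[OF p fm]) (auto simp: M_def f0)
  moreover have "(\<integral>t. f t \<partial>M) = (LBINT t. poisson_kernel y (x - t) * f t)"
   unfolding M_def using poisson_kernel_pos[OF y] by (subst integral_density) (auto simp: less_imp_le)
  moreover have "(\<integral>\<^sup>+t. ennreal (f t powr p) \<partial>M) = (NBINT t. ennreal (poisson_kernel y (x - t)) * ennreal (f t powr p))"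
   unfolding M_def by (subst nn_integral_density) auto
  ultimately show ?thesis by (simp add: prob_space.prob_space[OF pr])
 qed
 have "(NBINT x. ennreal ((LBINT t. poisson_kernel y (x - t) * f t) powr p))
   \<le> (NBINT x. NBINT t. ennreal (poisson_kernel y (x - t)) * ennreal (f t powr p))"
  by (intro nn_integral_mono 1)
 also have "... = (NBINT t. NBINT x. ennreal (poisson_kernel y (x - t)) * ennreal (f t powr p))"
  by (rule lborel_pair.Fubini') measurable
 also have "... = (NBINT t. ennreal (f t powr p))"
  by (subst nn_integral_multc) (auto simp: nn)
 finally show ?thesis .
qed

lemma kernel_integrable_mult:
 assumes y: "y > 0" and f: "L1 f"
 shows "L1 (\<lambda>t. poisson_kernel y (x - t) * f t)"
  "L1 (\<lambda>t. conj_poisson y (x - t) * f t)"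
proof -
 have [measurable]: "f \<in> borel_measurable lborel" using f by auto
 have 1: "\<bar>poisson_kernel y s\<bar> \<le> 1 / (pi * y)" for s
 proof -
  have "y / (pi * (s\<^sup>2 + y\<^sup>2)) \<le> y / (pi * y\<^sup>2)"
   using y by (intro divide_left_mono mult_left_mono mult_pos_pos add_nonneg_pos) auto
  then show ?thesis using y by (simp add: poisson_kernel_def power2_eq_square abs_mult)
 qed
 have 2: "\<bar>conj_poisson y s\<bar> \<le> 1 / (pi * y)" for s
 proof -
  have "0 \<le> (\<bar>s\<bar> - y)\<^sup>2" by simp
  then have "2 * (\<bar>s\<bar> * y) \<le> s\<^sup>2 + y\<^sup>2" by (simp add: power2_diff)
  moreover have "0 \<le> \<bar>s\<bar> * y" using y by simp
  ultimately have "\<bar>s\<bar> * y \<le> s\<^sup>2 + y\<^sup>2" by linarith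
  moreover have "s\<^sup>2 + y\<^sup>2 > 0" using y by (intro add_nonneg_pos) auto
  ultimately have "\<bar>s\<bar> / (s\<^sup>2 + y\<^sup>2) \<le> 1 / y" using y by (simp add: field_simps)
  then have "\<bar>s\<bar> / (s\<^sup>2 + y\<^sup>2) / pi \<le> 1 / y / pi" by (intro divide_right_mono) auto
  then show ?thesis using \<open>s\<^sup>2 + y\<^sup>2 > 0\<close> by (simp add: conj_poisson_def abs_mult mult.commute)
 qed
 show "L1 (\<lambda>t. poisson_kernel y (x - t) * f t)"
 proof (rule integrable_bound[where f="\<lambda>t. 1 / (pi * y) * f t"])
  show "AE t in lborel. norm (poisson_kernel y (x - t) * f t) \<le> norm (1 / (pi * y) * f t)"
   unfolding norm_mult using 1 y by (intro AE_I2 mult_right_mono) auto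
 qed (use f in auto)
 show "L1 (\<lambda>t. conj_poisson y (x - t) * f t)"
 proof (rule integrable_bound[where f="\<lambda>t. 1 / (pi * y) * f t"])
  show "AE t in lborel. norm (conj_poisson y (x - t) * f t) \<le> norm (1 / (pi * y) * f t)"
   unfolding norm_mult using 2 y by (intro AE_I2 mult_right_mono) auto
 qed (use f in auto)
qed

text \<open>Integrate the half-plane inequality for \<open>w = cauchy_transform f (x + i y)\<close> over \<open>x\<close>: the term with
 \<open>w\<^sup>p\<close> integrates to zero by Cauchy's theorem, and the real part is a Poisson average of \<open>f\<close>.\<close>

lemma conj_poisson_powr_le_compact:
 fixes f :: "real => real"
 assumes p: "1 < p" and A: "A > 0" and B: "B > 0"
  and ineq: "\<And>w. Re w > 0 ==> \<bar>Im w\<bar> powr p \<le> A * Re w powr p - B * Re (w powr of_real p)"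
  and y: "y > 0" and [measurable]: "f \<in> borel_fun" and f0: "\<And>t. 0 \<le> f t"
  and f: "L1 f" and supp: "\<And>t. \<bar>t\<bar> > L ==> f t = 0" and L: "L \<ge> 0"
 shows "(NBINT x. ennreal (\<bar>(LBINT t. conj_poisson y (x - t) * f t)\<bar> powr p))
  \<le> ennreal A * (NBINT t. ennreal (f t powr p))"
proof (cases "AE t in lborel. f t = 0")
 case True
 have "(LBINT t. conj_poisson y (x - t) * f t) = 0" for x
  by (rule integral_eq_zero_AE) (use True in auto)
 then show ?thesis by simp
next
 case False
 have pos: "Re (cauchy_transform f z) > 0" if z: "Im z > 0" for z
 proof -
  have e: "Re (cauchy_transform f z) = (LBINT t. poisson_kernel (Im z) (Re z - t) * f t)"
   using cauchy_transform_Re_Im(1)[OF f z, of "Re z"] by simp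
  have nn: "AE t in lborel. 0 \<le> poisson_kernel (Im z) (Re z - t) * f t"
   using f0 poisson_kernel_pos[OF z] by (intro AE_I2 mult_nonneg_nonneg) (auto simp: less_imp_le)
  have "(LBINT t. poisson_kernel (Im z) (Re z - t) * f t) \<noteq> 0"
  proof
   assume "(LBINT t. poisson_kernel (Im z) (Re z - t) * f t) = 0"
   then have "AE t in lborel. poisson_kernel (Im z) (Re z - t) * f t = 0"
    using integral_nonneg_eq_0_iff_AE[OF kernel_integrable_mult(1)[OF z f] nn] by simp
   then have "AE t in lborel. f t = 0"
    by eventually_elim (use poisson_kernel_pos[OF z] in \<open>simp add: less_imp_neq[symmetric]\<close>)
   then show False using False by simp
  qed
  moreover have "(LBINT t. poisson_kernel (Im z) (Re z - t) * f t) \<ge> 0"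
   using nn by (rule integral_nonneg_AE)
  ultimately show ?thesis unfolding e by linarith
 qed
 define u where "u x = cauchy_transform f (Complex x y)" for x
 have u0: "Re (u x) > 0" for x unfolding u_def using pos y by simp
 have cu: "continuous_on UNIV u"
 proof -
  have "continuous_on {z. Im z > 0} (cauchy_transform f)"
   using cauchy_transform_holomorphic[OF f] by (rule holomorphic_on_imp_continuous_on)
  then show ?thesis unfolding u_def
   by (rule continuous_on_compose2) (use y in \<open>auto intro!: continuous_intros\<close>)
 qed
 have cp: "continuous_on UNIV (\<lambda>x. u x powr of_real p)"
  by (rule continuous_on_powr_complex)
    (use cu u0 p in \<open>auto intro!: continuous_intros simp: complex_nonpos_Reals_iff less_imp_le\<close>)
 have cI: "continuous_on UNIV (\<lambda>x. \<bar>Im (u x)\<bar> powr p)"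
  by (rule continuous_on_powr') (use cu p in \<open>auto intro!: continuous_intros\<close>)
 have cR: "continuous_on UNIV (\<lambda>x. Re (u x) powr p)"
  by (rule continuous_on_powr') (use cu p u0 in \<open>auto intro!: continuous_intros simp: less_imp_le\<close>)
 have [measurable]: "u \<in> borel_fun" using cu by (rule borel_measurable_continuous_onI)
 define S where "S = (NBINT x. ennreal (Re (u x) powr p))"
 define er where "er n = B * cmod (integral {- real n..real n} (\<lambda>x. u x powr of_real p))" for n
 have er: "er \<longlonglongrightarrow> 0"
 proof -
  have "(\<lambda>n. integral {- real n..real n} (\<lambda>x. u x powr of_real p)) \<longlonglongrightarrow> 0"
   unfolding u_def by (rule cauchy_transform_powr_integral_tendsto_0[OF p f supp L pos y])
  then show ?thesis unfolding er_def by (intro tendsto_mult_right_zero tendsto_norm_zero)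
 qed
 have conv: "ennreal (integral {- real n..real n} h) = (NBINT x. ennreal (h x) * indicator {- real n..real n} x)"
  if h: "continuous_on UNIV h" "\<And>x. 0 \<le> h x" for h :: "real => real" and n
 proof -
  have si: "set_integrable lborel {- real n..real n} h"
   using borel_integrable_atLeastAtMost' continuous_on_subset[OF h(1)] by blast
  have "(NBINT x. ennreal (h x) * indicator {- real n..real n} x)
    = (NBINT x. ennreal (indicator {- real n..real n} x *\<^sub>R h x))"
   by (intro nn_integral_cong) (simp add: indicator_def)
  also have "... = ennreal (LBINT x. indicator {- real n..real n} x *\<^sub>R h x)"
   using si h(2) by (intro nn_integral_eq_integral) (auto simp: set_integrable_def)
  also have "... = ennreal (integral {- real n..real n} h)"
   using set_borel_integral_eq_integral(2)[OF si] by (simp add: set_lebesgue_integral_def)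
  finally show ?thesis by simp
 qed
 have step: "(NBINT x. ennreal (\<bar>Im (u x)\<bar> powr p) * indicator {- real n..real n} x)
   \<le> ennreal A * S + ennreal (er n)" for n
 proof -
  let ?I = "{- real n..real n}"
  have ii: "(\<lambda>x. \<bar>Im (u x)\<bar> powr p) integrable_on ?I" "(\<lambda>x. Re (u x) powr p) integrable_on ?I"
   "(\<lambda>x. u x powr of_real p) integrable_on ?I"
   by (intro integrable_continuous_interval continuous_on_subset[OF cI] continuous_on_subset[OF cR]
      continuous_on_subset[OF cp]; simp)+
  have rI: "(\<lambda>x. Re (u x powr of_real p)) integrable_on ?I"
   using integrable_linear[OF ii(3) bounded_linear_Re] by (simp add: o_def)
  have "integral ?I (\<lambda>x. \<bar>Im (u x)\<bar> powr p) \<le> integral ?I (\<lambda>x. A * Re (u x) powr p - B * Re (u x powr of_real p))"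
   by (intro integral_le Henstock_Kurzweil_Integration.integrable_diff integrable_on_mult_right ii rI ineq u0)
  also have "... = A * integral ?I (\<lambda>x. Re (u x) powr p) - B * integral ?I (\<lambda>x. Re (u x powr of_real p))"
   using ii rI by (subst Henstock_Kurzweil_Integration.integral_diff) (auto intro!: integrable_on_mult_right)
  also have "integral ?I (\<lambda>x. Re (u x powr of_real p)) = Re (integral ?I (\<lambda>x. u x powr of_real p))"
   using integral_linear[OF ii(3) bounded_linear_Re] by (simp add: o_def)
  also have "A * integral ?I (\<lambda>x. Re (u x) powr p) - B * Re (integral ?I (\<lambda>x. u x powr of_real p))
    \<le> A * integral ?I (\<lambda>x. Re (u x) powr p) + er n"
  proof -
   have "- Re (integral ?I (\<lambda>x. u x powr of_real p)) \<le> cmod (integral ?I (\<lambda>x. u x powr of_real p))"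
    using abs_Re_le_cmod[of "integral ?I (\<lambda>x. u x powr of_real p)"] by linarith
   then have "B * (- Re (integral ?I (\<lambda>x. u x powr of_real p))) \<le> er n" unfolding er_def
    using B by (intro mult_left_mono) auto
   then show ?thesis by simp
  qed
  finally have "ennreal (integral ?I (\<lambda>x. \<bar>Im (u x)\<bar> powr p))
    \<le> ennreal (A * integral ?I (\<lambda>x. Re (u x) powr p) + er n)" by (rule ennreal_leI)
  also have "... = ennreal A * ennreal (integral ?I (\<lambda>x. Re (u x) powr p)) + ennreal (er n)"
   using A B ii by (subst ennreal_plus)
    (simp_all add: er_def ennreal_mult' Henstock_Kurzweil_Integration.integral_nonneg)
  also have "ennreal (integral ?I (\<lambda>x. Re (u x) powr p)) \<le> S"
   unfolding S_def conv[OF cR powr_ge_zero] by (intro nn_integral_mono) (auto simp: indicator_def)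
  finally show ?thesis unfolding conv[OF cI powr_ge_zero] by (simp add: mult_left_mono add_right_mono)
 qed
 have lim: "(\<lambda>n. NBINT x. ennreal (\<bar>Im (u x)\<bar> powr p) * indicator {- real n..real n} x)
   \<longlonglongrightarrow> (NBINT x. ennreal (\<bar>Im (u x)\<bar> powr p))"
 proof (rule nn_integral_LIMSEQ)
  show "incseq (\<lambda>n x. ennreal (\<bar>Im (u x)\<bar> powr p) * indicator {- real n..real n} x)"
   by (auto simp: incseq_def le_fun_def indicator_def)
  fix x
  have "\<forall>\<^sub>F n in sequentially. real n > \<bar>x\<bar>" by real_asymp
  then have "\<forall>\<^sub>F n in sequentially. ennreal (\<bar>Im (u x)\<bar> powr p) * indicator {- real n..real n} x = ennreal (\<bar>Im (u x)\<bar> powr p)"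
   by eventually_elim (auto simp: indicator_def)
  then show "(\<lambda>n. ennreal (\<bar>Im (u x)\<bar> powr p) * indicator {- real n..real n} x) \<longlonglongrightarrow> ennreal (\<bar>Im (u x)\<bar> powr p)"
   by (rule tendsto_eventually)
 qed measurable
 have "(NBINT x. ennreal (\<bar>Im (u x)\<bar> powr p)) \<le> ennreal A * S + ennreal 0"
  by (rule LIMSEQ_le[OF lim tendsto_add[OF tendsto_const tendsto_ennrealI[OF er]]])
    (use step in auto)
 also have "S \<le> (NBINT t. ennreal (f t powr p))"
  unfolding S_def u_def cauchy_transform_Re_Im(1)[OF f y]
  by (rule poisson_average_powr_le[OF p y]) (use f0 in auto)
 finally show ?thesis unfolding u_def cauchy_transform_Re_Im(2)[OF f y] by (simp add: mult_left_mono)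
qed

lemma abs_conj_poisson_le:
 assumes y: "y > 0"
 shows "\<bar>conj_poisson y s\<bar> \<le> 1 / (pi * y)"
  and "(conj_poisson y s)\<^sup>2 \<le> poisson_kernel y s / (pi * y)"
proof -
 have D: "s\<^sup>2 + y\<^sup>2 > 0" using y by (intro add_nonneg_pos) auto
 have "s\<^sup>2 * (s\<^sup>2 + y\<^sup>2) \<le> (s\<^sup>2 + y\<^sup>2) * (s\<^sup>2 + y\<^sup>2)" by (intro mult_right_mono) (use D in auto)
 then have "s\<^sup>2 / (s\<^sup>2 + y\<^sup>2)\<^sup>2 \<le> 1 / (s\<^sup>2 + y\<^sup>2)"
  using D by (simp add: divide_simps power2_eq_square[of "s\<^sup>2 + y\<^sup>2"])
 then have "s\<^sup>2 / (s\<^sup>2 + y\<^sup>2)\<^sup>2 / pi\<^sup>2 \<le> 1 / (s\<^sup>2 + y\<^sup>2) / pi\<^sup>2" by (intro divide_right_mono) auto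
 also have "1 / (s\<^sup>2 + y\<^sup>2) / pi\<^sup>2 = poisson_kernel y s / (pi * y)"
  using y by (simp add: poisson_kernel_def power2_eq_square)
 finally show 2: "(conj_poisson y s)\<^sup>2 \<le> poisson_kernel y s / (pi * y)"
  by (simp add: conj_poisson_def power_divide power_mult_distrib mult.commute)
 have "y / (pi * (s\<^sup>2 + y\<^sup>2)) \<le> y / (pi * y\<^sup>2)"
  using y by (intro divide_left_mono mult_left_mono mult_pos_pos add_nonneg_pos) auto
 then have "poisson_kernel y s \<le> 1 / (pi * y)" using y by (simp add: poisson_kernel_def power2_eq_square)
 then have "poisson_kernel y s / (pi * y) \<le> 1 / (pi * y) / (pi * y)" using y by (intro divide_right_mono) auto
 with 2 have "\<bar>conj_poisson y s\<bar>\<^sup>2 \<le> (1 / (pi * y))\<^sup>2" by (simp add: power2_eq_square)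
 then show "\<bar>conj_poisson y s\<bar> \<le> 1 / (pi * y)"
  by (rule power2_le_imp_le) (use y in simp)
qed

lemma conj_poisson_integrable_mult:
 fixes f :: "real => real"
 assumes p: "1 < p" "p \<le> 2" and y: "y > 0" and [measurable]: "f \<in> borel_fun"
  and f: "L1 (\<lambda>t. \<bar>f t\<bar> powr p)"
 shows "L1 (\<lambda>t. conj_poisson y (x - t) * f t)"
proof -
 define q where "q = p / (p - 1)"
 have pq: "1 / p + 1 / q = 1" unfolding q_def using p by (simp add: field_simps)
 have q: "q \<ge> 2" unfolding q_def using p by (simp add: field_simps)
 have bound: "\<bar>conj_poisson y s\<bar> powr q \<le> (1 / (pi * y)) powr (q - 2) / (pi * y) * poisson_kernel y s" for s
 proof -
  have "\<bar>conj_poisson y s\<bar> powr q = \<bar>conj_poisson y s\<bar> powr (q - 2) * \<bar>conj_poisson y s\<bar> powr 2"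
   by (subst powr_add[symmetric]) simp
  also have "\<bar>conj_poisson y s\<bar> powr 2 = (conj_poisson y s)\<^sup>2"
   by (cases "conj_poisson y s = 0") (auto simp: powr_numeral)
  also have "\<bar>conj_poisson y s\<bar> powr (q - 2) * (conj_poisson y s)\<^sup>2
    \<le> (1 / (pi * y)) powr (q - 2) * (poisson_kernel y s / (pi * y))"
   using abs_conj_poisson_le[OF y] q by (intro mult_mono powr_mono2) auto
  finally show ?thesis by simp
 qed
 have "L1 (\<lambda>t. poisson_kernel y (t + (- x)))"
  by (rule integrable_translate[OF integral_poisson_kernel(1)[OF y]])
 then have ip: "L1 (\<lambda>t. poisson_kernel y (x - t))"
  by (simp add: poisson_kernel_def power2_commute)
 have iq: "L1 (\<lambda>t. \<bar>conj_poisson y (x - t)\<bar> powr q)"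
 proof (rule integrable_bound[where f="\<lambda>t. (1 / (pi * y)) powr (q - 2) / (pi * y) * poisson_kernel y (x - t)"])
  show "AE t in lborel. norm (\<bar>conj_poisson y (x - t)\<bar> powr q)
    \<le> norm ((1 / (pi * y)) powr (q - 2) / (pi * y) * poisson_kernel y (x - t))"
  proof (rule AE_I2, goal_cases)
   case (1 t)
   have "norm (\<bar>conj_poisson y (x - t)\<bar> powr q) = \<bar>conj_poisson y (x - t)\<bar> powr q" by simp
   also note bound
   also note abs_ge_self
   finally show ?case by simp
  qed
 qed (use ip in auto)
 have "L1 (\<lambda>t. \<bar>f t\<bar> * \<bar>conj_poisson y (x - t)\<bar>)"
  by (rule Holder_inequality(1)[OF p(1) pq _ _ _ _ f iq]) auto
 then show ?thesis
  by (rule integrable_bound) (auto simp: abs_mult mult.commute)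
qed

text \<open>Truncate \<open>f\<close> in value and support. The inner integrals converge by dominated convergence, and Fatou's
 lemma handles the outer one.\<close>

lemma conj_poisson_powr_le_nonneg:
 fixes p :: real
 assumes p: "1 < p" "p \<le> 2"
 obtains A where "A > 0"
  "\<And>y (f :: real => real). y > 0 ==> f \<in> borel_fun ==> (\<And>t. 0 \<le> f t) ==>
   (NBINT x. ennreal (\<bar>(LBINT t. conj_poisson y (x - t) * f t)\<bar> powr p))
   \<le> ennreal A * (NBINT t. ennreal (f t powr p))"
proof -
 obtain A B where A: "A > 0" and B: "B > 0" and
  ineq: "\<And>w. Re w > 0 ==> \<bar>Im w\<bar> powr p \<le> A * Re w powr p - B * Re (w powr of_real p)"
  using half_plane_powr_inequality[OF p] by blast
 have main: "(NBINT x. ennreal (\<bar>(LBINT t. conj_poisson y (x - t) * f t)\<bar> powr p))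
   \<le> ennreal A * (NBINT t. ennreal (f t powr p))"
  if y: "y > 0" and fm[measurable]: "f \<in> borel_fun" and f0: "\<And>t. 0 \<le> f t" for y f
 proof (cases "(NBINT t. ennreal (f t powr p)) = \<infinity>")
  case True
  then show ?thesis using A by (simp add: ennreal_mult_top)
 next
  case False
  have fi: "L1 (\<lambda>t. \<bar>f t\<bar> powr p)"
   using False f0 by (intro integrableI_nonneg) (auto simp: top.not_eq_extremum)
  define g where "g n t = min (f t) (real n) * indicator {- real n..real n} t" for n t
  have gm[measurable]: "g n \<in> borel_fun" for n unfolding g_def by measurable
  have g0: "0 \<le> g n t" and gf: "g n t \<le> f t" for n t using f0[of t] by (auto simp: g_def indicator_def)
  have gi: "L1 (g n)" for n
  proof (rule integrable_bound[where f="\<lambda>t. real n * indicator {- real n..real n} t"])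
   show "L1 (\<lambda>t. real n * indicator {- real n..real n} t :: real)" by simp
   show "AE t in lborel. norm (g n t) \<le> norm (real n * indicator {- real n..real n} t :: real)"
    using f0 by (intro AE_I2) (auto simp: g_def indicator_def)
  qed simp
  have gn: "(NBINT x. ennreal (\<bar>(LBINT t. conj_poisson y (x - t) * g n t)\<bar> powr p))
   \<le> ennreal A * (NBINT t. ennreal (f t powr p))" for n
  proof -
   have "(NBINT x. ennreal (\<bar>(LBINT t. conj_poisson y (x - t) * g n t)\<bar> powr p))
    \<le> ennreal A * (NBINT t. ennreal (g n t powr p))"
    by (rule conj_poisson_powr_le_compact[OF p(1) A B ineq y gm g0 gi, of "real n"]) (auto simp: g_def indicator_def split: if_splits)
   also have "... \<le> ennreal A * (NBINT t. ennreal (f t powr p))"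
    using p g0 gf by (intro mult_left_mono nn_integral_mono ennreal_leI powr_mono2) auto
   finally show ?thesis .
  qed
  have lim: "(\<lambda>n. LBINT t. conj_poisson y (x - t) * g n t) \<longlonglongrightarrow> (LBINT t. conj_poisson y (x - t) * f t)" for x
  proof (rule integral_dominated_convergence[where w="\<lambda>t. \<bar>conj_poisson y (x - t) * f t\<bar>"])
   show "L1 (\<lambda>t. \<bar>conj_poisson y (x - t) * f t\<bar>)"
    by (rule integrable_abs[OF conj_poisson_integrable_mult[OF p y fm fi]])
   show "AE t in lborel. (\<lambda>n. conj_poisson y (x - t) * g n t) \<longlonglongrightarrow> conj_poisson y (x - t) * f t"
   proof (rule AE_I2, goal_cases)
    case (1 t)
    have "\<forall>\<^sub>F n in sequentially. real n > \<bar>t\<bar> + f t" by real_asymp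
    then have "\<forall>\<^sub>F n in sequentially. g n t = f t"
     by eventually_elim (use f0[of t] in \<open>auto simp: g_def indicator_def\<close>)
    then show ?case
     by (intro tendsto_mult_left tendsto_eventually)
   qed
   show "AE t in lborel. norm (conj_poisson y (x - t) * g n t) \<le> \<bar>conj_poisson y (x - t) * f t\<bar>" for n
    using g0 gf f0 by (intro AE_I2) (auto simp: abs_mult intro!: mult_left_mono)
  qed auto
  have "(NBINT x. ennreal (\<bar>(LBINT t. conj_poisson y (x - t) * f t)\<bar> powr p))
   = (NBINT x. liminf (\<lambda>n. ennreal (\<bar>(LBINT t. conj_poisson y (x - t) * g n t)\<bar> powr p)))"
  proof (rule nn_integral_cong, goal_cases)
   case (1 x)
   have "(\<lambda>n. ennreal (\<bar>(LBINT t. conj_poisson y (x - t) * g n t)\<bar> powr p))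
     \<longlonglongrightarrow> ennreal (\<bar>(LBINT t. conj_poisson y (x - t) * f t)\<bar> powr p)"
    using p by (intro tendsto_ennrealI tendsto_powr' tendsto_rabs lim tendsto_const) auto
   then show ?case
    by (intro lim_imp_Liminf[symmetric]) auto
  qed
  also have "... \<le> liminf (\<lambda>n. NBINT x. ennreal (\<bar>(LBINT t. conj_poisson y (x - t) * g n t)\<bar> powr p))"
   by (rule nn_integral_liminf) measurable
  also have "... \<le> ennreal A * (NBINT t. ennreal (f t powr p))"
   by (rule Liminf_le) (use gn in auto)
  finally show ?thesis .
 qed
 show ?thesis by (rule that[OF A main])
qed

lemma powr_add4_le:
 fixes a b c d :: real
 assumes p: "p > 0" and "a \<ge> 0" "b \<ge> 0" "c \<ge> 0" "d \<ge> 0"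
 shows "(a + b + c + d) powr p \<le> 4 powr p * (a powr p + b powr p + c powr p + d powr p)"
proof -
 define m where "m = max (max a b) (max c d)"
 have m: "a \<le> m" "b \<le> m" "c \<le> m" "d \<le> m" "0 \<le> m" unfolding m_def using assms by auto
 have "(a + b + c + d) powr p \<le> (4 * m) powr p" using assms m by (intro powr_mono2) auto
 also have "... = 4 powr p * m powr p" using m by (simp add: powr_mult)
 also have "m powr p \<le> a powr p + b powr p + c powr p + d powr p"
  by (auto simp: m_def max_def add.assoc intro: add_increasing add_increasing2)
 finally show ?thesis by simp
qed

text \<open>A complex function is split into the positive and negative parts of its real and imaginary parts. The
 constant does not depend on \<open>y\<close>.\<close>

theorem Riesz_conj_poisson:
 fixes p :: real
 assumes p: "1 < p" "p \<le> 2"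
 obtains C where "C > 0"
  "\<And>y (f :: real => complex). y > 0 ==> f \<in> borel_fun ==>
   (NBINT x. ennreal (cmod (LBINT s. conj_poisson y s *\<^sub>R f (x - s)) powr p))
   \<le> ennreal C * (NBINT t. ennreal (cmod (f t) powr p))"
proof -
 obtain A where A: "A > 0" and ineq: 
  "\<And>y (f :: real => real). y > 0 ==> f \<in> borel_fun ==> (\<And>t. 0 \<le> f t) ==>
   (NBINT x. ennreal (\<bar>(LBINT t. conj_poisson y (x - t) * f t)\<bar> powr p))
   \<le> ennreal A * (NBINT t. ennreal (f t powr p))"
  using conj_poisson_powr_le_nonneg[OF p] by blast
 define C where "C = 4 powr p * (4 * A)"
 have C: "C > 0" using A by (simp add: C_def)
 have main: "(NBINT x. ennreal (cmod (LBINT s. conj_poisson y s *\<^sub>R f (x - s)) powr p))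
   \<le> ennreal C * (NBINT t. ennreal (cmod (f t) powr p))"
  if y: "y > 0" and fm[measurable]: "f \<in> borel_fun" for y and f :: "real => complex"
 proof (cases "(NBINT t. ennreal (cmod (f t) powr p)) = \<infinity>")
  case True
  then show ?thesis using C by (simp add: ennreal_mult_top)
 next
  case False
  define N where "N = (NBINT t. ennreal (cmod (f t) powr p))"
  define T where "T g x = (LBINT t. conj_poisson y (x - t) * g t)" for g :: "real => real" and x
  define f1 where "f1 t = max 0 (Re (f t))" for t
  define f2 where "f2 t = max 0 (- Re (f t))" for t
  define f3 where "f3 t = max 0 (Im (f t))" for t
  define f4 where "f4 t = max 0 (- Im (f t))" for t
  note fdefs = f1_def f2_def f3_def f4_def
  have [measurable]: "f1 \<in> borel_fun" "f2 \<in> borel_fun"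
   "f3 \<in> borel_fun" "f4 \<in> borel_fun" unfolding fdefs[abs_def] by measurable
  have f0: "0 \<le> f1 t" "0 \<le> f2 t" "0 \<le> f3 t" "0 \<le> f4 t" for t by (auto simp: fdefs)
  have fle: "f1 t \<le> cmod (f t)" "f2 t \<le> cmod (f t)" "f3 t \<le> cmod (f t)" "f4 t \<le> cmod (f t)" for t
   using abs_Re_le_cmod[of "f t"] abs_Im_le_cmod[of "f t"] by (auto simp: fdefs)
  have feq: "f t = of_real (f1 t) - of_real (f2 t) + \<i> * (of_real (f3 t) - of_real (f4 t))" for t
   by (auto simp: complex_eq_iff fdefs)
  have fi: "L1 (\<lambda>t. cmod (f t) powr p)"
   using False by (intro integrableI_nonneg) (auto simp: top.not_eq_extremum)
  have Ti: "L1 (\<lambda>t. conj_poisson y (x - t) * g t)"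
   if [measurable]: "g \<in> borel_fun" and g: "\<And>t. 0 \<le> g t" "\<And>t. g t \<le> cmod (f t)" for g x
  proof (rule conj_poisson_integrable_mult[OF p y])
   show "L1 (\<lambda>t. \<bar>g t\<bar> powr p)"
    by (rule integrable_bound[OF fi]) (use g p in \<open>auto intro!: AE_I2 powr_mono2\<close>)
  qed simp
  have Tb: "(NBINT x. ennreal (\<bar>T g x\<bar> powr p)) \<le> ennreal A * N"
   if [measurable]: "g \<in> borel_fun" and g: "\<And>t. 0 \<le> g t" "\<And>t. g t \<le> cmod (f t)" for g
  proof -
   have "(NBINT x. ennreal (\<bar>T g x\<bar> powr p)) \<le> ennreal A * (NBINT t. ennreal (g t powr p))"
    unfolding T_def by (rule ineq[OF y _ g(1)]) simp
   also have "... \<le> ennreal A * N" unfolding N_def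
    using p g by (intro mult_left_mono nn_integral_mono ennreal_leI powr_mono2) auto
   finally show ?thesis .
  qed
  have bound: "cmod (LBINT s. conj_poisson y s *\<^sub>R f (x - s)) \<le> \<bar>T f1 x\<bar> + \<bar>T f2 x\<bar> + \<bar>T f3 x\<bar> + \<bar>T f4 x\<bar>" for x
  proof -
   have "(LBINT s. conj_poisson y s *\<^sub>R f (x - s)) = (LBINT t. conj_poisson y (x - t) *\<^sub>R f t)"
    using lborel_integral_real_affine[of "-1" "\<lambda>t. conj_poisson y (x - t) *\<^sub>R f t" x] by simp
   also have "... = (LBINT t. of_real (conj_poisson y (x - t) * f1 t) - of_real (conj_poisson y (x - t) * f2 t)
     + \<i> * (of_real (conj_poisson y (x - t) * f3 t) - of_real (conj_poisson y (x - t) * f4 t)))"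
    by (intro integral_cong refl, subst feq) (simp add: scaleR_conv_of_real algebra_simps)
   also have "... = of_real (T f1 x) - of_real (T f2 x) + \<i> * (of_real (T f3 x) - of_real (T f4 x))"
    unfolding T_def using Ti[of f1 x] Ti[of f2 x] Ti[of f3 x] Ti[of f4 x] f0 fle by (simp del: of_real_mult)
   also have "cmod \<dots> \<le> cmod (of_real (T f1 x) - of_real (T f2 x)) + cmod (of_real (T f3 x) - of_real (T f4 x))"
    by (rule norm_triangle_le) (simp add: norm_mult)
   also have "... \<le> (\<bar>T f1 x\<bar> + \<bar>T f2 x\<bar>) + (\<bar>T f3 x\<bar> + \<bar>T f4 x\<bar>)"
    by (intro add_mono norm_triangle_le_diff) auto
   finally show ?thesis by simp
  qed
  have Tm[measurable]: "T g \<in> borel_fun" if [measurable]: "g \<in> borel_fun" for g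
   unfolding T_def by measurable
  have "(NBINT x. ennreal (cmod (LBINT s. conj_poisson y s *\<^sub>R f (x - s)) powr p))
   \<le> (NBINT x. ennreal (4 powr p) * (ennreal (\<bar>T f1 x\<bar> powr p) + ennreal (\<bar>T f2 x\<bar> powr p) + ennreal (\<bar>T f3 x\<bar> powr p) + ennreal (\<bar>T f4 x\<bar> powr p)))"
  proof (rule nn_integral_mono, goal_cases)
   case (1 x)
   have "cmod (LBINT s. conj_poisson y s *\<^sub>R f (x - s)) powr p
     \<le> (\<bar>T f1 x\<bar> + \<bar>T f2 x\<bar> + \<bar>T f3 x\<bar> + \<bar>T f4 x\<bar>) powr p"
    using p bound[of x] by (intro powr_mono2) auto
   also have "... \<le> 4 powr p * (\<bar>T f1 x\<bar> powr p + \<bar>T f2 x\<bar> powr p + \<bar>T f3 x\<bar> powr p + \<bar>T f4 x\<bar> powr p)"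
    using p by (intro powr_add4_le) auto
   finally show ?case
    by (simp add: ennreal_mult'[symmetric] ennreal_plus[symmetric] del: ennreal_plus)
  qed
  also have "... = ennreal (4 powr p) * ((NBINT x. ennreal (\<bar>T f1 x\<bar> powr p)) + (NBINT x. ennreal (\<bar>T f2 x\<bar> powr p))
    + (NBINT x. ennreal (\<bar>T f3 x\<bar> powr p)) + (NBINT x. ennreal (\<bar>T f4 x\<bar> powr p)))"
   by (simp add: nn_integral_cmult nn_integral_add)
  also have "... \<le> ennreal (4 powr p) * (ennreal A * N + ennreal A * N + ennreal A * N + ennreal A * N)"
   by (intro mult_left_mono add_mono Tb f0 fle) auto
  also have "... = ennreal C * N"
  proof -
   have "ennreal A * N + ennreal A * N + ennreal A * N + ennreal A * N = 4 * (ennreal A * N)"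
   proof -
    have "(4::ennreal) = 1 + 1 + 1 + 1" by simp
    then show ?thesis by (simp only: distrib_right mult_1)
   qed
   also have "ennreal (4 powr p) * (4 * (ennreal A * N)) = ennreal C * N"
    using A by (simp add: C_def ennreal_mult mult.assoc)
   finally show ?thesis .
  qed
  finally show ?thesis unfolding N_def .
 qed
 show ?thesis by (rule that[OF C main])
qed

section \<open>The energy form and its upper bound\<close>

lemma Fubini_swap:
 fixes f :: "'a::euclidean_space => 'b::euclidean_space => 'c::{banach, second_countable_topology}"
 assumes m: "(\<lambda>z. f (fst z) (snd z)) \<in> borel_measurable (borel \<Otimes>\<^sub>M borel)"
  and fin: "(NBINT x. NBINT y. ennreal (norm (f x y))) < \<infinity>"
 shows "(LBINT x. LBINT y. f x y) = (LBINT y. LBINT x. f x y)"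
  and "L1 (\<lambda>z. f (fst z) (snd z))"
  and "L1 (\<lambda>x. LBINT y. f x y)"
  and "L1 (\<lambda>y. LBINT x. f x y)"
proof -
 have m2: "(\<lambda>z. f (fst z) (snd z)) \<in> borel_measurable (lborel \<Otimes>\<^sub>M lborel)"
  using m by (simp cong: measurable_cong_sets)
 have [measurable]: "case_prod f \<in> borel_measurable (lborel \<Otimes>\<^sub>M lborel)"
  using m2 by (simp add: case_prod_beta')
 have "(\<integral>\<^sup>+z. ennreal (norm (f (fst z) (snd z))) \<partial>(lborel \<Otimes>\<^sub>M lborel)) < \<infinity>"
  using fin m2 by (subst lborel.nn_integral_fst[symmetric]) auto
 then have i: "integrable (lborel \<Otimes>\<^sub>M lborel) (\<lambda>z. f (fst z) (snd z))"
  by (intro integrableI_bounded m2)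
 then have i2: "integrable (lborel \<Otimes>\<^sub>M lborel) (case_prod f)"
  by (simp add: case_prod_beta')
 show "L1 (\<lambda>z. f (fst z) (snd z))" using i by (simp add: lborel_prod)
 show "(LBINT x. LBINT y. f x y) = (LBINT y. LBINT x. f x y)"
  using lborel_pair.Fubini_integral[OF i2] by simp
 show "L1 (\<lambda>x. LBINT y. f x y)"
  using lborel_pair.integrable_fst[OF i2] by simp
 show "L1 (\<lambda>y. LBINT x. f x y)"
  using lborel_pair.integrable_snd[OF i2] by simp
qed

lemma cnj_measurable [measurable]: "cnj \<in> borel_fun"
 by (intro borel_measurable_continuous_onI continuous_intros)

text \<open>Convolution with \<open>K\<close> is bounded on \<open>L\<^sup>p\<close>. Where the convolution integral diverges its value is 0 by
 convention, so the inequality is meaningful for every Borel function.\<close>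

definition bounded_on_powr :: "real => real => (real => real) => bool" where
 "bounded_on_powr p C K \<longleftrightarrow> (\<forall>f::real => complex. f \<in> borel_fun \<longrightarrow>
   (NBINT x. ennreal (cmod (LBINT s. K s *\<^sub>R f (x - s)) powr p))
   \<le> ennreal C * (NBINT t. ennreal (cmod (f t) powr p)))"

text \<open>On each line parallel to \<open>a\<close> this is the one-dimensional bound.\<close>

lemma directional_convolution_bound:
 fixes F :: "'a::euclidean_space => complex"
 assumes K: "bounded_on_powr p C K" and [measurable]: "K \<in> borel_fun"
  and [measurable]: "F \<in> borel_fun" and a: "a \<noteq> 0"
 shows "(NBINT u. ennreal (cmod (LBINT s. K s *\<^sub>R F (u - s *\<^sub>R a)) powr p))
  \<le> ennreal C * (NBINT u. ennreal (cmod (F u) powr p))"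
proof -
 have "(NBINT u. ennreal (cmod (LBINT s. K s *\<^sub>R F (u - s *\<^sub>R a)) powr p))
  \<le> (NBINT u. ennreal C * ennreal (cmod (F u) powr p))"
 proof (rule nn_integral_mono_by_lines[OF _ _ a])
  fix u
  define f where "f \<sigma> = F (u + \<sigma> *\<^sub>R a)" for \<sigma>
  have [measurable]: "f \<in> borel_fun" unfolding f_def by measurable
  have "(NBINT x. ennreal (cmod (LBINT s. K s *\<^sub>R f (x - s)) powr p))
   \<le> ennreal C * (NBINT t. ennreal (cmod (f t) powr p))"
   using K unfolding bounded_on_powr_def by simp
  then show "(NBINT \<sigma>. ennreal (cmod (LBINT s. K s *\<^sub>R F (u + \<sigma> *\<^sub>R a - s *\<^sub>R a)) powr p))
    \<le> (NBINT \<sigma>. ennreal C * ennreal (cmod (F (u + \<sigma> *\<^sub>R a)) powr p))"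
   by (simp add: f_def nn_integral_cmult algebra_simps)
 qed measurable
 then show ?thesis by (simp add: nn_integral_cmult)
qed

text \<open>The difference decays like \<open>s\<^sup>-\<^sup>2\<close>, hence is integrable, while a single conjugate Poisson kernel is
 not. As \<open>y\<close> tends to 0 and \<open>Y\<close> to infinity it tends to \<open>1 / (\<pi> s)\<close>.\<close>

definition conj_poisson_diff :: "real => real => real => real" where
 "conj_poisson_diff y Y s = conj_poisson y s - conj_poisson Y s"

lemma conj_poisson_diff_measurable [measurable]: "conj_poisson_diff y Y \<in> borel_fun"
 unfolding conj_poisson_diff_def[abs_def] by measurable

lemma conj_poisson_diff_minus: "conj_poisson_diff y Y (- s) = - conj_poisson_diff y Y s"
 by (simp add: conj_poisson_diff_def conj_poisson_minus)

lemma conj_poisson_diff_integrable: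
 assumes y: "0 < y" "y < Y"
 shows "L1 (conj_poisson_diff y Y)"
proof (rule integrable_dominated)
 show "L1 (\<lambda>s. (Y\<^sup>2 - y\<^sup>2) / (Y * y) * poisson_kernel y s)"
  using integral_poisson_kernel(1)[OF y(1)] by simp
 show "norm (conj_poisson_diff y Y s) \<le> (Y\<^sup>2 - y\<^sup>2) / (Y * y) * poisson_kernel y s" for s
 proof -
  have D: "s\<^sup>2 + y\<^sup>2 > 0" "s\<^sup>2 + Y\<^sup>2 > 0" using y by (auto intro!: add_nonneg_pos)
  have "0 \<le> (\<bar>s\<bar> - Y)\<^sup>2" by simp
  then have "2 * (\<bar>s\<bar> * Y) \<le> s\<^sup>2 + Y\<^sup>2" by (simp add: power2_diff)
  moreover have "0 \<le> \<bar>s\<bar> * Y" using y by simp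
  ultimately have "\<bar>s\<bar> * Y \<le> s\<^sup>2 + Y\<^sup>2" by linarith
  then have le: "\<bar>s\<bar> / (s\<^sup>2 + Y\<^sup>2) \<le> 1 / Y" using y D by (simp add: field_simps)
  have Yy: "y\<^sup>2 \<le> Y\<^sup>2" using y by (intro power_mono) auto
  have "conj_poisson_diff y Y s = (Y\<^sup>2 - y\<^sup>2) / (pi * (s\<^sup>2 + y\<^sup>2)) * (s / (s\<^sup>2 + Y\<^sup>2))"
   using D by (simp add: conj_poisson_diff_def conj_poisson_def divide_simps) (simp add: algebra_simps)
  then have "norm (conj_poisson_diff y Y s) = (Y\<^sup>2 - y\<^sup>2) / (pi * (s\<^sup>2 + y\<^sup>2)) * (\<bar>s\<bar> / (s\<^sup>2 + Y\<^sup>2))"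
   using D Yy by (simp add: abs_mult)
  also have "... \<le> (Y\<^sup>2 - y\<^sup>2) / (pi * (s\<^sup>2 + y\<^sup>2)) * (1 / Y)"
   using le D Yy by (intro mult_left_mono) auto
  also have "... = (Y\<^sup>2 - y\<^sup>2) / (Y * y) * poisson_kernel y s"
   using y D by (simp add: poisson_kernel_def)
  finally show ?thesis
   by (rule order_trans) (simp only: real_norm_def abs_ge_self)
 qed
qed simp

lemma Riesz_kernels:
 fixes p :: real
 assumes p: "1 < p" "p \<le> 2"
 obtains C where "C > 0" "\<And>y. y > 0 ==> bounded_on_powr p C (conj_poisson y)"
  "\<And>y Y. 0 < y ==> y < Y ==> bounded_on_powr p C (conj_poisson_diff y Y)"
proof -
 obtain A where A: "A > 0" and R: "\<And>y (f :: real => complex). y > 0 ==> f \<in> borel_fun ==>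
   (NBINT x. ennreal (cmod (LBINT s. conj_poisson y s *\<^sub>R f (x - s)) powr p))
   \<le> ennreal A * (NBINT t. ennreal (cmod (f t) powr p))"
  using Riesz_conj_poisson[OF p] by blast
 define C where "C = 4 powr p * (2 * A)"
 have "1 \<le> (4::real) powr p" using p by (intro ge_one_powr_ge_zero) auto
 then have "1 * A \<le> 4 powr p * (2 * A)" using A by (intro mult_mono) auto
 then have AC: "A \<le> C" by (simp add: C_def)
 have C: "C > 0" using A AC by simp
 have 1: "bounded_on_powr p C (conj_poisson y)" if y: "y > 0" for y
  unfolding bounded_on_powr_def
 proof (intro allI impI)
  fix f :: "real => complex" assume f: "f \<in> borel_fun"
  show "(NBINT x. ennreal (cmod (LBINT s. conj_poisson y s *\<^sub>R f (x - s)) powr p))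
   \<le> ennreal C * (NBINT t. ennreal (cmod (f t) powr p))"
   by (rule order_trans[OF R[OF y f]]) (use AC in \<open>intro mult_right_mono ennreal_leI; simp\<close>)
 qed
 have 2: "bounded_on_powr p C (conj_poisson_diff y Y)" if yY: "0 < y" "y < Y" for y Y
  unfolding bounded_on_powr_def
 proof (intro allI impI)
  fix f :: "real => complex" assume f[measurable]: "f \<in> borel_fun"
  define N where "N = (NBINT t. ennreal (cmod (f t) powr p))"
  have Y: "Y > 0" using yY by simp
  show "(NBINT x. ennreal (cmod (LBINT s. conj_poisson_diff y Y s *\<^sub>R f (x - s)) powr p))
   \<le> ennreal C * (NBINT t. ennreal (cmod (f t) powr p))"
  proof (cases "N = \<infinity>")
   case True
   then show ?thesis using C by (simp add: ennreal_mult_top N_def)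
  next
   case False
   then have fi: "L1 (\<lambda>t. \<bar>cmod (f t)\<bar> powr p)"
    unfolding N_def by (intro integrableI_nonneg) (auto simp: top.not_eq_extremum)
   have i: "L1 (\<lambda>s. conj_poisson y s *\<^sub>R f (x - s))" if y: "y > 0" for y x
   proof -
    have "L1 (\<lambda>t. conj_poisson y (x - t) * cmod (f t))"
     by (rule conj_poisson_integrable_mult[OF p y _ fi]) simp
    then have "L1 (\<lambda>t. conj_poisson y (x - t) *\<^sub>R f t)"
     by (rule integrable_bound) (auto simp: abs_mult)
    then show ?thesis
     using lborel_integrable_real_affine[of "\<lambda>t. conj_poisson y (x - t) *\<^sub>R f t" "-1" x] by simp
   qed
   define T where "T y x = cmod (LBINT s. conj_poisson y s *\<^sub>R f (x - s))" for y x
   have T[measurable]: "T y \<in> borel_fun" for y unfolding T_def by measurable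
   have "(NBINT x. ennreal (cmod (LBINT s. conj_poisson_diff y Y s *\<^sub>R f (x - s)) powr p))
    \<le> (NBINT x. ennreal (4 powr p) * (ennreal (T y x powr p) + ennreal (T Y x powr p)))"
   proof (rule nn_integral_mono, goal_cases)
    case (1 x)
    have "(LBINT s. conj_poisson_diff y Y s *\<^sub>R f (x - s))
     = (LBINT s. conj_poisson y s *\<^sub>R f (x - s)) - (LBINT s. conj_poisson Y s *\<^sub>R f (x - s))"
     using i[OF yY(1)] i[OF Y] by (simp add: conj_poisson_diff_def scaleR_diff_left)
    then have "cmod (LBINT s. conj_poisson_diff y Y s *\<^sub>R f (x - s)) \<le> T y x + T Y x + 0 + 0"
     unfolding T_def using norm_triangle_ineq4 by simp
    then have "cmod (LBINT s. conj_poisson_diff y Y s *\<^sub>R f (x - s)) powr p \<le> (T y x + T Y x + 0 + 0) powr p"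
     using p by (intro powr_mono2) auto
    also have "... \<le> 4 powr p * (T y x powr p + T Y x powr p + 0 powr p + 0 powr p)"
     by (rule powr_add4_le) (use p in \<open>auto simp: T_def\<close>)
    finally show ?case
     by (simp add: ennreal_mult'[symmetric] ennreal_plus[symmetric] del: ennreal_plus)
   qed
   also have "... = ennreal (4 powr p) * ((NBINT x. ennreal (T y x powr p)) + (NBINT x. ennreal (T Y x powr p)))"
    by (simp add: nn_integral_cmult nn_integral_add)
   also have "... \<le> ennreal (4 powr p) * (ennreal A * N + ennreal A * N)"
    unfolding T_def N_def by (intro mult_left_mono add_mono R yY Y f) auto
   also have "... = ennreal C * N"
    using A by (simp add: C_def ennreal_mult mult.assoc flip: mult_2)
   finally show ?thesis unfolding N_def .
  qed
 qed
 show ?thesis by (rule that[OF C 1 2])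
qed

definition Lpn :: "real => ('a::euclidean_space => complex) => real" where
 "Lpn p F = (LBINT u. cmod (F u) powr p) powr (1 / p)"

lemma integrable_powr_bounded:
 fixes F :: "'a::euclidean_space => complex"
 assumes F: "L1 F" and M: "\<And>u. cmod (F u) \<le> M" and p: "p > 1"
 shows "L1 (\<lambda>u. cmod (F u) powr p)"
proof (rule integrable_dominated)
 have M0: "M \<ge> 0" using M[of 0] norm_ge_zero[of "F 0"] by linarith
 show "L1 (\<lambda>u. M powr (p - 1) * cmod (F u))" using F by simp
 show "norm (cmod (F u) powr p) \<le> M powr (p - 1) * cmod (F u)" for u
 proof -
  have "cmod (F u) powr p = cmod (F u) powr (p - 1) * cmod (F u) powr 1"
   by (subst powr_add[symmetric]) simp
  also have "... \<le> M powr (p - 1) * cmod (F u)"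
   using M[of u] p by (auto intro!: mult_mono powr_mono2)
  finally show ?thesis using M0 by simp
 qed
 have [measurable]: "F \<in> borel_fun" using F by auto
 show "(\<lambda>u. cmod (F u) powr p) \<in> borel_measurable lborel" by measurable
qed

lemma line_integral_bound:
 fixes F :: "'a::euclidean_space \<times> 'a => complex" and b :: 'a
 assumes b: "b \<in> Basis" and M: "\<And>u. cmod (F u) \<le> M" and supp: "\<And>x v. norm v > R ==> F (x, v) = 0"
  and K: "\<And>s. \<bar>K s\<bar> \<le> k" and R: "R \<ge> 0"
 shows "(NBINT z. ennreal (norm (K z *\<^sub>R F (u - z *\<^sub>R (0, b))))) \<le> ennreal (k * M * (2 * R))"
proof -
 have k0: "k \<ge> 0" using K[of 0] by linarith
 have M0: "M \<ge> 0" using M[of 0] norm_ge_zero[of "F 0"] by linarith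
 define c where "c = snd u \<bullet> b"
 have "ennreal (norm (K z *\<^sub>R F (u - z *\<^sub>R (0, b)))) \<le> ennreal (k * M) * indicator {c - R..c + R} z" for z
 proof (cases "z \<in> {c - R..c + R}")
  case True
  then show ?thesis using K[of z] M[of "u - z *\<^sub>R (0, b)"] by (auto intro!: ennreal_leI mult_mono)
 next
  case False
  have "\<bar>c - z\<bar> = \<bar>(snd u - z *\<^sub>R b) \<bullet> b\<bar>" using b by (simp add: inner_diff_left c_def)
  also have "... \<le> norm (snd u - z *\<^sub>R b)" using Basis_le_norm[OF b] by simp
  finally have "norm (snd u - z *\<^sub>R b) > R" using False by auto
  then have "F (fst u, snd u - z *\<^sub>R b) = 0" by (rule supp)
  moreover have "u - z *\<^sub>R (0, b) = (fst u, snd u - z *\<^sub>R b)" by (simp add: prod_eq_iff)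
  ultimately show ?thesis by simp
 qed
 then have "(NBINT z. ennreal (norm (K z *\<^sub>R F (u - z *\<^sub>R (0, b)))))
   \<le> (NBINT z. ennreal (k * M) * indicator {c - R..c + R} z)"
  by (rule nn_integral_mono)
 also have "... = ennreal (k * M * (2 * R))"
  using R k0 M0 by (simp add: nn_integral_cmult_indicator ennreal_mult)
 finally show ?thesis .
qed

text \<open>Move both convolutions onto \<open>F\<close>, apply Hoelder's inequality, and then the directional bound
 twice, each application costing a factor \<open>C\<^sup>1\<^sup>/\<^sup>p\<close>.\<close>

lemma double_Hilbert_bilinear_bound:
 fixes F G :: "'a::euclidean_space \<times> 'a => complex"
 assumes p: "1 < p" and pq: "1 / p + 1 / q = 1" and b: "b \<in> Basis"
  and F: "L1 F" "\<And>u. cmod (F u) \<le> M" "\<And>x v. norm v > R ==> F (x, v) = 0"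
  and G: "L1 G" "\<And>u. cmod (G u) \<le> M" and R: "R \<ge> 0"
  and K1: "L1 K1" "bounded_on_powr p C K1"
  and K2[measurable]: "K2 \<in> borel_fun" and K2b: "\<And>z. \<bar>K2 z\<bar> \<le> k" "bounded_on_powr p C K2"
  and C: "C > 0"
 shows "cmod (LBINT s. K1 s *\<^sub>R (LBINT z. K2 z *\<^sub>R (LBINT u. G u * cnj (F (u - (s *\<^sub>R b, z *\<^sub>R b))))))
  \<le> C powr (2 / p) * Lpn q G * Lpn p F"
proof -
 have [measurable]: "F \<in> borel_fun" "G \<in> borel_fun" "K1 \<in> borel_fun"
  using F(1) G(1) K1(1) by auto
 have "1 / p < 1" using p by simp
 then have "1 / q > 0" using pq by linarith
 then have q0: "q > 0" by simp
 have "1 / q < 1" using pq p by (smt (verit) divide_pos_pos)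
 then have q: "q > 1" using q0 by (simp add: field_simps)
 have k0: "k \<ge> 0" using K2b(1)[of 0] by linarith
 have M0: "M \<ge> 0" using F(2)[of 0] norm_ge_zero[of "F 0"] by linarith
 have b0: "b \<noteq> 0" using b by auto
 define Fc where "Fc u = cnj (F u)" for u
 have Fc[measurable]: "Fc \<in> borel_fun" unfolding Fc_def by measurable
 have Fcb: "\<And>u. cmod (Fc u) \<le> M" "\<And>x v. norm v > R ==> Fc (x, v) = 0" using F(2,3) by (auto simp: Fc_def)
 define F1 where "F1 u = (LBINT z. K2 z *\<^sub>R Fc (u - z *\<^sub>R (0, b)))" for u
 define F2 where "F2 u = (LBINT s. K1 s *\<^sub>R F1 (u - s *\<^sub>R (b, 0)))" for u
 have [measurable]: "F1 \<in> borel_fun" unfolding F1_def by measurable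
 have [measurable]: "F2 \<in> borel_fun" unfolding F2_def by measurable
 define B where "B = k * M * (2 * R)"
 have B0: "B \<ge> 0" unfolding B_def using k0 M0 R by simp
 have line: "(NBINT z. ennreal (norm (K2 z *\<^sub>R Fc (u - z *\<^sub>R (0, b))))) \<le> ennreal B" for u
  unfolding B_def by (rule line_integral_bound[where R = R and F = Fc and K = K2, OF b Fcb(1) Fcb(2) K2b(1) R])
 have F1b: "cmod (F1 u) \<le> B" for u
 proof -
  have "ecmod (F1 u) \<le> (NBINT z. ennreal (norm (K2 z *\<^sub>R Fc (u - z *\<^sub>R (0, b)))))"
  proof (cases "L1 (\<lambda>z. K2 z *\<^sub>R Fc (u - z *\<^sub>R (0, b)))")
   case True then show ?thesis unfolding F1_def by (rule integral_norm_bound_ennreal)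
  next
   case False then show ?thesis unfolding F1_def by (simp add: not_integrable_integral_eq)
  qed
  also note line
  finally show ?thesis using B0 by simp
 qed
 have Gfin: "(NBINT u. ecmod (G u)) < \<infinity>" using G(1) by (simp add: integrable_iff_bounded)
 have K1fin: "(NBINT s. ennreal \<bar>K1 s\<bar>) < \<infinity>" using K1(1) by (simp add: integrable_iff_bounded)
 have inner: "(LBINT z. K2 z *\<^sub>R (LBINT u. G u * cnj (F (u - (s *\<^sub>R b, z *\<^sub>R b)))))
   = (LBINT u. G u * F1 (u - s *\<^sub>R (b, 0)))" for s
 proof -
  have e: "u - s *\<^sub>R (b, 0) - z *\<^sub>R (0, b) = u - (s *\<^sub>R b, z *\<^sub>R b)" for u and z :: real by (simp add: prod_eq_iff)
  have "(LBINT z. K2 z *\<^sub>R (LBINT u. G u * cnj (F (u - (s *\<^sub>R b, z *\<^sub>R b)))))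
   = (LBINT z. LBINT u. G u * (K2 z *\<^sub>R Fc (u - s *\<^sub>R (b, 0) - z *\<^sub>R (0, b))))"
   unfolding e Fc_def by (simp only: mult_scaleR_right integral_scaleR_right)
  also have "... = (LBINT u. LBINT z. G u * (K2 z *\<^sub>R Fc (u - s *\<^sub>R (b, 0) - z *\<^sub>R (0, b))))"
  proof (rule Fubini_swap(1)[symmetric])
   have "(NBINT u. NBINT z. ecmod (G u * (K2 z *\<^sub>R Fc (u - s *\<^sub>R (b, 0) - z *\<^sub>R (0, b)))))
     = (NBINT u. ecmod (G u) * (NBINT z. ennreal (norm (K2 z *\<^sub>R Fc (u - s *\<^sub>R (b, 0) - z *\<^sub>R (0, b))))))"
    by (subst nn_integral_cmult[symmetric]) (auto simp: norm_mult ennreal_mult mult_ac)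
   also have "... \<le> (NBINT u. ecmod (G u) * ennreal B)"
    by (intro nn_integral_mono mult_left_mono line) auto
   also have "... < \<infinity>" using Gfin by (simp add: nn_integral_multc ennreal_mult_less_top)
   finally show "(NBINT u. NBINT z. ecmod (G u * (K2 z *\<^sub>R Fc (u - s *\<^sub>R (b, 0) - z *\<^sub>R (0, b))))) < \<infinity>" .
  qed measurable
  also have "... = (LBINT u. G u * F1 (u - s *\<^sub>R (b, 0)))" unfolding F1_def by (simp only: integral_mult_right_zero)
  finally show ?thesis .
 qed
 have outer: "(LBINT s. K1 s *\<^sub>R (LBINT u. G u * F1 (u - s *\<^sub>R (b, 0)))) = (LBINT u. G u * F2 u)"
 proof -
  have "(LBINT s. K1 s *\<^sub>R (LBINT u. G u * F1 (u - s *\<^sub>R (b, 0))))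
   = (LBINT s. LBINT u. G u * (K1 s *\<^sub>R F1 (u - s *\<^sub>R (b, 0))))"
   by (simp only: mult_scaleR_right integral_scaleR_right)
  also have "... = (LBINT u. LBINT s. G u * (K1 s *\<^sub>R F1 (u - s *\<^sub>R (b, 0))))"
  proof (rule Fubini_swap(1)[symmetric])
   have "(NBINT u. NBINT s. ecmod (G u * (K1 s *\<^sub>R F1 (u - s *\<^sub>R (b, 0)))))
     \<le> (NBINT u. NBINT s. ecmod (G u) * (ennreal \<bar>K1 s\<bar> * ennreal B))"
   proof (intro nn_integral_mono)
    fix u :: "'a \<times> 'a" and s :: real
    have "cmod (G u * (K1 s *\<^sub>R F1 (u - s *\<^sub>R (b, 0)))) = cmod (G u) * (\<bar>K1 s\<bar> * cmod (F1 (u - s *\<^sub>R (b, 0))))"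
     by (simp add: norm_mult)
    also have "... \<le> cmod (G u) * (\<bar>K1 s\<bar> * B)" by (intro mult_left_mono F1b) auto
    finally show "ecmod (G u * (K1 s *\<^sub>R F1 (u - s *\<^sub>R (b, 0)))) \<le> ecmod (G u) * (ennreal \<bar>K1 s\<bar> * ennreal B)"
     using B0 by (simp add: ennreal_mult[symmetric] ennreal_leI)
   qed
   also have "... = (NBINT u. ecmod (G u) * ((NBINT s. ennreal \<bar>K1 s\<bar>) * ennreal B))"
    by (simp add: nn_integral_cmult nn_integral_multc)
   also have "... = (NBINT u. ecmod (G u)) * ((NBINT s. ennreal \<bar>K1 s\<bar>) * ennreal B)"
    by (simp add: nn_integral_multc)
   also have "... < \<infinity>" using Gfin K1fin by (simp add: ennreal_mult_less_top)
   finally show "(NBINT u. NBINT s. ecmod (G u * (K1 s *\<^sub>R F1 (u - s *\<^sub>R (b, 0))))) < \<infinity>" .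
  qed measurable
  also have "... = (LBINT u. G u * F2 u)" unfolding F2_def by (simp only: integral_mult_right_zero)
  finally show ?thesis .
 qed
 have Fpi: "L1 (\<lambda>u. cmod (F u) powr p)" by (rule integrable_powr_bounded[OF F(1,2) p])
 have Gqi: "L1 (\<lambda>u. cmod (G u) powr q)" by (rule integrable_powr_bounded[OF G q])
 have "(NBINT u. ennreal (cmod (F2 u) powr p)) \<le> ennreal C * (NBINT u. ennreal (cmod (F1 u) powr p))"
  unfolding F2_def using b0 by (intro directional_convolution_bound[OF K1(2)]) (auto simp: zero_prod_def)
 also have "(NBINT u. ennreal (cmod (F1 u) powr p)) \<le> ennreal C * (NBINT u. ennreal (cmod (Fc u) powr p))"
  unfolding F1_def using b0 by (intro directional_convolution_bound[OF K2b(2)]) (auto simp: zero_prod_def)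
 also have "(NBINT u. ennreal (cmod (Fc u) powr p)) = ennreal (LBINT u. cmod (F u) powr p)"
  using Fpi by (simp add: Fc_def nn_integral_eq_integral)
 finally have F2n: "(NBINT u. ennreal (cmod (F2 u) powr p)) \<le> ennreal (C * (C * (LBINT u. cmod (F u) powr p)))"
  using C by (simp add: ennreal_mult mult_left_mono)
 then have F2i: "L1 (\<lambda>u. cmod (F2 u) powr p)"
  by (intro integrableI_nonneg) (auto intro: le_less_trans)
 have F2le: "(LBINT u. cmod (F2 u) powr p) \<le> C * (C * (LBINT u. cmod (F u) powr p))"
  using F2n C by (simp add: nn_integral_eq_integral[OF F2i])
 have "cmod (LBINT u. G u * F2 u) \<le> (LBINT u. cmod (F2 u) * cmod (G u))"
  using integral_norm_bound[of lborel "\<lambda>u. G u * F2 u"] by (simp add: norm_mult mult.commute)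
 also have "... \<le> (LBINT u. cmod (F2 u) powr p) powr (1 / p) * (LBINT u. cmod (G u) powr q) powr (1 / q)"
  by (rule Holder_inequality(2)[OF p pq _ _ _ _ F2i Gqi]) auto
 also have "... \<le> (C * (C * (LBINT u. cmod (F u) powr p))) powr (1 / p) * (LBINT u. cmod (G u) powr q) powr (1 / q)"
  using F2le p by (intro mult_right_mono powr_mono2) auto
 also have "(C * (C * (LBINT u. cmod (F u) powr p))) powr (1 / p) = C powr (2 / p) * Lpn p F"
 proof -
  have "C powr (1 / p) * C powr (1 / p) = C powr (2 / p)" by (simp flip: powr_add)
  then show ?thesis using C by (simp add: powr_mult Lpn_def flip: mult.assoc)
 qed
 finally show ?thesis unfolding inner outer Lpn_def by (simp add: mult_ac)
qed

text \<open>The pairing of \<open>G\<close> with the image of \<open>F\<close> under convolution with \<open>K1\<close> in the direction \<open>(b, 0)\<close>, with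
 \<open>K2\<close> in the direction \<open>(0, b)\<close>, and with the density \<open>\<rho>\<close> in position. Fourier transformation turns \<open>\<rho>\<close>
 into a factor that makes the integrals over the frequency converge.\<close>

definition energy_form :: "(real => real) => (real => real) => ('a => real) => 'a::euclidean_space
  => ('a \<times> 'a => complex) => ('a \<times> 'a => complex) => complex" where
 "energy_form K1 K2 \<rho> b G F = (LBINT r. \<rho> r *\<^sub>R (LBINT s. K1 s *\<^sub>R (LBINT z. K2 z *\<^sub>R
   (LBINT u. G u * cnj (F (u - (r + s *\<^sub>R b, z *\<^sub>R b)))))))"

lemma norm_integral_le_const:
 fixes f :: "'a => 'b::{banach, second_countable_topology}"
 assumes w: "integrable M w" "\<And>x. 0 \<le> w x" "(\<integral>x. w x \<partial>M) = 1"
  and f: "\<And>x. norm (f x) \<le> B"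
 shows "norm (\<integral>x. w x *\<^sub>R f x \<partial>M) \<le> B"
proof (cases "integrable M (\<lambda>x. w x *\<^sub>R f x)")
 case True
 have "norm (\<integral>x. w x *\<^sub>R f x \<partial>M) \<le> (\<integral>x. norm (w x *\<^sub>R f x) \<partial>M)" by (rule integral_norm_bound)
 also have "... \<le> (\<integral>x. w x * B \<partial>M)"
  using w f True by (intro integral_mono integrable_norm) (auto intro!: mult_left_mono)
 also have "... = B" using w by simp
 finally show ?thesis .
next
 case False
 then show ?thesis using order_trans[OF norm_ge_zero f] by (simp add: not_integrable_integral_eq)
qed

lemma energy_form_bound_le_2:
 fixes F G :: "'a::euclidean_space \<times> 'a => complex"
 assumes p: "1 < p" and pq: "1 / p + 1 / q = 1" and b: "b \<in> Basis"
  and F: "L1 F" "\<And>u. cmod (F u) \<le> M" "\<And>x v. norm v > R ==> F (x, v) = 0"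
  and G: "L1 G" "\<And>u. cmod (G u) \<le> M" and R: "R \<ge> 0"
  and K1: "L1 K1" "bounded_on_powr p C K1"
  and K2: "K2 \<in> borel_fun" and K2b: "\<And>z. \<bar>K2 z\<bar> \<le> k" "bounded_on_powr p C K2"
  and C: "C > 0" and \<rho>: "L1 \<rho>" "\<And>r. 0 \<le> \<rho> r" "(LBINT r. \<rho> r) = 1"
 shows "cmod (energy_form K1 K2 \<rho> b G F) \<le> C powr (2 / p) * Lpn q G * Lpn p F"
 unfolding energy_form_def
proof (rule norm_integral_le_const[OF \<rho>])
 fix r :: 'a
 define F' where "F' u = F (u - (r, 0))" for u
 have [measurable]: "F \<in> borel_fun" using F by auto
 have i: "L1 F'" using integrable_translate[OF F(1), of "- (r, 0)"] unfolding F'_def[abs_def] diff_conv_add_uminus .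
 have b': "cmod (F' u) \<le> M" for u unfolding F'_def by (rule F)
 have s': "F' (x, v) = 0" if "norm v > R" for x v using F(3)[OF that] by (simp add: F'_def)
 have L: "Lpn p F' = Lpn p F"
  using integral_translate[of "\<lambda>u. cmod (F u) powr p" "- (r, 0)"] unfolding Lpn_def F'_def diff_conv_add_uminus by simp
 have e: "F (u - (r + s *\<^sub>R b, z *\<^sub>R b)) = F' (u - (s *\<^sub>R b, z *\<^sub>R b))" for u s z
  unfolding F'_def by (rule arg_cong[of _ _ F]) (simp add: prod_eq_iff algebra_simps)
 show "cmod (LBINT s. K1 s *\<^sub>R (LBINT z. K2 z *\<^sub>R (LBINT u. G u * cnj (F (u - (r + s *\<^sub>R b, z *\<^sub>R b))))))
  \<le> C powr (2 / p) * Lpn q G * Lpn p F"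
  unfolding e L[symmetric]
  by (rule double_Hilbert_bilinear_bound[where M = M and R = R and k = k, OF p pq b i b' s' G R K1 K2 K2b C])
qed

text \<open>The kernels of the two Hilbert transforms are odd, so reversing the translations changes the sign
 twice. This symmetry replaces duality: it reduces exponents above 2 to those below 2.\<close>

lemma energy_form_hermitian:
 fixes F G :: "'a::euclidean_space \<times> 'a => complex"
 assumes [measurable]: "F \<in> borel_fun" "G \<in> borel_fun" "K1 \<in> borel_fun"
  "K2 \<in> borel_fun" "\<rho> \<in> borel_fun"
  and odd: "\<And>s. K1 (- s) = - K1 s" "\<And>z. K2 (- z) = - K2 z" and even: "\<And>r. \<rho> (- r) = \<rho> r"
 shows "energy_form K1 K2 \<rho> b G F = cnj (energy_form K1 K2 \<rho> b F G)"
proof -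
 define T where "T w = (LBINT u. G u * cnj (F (u - w)))" for w
 define S where "S w = (LBINT u. F u * cnj (G (u - w)))" for w
 have [measurable]: "T \<in> borel_fun" unfolding T_def by measurable
 have [measurable]: "S \<in> borel_fun" unfolding S_def by measurable
 have TS: "T w = cnj (S (- w))" for w
 proof -
  have "T w = (LBINT u. G (u + w) * cnj (F u))"
   unfolding T_def using integral_translate[of "\<lambda>u. G u * cnj (F (u - w))" w] by simp
  also have "... = (LBINT u. cnj (F u * cnj (G (u + w))))" by (simp add: mult.commute)
  also have "... = cnj (S (- w))" unfolding S_def by (simp only: integral_cnj diff_minus_eq_add)
  finally show ?thesis .
 qed
 define T2 where "T2 r s = (LBINT z. K2 z *\<^sub>R T (r + s *\<^sub>R b, z *\<^sub>R b))" for r s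
 define S2 where "S2 r s = (LBINT z. K2 z *\<^sub>R S (r + s *\<^sub>R b, z *\<^sub>R b))" for r s
 have T2S2: "T2 r s = - cnj (S2 (- r) (- s))" for r s
 proof -
  have "T2 r s = (LBINT z. cnj (K2 z *\<^sub>R S (- r - s *\<^sub>R b, - (z *\<^sub>R b))))"
   unfolding T2_def TS by (simp add: algebra_simps)
  also have "... = cnj (LBINT z. K2 z *\<^sub>R S (- r - s *\<^sub>R b, - (z *\<^sub>R b)))"
   by (rule integral_cnj)
  also have "(LBINT z. K2 z *\<^sub>R S (- r - s *\<^sub>R b, - (z *\<^sub>R b)))
    = (LBINT z. K2 (- z) *\<^sub>R S (- r - s *\<^sub>R b, z *\<^sub>R b))"
   using integral_reflect[of "\<lambda>z. K2 (- z) *\<^sub>R S (- r - s *\<^sub>R b, z *\<^sub>R b)"] by simp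
  also have "... = - S2 (- r) (- s)" unfolding S2_def by (simp add: odd)
  finally show ?thesis by simp
 qed
 have [measurable]: "case_prod S2 \<in> borel_measurable (borel \<Otimes>\<^sub>M borel)"
  unfolding S2_def case_prod_beta' by measurable
 define T3 where "T3 r = (LBINT s. K1 s *\<^sub>R T2 r s)" for r
 define S3 where "S3 r = (LBINT s. K1 s *\<^sub>R S2 r s)" for r
 have T3S3: "T3 r = cnj (S3 (- r))" for r
 proof -
  have "T3 r = (LBINT s. cnj (- (K1 s *\<^sub>R S2 (- r) (- s))))"
   unfolding T3_def T2S2 by simp
  also have "... = cnj (LBINT s. - (K1 s *\<^sub>R S2 (- r) (- s)))" by (rule integral_cnj)
  also have "(LBINT s. - (K1 s *\<^sub>R S2 (- r) (- s))) = (LBINT s. K1 (- s) *\<^sub>R S2 (- r) (- s))"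
   by (simp add: odd)
  also have "... = S3 (- r)" unfolding S3_def using integral_reflect[of "\<lambda>s. K1 s *\<^sub>R S2 (- r) s"] by simp
  finally show ?thesis .
 qed
 have [measurable]: "(\<lambda>r. S3 r) \<in> borel_fun"
  unfolding S3_def by measurable
 have "energy_form K1 K2 \<rho> b G F = (LBINT r. \<rho> r *\<^sub>R T3 r)"
  by (simp add: energy_form_def T3_def T2_def T_def)
 also have "... = (LBINT r. cnj (\<rho> r *\<^sub>R S3 (- r)))" unfolding T3S3 by simp
 also have "... = cnj (LBINT r. \<rho> r *\<^sub>R S3 (- r))" by (rule integral_cnj)
 also have "(LBINT r. \<rho> r *\<^sub>R S3 (- r)) = (LBINT r. \<rho> r *\<^sub>R S3 r)"
  using integral_reflect[of "\<lambda>r. \<rho> r *\<^sub>R S3 r"] by (simp add: even)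
 also have "... = energy_form K1 K2 \<rho> b F G"
  by (simp add: energy_form_def S3_def S2_def S_def)
 finally show ?thesis .
qed

text \<open>If \<open>p \<le> 2\<close> the bound puts the convolutions on the function measured in \<open>L\<^sup>p\<close>; otherwise \<open>q \<le> 2\<close>
 and, by symmetry, they can be put on the function measured in \<open>L\<^sup>q\<close>.\<close>

proposition energy_form_bound:
 fixes p q :: real
 assumes p: "1 < p" and pq: "1 / p + 1 / q = 1"
 obtains C where "C > 0"
  "\<And>(F :: 'a::euclidean_space \<times> 'a => complex) G M R b \<rho> y Y \<epsilon>.
   L1 F ==> (\<And>u. cmod (F u) \<le> M) ==> (\<And>x v. norm v > R ==> F (x, v) = 0) ==>
   L1 G ==> (\<And>u. cmod (G u) \<le> M) ==> (\<And>x v. norm v > R ==> G (x, v) = 0) ==> R \<ge> 0 ==>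
   b \<in> Basis ==> 0 < y ==> y < Y ==> 0 < \<epsilon> ==>
   L1 \<rho> ==> (\<And>r. 0 \<le> \<rho> r) ==> (LBINT r. \<rho> r) = 1 ==> (\<And>r. \<rho> (- r) = \<rho> r) ==>
   cmod (energy_form (conj_poisson_diff y Y) (conj_poisson \<epsilon>) \<rho> b G F) \<le> C * Lpn q G * Lpn p F \<and>
   cmod (energy_form (conj_poisson_diff y Y) (conj_poisson \<epsilon>) \<rho> b F G) \<le> C * Lpn q G * Lpn p F"
proof -
 have "1 / p < 1" using p by simp
 then have "1 / q > 0" using pq by linarith
 then have q0: "q > 0" by simp
 have "1 / q < 1" using pq p by (smt (verit) divide_pos_pos)
 then have q: "q > 1" using q0 by (simp add: field_simps)
 have qp: "1 / q + 1 / p = 1" using pq by simp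
 have cases: "p \<le> 2 \<or> q \<le> 2"
 proof (rule ccontr)
  assume "\<not> (p \<le> 2 \<or> q \<le> 2)"
  then have "1 / p < 1 / 2" "1 / q < 1 / 2" by (auto intro!: divide_strict_left_mono)
  then show False using pq by simp
 qed
 define r where "r = (if p \<le> 2 then p else q)"
 have r: "1 < r" "r \<le> 2" using p q cases by (auto simp: r_def)
 obtain C where C: "C > 0" and K: "\<And>y. y > 0 ==> bounded_on_powr r C (conj_poisson y)"
  "\<And>y Y. 0 < y ==> y < Y ==> bounded_on_powr r C (conj_poisson_diff y Y)"
  using Riesz_kernels[OF r] by blast
 define C' where "C' = C powr (2 / r)"
 have C': "C' > 0" using C by (simp add: C'_def)
 have main: "cmod (energy_form (conj_poisson_diff y Y) (conj_poisson \<epsilon>) \<rho> b G F) \<le> C' * Lpn q G * Lpn p F \<and>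
   cmod (energy_form (conj_poisson_diff y Y) (conj_poisson \<epsilon>) \<rho> b F G) \<le> C' * Lpn q G * Lpn p F"
  if F: "L1 F" "\<And>u. cmod (F u) \<le> M" "\<And>x v. norm v > R ==> F (x, v) = 0"
   and G: "L1 G" "\<And>u. cmod (G u) \<le> M" "\<And>x v. norm v > R ==> G (x, v) = 0" and R: "R \<ge> 0"
   and b: "b \<in> Basis" and y: "0 < y" "y < Y" and \<epsilon>: "0 < \<epsilon>"
   and \<rho>: "L1 \<rho>" "\<And>r. 0 \<le> \<rho> r" "(LBINT r. \<rho> r) = 1" "\<And>r. \<rho> (- r) = \<rho> r"
  for F G :: "'a \<times> 'a => complex" and M R b \<rho> y Y \<epsilon>
 proof -
  have m[measurable]: "F \<in> borel_fun" "G \<in> borel_fun" "\<rho> \<in> borel_fun"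
   using F(1) G(1) \<rho>(1) by auto
  note k = abs_conj_poisson_le(1)[OF \<epsilon>]
  have "energy_form (conj_poisson_diff y Y) (conj_poisson \<epsilon>) \<rho> b G F
    = cnj (energy_form (conj_poisson_diff y Y) (conj_poisson \<epsilon>) \<rho> b F G)"
   by (rule energy_form_hermitian) (simp_all add: conj_poisson_diff_minus conj_poisson_minus \<rho>(4))
  then have h: "cmod (energy_form (conj_poisson_diff y Y) (conj_poisson \<epsilon>) \<rho> b G F)
    = cmod (energy_form (conj_poisson_diff y Y) (conj_poisson \<epsilon>) \<rho> b F G)" by simp
  have "cmod (energy_form (conj_poisson_diff y Y) (conj_poisson \<epsilon>) \<rho> b G F) \<le> C' * Lpn q G * Lpn p F"
  proof (cases "p \<le> 2")
   case True
   then have rp: "r = p" by (simp add: r_def)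
   show ?thesis unfolding C'_def rp
    by (rule energy_form_bound_le_2[where M = M and R = R, OF p pq b F G(1,2) R conj_poisson_diff_integrable[OF y]
       K(2)[OF y, unfolded rp] kernel_measurable(2) k K(1)[OF \<epsilon>, unfolded rp] C \<rho>(1,2,3)])
  next
   case False
   then have rq: "r = q" by (simp add: r_def)
   have "cmod (energy_form (conj_poisson_diff y Y) (conj_poisson \<epsilon>) \<rho> b F G) \<le> C' * Lpn p F * Lpn q G"
    unfolding C'_def rq
    by (rule energy_form_bound_le_2[where M = M and R = R, OF q qp b G F(1,2) R conj_poisson_diff_integrable[OF y]
       K(2)[OF y, unfolded rq] kernel_measurable(2) k K(1)[OF \<epsilon>, unfolded rq] C \<rho>(1,2,3)])
   then show ?thesis unfolding h by (simp add: mult_ac)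
  qed
  then show ?thesis using h by simp
 qed
 show ?thesis by (rule that[OF C' main])
qed

section \<open>Gaussians and Fourier inversion\<close>

lemma lborel_integral_prod_Basis:
 fixes f :: "'a::euclidean_space => real => complex"
 assumes f: "\<And>b. b \<in> Basis ==> L1 (f b)"
 shows "L1 (\<lambda>x::'a. \<Prod>b\<in>Basis. f b (x \<bullet> b))"
  and "(LBINT x. (\<Prod>b\<in>Basis. f b (x \<bullet> b))) = (\<Prod>b\<in>Basis. LBINT t. f b t)"
proof -
 interpret product_sigma_finite "\<lambda>_::'a. lborel :: real measure" ..
 have fm[measurable]: "f b \<in> borel_fun" if "b \<in> Basis" for b using f[OF that] by auto
 have m: "(\<lambda>x. \<Prod>b\<in>Basis. f b (x \<bullet> b)) \<in> borel_measurable (borel :: 'a measure)" by measurable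
 have s: "(\<lambda>g. \<Sum>b\<in>Basis. g b *\<^sub>R b) \<in> (\<Pi>\<^sub>M b\<in>(Basis :: 'a set). lborel) \<rightarrow>\<^sub>M borel" by measurable
 have e: "(\<Prod>b\<in>Basis. f b ((\<Sum>b\<in>Basis. g b *\<^sub>R b) \<bullet> b)) = (\<Prod>b\<in>Basis. f b (g b))" for g
  by (intro prod.cong refl) simp
 have i: "integrable (\<Pi>\<^sub>M b\<in>(Basis :: 'a set). lborel) (\<lambda>g. \<Prod>b\<in>Basis. f b (g b))"
  by (rule product_integrable_prod) (use f in auto)
 show "L1 (\<lambda>x::'a. \<Prod>b\<in>Basis. f b (x \<bullet> b))"
  by (subst lborel_eq, subst integrable_distr_eq[OF s m]) (simp only: e i)
 have "(\<integral>x. (\<Prod>b\<in>Basis. f b (x \<bullet> b)) \<partial>(lborel :: 'a measure)) = (\<integral>g. (\<Prod>b\<in>Basis. f b (g b)) \<partial>(\<Pi>\<^sub>M b\<in>(Basis :: 'a set). lborel))"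
  by (subst lborel_eq, subst integral_distr[OF s m]) (simp only: e)
 also have "... = (\<Prod>b\<in>Basis. LBINT t. f b t)"
  by (rule product_integral_prod) (use f in auto)
 finally show "(LBINT x. (\<Prod>b\<in>Basis. f b (x \<bullet> b))) = (\<Prod>b\<in>Basis. LBINT t. f b t)" .
qed

lemma normal_density_fourier:
 assumes \<sigma>: "\<sigma> > 0"
 shows "(LBINT t. cis (- (t * x)) * of_real (normal_density 0 \<sigma> t)) = of_real (exp (- (\<sigma> * x)\<^sup>2 / 2))"
proof -
 have e: "of_real (normal_density 0 \<sigma> (\<sigma> * s)) = (of_real (std_normal_density s / \<sigma>) :: complex)" for s
  using \<sigma> by (simp add: normal_density_def real_sqrt_mult power_mult_distrib)
 have "(LBINT t. cis (- (t * x)) * of_real (normal_density 0 \<sigma> t))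
   = \<sigma> *\<^sub>R (LBINT s. cis (- ((\<sigma> * s) * x)) * of_real (normal_density 0 \<sigma> (\<sigma> * s)))"
  using lborel_integral_real_affine[of \<sigma> "\<lambda>t. cis (- (t * x)) * of_real (normal_density 0 \<sigma> t)" 0] \<sigma> by simp
 also have "... = \<sigma> *\<^sub>R (LBINT s. (1 / \<sigma>) *\<^sub>R (std_normal_density s *\<^sub>R cis (- (\<sigma> * x) * s)))"
  unfolding e using \<sigma>
  by (intro arg_cong[where f="\<lambda>z. \<sigma> *\<^sub>R z"] integral_cong refl)
    (simp add: scaleR_conv_of_real mult_ac)
 also have "... = (LBINT s. std_normal_density s *\<^sub>R cis (- (\<sigma> * x) * s))"
  by (simp only: integral_scaleR_right) (use \<sigma> in simp)
 also have "... = char std_normal_distribution (- (\<sigma> * x))"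
  unfolding char_def by (subst integral_density) (auto simp: cis_conv_exp)
 also have "... = of_real (exp (- (\<sigma> * x)\<^sup>2 / 2))"
  by (simp add: char_std_normal_distribution)
 finally show ?thesis .
qed

definition gaussian :: "real => 'a::euclidean_space => real" where
 "gaussian \<sigma> x = (\<Prod>b\<in>Basis. normal_density 0 \<sigma> (x \<bullet> b))"

lemma gaussian_measurable [measurable]: "gaussian \<sigma> \<in> borel_fun"
 unfolding gaussian_def[abs_def] by measurable

lemma gaussian_nonneg: "0 \<le> gaussian \<sigma> x"
 unfolding gaussian_def by (intro prod_nonneg) auto

lemma gaussian_even: "gaussian \<sigma> (- x) = gaussian \<sigma> x"
 unfolding gaussian_def normal_density_def by simp

lemma sum_Basis_inner_square: "(\<Sum>b\<in>Basis. (x \<bullet> b)\<^sup>2) = (norm x)\<^sup>2"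
 unfolding power2_norm_eq_inner by (subst euclidean_inner) (simp add: power2_eq_square)

lemma gaussian_eq_exp:
 assumes \<sigma>: "\<sigma> > 0"
 shows "gaussian \<sigma> (x :: 'a::euclidean_space) = (1 / (sqrt (2 * pi) * \<sigma>)) ^ DIM('a) * exp (- (norm x)\<^sup>2 / (2 * \<sigma>\<^sup>2))"
proof -
 have "gaussian \<sigma> x = (\<Prod>b\<in>Basis. 1 / (sqrt (2 * pi) * \<sigma>) * exp (- (x \<bullet> b)\<^sup>2 / (2 * \<sigma>\<^sup>2)))"
  unfolding gaussian_def normal_density_def using \<sigma> by (simp add: real_sqrt_mult)
 also have "... = (1 / (sqrt (2 * pi) * \<sigma>)) ^ DIM('a) * exp (\<Sum>b\<in>Basis. - (x \<bullet> b)\<^sup>2 / (2 * \<sigma>\<^sup>2))"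
  by (simp only: prod.distrib prod_constant exp_sum[OF finite_Basis])
 also have "(\<Sum>b\<in>Basis. - (x \<bullet> b)\<^sup>2 / (2 * \<sigma>\<^sup>2)) = - (norm x)\<^sup>2 / (2 * \<sigma>\<^sup>2)"
  by (simp only: sum_divide_distrib[symmetric] sum_negf sum_Basis_inner_square)
 finally show ?thesis .
qed

lemma gaussian_integral:
 assumes \<sigma>: "\<sigma> > 0"
 shows "L1 (gaussian \<sigma> :: 'a::euclidean_space => real)"
  and "(\<integral>x. gaussian \<sigma> x \<partial>(lborel :: 'a measure)) = 1"
proof -
 have i: "L1 (\<lambda>t. of_real (normal_density 0 \<sigma> t) :: complex)"
  using \<sigma> by (simp add: integrable_normal_density)
 have c: "(\<lambda>x::'a. \<Prod>b\<in>Basis. of_real (normal_density 0 \<sigma> (x \<bullet> b)) :: complex) = (\<lambda>x. of_real (gaussian \<sigma> x))"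
  by (simp add: gaussian_def)
 have ic: "L1 (\<lambda>x::'a. of_real (gaussian \<sigma> x) :: complex)"
  using lborel_integral_prod_Basis(1)[where f="\<lambda>b t. of_real (normal_density 0 \<sigma> t)" and 'a='a, OF i] unfolding c .
 show i1: "L1 (gaussian \<sigma> :: 'a => real)" using integrable_Re[OF ic] by simp
 have "(\<integral>x. of_real (gaussian \<sigma> x) \<partial>(lborel :: 'a measure)) = (1 :: complex)"
  using lborel_integral_prod_Basis(2)[where f="\<lambda>b t. of_real (normal_density 0 \<sigma> t)" and 'a='a, OF i] \<sigma>
  unfolding c by (simp add: integral_normal_density)
 then have "complex_of_real (\<integral>x. gaussian \<sigma> x \<partial>(lborel :: 'a measure)) = of_real 1"
  by (simp only: integral_complex_of_real of_real_1)
 then show "(\<integral>x. gaussian \<sigma> x \<partial>(lborel :: 'a measure)) = 1" by (simp only: of_real_eq_iff)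
qed

lemma cis_sum: "finite A ==> cis (\<Sum>a\<in>A. f a) = (\<Prod>a\<in>A. cis (f a))"
 by (induction A rule: finite_induct) (auto simp: cis_mult[symmetric])

lemma gaussian_fourier:
 assumes \<sigma>: "\<sigma> > 0"
 shows "(LBINT x. cis (- (x \<bullet> \<xi>)) * of_real (gaussian \<sigma> x))
  = of_real (exp (- (\<sigma> * norm (\<xi> :: 'a::euclidean_space))\<^sup>2 / 2))"
proof -
 define f where "f b t = cis (- (t * (\<xi> \<bullet> b))) * of_real (normal_density 0 \<sigma> t)" for b :: 'a and t
 have i: "L1 (f b)" for b
 proof (rule integrable_bound)
  show "L1 (normal_density 0 \<sigma>)" using \<sigma> by (simp add: integrable_normal_density)
  show "AE t in lborel. cmod (f b t) \<le> norm (normal_density 0 \<sigma> t)" by (simp add: f_def norm_mult)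
 qed (auto simp: f_def[abs_def] cis_conv_exp)
 have e: "cis (- (x \<bullet> \<xi>)) * of_real (gaussian \<sigma> x) = (\<Prod>b\<in>Basis. f b (x \<bullet> b))" for x
 proof -
  have "cis (- (x \<bullet> \<xi>)) = (\<Prod>b\<in>Basis. cis (- ((x \<bullet> b) * (\<xi> \<bullet> b))))"
   by (subst euclidean_inner) (simp add: sum_negf[symmetric] cis_sum)
  then show ?thesis by (simp add: f_def gaussian_def prod.distrib)
 qed
 have "(LBINT x. cis (- (x \<bullet> \<xi>)) * of_real (gaussian \<sigma> x)) = (\<Prod>b\<in>Basis. LBINT t. f b t)"
  unfolding e by (rule lborel_integral_prod_Basis(2)[OF i])
 also have "... = (\<Prod>b\<in>Basis. of_real (exp (- (\<sigma> * (\<xi> \<bullet> b))\<^sup>2 / 2)))"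
  unfolding f_def normal_density_fourier[OF \<sigma>] ..
 also have "... = of_real (exp (\<Sum>b\<in>Basis. - (\<sigma> * (\<xi> \<bullet> b))\<^sup>2 / 2))"
  by (simp only: exp_sum[OF finite_Basis] of_real_prod)
 also have "(\<Sum>b\<in>Basis. - (\<sigma> * (\<xi> \<bullet> b))\<^sup>2 / 2) = - (\<sigma> * norm \<xi>)\<^sup>2 / 2"
  by (simp only: sum_divide_distrib[symmetric] sum_negf power_mult_distrib sum_distrib_left[symmetric] sum_Basis_inner_square)
 finally show ?thesis .
qed

lemma gaussian_multiplier_eq:
 assumes \<sigma>: "\<sigma> > 0"
 shows "exp (- (\<sigma> * norm (\<xi> :: 'a::euclidean_space))\<^sup>2 / 2) = (sqrt (2 * pi) / \<sigma>) ^ DIM('a) * gaussian (1 / \<sigma>) \<xi>"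
 using \<sigma> by (simp add: gaussian_eq_exp power_divide power_mult_distrib field_simps)

lemma gaussian_multiplier_integrable:
 assumes \<sigma>: "\<sigma> > 0"
 shows "L1 (\<lambda>\<xi> :: 'a::euclidean_space. exp (- (\<sigma> * norm \<xi>)\<^sup>2 / 2))"
 unfolding gaussian_multiplier_eq[OF \<sigma>] using gaussian_integral(1)[of "1 / \<sigma>"] \<sigma> by simp

lemma gaussian_inverse_fourier:
 assumes \<sigma>: "\<sigma> > 0"
 shows "(LBINT \<xi>. cis (- (x \<bullet> \<xi>)) * of_real (exp (- (\<sigma> * norm \<xi>)\<^sup>2 / 2)))
  = of_real ((2 * pi) ^ DIM('a) * gaussian \<sigma> (x :: 'a::euclidean_space))"
proof -
 have \<sigma>': "1 / \<sigma> > 0" using \<sigma> by simp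
 have "(LBINT \<xi>. cis (- (x \<bullet> \<xi>)) * of_real (exp (- (\<sigma> * norm \<xi>)\<^sup>2 / 2)))
  = (LBINT \<xi>. of_real ((sqrt (2 * pi) / \<sigma>) ^ DIM('a)) * (cis (- (\<xi> \<bullet> x)) * of_real (gaussian (1 / \<sigma>) \<xi>)))"
  unfolding gaussian_multiplier_eq[OF \<sigma>]
  by (intro integral_cong refl) (simp add: inner_commute mult_ac)
 also have "... = of_real ((sqrt (2 * pi) / \<sigma>) ^ DIM('a)) * of_real (exp (- (1 / \<sigma> * norm x)\<^sup>2 / 2))"
  by (simp only: integral_mult_right_zero gaussian_fourier[OF \<sigma>'])
 also have "... = of_real ((2 * pi) ^ DIM('a) * gaussian \<sigma> x)"
 proof -
  have "(2 * pi) ^ DIM('a) * (1 / (sqrt (2 * pi) * \<sigma>)) ^ DIM('a) = (sqrt (2 * pi) / \<sigma>) ^ DIM('a)"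
  proof -
   have "2 * pi * (1 / (sqrt (2 * pi) * \<sigma>)) = sqrt (2 * pi) / \<sigma>"
    using \<sigma> by (simp add: divide_simps)
   then show ?thesis by (simp only: power_mult_distrib[symmetric])
  qed
  moreover have "- (1 / \<sigma> * norm x)\<^sup>2 / 2 = - (norm x)\<^sup>2 / (2 * \<sigma>\<^sup>2)" by (simp add: power_divide)
  ultimately have "(2 * pi) ^ DIM('a) * gaussian \<sigma> x = (sqrt (2 * pi) / \<sigma>) ^ DIM('a) * exp (- (1 / \<sigma> * norm x)\<^sup>2 / 2)"
   using gaussian_eq_exp[OF \<sigma>, of x] by (simp only: mult.assoc[symmetric])
  then show ?thesis by (simp only: of_real_mult)
 qed
 finally show ?thesis .
qed

definition FT :: "('a::euclidean_space => complex) => 'a => complex" where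
 "FT \<phi> \<xi> = (LBINT x. cis (- (x \<bullet> \<xi>)) * \<phi> x)"

lemma cis_measurable [measurable]: "cis \<in> borel_fun"
 by (intro borel_measurable_continuous_onI continuous_intros)

lemma FT_measurable [measurable (raw)]:
 assumes [measurable]: "\<phi> \<in> borel_fun"
 shows "FT \<phi> \<in> borel_fun"
 unfolding FT_def[abs_def] by measurable

lemma cis_mult_integrable:
 fixes \<phi> :: "'a::euclidean_space => complex"
 assumes "L1 \<phi>" and [measurable]: "g \<in> borel_fun"
 shows "L1 (\<lambda>x. cis (g x) * \<phi> x)"
proof (rule integrable_bound[OF assms(1)])
 have [measurable]: "\<phi> \<in> borel_fun" using assms(1) by auto
 show "(\<lambda>x. cis (g x) * \<phi> x) \<in> borel_measurable lborel" by measurable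
qed (simp add: norm_mult)

lemma norm_FT_le: "cmod (FT \<phi> \<xi>) \<le> (LBINT x. cmod (\<phi> x))"
 unfolding FT_def using integral_norm_bound[of lborel "\<lambda>x. cis (- (x \<bullet> \<xi>)) * \<phi> x"] by (simp add: norm_mult)

text \<open>Fubini and the Fourier transform of the Gaussian. The formula holds for every integrable function;
 both Fourier inversion and the subordination formula for \<open>|D|\<^sup>1\<^sup>/\<^sup>2\<close> are read off from it.\<close>

lemma FT_gaussian_regularized_inversion:
 fixes \<phi> :: "'a::euclidean_space => complex"
 assumes \<phi>: "L1 \<phi>" and \<sigma>: "\<sigma> > 0"
 shows "(LBINT \<xi>. cis (x \<bullet> \<xi>) * (of_real (exp (- (\<sigma> * norm \<xi>)\<^sup>2 / 2)) * FT \<phi> \<xi>))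
  = of_real ((2 * pi) ^ DIM('a)) * (LBINT r. gaussian \<sigma> r *\<^sub>R \<phi> (x - r))"
proof -
 have [measurable]: "\<phi> \<in> borel_fun" using \<phi> by auto
 let ?E = "\<lambda>\<xi>::'a. exp (- (\<sigma> * norm \<xi>)\<^sup>2 / 2)"
 have "(LBINT \<xi>. cis (x \<bullet> \<xi>) * (of_real (?E \<xi>) * FT \<phi> \<xi>))
   = (LBINT \<xi>. LBINT t. cis (- ((t - x) \<bullet> \<xi>)) * of_real (?E \<xi>) * \<phi> t)"
 proof (rule integral_cong[OF refl], goal_cases)
  case (1 \<xi>)
  have "cis (x \<bullet> \<xi>) * (of_real (?E \<xi>) * FT \<phi> \<xi>)
    = (LBINT t. cis (x \<bullet> \<xi>) * of_real (?E \<xi>) * (cis (- (t \<bullet> \<xi>)) * \<phi> t))"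
   unfolding FT_def by (simp only: integral_mult_right_zero mult.assoc)
  also have "... = (LBINT t. cis (- ((t - x) \<bullet> \<xi>)) * of_real (?E \<xi>) * \<phi> t)"
  proof (rule integral_cong[OF refl], goal_cases)
   case (1 t)
   have "cis (- ((t - x) \<bullet> \<xi>)) = cis (x \<bullet> \<xi>) * cis (- (t \<bullet> \<xi>))"
    by (simp add: cis_mult inner_diff_left)
   then show ?case by simp
  qed
  finally show ?case .
 qed
 also have "... = (LBINT t. LBINT \<xi>. cis (- ((t - x) \<bullet> \<xi>)) * of_real (?E \<xi>) * \<phi> t)"
 proof (rule Fubini_swap(1))
  have "(NBINT \<xi>. NBINT t. ecmod (cis (- ((t - x) \<bullet> \<xi>)) * of_real (?E \<xi>) * \<phi> t))
    = (NBINT \<xi>. ennreal (?E \<xi>)) * (NBINT t. ecmod (\<phi> t))"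
   by (simp add: norm_mult ennreal_mult nn_integral_cmult nn_integral_multc)
  also have "... < \<infinity>"
  proof -
   have "(NBINT \<xi>. ennreal (?E \<xi>)) < \<infinity>"
    using gaussian_multiplier_integrable[OF \<sigma>, where 'a='a] by (simp add: integrable_iff_bounded)
   moreover have "(NBINT t. ecmod (\<phi> t)) < \<infinity>"
    using \<phi> by (simp add: integrable_iff_bounded)
   ultimately show ?thesis by (simp add: ennreal_mult_less_top)
  qed
  finally show "(NBINT \<xi>. NBINT t. ecmod (cis (- ((t - x) \<bullet> \<xi>)) * of_real (?E \<xi>) * \<phi> t)) < \<infinity>" .
 qed measurable
 also have "... = (LBINT t. of_real ((2 * pi) ^ DIM('a) * gaussian \<sigma> (t - x)) * \<phi> t)"
  by (simp only: integral_mult_left_zero gaussian_inverse_fourier[OF \<sigma>])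
 also have "... = (LBINT t. of_real ((2 * pi) ^ DIM('a)) * (gaussian \<sigma> (x - t) *\<^sub>R \<phi> t))"
  using gaussian_even[of \<sigma> "x - t" for t] by (simp add: scaleR_conv_of_real mult.assoc)
 also have "... = of_real ((2 * pi) ^ DIM('a)) * (LBINT t. gaussian \<sigma> (x - t) *\<^sub>R \<phi> t)"
  by (rule integral_mult_right_zero)
 also have "(LBINT t. gaussian \<sigma> (x - t) *\<^sub>R \<phi> t) = (LBINT r. gaussian \<sigma> r *\<^sub>R \<phi> (x - r))"
 proof -
  have "(LBINT t. gaussian \<sigma> (x - t) *\<^sub>R \<phi> t) = (LBINT t. gaussian \<sigma> (- t) *\<^sub>R \<phi> (t + x))"
   using integral_translate[of "\<lambda>t. gaussian \<sigma> (x - t) *\<^sub>R \<phi> t" x] by simp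
  also have "... = (LBINT r. gaussian \<sigma> r *\<^sub>R \<phi> (x - r))"
   using integral_reflect[of "\<lambda>r. gaussian \<sigma> r *\<^sub>R \<phi> (x - r)"] by (simp add: add.commute)
  finally show ?thesis .
 qed
 finally show ?thesis .
qed

lemma integral_scale:
 fixes f :: "'a::euclidean_space => 'b::{banach, second_countable_topology}"
 assumes [measurable]: "f \<in> borel_fun" and c: "c > (0::real)"
 shows "(LBINT x. f x) = c ^ DIM('a) *\<^sub>R (LBINT x. f (c *\<^sub>R x))"
proof -
 have "(lborel :: 'a measure) = density (distr lborel borel (\<lambda>x. 0 + c *\<^sub>R x)) (\<lambda>_. ennreal (\<bar>c\<bar> ^ DIM('a)))"
  by (rule lborel_affine) (use c in simp)
 then have "(LBINT x. f x) = (\<integral>x. f x \<partial>(density (distr lborel borel (\<lambda>x::'a. c *\<^sub>R x)) (\<lambda>_. ennreal (c ^ DIM('a)))))"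
  using c by simp
 also have "... = (\<integral>x. c ^ DIM('a) *\<^sub>R f x \<partial>(distr lborel borel (\<lambda>x::'a. c *\<^sub>R x)))"
  using c by (subst integral_density) auto
 also have "... = (LBINT x. c ^ DIM('a) *\<^sub>R f (c *\<^sub>R x))"
  by (subst integral_distr) auto
 finally show ?thesis by simp
qed

lemma gaussian_scale:
 assumes \<sigma>: "\<sigma> > 0"
 shows "\<sigma> ^ DIM('a) * gaussian \<sigma> (\<sigma> *\<^sub>R (x :: 'a::euclidean_space)) = gaussian 1 x"
 using \<sigma> by (simp add: gaussian_eq_exp power_mult_distrib field_simps)

lemma gaussian_average_scale:
 fixes \<phi> :: "'a::euclidean_space => 'b::{banach, second_countable_topology}"
 assumes [measurable]: "\<phi> \<in> borel_fun" and \<sigma>: "\<sigma> > 0"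
 shows "(LBINT r. gaussian \<sigma> r *\<^sub>R \<phi> (x - r)) = (LBINT r. gaussian 1 r *\<^sub>R \<phi> (x - \<sigma> *\<^sub>R r))"
 using integral_scale[of "\<lambda>r. gaussian \<sigma> r *\<^sub>R \<phi> (x - r)" \<sigma>] \<sigma> gaussian_scale[OF \<sigma>, where 'a='a]
 by (simp flip: integral_scaleR_right)

theorem FT_inversion:
 fixes \<phi> :: "'a::euclidean_space => complex"
 assumes \<phi>: "L1 \<phi>" and cont: "continuous_on UNIV \<phi>" and bnd: "\<And>x. cmod (\<phi> x) \<le> B"
  and F: "L1 (FT \<phi>)"
 shows "(LBINT \<xi>. cis (x \<bullet> \<xi>) * FT \<phi> \<xi>) = of_real ((2 * pi) ^ DIM('a)) * \<phi> x"
proof -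
 have \<phi>m[measurable]: "\<phi> \<in> borel_fun" using \<phi> by auto
 define s where "s k = 1 / real (Suc k)" for k
 have s: "s k > 0" for k by (simp add: s_def)
 have s0: "s \<longlonglongrightarrow> 0" unfolding s_def by real_asymp
 have L: "(\<lambda>k. LBINT \<xi>. cis (x \<bullet> \<xi>) * (of_real (exp (- (s k * norm \<xi>)\<^sup>2 / 2)) * FT \<phi> \<xi>))
   \<longlonglongrightarrow> (LBINT \<xi>. cis (x \<bullet> \<xi>) * FT \<phi> \<xi>)"
 proof (rule integral_dominated_convergence[where w="\<lambda>\<xi>. cmod (FT \<phi> \<xi>)"])
  show "AE \<xi> in lborel. (\<lambda>k. cis (x \<bullet> \<xi>) * (of_real (exp (- (s k * norm \<xi>)\<^sup>2 / 2)) * FT \<phi> \<xi>)) \<longlonglongrightarrow> cis (x \<bullet> \<xi>) * FT \<phi> \<xi>"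
  proof (rule AE_I2, goal_cases)
   case (1 \<xi>)
   have "(\<lambda>k. cis (x \<bullet> \<xi>) * (of_real (exp (- (s k * norm \<xi>)\<^sup>2 / 2)) * FT \<phi> \<xi>))
     \<longlonglongrightarrow> cis (x \<bullet> \<xi>) * (of_real (exp (- (0 * norm \<xi>)\<^sup>2 / 2)) * FT \<phi> \<xi>)"
    by (intro tendsto_intros s0) auto
   then show ?case
    by simp
  qed
  show "AE \<xi> in lborel. cmod (cis (x \<bullet> \<xi>) * (of_real (exp (- (s k * norm \<xi>)\<^sup>2 / 2)) * FT \<phi> \<xi>)) \<le> cmod (FT \<phi> \<xi>)" for k
   by (intro AE_I2) (auto simp: norm_mult intro!: mult_left_le_one_le)
 qed (use F in auto)
 have R: "(\<lambda>k. LBINT r. gaussian 1 r *\<^sub>R \<phi> (x - s k *\<^sub>R r)) \<longlonglongrightarrow> (\<integral>r. gaussian 1 r *\<^sub>R \<phi> x \<partial>(lborel :: 'a measure))"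
 proof (rule integral_dominated_convergence[where w="\<lambda>r :: 'a. gaussian 1 r * B"])
  show "AE r in lborel. (\<lambda>k. gaussian 1 r *\<^sub>R \<phi> (x - s k *\<^sub>R r)) \<longlonglongrightarrow> gaussian 1 r *\<^sub>R \<phi> x"
  proof (rule AE_I2, goal_cases)
   case (1 r)
   have "(\<lambda>k. x - s k *\<^sub>R r) \<longlonglongrightarrow> x - 0 *\<^sub>R r" by (intro tendsto_intros s0)
   then have "(\<lambda>k. x - s k *\<^sub>R r) \<longlonglongrightarrow> x" by simp
   then have "(\<lambda>k. \<phi> (x - s k *\<^sub>R r)) \<longlonglongrightarrow> \<phi> x"
    using cont by (auto intro: continuous_on_tendsto_compose)
   then show ?case
    by (intro tendsto_intros)
  qed
  show "AE r in lborel. norm (gaussian 1 r *\<^sub>R \<phi> (x - s k *\<^sub>R r)) \<le> gaussian 1 r * B" for k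
   using bnd gaussian_nonneg by (intro AE_I2) (auto intro!: mult_mono)
  show "L1 (\<lambda>r :: 'a. gaussian 1 r * B)" using gaussian_integral(1)[of 1, where 'a='a] by simp
 qed measurable
 have "(\<integral>r. gaussian 1 r *\<^sub>R \<phi> x \<partial>(lborel :: 'a measure)) = \<phi> x"
  using gaussian_integral[of 1, where 'a='a] by simp
 then have "(\<lambda>k. of_real ((2 * pi) ^ DIM('a)) * (LBINT r. gaussian 1 r *\<^sub>R \<phi> (x - s k *\<^sub>R r)))
   \<longlonglongrightarrow> of_real ((2 * pi) ^ DIM('a)) * \<phi> x"
  using R by (intro tendsto_mult_left) simp
 moreover have "(\<lambda>k. of_real ((2 * pi) ^ DIM('a)) * (LBINT r. gaussian 1 r *\<^sub>R \<phi> (x - s k *\<^sub>R r)))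
   \<longlonglongrightarrow> (LBINT \<xi>. cis (x \<bullet> \<xi>) * FT \<phi> \<xi>)"
  using L by (simp only: FT_gaussian_regularized_inversion[OF \<phi> s] gaussian_average_scale[OF \<phi>m s])
 ultimately show ?thesis by (rule LIMSEQ_unique[rotated])
qed

lemma integral_exp_half_line:
 fixes c :: complex
 assumes c: "Re c > 0"
 shows "L1 (\<lambda>t. indicator {0<..} t *\<^sub>R exp (- (c * of_real t)))"
  and "(LBINT t. indicator {0<..} t *\<^sub>R exp (- (c * of_real t))) = 1 / c"
proof -
 have c0: "c \<noteq> 0" using c by auto
 have n: "cmod (exp (- (c * of_real t))) = exp (- (t * Re c))" for t
  by (simp add: mult.commute)
 have I: "einterval 0 \<infinity> = {0::real<..}"
  by (auto simp: einterval_def simp flip: zero_ereal_def)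
 have i: "set_integrable lborel (einterval 0 \<infinity>) (\<lambda>t. exp (- (c * of_real t)))"
 proof -
  have "set_integrable lborel {0<..} (\<lambda>t. exp (- (t * Re c)))"
   using integrable_I0i_exp_mscale[OF c] by (simp add: interval_lebesgue_integrable_def I)
  then show ?thesis unfolding I set_integrable_def
   by (rule integrable_bound) (auto simp: indicator_def n)
 qed
 then show "L1 (\<lambda>t. indicator {0<..} t *\<^sub>R exp (- (c * of_real t)))"
  by (simp add: I set_integrable_def)
 have "(LBINT t=0..\<infinity>. exp (- (c * of_real t))) = 0 - (- 1 / c)"
 proof (rule interval_integral_FTC_integrable[where F="\<lambda>t. - exp (- (c * of_real t)) / c"])
  show "((\<lambda>t. - exp (- (c * of_real t)) / c) has_vector_derivative exp (- (c * of_real t))) (at t)" for t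
  proof -
   have "((\<lambda>z. - exp (- (c * z)) / c) has_field_derivative exp (- (c * of_real t))) (at (of_real t))"
    using c0 by (auto intro!: derivative_eq_intros)
   then show ?thesis by (rule has_vector_derivative_real_field)
  qed
  show "isCont (\<lambda>t. exp (- (c * of_real t))) t" for t by (intro continuous_intros)
  show "(((\<lambda>t. - exp (- (c * of_real t)) / c) \<circ> real_of_ereal) \<longlongrightarrow> - 1 / c) (at_right 0)"
  proof -
   have "((\<lambda>t. - exp (- (c * of_real t)) / c) \<longlongrightarrow> - exp (- (c * of_real 0)) / c) (at_right 0)"
    using c0 by (intro tendsto_intros)
   then show ?thesis by (simp add: zero_ereal_def ereal_tendsto_simps)
  qed
  show "(((\<lambda>t. - exp (- (c * of_real t)) / c) \<circ> real_of_ereal) \<longlongrightarrow> 0) (at_left \<infinity>)"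
   unfolding ereal_tendsto_simps
  proof (rule Lim_null_comparison)
   show "\<forall>\<^sub>F t in at_top. norm (- exp (- (c * of_real t)) / c) \<le> exp (- (t * Re c)) / cmod c"
    by (simp add: norm_divide mult.commute)
   have "((\<lambda>t. exp (- (t * Re c))) \<longlongrightarrow> 0) at_top" using c by real_asymp
   then show "((\<lambda>t. exp (- (t * Re c)) / cmod c) \<longlongrightarrow> 0) at_top"
    by (rule tendsto_divide_zero)
  qed
 qed (use i in auto)
 then show "(LBINT t. indicator {0<..} t *\<^sub>R exp (- (c * of_real t))) = 1 / c"
  by (simp add: interval_lebesgue_integral_def I set_lebesgue_integral_def)
qed

text \<open>The Fourier multiplier of \<open>conj_poisson_diff\<close> up to the factor \<open>i\<close>: a regularised sign function, which
 is integrable and continuous at 0.\<close>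

definition sgn_exp :: "real => real => real => real" where
 "sgn_exp y Y \<tau> = sgn \<tau> * (exp (- (y * \<bar>\<tau>\<bar>)) - exp (- (Y * \<bar>\<tau>\<bar>)))"

lemma sgn_exp_measurable [measurable]: "sgn_exp y Y \<in> borel_fun"
 unfolding sgn_exp_def[abs_def] by measurable

lemma sgn_exp_fourier:
 assumes y: "0 < y" and Y: "0 < Y"
 shows "L1 (sgn_exp y Y)"
  and "FT (\<lambda>\<tau>. of_real (sgn_exp y Y \<tau>)) s = - 2 * of_real pi * \<i> * of_real (conj_poisson_diff y Y s)"
proof -
 define h where "h c t = indicator {0<..} t *\<^sub>R exp (- (c * of_real t))" for c :: complex and t :: real
 have hi: "L1 (h c)" and hv: "(LBINT t. h c t) = 1 / c" if "Re c > 0" for c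
  unfolding h_def using integral_exp_half_line[OF that] by auto
 have hr: "L1 (\<lambda>t. h c (- t))" "(LBINT t. h c (- t)) = 1 / c" if c: "Re c > 0" for c
  using lborel_integrable_real_affine[OF hi[OF c], of "-1" 0] lborel_integral_real_affine[of "-1" "h c" 0] hv[OF c]
  by simp_all
 define a where "a = Complex y s"
 define b where "b = Complex Y s"
 have e: "cis (- (\<tau> * s)) * of_real (sgn_exp y Y \<tau>)
   = h (Complex y s) \<tau> - h (Complex Y s) \<tau> - (h (Complex y (- s)) (- \<tau>) - h (Complex Y (- s)) (- \<tau>))" for \<tau> s
 proof -
  have x: "exp (- (Complex k u * of_real t)) = of_real (exp (- (k * t))) * cis (- (u * t))" for k u t
   by (simp add: exp_eq_polar)
  have hp: "h (Complex k u) t = of_real (exp (- (k * t))) * cis (- (u * t))" if "t > 0" for k u t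
   unfolding h_def using that by (simp add: x)
  have h0: "h c t = 0" if "t \<le> 0" for c t unfolding h_def using that by simp
  consider "\<tau> > 0" | "\<tau> = 0" | "\<tau> < 0" by linarith
  then show ?thesis
  proof cases
   case 3
   then show ?thesis by (simp add: h0 hp sgn_exp_def algebra_simps)
  qed (simp_all add: h0 hp sgn_exp_def algebra_simps)
 qed
 have ii: "L1 (\<lambda>\<tau>. of_real (sgn_exp y Y \<tau>) :: complex)"
 proof -
  have "L1 (\<lambda>\<tau>. cis (- (\<tau> * 0)) * of_real (sgn_exp y Y \<tau>))"
   unfolding e using y Y by (intro integrable_diff hi hr(1)) auto
  then show ?thesis by simp
 qed
 show "L1 (sgn_exp y Y)" using integrable_Re[OF ii] by simp
 have "FT (\<lambda>\<tau>. of_real (sgn_exp y Y \<tau>)) s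
   = (LBINT \<tau>. h (Complex y s) \<tau> - h (Complex Y s) \<tau> - (h (Complex y (- s)) (- \<tau>) - h (Complex Y (- s)) (- \<tau>)))"
  unfolding FT_def inner_real_def e ..
 also have "... = 1 / Complex y s - 1 / Complex Y s - (1 / Complex y (- s) - 1 / Complex Y (- s))"
  using y Y by (simp add: hi hv hr integrable_diff integral_diff)
 also have "... = - 2 * of_real pi * \<i> * of_real (conj_poisson_diff y Y s)"
 proof -
  have "1 / Complex k s - 1 / Complex k (- s) = - 2 * of_real pi * \<i> * of_real (conj_poisson k s)" if "k > 0" for k
  proof -
   have inv: "1 / Complex k u = Complex (k / (k\<^sup>2 + u\<^sup>2)) (- u / (k\<^sup>2 + u\<^sup>2))" for u
    by (simp add: complex_eq_iff Re_divide Im_divide)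
   show ?thesis unfolding inv
    by (simp add: complex_eq_iff conj_poisson_def add.commute)
  qed
  note K = this
  have "1 / Complex y s - 1 / Complex Y s - (1 / Complex y (- s) - 1 / Complex Y (- s))
   = (1 / Complex y s - 1 / Complex y (- s)) - (1 / Complex Y s - 1 / Complex Y (- s))" by simp
  then show ?thesis unfolding K[OF y] K[OF Y] conj_poisson_diff_def by (simp add: algebra_simps)
 qed
 finally show "FT (\<lambda>\<tau>. of_real (sgn_exp y Y \<tau>)) s = - 2 * of_real pi * \<i> * of_real (conj_poisson_diff y Y s)" .
qed

text \<open>The Fourier transform of \<open>sgn_exp\<close> is elementary; inversion gives that of the kernel.\<close>

lemma conj_poisson_diff_fourier:
 assumes y: "0 < y" "y < Y"
 shows "(LBINT s. conj_poisson_diff y Y s *\<^sub>R cis (s * \<tau>)) = \<i> * of_real (sgn_exp y Y \<tau>)"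
proof -
 have Y: "0 < Y" using y by simp
 note f = sgn_exp_fourier[OF y(1) Y]
 have c: "continuous_on UNIV (\<lambda>\<tau>. of_real (sgn_exp y Y \<tau>) :: complex)"
 proof -
  have "isCont (sgn_exp y Y) \<tau>" for \<tau>
  proof (cases "\<tau> = 0")
   case False
   then show ?thesis unfolding sgn_exp_def[abs_def] by (intro continuous_intros) auto
  next
   case True
   have "((\<lambda>\<tau>. sgn_exp y Y \<tau>) \<longlongrightarrow> 0) (at 0)"
   proof (rule Lim_null_comparison)
    show "\<forall>\<^sub>F \<tau> in at 0. norm (sgn_exp y Y \<tau>) \<le> \<bar>exp (- (y * \<bar>\<tau>\<bar>)) - exp (- (Y * \<bar>\<tau>\<bar>))\<bar>"
     by (intro always_eventually allI) (simp add: sgn_exp_def abs_mult mult_left_le_one_le abs_sgn_eq)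
    have "((\<lambda>\<tau>. \<bar>exp (- (y * \<bar>\<tau>\<bar>)) - exp (- (Y * \<bar>\<tau>\<bar>))\<bar>) \<longlongrightarrow> \<bar>exp (- (y * \<bar>0\<bar>)) - exp (- (Y * \<bar>0\<bar>))\<bar>) (at (0::real))"
     by (intro tendsto_intros)
    then show "((\<lambda>\<tau>. \<bar>exp (- (y * \<bar>\<tau>\<bar>)) - exp (- (Y * \<bar>\<tau>\<bar>))\<bar>) \<longlongrightarrow> 0) (at (0::real))" by simp
   qed
   moreover have "sgn_exp y Y 0 = 0" by (simp add: sgn_exp_def)
   ultimately show ?thesis unfolding True isCont_def by simp
  qed
  then show ?thesis by (intro continuous_on_of_real continuous_at_imp_continuous_on ballI)
 qed
 have bnd: "cmod (of_real (sgn_exp y Y \<tau>)) \<le> 1" for \<tau>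
 proof -
  have "\<bar>exp (- (y * \<bar>\<tau>\<bar>)) - exp (- (Y * \<bar>\<tau>\<bar>))\<bar> \<le> 1"
  proof -
   have "0 < exp (- (y * \<bar>\<tau>\<bar>))" "exp (- (y * \<bar>\<tau>\<bar>)) \<le> 1" "0 < exp (- (Y * \<bar>\<tau>\<bar>))" "exp (- (Y * \<bar>\<tau>\<bar>)) \<le> 1"
    using y Y by auto
   then show ?thesis unfolding abs_le_iff by linarith
  qed
  then show ?thesis unfolding norm_of_real by (simp add: sgn_exp_def abs_mult abs_sgn_eq)
 qed
 have I: "(LBINT s. cis (\<tau> \<bullet> s) * FT (\<lambda>\<tau>. of_real (sgn_exp y Y \<tau>)) s) = of_real ((2 * pi) ^ DIM(real)) * of_real (sgn_exp y Y \<tau>)"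
 proof (rule FT_inversion[OF _ c bnd])
  show "L1 (\<lambda>\<tau>. of_real (sgn_exp y Y \<tau>) :: complex)" using f(1) by simp
  show "L1 (FT (\<lambda>\<tau>. of_real (sgn_exp y Y \<tau>)))"
   unfolding f(2)[abs_def] using conj_poisson_diff_integrable[OF y] by simp
 qed
 have "- 2 * of_real pi * \<i> * (LBINT s. conj_poisson_diff y Y s *\<^sub>R cis (s * \<tau>))
   = (LBINT s. - 2 * of_real pi * \<i> * (conj_poisson_diff y Y s *\<^sub>R cis (s * \<tau>)))"
  by (rule integral_mult_right_zero[symmetric])
 also have "... = (LBINT s. cis (\<tau> \<bullet> s) * FT (\<lambda>\<tau>. of_real (sgn_exp y Y \<tau>)) s)"
  unfolding f(2) by (intro integral_cong refl) (simp add: scaleR_conv_of_real mult_ac)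
 also have "... = - 2 * of_real pi * \<i> * (\<i> * of_real (sgn_exp y Y \<tau>))"
 proof -
  have "- 2 * of_real pi * \<i> * (\<i> * z) = of_real (2 * pi) * z" for z
   by (simp add: complex_eq_iff)
  then show ?thesis unfolding I by (simp only: DIM_real power_one_right)
 qed
 finally have "- 2 * of_real pi * \<i> * (LBINT s. conj_poisson_diff y Y s *\<^sub>R cis (s * \<tau>))
   = - 2 * of_real pi * \<i> * (\<i> * of_real (sgn_exp y Y \<tau>))" .
 moreover have "- 2 * of_real pi * \<i> \<noteq> (0 :: complex)" by simp
 ultimately show ?thesis using mult_left_cancel by blast
qed

lemma integrable_indicator_cball: "L1 (\<lambda>v::'a::euclidean_space. c * indicator (cball a R) v :: real)"
 using emeasure_lborel_cball_finite[of a R]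
 by (intro integrable_mult_right integrable_real_indicator) (auto simp: infinity_ennreal_def)

lemma integrable_indicator_Icc: "L1 (\<lambda>z::real. c * indicator {a..b} z :: real)"
 by (intro integrable_mult_right integrable_real_indicator, simp, cases "a \<le> b") auto

text \<open>\<open>Q\<close> is the sum over all lines parallel to \<open>b\<close> of \<open>|m|\<^sup>2\<close>, where \<open>m\<close> is the integral of \<open>a\<close> over
 the line. The lines are parametrised by the slab \<open>0 \<le> v \<cdot> b \<le> 1\<close>, in which each has length one
 (the weight \<open>w\<close>), and those that meet the support of \<open>a\<close> cross the slab inside the ball of radius
 \<open>R + 1\<close>. The inequality is then the Cauchy-Schwarz inequality on this ball.\<close>

lemma line_mass_inequality:
 fixes a :: "'a::euclidean_space => complex" and b :: 'a
 assumes [measurable]: "a \<in> borel_fun" and bnd: "\<And>v. cmod (a v) \<le> M"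
  and supp: "\<And>v. norm v > R ==> a v = 0" and R: "R \<ge> 0" and b: "b \<in> Basis"
 defines "Q \<equiv> (LBINT z. LBINT v. a v * cnj (a (v - z *\<^sub>R b)))"
 shows "Im Q = 0" and "(cmod (LBINT v. a v))\<^sup>2 \<le> measure lborel (cball (0::'a) (R + 1)) * Re Q"
proof -
 have bb: "b \<bullet> b = 1" "norm b = 1" using b by auto
 have M0: "M \<ge> 0" using bnd[of 0] norm_ge_zero[of "a 0"] by linarith
 define w :: "'a => real" where "w v = indicator {0..1} (v \<bullet> b)" for v
 define m where "m v = (LBINT z. a (v - z *\<^sub>R b))" for v
 have [measurable]: "w \<in> borel_fun" unfolding w_def by measurable
 have [measurable]: "m \<in> borel_fun" unfolding m_def by measurable
 have w0: "0 \<le> w v" "w v \<le> 1" for v by (auto simp: w_def indicator_def)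
 have wone: "(LBINT s. w (v - s *\<^sub>R b)) = 1" "(NBINT s. ennreal (w (v - s *\<^sub>R b))) = 1" for v
 proof -
  have "w (v - s *\<^sub>R b) = indicator {v \<bullet> b - 1..v \<bullet> b} s" for s
   unfolding w_def using bb by (auto simp: inner_diff_left indicator_def)
  then show "(LBINT s. w (v - s *\<^sub>R b)) = 1" "(NBINT s. ennreal (w (v - s *\<^sub>R b))) = 1" by (simp_all add: ennreal_indicator)
 qed
 have line: "(NBINT z. ecmod (a (v - z *\<^sub>R b))) \<le> ennreal (M * (2 * R))" for v
 proof -
  have "cmod (a (v - z *\<^sub>R b)) \<le> M * indicator {v \<bullet> b - R..v \<bullet> b + R} z" for z
  proof (cases "z \<in> {v \<bullet> b - R..v \<bullet> b + R}")
   case False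
   have "\<bar>v \<bullet> b - z\<bar> = \<bar>(v - z *\<^sub>R b) \<bullet> b\<bar>" using bb by (simp add: inner_diff_left)
   also have "... \<le> norm (v - z *\<^sub>R b)" using Basis_le_norm[OF b] by simp
   finally have "norm (v - z *\<^sub>R b) > R" using False by auto
   then show ?thesis using supp M0 by simp
  qed (use bnd in simp)
  then have "ecmod (a (v - z *\<^sub>R b)) \<le> ennreal M * indicator {v \<bullet> b - R..v \<bullet> b + R} z" for z
   using ennreal_leI[of "cmod (a (v - z *\<^sub>R b))" "M * indicator {v \<bullet> b - R..v \<bullet> b + R} z"] M0
   by (simp add: ennreal_mult ennreal_indicator)
  then have "(NBINT z. ecmod (a (v - z *\<^sub>R b))) \<le> (NBINT z. ennreal M * indicator {v \<bullet> b - R..v \<bullet> b + R} z)"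
   by (rule nn_integral_mono)
  also have "... = ennreal (M * (2 * R))" using M0 R by (simp add: nn_integral_cmult_indicator ennreal_mult)
  finally show ?thesis .
 qed
 have minv: "m (v - s *\<^sub>R b) = m v" for v s
  using integral_translate[of "\<lambda>z. a (v - z *\<^sub>R b)" s] unfolding m_def by (simp add: algebra_simps)
 have m_alt: "m v = (LBINT s. a (v + s *\<^sub>R b))" for v
  using integral_reflect[of "\<lambda>z. a (v - z *\<^sub>R b)"] unfolding m_def by simp
 have mb: "cmod (m v) \<le> M * (2 * R)" for v
 proof -
  have "ecmod (m v) \<le> (NBINT z. ecmod (a (v - z *\<^sub>R b)))"
  proof (cases "L1 (\<lambda>z. a (v - z *\<^sub>R b))")
   case True then show ?thesis unfolding m_def by (rule integral_norm_bound_ennreal)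
  qed (simp add: m_def not_integrable_integral_eq)
  also note line
  finally show ?thesis using M0 R by simp
 qed
 have ia: "L1 a"
 proof (rule integrable_bound[where f="\<lambda>v. M * indicator (cball 0 R) v"])
  show "L1 (\<lambda>v::'a. M * indicator (cball 0 R) v :: real)" by (rule integrable_indicator_cball)
  show "AE v in lborel. norm (a v) \<le> norm (M * indicator (cball 0 R) v :: real)"
   using bnd supp M0 by (intro AE_I2) (auto simp: indicator_def not_le)
 qed simp
 have fa: "(NBINT v. ecmod (a v)) < \<infinity>" using ia by (simp add: integrable_iff_bounded)
 text \<open>Unfolding along lines: any function that is invariant in direction \<open>b\<close> may be
  tested against \<open>a\<close> or against \<open>w m\<close>.\<close>
 have unfold: "(LBINT v. a v * g v) = (LBINT v. w v *\<^sub>R (m v * g v))"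
  if [measurable]: "g \<in> borel_fun" and gi: "\<And>v s. g (v - s *\<^sub>R b) = g v" and gb: "\<And>v. cmod (g v) \<le> B" for g B
 proof -
  have gi': "g (v + s *\<^sub>R b) = g v" for v s using gi[of v "- s"] by simp
  have B0: "B \<ge> 0" using gb[of 0] norm_ge_zero[of "g 0"] by linarith
  let ?I = "\<lambda>v s. w (v - s *\<^sub>R b) *\<^sub>R (a v * g v)"
  have "(NBINT v. NBINT s. ecmod (?I v s)) = (NBINT v. NBINT s. ecmod (a v * g v) * ennreal (w (v - s *\<^sub>R b)))"
   using w0 by (simp add: ennreal_mult mult.commute)
  also have "... = (NBINT v. ecmod (a v * g v))" by (simp add: nn_integral_cmult wone)
  also have "... \<le> (NBINT v. ecmod (a v) * ennreal B)"
   using gb B0 by (intro nn_integral_mono) (auto simp: norm_mult ennreal_mult[symmetric] intro!: ennreal_leI mult_left_mono)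
  also have "... < \<infinity>" using fa by (simp add: nn_integral_multc ennreal_mult_less_top)
  finally have fin: "(NBINT v. NBINT s. ecmod (?I v s)) < \<infinity>" .
  have "(LBINT v. a v * g v) = (LBINT v. LBINT s. w (v - s *\<^sub>R b) *\<^sub>R (a v * g v))"
  proof (rule integral_cong[OF refl], goal_cases)
   case (1 v)
   have "L1 (\<lambda>s. w (v - s *\<^sub>R b))"
    using wone(1)[of v] not_integrable_integral_eq by force
   then show ?case
    by (simp add: wone)
  qed
  also have "... = (LBINT s. LBINT v. ?I v s)" by (rule Fubini_swap(1)[OF _ fin]) measurable
  also have "... = (LBINT s. LBINT v. w v *\<^sub>R (a (v + s *\<^sub>R b) * g v))"
  proof (rule integral_cong[OF refl], goal_cases)
   case (1 s)
   show ?case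
    using integral_translate[of "\<lambda>v. w (v - s *\<^sub>R b) *\<^sub>R (a v * g v)" "s *\<^sub>R b"] by (simp add: gi')
  qed
  also have "... = (LBINT v. LBINT s. w v *\<^sub>R (a (v + s *\<^sub>R b) * g v))"
  proof (rule Fubini_swap(1))
   have "(NBINT s. NBINT v. ecmod (w v *\<^sub>R (a (v + s *\<^sub>R b) * g v))) = (NBINT s. NBINT v. ecmod (?I v s))"
   proof (rule nn_integral_cong, goal_cases)
    case (1 s)
    show ?case using nn_integral_translate[of "\<lambda>v. ecmod (?I v s)" "s *\<^sub>R b"] by (simp add: gi')
   qed
   also have "... = (NBINT v. NBINT s. ecmod (?I v s))" by (rule lborel_pair.Fubini') measurable
   also note fin
   finally show "(NBINT s. NBINT v. ecmod (w v *\<^sub>R (a (v + s *\<^sub>R b) * g v))) < \<infinity>" .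
  qed measurable
  also have "... = (LBINT v. w v *\<^sub>R (m v * g v))"
   unfolding m_alt by (simp only: integral_scaleR_right integral_mult_left_zero)
  finally show ?thesis .
 qed
 have supp_m: "w v *\<^sub>R m v = 0" if v: "v \<notin> cball 0 (R + 1)" for v
 proof (cases "w v = 0")
  case False
  then have vb: "0 \<le> v \<bullet> b" "v \<bullet> b \<le> 1" by (auto simp: w_def indicator_def split: if_splits)
  have "a (v - z *\<^sub>R b) = 0" for z
  proof (rule supp)
   have "norm v \<le> norm (v - (v \<bullet> b) *\<^sub>R b) + norm ((v \<bullet> b) *\<^sub>R b)" using norm_triangle_ineq[of "v - (v \<bullet> b) *\<^sub>R b" "(v \<bullet> b) *\<^sub>R b"] by simp
   then have "norm v \<le> norm (v - (v \<bullet> b) *\<^sub>R b) + 1" using vb bb by simp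
   then have "R < norm (v - (v \<bullet> b) *\<^sub>R b)" using v by (simp add: not_le)
   also have "... \<le> norm (v - z *\<^sub>R b)"
   proof (rule norm_le[THEN iffD2])
    have "(v - z *\<^sub>R b) \<bullet> (v - z *\<^sub>R b) = (v - (v \<bullet> b) *\<^sub>R b) \<bullet> (v - (v \<bullet> b) *\<^sub>R b) + (v \<bullet> b - z)\<^sup>2"
     using bb by (simp add: inner_diff_left inner_diff_right power2_eq_square algebra_simps inner_commute[of b v])
    then show "(v - (v \<bullet> b) *\<^sub>R b) \<bullet> (v - (v \<bullet> b) *\<^sub>R b) \<le> (v - z *\<^sub>R b) \<bullet> (v - z *\<^sub>R b)" by simp
   qed
   finally show "R < norm (v - z *\<^sub>R b)" .
  qed
  then show ?thesis by (simp add: m_def)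
 qed simp
 have Qeq: "Q = (LBINT v. of_real (w v * (cmod (m v))\<^sup>2))"
 proof -
  have "Q = (LBINT v. LBINT z. a v * cnj (a (v - z *\<^sub>R b)))"
   unfolding Q_def
  proof (rule Fubini_swap(1)[symmetric])
   have "(NBINT v. NBINT z. ecmod (a v * cnj (a (v - z *\<^sub>R b))))
     = (NBINT v. ecmod (a v) * (NBINT z. ecmod (a (v - z *\<^sub>R b))))"
    by (simp add: norm_mult ennreal_mult nn_integral_cmult)
   also have "... \<le> (NBINT v. ecmod (a v) * ennreal (M * (2 * R)))"
    by (intro nn_integral_mono mult_left_mono line) auto
   also have "... < \<infinity>" using fa by (simp add: nn_integral_multc ennreal_mult_less_top)
   finally show "(NBINT v. NBINT z. ecmod (a v * cnj (a (v - z *\<^sub>R b)))) < \<infinity>" .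
  qed measurable
  also have "... = (LBINT v. a v * cnj (m v))"
   unfolding m_def by (simp only: integral_mult_right_zero integral_cnj)
  also have "... = (LBINT v. w v *\<^sub>R (m v * cnj (m v)))"
   by (rule unfold[where B="M * (2 * R)"]) (use minv mb in auto)
  also have "... = (LBINT v. of_real (w v * (cmod (m v))\<^sup>2))"
   by (intro integral_cong refl)
    (simp only: scaleR_conv_of_real complex_norm_square[symmetric] of_real_mult)
  finally show ?thesis .
 qed
 then have Qr: "Q = of_real (LBINT v. w v * (cmod (m v))\<^sup>2)" by (simp only: integral_complex_of_real)
 show "Im Q = 0" unfolding Qr by simp
 have wmi: "L1 (\<lambda>v. (w v * (cmod (m v)) ^ 2))"
 proof (rule integrable_dominated[where g="\<lambda>v. (M * (2 * R))\<^sup>2 * indicator (cball 0 (R + 1)) v"])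
  show "L1 (\<lambda>v::'a. (M * (2 * R))\<^sup>2 * indicator (cball 0 (R + 1)) v :: real)" by (rule integrable_indicator_cball)
  show "norm (w v * (cmod (m v))\<^sup>2) \<le> (M * (2 * R))\<^sup>2 * indicator (cball 0 (R + 1)) v" for v
  proof (cases "v \<in> cball 0 (R + 1)")
   case True
   have "w v * (cmod (m v))\<^sup>2 \<le> 1 * (M * (2 * R))\<^sup>2" using w0[of v] mb[of v] by (intro mult_mono power_mono) auto
   then show ?thesis using True w0[of v] by simp
  next
   case False
   then show ?thesis using supp_m[OF False] by auto
  qed
 qed measurable
 have e: "(LBINT v. a v) = (LBINT v. w v *\<^sub>R m v)"
  using unfold[of "\<lambda>_. 1" 1] by simp
 have "cmod (LBINT v. a v) \<le> (LBINT v. cmod (w v *\<^sub>R m v))"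
  unfolding e by (rule integral_norm_bound)
 also have "... = (LBINT v. (sqrt (w v) * cmod (m v)) * indicator (cball 0 (R + 1)) v)"
 proof (intro integral_cong refl)
  fix v
  have "sqrt (w v) = w v" by (simp add: w_def indicator_def)
  then show "cmod (w v *\<^sub>R m v) = (sqrt (w v) * cmod (m v)) * indicator (cball 0 (R + 1)) v"
   using supp_m[of v] w0[of v] by (cases "v \<in> cball 0 (R + 1)") auto
 qed
 also have "... \<le> (LBINT v. (sqrt (w v) * cmod (m v)) powr 2) powr (1/2) * (\<integral>v. (indicator (cball 0 (R + 1)) v :: real) powr 2 \<partial>(lborel :: 'a measure)) powr (1/2)"
 proof (rule Holder_inequality(2))
  show "L1 (\<lambda>v. (sqrt (w v) * cmod (m v)) powr 2)"
   using wmi w0 by (simp add: powr_numeral power_mult_distrib)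
  have "(indicator (cball 0 (R + 1)) v :: real) powr 2 = indicator (cball 0 (R + 1)) v" for v :: 'a by (simp add: indicator_def)
  then show "L1 (\<lambda>v::'a. (indicator (cball 0 (R + 1)) v :: real) powr 2)"
   using integrable_indicator_cball[of 1 "0::'a" "R + 1"] by simp
 qed (use w0 in \<open>auto intro!: borel_measurable_indicator borel_closed\<close>)
 also have "... = sqrt (Re Q) * sqrt (measure lborel (cball (0::'a) (R + 1)))"
 proof -
  have "(indicator (cball 0 (R + 1)) v :: real) powr 2 = indicator (cball 0 (R + 1)) v" for v :: 'a by (simp add: indicator_def)
  then show ?thesis using w0 unfolding Qr by (simp add: powr_numeral power_mult_distrib powr_half_sqrt)
 qed
 finally have "(cmod (LBINT v. a v))\<^sup>2 \<le> (sqrt (Re Q) * sqrt (measure lborel (cball (0::'a) (R + 1))))\<^sup>2"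
  by (intro power_mono) auto
 also have "... = Re Q * measure lborel (cball (0::'a) (R + 1))"
 proof -
  have "Re Q \<ge> 0" unfolding Qr using w0 by (simp add: integral_nonneg)
  then show ?thesis by (simp add: power_mult_distrib)
 qed
 finally show "(cmod (LBINT v. a v))\<^sup>2 \<le> measure lborel (cball (0::'a) (R + 1)) * Re Q"
  by (simp add: mult.commute)
qed

text \<open>The functions for which all integrals of this part converge absolutely. The last condition, uniform in
 \<open>v\<close>, bounds the Fourier transform in position for every velocity, not only for almost every one.\<close>

definition tame :: "real => real => ('a::euclidean_space \<times> 'a => complex) => bool" where
 "tame R M F \<longleftrightarrow> F \<in> borel_fun \<and> (\<forall>u. cmod (F u) \<le> M) \<and>
   (\<forall>x v. norm v > R \<longrightarrow> F (x, v) = 0) \<and> (\<forall>v. (NBINT x. ecmod (F (x, v))) \<le> ennreal M)"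

lemma tameD:
 assumes "tame R M F"
 shows "F \<in> borel_fun" "\<And>u. cmod (F u) \<le> M" "\<And>x v. norm v > R ==> F (x, v) = 0"
  "\<And>v. (NBINT x. ecmod (F (x, v))) \<le> ennreal M" "M \<ge> 0"
proof -
 show "\<And>u. cmod (F u) \<le> M" using assms unfolding tame_def by blast
 from this[of 0] show "M \<ge> 0" using norm_ge_zero[of "F 0"] by linarith
qed (use assms in \<open>unfold tame_def, blast+\<close>)

lemma tame_integrable:
 fixes F :: "'a::euclidean_space \<times> 'a => complex"
 assumes F: "tame R M F"
 shows "L1 F" "L1 (\<lambda>x. F (x, v))"
proof -
 note [measurable] = tameD(1)[OF F]
 show "L1 (\<lambda>x. F (x, v))"
  using tameD(4)[OF F, of v] by (intro integrableI_bounded) (auto intro: le_less_trans)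
 have m: "(\<lambda>u. ecmod (F u)) \<in> borel_measurable (lborel \<Otimes>\<^sub>M lborel)" by (simp add: lborel_prod)
 have "(NBINT u. ecmod (F u)) = (NBINT v. NBINT x. ecmod (F (x, v)))"
  using lborel_pair.nn_integral_snd[OF m] by (simp add: lborel_prod)
 also have "... \<le> (\<integral>\<^sup>+v. ennreal M * indicator (cball 0 R) v \<partial>(lborel :: 'a measure))"
 proof (rule nn_integral_mono, goal_cases)
  case (1 v)
  show ?case
   using tameD(4)[OF F, of v] tameD(3)[OF F, of v] by (cases "norm v > R") auto
 qed
 also have "... < \<infinity>"
  using emeasure_bounded_finite[of "cball (0::'a) R"]
  by (simp add: nn_integral_cmult_indicator ennreal_mult_less_top)
 finally show "L1 F" by (intro integrableI_bounded) auto
qed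

lemma tame_shear:
 assumes F: "tame R M F"
 shows "tame R M (\<lambda>u. F (shear t u))"
 unfolding tame_def
proof (intro conjI allI impI)
 note [measurable] = tameD(1)[OF F]
 show "(\<lambda>u. F (shear t u)) \<in> borel_fun" by measurable
 show "cmod (F (shear t u)) \<le> M" for u by (rule tameD(2)[OF F])
 show "norm v > R ==> F (shear t (x, v)) = 0" for x v by (simp add: shear_def tameD(3)[OF F])
 fix v
 have "(NBINT x. ecmod (F (x + t *\<^sub>R v, v))) = (NBINT x. ecmod (F (x, v)))"
  by (rule nn_integral_translate[of "\<lambda>x. ecmod (F (x, v))"]) simp
 then show "(NBINT x. ecmod (F (shear t (x, v)))) \<le> ennreal M"
  using tameD(4)[OF F, of v] by (simp add: shear_def)
qed

text \<open>The Fourier transform in position at fixed velocity.\<close>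

definition xFT :: "('a::euclidean_space \<times> 'a => complex) => 'a => 'a => complex" where
 "xFT F v \<xi> = FT (\<lambda>x. F (x, v)) \<xi>"

lemma xFT_facts:
 fixes F :: "'a::euclidean_space \<times> 'a => complex"
 assumes F: "tame R M F"
 shows "(\<lambda>w. xFT F (fst w) (snd w)) \<in> borel_measurable (borel \<Otimes>\<^sub>M borel)"
  and "cmod (xFT F v \<xi>) \<le> M" and "norm v > R ==> xFT F v \<xi> = 0"
  and "xFT (\<lambda>u. F (shear t u)) v \<xi> = cis (t * (v \<bullet> \<xi>)) * xFT F v \<xi>"
proof -
 note [measurable] = tameD(1)[OF F]
 show "(\<lambda>w. xFT F (fst w) (snd w)) \<in> borel_measurable (borel \<Otimes>\<^sub>M borel)"
  unfolding xFT_def FT_def by measurable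
 have "cmod (xFT F v \<xi>) \<le> (LBINT x. cmod (F (x, v)))" unfolding xFT_def by (rule norm_FT_le)
 also have "... \<le> M"
 proof -
  have "ennreal (LBINT x. cmod (F (x, v))) = (NBINT x. ecmod (F (x, v)))"
   using tame_integrable(2)[OF F, of v] by (intro nn_integral_eq_integral[symmetric]) auto
  then have "ennreal (LBINT x. cmod (F (x, v))) \<le> ennreal M" using tameD(4)[OF F, of v] by simp
  then show ?thesis using tameD(5)[OF F] by (simp only: ennreal_le_iff)
 qed
 finally show "cmod (xFT F v \<xi>) \<le> M" .
 show "norm v > R ==> xFT F v \<xi> = 0" by (simp add: xFT_def FT_def tameD(3)[OF F])
 have "xFT (\<lambda>u. F (shear t u)) v \<xi> = (LBINT x. cis (- ((x + t *\<^sub>R v - t *\<^sub>R v) \<bullet> \<xi>)) * F (x + t *\<^sub>R v, v))"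
  by (simp add: xFT_def FT_def shear_def)
 also have "... = (LBINT x. cis (- ((x - t *\<^sub>R v) \<bullet> \<xi>)) * F (x, v))"
  by (rule integral_translate[of "\<lambda>x. cis (- ((x - t *\<^sub>R v) \<bullet> \<xi>)) * F (x, v)" "t *\<^sub>R v"]) measurable
 also have "... = (LBINT x. cis (t * (v \<bullet> \<xi>)) * (cis (- (x \<bullet> \<xi>)) * F (x, v)))"
  by (simp add: inner_diff_left cis_mult flip: mult.assoc)
 also have "... = cis (t * (v \<bullet> \<xi>)) * xFT F v \<xi>"
  unfolding xFT_def FT_def by (rule integral_mult_right_zero)
 finally show "xFT (\<lambda>u. F (shear t u)) v \<xi> = cis (t * (v \<bullet> \<xi>)) * xFT F v \<xi>" .
qed

text \<open>Its integral over \<open>z\<close> is the quantity \<open>Q\<close> of \<open>line_mass_inequality\<close> for the function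
 \<open>v \<mapsto> xFT F v \<xi>\<close>.\<close>

definition line_correlation :: "('a::euclidean_space \<times> 'a => complex) => ('a \<times> 'a => complex) => 'a => 'a => real => complex" where
 "line_correlation G F b \<xi> z = (LBINT v. xFT G v \<xi> * cnj (xFT F (v - z *\<^sub>R b) \<xi>))"

text \<open>The last equation is the heart of the method: the flow acts on \<open>xFT\<close> by the phase
 \<open>exp (i t v \<cdot> \<xi>)\<close>, of which only \<open>exp (i t z b \<cdot> \<xi>)\<close> survives in the correlation.\<close>

lemma line_correlation_facts:
 fixes F G :: "'a::euclidean_space \<times> 'a => complex"
 assumes G: "tame R M G" and F: "tame R M F" and b: "b \<in> Basis" and R: "R \<ge> 0"
 shows "(\<lambda>w. line_correlation G F b (fst w) (snd w)) \<in> borel_measurable (borel \<Otimes>\<^sub>M borel)"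
  and "cmod (line_correlation G F b \<xi> z) \<le> M\<^sup>2 * measure lborel (cball (0::'a) R)"
  and "\<bar>z\<bar> > 2 * R ==> line_correlation G F b \<xi> z = 0"
  and "line_correlation (\<lambda>u. G (shear t u)) (\<lambda>u. F (shear t u)) b \<xi> z = cis (t * z * (\<xi> \<bullet> b)) * line_correlation G F b \<xi> z"
proof -
 note [measurable] = tameD(1)[OF F] tameD(1)[OF G]
 have [measurable]: "case_prod (xFT F) \<in> borel_measurable (borel \<Otimes>\<^sub>M borel)"
  "case_prod (xFT G) \<in> borel_measurable (borel \<Otimes>\<^sub>M borel)"
  using xFT_facts(1)[OF F] xFT_facts(1)[OF G] by (simp_all add: case_prod_beta')
 show "(\<lambda>w. line_correlation G F b (fst w) (snd w)) \<in> borel_measurable (borel \<Otimes>\<^sub>M borel)"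
  unfolding line_correlation_def by measurable
 have pt: "cmod (xFT G v \<xi> * cnj (xFT F (v - z *\<^sub>R b) \<xi>)) \<le> M\<^sup>2 * indicator (cball 0 R) v" for v
  using xFT_facts(2,3)[OF G] xFT_facts(2,3)[OF F] tameD(5)[OF F]
  by (cases "norm v > R") (auto simp: norm_mult power2_eq_square intro!: mult_mono)
 have i: "L1 (\<lambda>v::'a. M\<^sup>2 * indicator (cball 0 R) v :: real)" by (rule integrable_indicator_cball)
 have ic: "L1 (\<lambda>v. xFT G v \<xi> * cnj (xFT F (v - z *\<^sub>R b) \<xi>))"
  by (rule integrable_bound[OF i]) (use pt in \<open>auto intro!: AE_I2 order_trans[OF pt]\<close>)
 have "cmod (line_correlation G F b \<xi> z) \<le> (\<integral>v. M\<^sup>2 * indicator (cball 0 R) v \<partial>(lborel :: 'a measure))"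
  unfolding line_correlation_def
  by (rule integral_norm_bound_integral[OF ic i]) (rule pt)
 then show "cmod (line_correlation G F b \<xi> z) \<le> M\<^sup>2 * measure lborel (cball (0::'a) R)" by simp
 show "line_correlation G F b \<xi> z = 0" if z: "\<bar>z\<bar> > 2 * R"
 proof -
  have "xFT G v \<xi> * cnj (xFT F (v - z *\<^sub>R b) \<xi>) = 0" for v
  proof -
   have "\<bar>z\<bar> = norm (z *\<^sub>R b)" using b by simp
   also have "... \<le> norm v + norm (v - z *\<^sub>R b)" using norm_triangle_ineq4[of v "v - z *\<^sub>R b"] by simp
   finally have "norm v > R \<or> norm (v - z *\<^sub>R b) > R" using z by linarith
   then show ?thesis using xFT_facts(3)[OF F] xFT_facts(3)[OF G] by auto
  qed
  then show ?thesis by (simp only: line_correlation_def integral_zero)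
 qed
 have "xFT (\<lambda>u. G (shear t u)) v \<xi> * cnj (xFT (\<lambda>u. F (shear t u)) (v - z *\<^sub>R b) \<xi>)
   = cis (t * z * (\<xi> \<bullet> b)) * (xFT G v \<xi> * cnj (xFT F (v - z *\<^sub>R b) \<xi>))" for v
 proof -
  have "cis (t * (v \<bullet> \<xi>)) * cnj (cis (t * ((v - z *\<^sub>R b) \<bullet> \<xi>))) = cis (t * z * (\<xi> \<bullet> b))"
   by (simp add: cis_cnj cis_mult inner_diff_left algebra_simps inner_commute)
  then show ?thesis unfolding xFT_facts(4)[OF F] xFT_facts(4)[OF G] by (simp add: mult_ac)
 qed
 then show "line_correlation (\<lambda>u. G (shear t u)) (\<lambda>u. F (shear t u)) b \<xi> z = cis (t * z * (\<xi> \<bullet> b)) * line_correlation G F b \<xi> z"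
  unfolding line_correlation_def by simp
qed

lemma pair_diff: "u - (a, b) = (fst u - a, snd u - b)"
 by (simp add: prod_eq_iff)

text \<open>As a function of the translation \<open>w\<close> in position, the correlation \<open>c z\<close> of \<open>G\<close> with \<open>F\<close> has the line
 correlation as its Fourier transform. The form evaluates \<open>A = \<integral> K2 z c z dz\<close> after convolution with
 \<open>K1\<close> and the Gaussian, so inversion applied to \<open>A\<close> expresses it through the multipliers of these two.\<close>

lemma energy_form_fourier:
 fixes F G :: "'a::euclidean_space \<times> 'a => complex"
 assumes G: "tame R M G" and F: "tame R M F" and b: "b \<in> Basis" and R: "R \<ge> 0" and y: "0 < y" "y < Y" and \<delta>: "\<delta> > 0"
  and [measurable]: "K2 \<in> borel_fun" and K2: "\<And>z. \<bar>K2 z\<bar> \<le> k"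
 shows "of_real ((2 * pi) ^ DIM('a)) * energy_form (conj_poisson_diff y Y) K2 (gaussian \<delta>) b G F
  = (LBINT \<xi>. of_real (exp (- (\<delta> * norm \<xi>)\<^sup>2 / 2)) * (\<i> * of_real (sgn_exp y Y (\<xi> \<bullet> b)))
     * (LBINT z. K2 z *\<^sub>R line_correlation G F b \<xi> z))"
proof -
 note [measurable] = tameD(1)[OF F] tameD(1)[OF G]
 note M0 = tameD(5)[OF F]
 have k0: "k \<ge> 0" using K2[of 0] by linarith
 have bn: "norm b = 1" using b by simp
 let ?E = "\<lambda>\<xi>::'a. exp (- (\<delta> * norm \<xi>)\<^sup>2 / 2)"
 have [measurable]: "case_prod (xFT F) \<in> borel_measurable (borel \<Otimes>\<^sub>M borel)"
  "case_prod (xFT G) \<in> borel_measurable (borel \<Otimes>\<^sub>M borel)"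
  using xFT_facts(1)[OF F] xFT_facts(1)[OF G] by (simp_all add: case_prod_beta')
 let ?GF = "\<lambda>u w z. G u * cnj (F (u - (w, z *\<^sub>R b)))"
 define N where "N = (NBINT u. ecmod (G u))"
 have N: "N < \<infinity>" unfolding N_def using tame_integrable(1)[OF G] by (simp add: integrable_iff_bounded)
 define c where "c z w = (LBINT u. ?GF u w z)" for z and w :: 'a
 have Pm[measurable]: "(\<lambda>q. (fst q, snd q *\<^sub>R b)) \<in> (borel \<Otimes>\<^sub>M borel) \<rightarrow>\<^sub>M (borel :: ('a \<times> 'a) measure)"
  unfolding borel_prod by (intro borel_measurable_continuous_onI continuous_intros)
 have cm[measurable]: "case_prod c \<in> borel_measurable (borel \<Otimes>\<^sub>M borel)"
  unfolding c_def case_prod_beta' by measurable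
 have supp: "?GF u w z = 0" if z: "\<bar>z\<bar> > 2 * R" for u w z
 proof -
  obtain x v where u: "u = (x, v)" by (cases u)
  have "\<bar>z\<bar> = norm (z *\<^sub>R b)" using bn by simp
  also have "... \<le> norm v + norm (v - z *\<^sub>R b)" using norm_triangle_ineq4[of v "v - z *\<^sub>R b"] by simp
  finally have "norm v > R \<or> norm (v - z *\<^sub>R b) > R" using z by linarith
  then show ?thesis using tameD(3)[OF F] tameD(3)[OF G] unfolding u by auto
 qed
 have wint: "(NBINT w. ecmod (F (u - (w, z *\<^sub>R b)))) \<le> ennreal M" for u z
 proof -
  have "(NBINT w. ecmod (F (u - (w, z *\<^sub>R b))))
   = (NBINT w. ecmod (F (- (w + - fst u), snd u - z *\<^sub>R b)))"
   by (simp add: pair_diff)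
  also have "... = (NBINT w. ecmod (F (- w, snd u - z *\<^sub>R b)))"
   by (rule nn_integral_translate[of "\<lambda>w. ecmod (F (- w, snd u - z *\<^sub>R b))"]) measurable
  also have "... = (NBINT w. ecmod (F (w, snd u - z *\<^sub>R b)))"
   by (rule nn_integral_reflect[of "\<lambda>w. ecmod (F (w, snd u - z *\<^sub>R b))"]) measurable
  also have "... \<le> ennreal M" by (rule tameD(4)[OF F])
  finally show ?thesis .
 qed
 have cL1: "(NBINT w. NBINT u. ecmod (?GF u w z)) \<le> N * ennreal M" for z
 proof -
  have "(NBINT w. NBINT u. ecmod (?GF u w z))
    = (NBINT u. NBINT w. ecmod (?GF u w z))"
   by (rule lborel_pair.Fubini') measurable
  also have "... = (NBINT u. ecmod (G u) * (NBINT w. ecmod (F (u - (w, z *\<^sub>R b)))))"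
   by (simp add: norm_mult ennreal_mult nn_integral_cmult)
  also have "... \<le> (NBINT u. ecmod (G u) * ennreal M)"
   by (intro nn_integral_mono mult_left_mono wint) auto
  also have "... = N * ennreal M" by (simp add: nn_integral_multc N_def)
  finally show ?thesis .
 qed
 have cFT: "FT (c z) \<xi> = line_correlation G F b \<xi> z" for z \<xi>
 proof -
  have "FT (c z) \<xi> = (LBINT w. LBINT u. cis (- (w \<bullet> \<xi>)) * (?GF u w z))"
   unfolding FT_def c_def by (simp only: integral_mult_right_zero)
  also have "... = (LBINT u. LBINT w. cis (- (w \<bullet> \<xi>)) * (?GF u w z))"
  proof (rule Fubini_swap(1))
   show "(NBINT w. NBINT u. ecmod (cis (- (w \<bullet> \<xi>)) * (?GF u w z))) < \<infinity>"
    using le_less_trans[OF cL1[of z]] N by (simp add: norm_mult ennreal_mult_less_top)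
  qed measurable
  also have "... = (LBINT u. cis (- (fst u \<bullet> \<xi>)) * G u * cnj (xFT F (snd u - z *\<^sub>R b) \<xi>))"
  proof (rule integral_cong[OF refl], goal_cases)
   case (1 u)
   have "(LBINT w. cis (- (w \<bullet> \<xi>)) * (?GF u w z))
    = (LBINT w. cis (- (w \<bullet> \<xi>)) * (G u * cnj (F (fst u - w, snd u - z *\<^sub>R b))))"
    by (simp only: pair_diff)
   also have "... = (LBINT w. cis (- ((w + fst u) \<bullet> \<xi>)) * (G u * cnj (F (- w, snd u - z *\<^sub>R b))))"
    using integral_translate[of "\<lambda>w. cis (- (w \<bullet> \<xi>)) * (G u * cnj (F (fst u - w, snd u - z *\<^sub>R b)))" "fst u"] by simp
   also have "... = (LBINT w. cis (- ((- w + fst u) \<bullet> \<xi>)) * (G u * cnj (F (w, snd u - z *\<^sub>R b))))"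
    using integral_reflect[of "\<lambda>w. cis (- ((w + fst u) \<bullet> \<xi>)) * (G u * cnj (F (- w, snd u - z *\<^sub>R b)))"] by simp
   also have "... = (LBINT w. cis (- (fst u \<bullet> \<xi>)) * G u * cnj (cis (- (w \<bullet> \<xi>)) * F (w, snd u - z *\<^sub>R b)))"
   proof (rule integral_cong[OF refl], goal_cases)
    case (1 w)
    have "cis (- ((- w + fst u) \<bullet> \<xi>)) = cis (- (fst u \<bullet> \<xi>)) * cnj (cis (- (w \<bullet> \<xi>)))"
     by (simp add: cis_cnj cis_mult inner_add_left inner_diff_left)
    then show ?case by simp
   qed
   also have "... = cis (- (fst u \<bullet> \<xi>)) * G u * cnj (xFT F (snd u - z *\<^sub>R b) \<xi>)"
    unfolding xFT_def FT_def
    by (simp only: integral_mult_right_zero integral_cnj)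
   finally show ?case .
  qed
  also have "... = (LBINT v. LBINT x. cis (- (x \<bullet> \<xi>)) * G (x, v) * cnj (xFT F (v - z *\<^sub>R b) \<xi>))"
  proof -
   have "L1 (\<lambda>u. cis (- (fst u \<bullet> \<xi>)) * G u * cnj (xFT F (snd u - z *\<^sub>R b) \<xi>))"
   proof (rule integrable_bound[where f="\<lambda>u. cmod (G u) * M"])
    show "L1 (\<lambda>u. cmod (G u) * M)" using tame_integrable(1)[OF G] by simp
    have "(\<lambda>u. cis (- (fst u \<bullet> \<xi>)) * G (fst u, snd u) * cnj (xFT F (snd u - z *\<^sub>R b) \<xi>)) \<in> borel_measurable (borel \<Otimes>\<^sub>M borel)" by measurable
    then show "(\<lambda>u. cis (- (fst u \<bullet> \<xi>)) * G u * cnj (xFT F (snd u - z *\<^sub>R b) \<xi>)) \<in> borel_measurable lborel"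
     by (simp add: borel_prod)
    show "AE u in lborel. cmod (cis (- (fst u \<bullet> \<xi>)) * G u * cnj (xFT F (snd u - z *\<^sub>R b) \<xi>)) \<le> norm (cmod (G u) * M)"
     using xFT_facts(2)[OF F] M0 by (intro AE_I2) (auto simp: norm_mult intro!: mult_left_mono)
   qed
   then have "integrable (lborel \<Otimes>\<^sub>M lborel) (\<lambda>(x, v). cis (- (x \<bullet> \<xi>)) * G (x, v) * cnj (xFT F (v - z *\<^sub>R b) \<xi>))"
    by (simp add: lborel_prod case_prod_beta')
   from lborel_pair.integral_snd[OF this] show ?thesis by (simp add: lborel_prod case_prod_beta')
  qed
  also have "... = line_correlation G F b \<xi> z"
   unfolding line_correlation_def xFT_def FT_def
   by (simp only: integral_mult_left_zero)
  finally show ?thesis .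
 qed
 define A where "A w = (LBINT z. K2 z *\<^sub>R c z w)" for w
 have [measurable]: "A \<in> borel_fun" unfolding A_def by measurable
 have Afin: "(NBINT z. NBINT w. ecmod (K2 z *\<^sub>R c z w)) < \<infinity>"
 proof -
  have "(NBINT w. ecmod (K2 z *\<^sub>R c z w)) \<le> ennreal k * (N * ennreal M) * indicator {- (2 * R)..2 * R} z" for z
  proof (cases "\<bar>z\<bar> > 2 * R")
   case True
   have "c z w = 0" for w unfolding c_def by (simp only: supp[OF True] integral_zero)
   moreover have "indicator {- (2 * R)..2 * R} z = (0::real)" using True by (auto simp: indicator_def)
   ultimately show ?thesis by simp
  next
   case False
   have "(NBINT w. ecmod (K2 z *\<^sub>R c z w))
     \<le> (NBINT w. ennreal k * (NBINT u. ecmod (?GF u w z)))"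
   proof (rule nn_integral_mono, goal_cases)
    case (1 w)
    have 1: "ecmod (c z w) \<le> (NBINT u. ecmod (?GF u w z))"
    proof (cases "L1 (\<lambda>u. ?GF u w z)")
     case True then show ?thesis unfolding c_def by (rule integral_norm_bound_ennreal)
    qed (simp add: c_def not_integrable_integral_eq)
    have "ecmod (K2 z *\<^sub>R c z w) = ennreal \<bar>K2 z\<bar> * ecmod (c z w)"
     by (simp add: ennreal_mult)
    also have "... \<le> ennreal k * (NBINT u. ecmod (?GF u w z))"
     using K2 by (intro mult_mono 1 ennreal_leI) auto
    finally show ?case .
   qed
   also have "... = ennreal k * (NBINT w. NBINT u. ecmod (?GF u w z))"
    by (rule nn_integral_cmult) measurable
   also have "... \<le> ennreal k * (N * ennreal M)" by (intro mult_left_mono cL1) auto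
   finally show ?thesis using False by (auto simp: indicator_def)
  qed
  then have "(NBINT z. NBINT w. ecmod (K2 z *\<^sub>R c z w))
    \<le> (NBINT z. ennreal k * (N * ennreal M) * indicator {- (2 * R)..2 * R} z)" by (rule nn_integral_mono)
  also have "... < \<infinity>" using N R by (simp add: nn_integral_cmult_indicator ennreal_mult_less_top)
  finally show ?thesis .
 qed
 have Aint: "L1 A"
  unfolding A_def by (rule Fubini_swap(4)[OF _ Afin]) measurable
 have AFT: "FT A \<xi> = (LBINT z. K2 z *\<^sub>R line_correlation G F b \<xi> z)" for \<xi>
 proof -
  have "FT A \<xi> = (LBINT w. LBINT z. cis (- (w \<bullet> \<xi>)) * (K2 z *\<^sub>R c z w))"
   unfolding FT_def A_def by (simp only: integral_mult_right_zero)
  also have "... = (LBINT z. LBINT w. cis (- (w \<bullet> \<xi>)) * (K2 z *\<^sub>R c z w))"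
  proof (rule Fubini_swap(1)[symmetric])
   show "(NBINT z. NBINT w. ecmod (cis (- (w \<bullet> \<xi>)) * (K2 z *\<^sub>R c z w))) < \<infinity>"
    using Afin by (simp add: norm_mult)
  qed measurable
  also have "... = (LBINT z. K2 z *\<^sub>R FT (c z) \<xi>)"
   unfolding FT_def by (simp only: mult_scaleR_right integral_scaleR_right)
  finally show ?thesis unfolding cFT .
 qed
 have [measurable]: "FT A \<in> borel_fun" by (rule FT_measurable) measurable
 define K1 where "K1 = conj_poisson_diff y Y"
 have [measurable]: "K1 \<in> borel_fun" unfolding K1_def by measurable
 have K1i: "L1 K1" unfolding K1_def by (rule conj_poisson_diff_integrable[OF y])
 have K1fin: "(NBINT s. ennreal \<bar>K1 s\<bar>) < \<infinity>" using K1i by (simp add: integrable_iff_bounded)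
 have Ab: "\<exists>B. \<forall>w. cmod (A w) \<le> B"
 proof -
  define B where "B = k * (M * (LBINT u. cmod (G u))) * (4 * R)"
  have cb: "cmod (K2 z *\<^sub>R c z w) \<le> k * (M * (LBINT u. cmod (G u))) * indicator {- (2 * R)..2 * R} z" for z w
  proof (cases "\<bar>z\<bar> > 2 * R")
   case True
   have "c z w = 0" for w unfolding c_def by (simp only: supp[OF True] integral_zero)
   moreover have "indicator {- (2 * R)..2 * R} z = (0::real)" using True by (auto simp: indicator_def)
   ultimately show ?thesis by simp
  next
   case False
   have "cmod (c z w) \<le> (LBINT u. cmod (G u) * M)"
   proof (cases "L1 (\<lambda>u. ?GF u w z)")
    case True
    then show ?thesis unfolding c_def
     by (rule integral_norm_bound_integral)
       (use tame_integrable(1)[OF G] tameD(2)[OF F] in \<open>auto simp: norm_mult intro!: mult_left_mono\<close>)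
   next
    case False
    then show ?thesis using M0 by (simp add: c_def not_integrable_integral_eq)
   qed
   then have "cmod (c z w) \<le> M * (LBINT u. cmod (G u))" by (simp add: mult.commute)
   then have "\<bar>K2 z\<bar> * cmod (c z w) \<le> k * (M * (LBINT u. cmod (G u)))"
    using K2[of z] k0 by (intro mult_mono) auto
   then show ?thesis using False by (auto simp: indicator_def)
  qed
  have "cmod (A w) \<le> B" for w
  proof (cases "L1 (\<lambda>z. K2 z *\<^sub>R c z w)")
   case True
   have "cmod (A w) \<le> (LBINT z. k * (M * (LBINT u. cmod (G u))) * indicator {- (2 * R)..2 * R} z)"
    unfolding A_def by (rule integral_norm_bound_integral[OF True integrable_indicator_Icc cb])
   then show ?thesis using R by (simp add: B_def)
  next
   case False
   then show ?thesis using M0 k0 R by (simp add: A_def not_integrable_integral_eq B_def)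
  qed
  then show ?thesis by blast
 qed
 then obtain B where Ab: "\<And>w. cmod (A w) \<le> B" by blast
 have B0: "B \<ge> 0" using Ab[of 0] norm_ge_zero[of "A 0"] by linarith
 have G: "L1 (gaussian \<delta> :: 'a => real)" by (rule gaussian_integral(1)[OF \<delta>])
 have Gfin: "(\<integral>\<^sup>+r. ennreal (gaussian \<delta> r) \<partial>(lborel :: 'a measure)) < \<infinity>" using G by (simp add: integrable_iff_bounded abs_of_nonneg[OF gaussian_nonneg])
 let ?H = "\<lambda>r s. gaussian \<delta> r *\<^sub>R (K1 s *\<^sub>R A (r + s *\<^sub>R b))" and ?J = "\<lambda>s \<xi>. cis ((s *\<^sub>R b) \<bullet> \<xi>) * (of_real (?E \<xi>) * FT A \<xi>)"
 have "energy_form K1 K2 (gaussian \<delta>) b G F = (LBINT r. LBINT s. ?H r s)"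
  unfolding energy_form_def A_def c_def by (simp only: integral_scaleR_right)
 also have "... = (LBINT s. LBINT r. ?H r s)"
 proof (rule Fubini_swap(1))
  have "(NBINT r. NBINT s. ecmod (?H r s))
   \<le> (\<integral>\<^sup>+r. (NBINT s. ennreal (gaussian \<delta> r) * (ennreal \<bar>K1 s\<bar> * ennreal B)) \<partial>(lborel :: 'a measure))"
  proof (intro nn_integral_mono, goal_cases)
   case (1 r s)
   have "cmod (?H r s) \<le> gaussian \<delta> r * (\<bar>K1 s\<bar> * B)"
   proof -
    have "cmod (?H r s) = gaussian \<delta> r * (\<bar>K1 s\<bar> * cmod (A (r + s *\<^sub>R b)))"
     by (simp add: abs_mult abs_of_nonneg[OF gaussian_nonneg])
    also have "... \<le> gaussian \<delta> r * (\<bar>K1 s\<bar> * B)"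
     by (intro mult_left_mono Ab gaussian_nonneg) auto
    finally show ?thesis .
   qed
   then show ?case
   proof -
    assume "cmod (?H r s) \<le> gaussian \<delta> r * (\<bar>K1 s\<bar> * B)"
    then have "ecmod (?H r s) \<le> ennreal (gaussian \<delta> r * (\<bar>K1 s\<bar> * B))"
     by (rule ennreal_leI)
    also have "... = ennreal (gaussian \<delta> r) * (ennreal \<bar>K1 s\<bar> * ennreal B)"
     using B0 by (simp add: ennreal_mult gaussian_nonneg)
    finally show ?thesis .
   qed
  qed
  also have "... = (\<integral>\<^sup>+r. ennreal (gaussian \<delta> r) \<partial>(lborel :: 'a measure)) * ((NBINT s. ennreal \<bar>K1 s\<bar>) * ennreal B)"
   by (simp add: nn_integral_cmult nn_integral_multc)
  also have "... < \<infinity>" using Gfin K1fin by (simp add: ennreal_mult_less_top)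
  finally show "(NBINT r. NBINT s. ecmod (?H r s)) < \<infinity>" .
 qed measurable
 also have "... = (LBINT s. K1 s *\<^sub>R (LBINT r. gaussian \<delta> r *\<^sub>R A (s *\<^sub>R b - r)))"
 proof (rule integral_cong[OF refl], goal_cases)
  case (1 s)
  have "(LBINT r. ?H r s) = (LBINT r. K1 s *\<^sub>R (gaussian \<delta> r *\<^sub>R A (r + s *\<^sub>R b)))"
   by (simp add: mult.commute)
  also have "... = K1 s *\<^sub>R (LBINT r. gaussian \<delta> r *\<^sub>R A (r + s *\<^sub>R b))" by (rule integral_scaleR_right)
  also have "(LBINT r. gaussian \<delta> r *\<^sub>R A (r + s *\<^sub>R b)) = (LBINT r. gaussian \<delta> r *\<^sub>R A (s *\<^sub>R b - r))"
   using integral_reflect[of "\<lambda>r. gaussian \<delta> r *\<^sub>R A (r + s *\<^sub>R b)"] by (simp add: gaussian_even)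
  finally show ?case .
 qed
 finally have "of_real ((2 * pi) ^ DIM('a)) * energy_form K1 K2 (gaussian \<delta>) b G F
  = (LBINT s. K1 s *\<^sub>R (of_real ((2 * pi) ^ DIM('a)) * (LBINT r. gaussian \<delta> r *\<^sub>R A (s *\<^sub>R b - r))))"
  by (simp only: mult_scaleR_right[symmetric] integral_mult_right_zero)
 also have "... = (LBINT s. LBINT \<xi>. K1 s *\<^sub>R (?J s \<xi>))"
  by (simp only: FT_gaussian_regularized_inversion[OF Aint \<delta>, symmetric] integral_scaleR_right)
 also have "... = (LBINT \<xi>. LBINT s. K1 s *\<^sub>R (?J s \<xi>))"
 proof (rule Fubini_swap(1))
  define BF where "BF = (LBINT w. cmod (A w))"
  have "(NBINT s. NBINT \<xi>. ecmod (K1 s *\<^sub>R (?J s \<xi>)))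
    \<le> (NBINT s. NBINT \<xi>. ennreal \<bar>K1 s\<bar> * (ennreal (?E \<xi>) * ennreal BF))"
  proof (intro nn_integral_mono, goal_cases)
   case (1 s \<xi>)
   have "cmod (K1 s *\<^sub>R (?J s \<xi>)) \<le> \<bar>K1 s\<bar> * (?E \<xi> * BF)"
    using norm_FT_le[of A \<xi>] by (auto simp: norm_mult BF_def intro!: mult_left_mono)
   then show ?case
    by (simp add: ennreal_mult[symmetric] ennreal_leI BF_def)
  qed
  also have "... = (NBINT s. ennreal \<bar>K1 s\<bar>) * ((NBINT \<xi>. ennreal (?E \<xi>)) * ennreal BF)"
   by (simp add: nn_integral_cmult nn_integral_multc)
  also have "... < \<infinity>"
  proof -
   have "(NBINT \<xi>. ennreal (?E \<xi>)) < \<infinity>"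
    using gaussian_multiplier_integrable[OF \<delta>, where 'a='a] by (simp add: integrable_iff_bounded)
   then show ?thesis using K1fin by (simp add: ennreal_mult_less_top)
  qed
  finally show "(NBINT s. NBINT \<xi>. ecmod (K1 s *\<^sub>R (?J s \<xi>))) < \<infinity>" .
 qed measurable
 also have "... = (LBINT \<xi>. of_real (?E \<xi>) * (\<i> * of_real (sgn_exp y Y (\<xi> \<bullet> b))) * FT A \<xi>)"
 proof (rule integral_cong[OF refl], goal_cases)
  case (1 \<xi>)
  have "(LBINT s. K1 s *\<^sub>R (?J s \<xi>))
    = (LBINT s. K1 s *\<^sub>R cis (s * (\<xi> \<bullet> b)) * (of_real (?E \<xi>) * FT A \<xi>))"
   by (simp add: inner_commute)
  also have "... = (LBINT s. K1 s *\<^sub>R cis (s * (\<xi> \<bullet> b))) * (of_real (?E \<xi>) * FT A \<xi>)"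
   by (rule integral_mult_left_zero)
  also have "... = of_real (?E \<xi>) * (\<i> * of_real (sgn_exp y Y (\<xi> \<bullet> b))) * FT A \<xi>"
   unfolding K1_def conj_poisson_diff_fourier[OF y] by (simp add: mult_ac)
  finally show ?case .
 qed
 finally show ?thesis unfolding AFT K1_def .
qed

lemma cmod_cis_minus_1_le: "cmod (cis x - 1) \<le> \<bar>x\<bar>"
 using iexp_approx1[of x 0] by (simp add: cis_conv_exp)

lemma cis_difference_quotient_tendsto:
 assumes s: "s \<longlonglongrightarrow> 0" "\<And>k. s k \<noteq> (0::real)"
 shows "(\<lambda>k. (1 / s k) *\<^sub>R (cis (s k * c) - 1)) \<longlonglongrightarrow> \<i> * of_real c"
proof -
 have "((\<lambda>z. exp (\<i> * of_real c * z)) has_field_derivative (\<i> * of_real c)) (at 0)"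
  by (auto intro!: derivative_eq_intros)
 then have L: "((\<lambda>z. (exp (\<i> * of_real c * z) - 1) / z) \<longlongrightarrow> \<i> * of_real c) (at 0)"
  by (simp add: DERIV_def)
 have "filterlim (\<lambda>k. complex_of_real (s k)) (at 0) sequentially"
  unfolding filterlim_at using s tendsto_of_real[OF s(1), where 'a=complex] by auto
 from filterlim_compose[OF L this]
 have "(\<lambda>k. (exp (\<i> * of_real c * of_real (s k)) - 1) / of_real (s k)) \<longlonglongrightarrow> \<i> * of_real c" .
 then show ?thesis by (simp add: cis_conv_exp scaleR_conv_of_real mult_ac)
qed

lemma tame_mono: "tame R M F ==> M \<le> M' ==> tame R M' F"
 unfolding tame_def by (meson ennreal_leI order_trans)

lemma tame_diff:
 assumes F: "tame R M F" and G: "tame R M G"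
 shows "tame R (2 * M) (\<lambda>u. G u - F u)"
 unfolding tame_def
proof (intro conjI allI impI)
 note [measurable] = tameD(1)[OF F] tameD(1)[OF G]
 show "(\<lambda>u. G u - F u) \<in> borel_fun" by measurable
 show "cmod (G u - F u) \<le> 2 * M" for u
  using norm_triangle_ineq4[of "G u" "F u"] tameD(2)[OF F, of u] tameD(2)[OF G, of u] by linarith
 show "norm v > R ==> G (x, v) - F (x, v) = 0" for x v using tameD(3)[OF F] tameD(3)[OF G] by simp
 fix v
 have "(NBINT x. ecmod (G (x, v) - F (x, v)))
   \<le> (NBINT x. ecmod (G (x, v)) + ecmod (F (x, v)))"
  using norm_triangle_ineq4 by (intro nn_integral_mono) (simp add: ennreal_plus[symmetric] ennreal_leI del: ennreal_plus)
 also have "... = (NBINT x. ecmod (G (x, v))) + (NBINT x. ecmod (F (x, v)))"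
  by (rule nn_integral_add) measurable
 also have "... \<le> ennreal M + ennreal M" by (intro add_mono tameD(4)[OF F] tameD(4)[OF G])
 also have "... = ennreal (2 * M)" using tameD(5)[OF F] by (simp add: ennreal_plus[symmetric] del: ennreal_plus)
 finally show "(NBINT x. ecmod (G (x, v) - F (x, v))) \<le> ennreal (2 * M)" .
qed

lemma xFT_diff:
 assumes F: "tame R M F" and G: "tame R M G"
 shows "xFT (\<lambda>u. G u - F u) v \<xi> = xFT G v \<xi> - xFT F v \<xi>"
proof -
 have i: "L1 (\<lambda>x. cis (- (x \<bullet> \<xi>)) * H (x, v))" if "tame R M H" for H
  by (rule cis_mult_integrable[OF tame_integrable(2)[OF that]]) measurable
 show ?thesis unfolding xFT_def FT_def using i[OF F] i[OF G] by (simp add: right_diff_distrib)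
qed

lemma line_correlation_integrable:
 fixes F G :: "'a::euclidean_space \<times> 'a => complex"
 assumes G: "tame R M G" and F: "tame R M F" and b: "b \<in> Basis" and R: "R \<ge> 0"
  and [measurable]: "K2 \<in> borel_fun" and K2: "\<And>z. \<bar>z\<bar> \<le> 2 * R ==> cmod (K2 z) \<le> k"
 shows "L1 (\<lambda>z. K2 z * line_correlation G F b \<xi> z)"
  and "cmod (LBINT z. K2 z * line_correlation G F b \<xi> z) \<le> k * (M\<^sup>2 * measure lborel (cball (0::'a) R)) * (4 * R)"
proof -
 note lc = line_correlation_facts[OF G F b R]
 have [measurable]: "line_correlation G F b \<xi> \<in> borel_fun"
  using measurable_compose[OF measurable_Pair1' lc(1), of \<xi>] by simp
 have pt: "cmod (K2 z * line_correlation G F b \<xi> z)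
   \<le> k * (M\<^sup>2 * measure lborel (cball (0::'a) R)) * indicator {- (2 * R)..2 * R} z" for z
 proof (cases "\<bar>z\<bar> > 2 * R")
  case True
  then have "indicator {- (2 * R)..2 * R} z = (0::real)" by (auto simp: indicator_def)
  with True show ?thesis by (simp add: lc(3))
 next
  case False
  then have "cmod (K2 z) * cmod (line_correlation G F b \<xi> z) \<le> k * (M\<^sup>2 * measure lborel (cball (0::'a) R))"
   using K2[of z] lc(2)[of \<xi> z] by (intro mult_mono) (auto intro: order_trans[OF norm_ge_zero])
  then show ?thesis using False by (auto simp: norm_mult indicator_def)
 qed
 have i: "L1 (\<lambda>z. k * (M\<^sup>2 * measure lborel (cball (0::'a) R)) * indicator {- (2 * R)..2 * R} z :: real)" by (rule integrable_indicator_Icc)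
 show ic: "L1 (\<lambda>z. K2 z * line_correlation G F b \<xi> z)"
  by (rule integrable_bound[OF i]) (auto intro!: AE_I2 order_trans[OF pt])
 have "cmod (LBINT z. K2 z * line_correlation G F b \<xi> z)
   \<le> (LBINT z. k * (M\<^sup>2 * measure lborel (cball (0::'a) R)) * indicator {- (2 * R)..2 * R} z)"
  by (rule integral_norm_bound_integral[OF ic i]) (rule pt)
 then show "cmod (LBINT z. K2 z * line_correlation G F b \<xi> z) \<le> k * (M\<^sup>2 * measure lborel (cball (0::'a) R)) * (4 * R)"
  using R by simp
qed

lemma abs_sgn_exp_le: "0 < y ==> y < Y ==> \<bar>sgn_exp y Y \<tau>\<bar> \<le> 1"
 and sgn_exp_sign: "0 < y ==> y < Y ==> \<tau> * sgn_exp y Y \<tau> = \<bar>\<tau>\<bar> * (exp (- (y * \<bar>\<tau>\<bar>)) - exp (- (Y * \<bar>\<tau>\<bar>)))"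
 and exp_diff_nonneg: "0 < y ==> y < Y ==> 0 \<le> exp (- (y * \<bar>\<tau>\<bar>)) - exp (- (Y * \<bar>\<tau>\<bar>))"
 and abs_mult_sgn_exp_le: "0 < y ==> y < Y ==> \<bar>\<tau> * sgn_exp y Y \<tau>\<bar> \<le> 1 / y"
proof -
 assume y: "0 < y" "y < Y"
 have e: "0 < exp (- (y * \<bar>\<tau>\<bar>))" "exp (- (y * \<bar>\<tau>\<bar>)) \<le> 1" "0 < exp (- (Y * \<bar>\<tau>\<bar>))"
  "exp (- (Y * \<bar>\<tau>\<bar>)) \<le> exp (- (y * \<bar>\<tau>\<bar>))" using y by (auto intro!: mult_right_mono)
 then show n: "0 \<le> exp (- (y * \<bar>\<tau>\<bar>)) - exp (- (Y * \<bar>\<tau>\<bar>))" by simp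
 have "\<bar>exp (- (y * \<bar>\<tau>\<bar>)) - exp (- (Y * \<bar>\<tau>\<bar>))\<bar> \<le> 1" by (rule abs_leI) (use e in linarith)+
 then show "\<bar>sgn_exp y Y \<tau>\<bar> \<le> 1" by (simp add: sgn_exp_def abs_mult abs_sgn_eq)
 show s: "\<tau> * sgn_exp y Y \<tau> = \<bar>\<tau>\<bar> * (exp (- (y * \<bar>\<tau>\<bar>)) - exp (- (Y * \<bar>\<tau>\<bar>)))"
  by (simp add: sgn_exp_def abs_sgn)
 have "y * \<bar>\<tau>\<bar> * exp (- (y * \<bar>\<tau>\<bar>)) \<le> 1"
 proof -
  have "y * \<bar>\<tau>\<bar> \<le> exp (y * \<bar>\<tau>\<bar>)" using exp_ge_add_one_self[of "y * \<bar>\<tau>\<bar>"] by linarith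
  then show ?thesis by (simp add: exp_minus field_simps)
 qed
 then have "\<bar>\<tau>\<bar> * exp (- (y * \<bar>\<tau>\<bar>)) \<le> 1 / y" using y by (simp add: field_simps)
 moreover have "\<bar>\<tau>\<bar> * (exp (- (y * \<bar>\<tau>\<bar>)) - exp (- (Y * \<bar>\<tau>\<bar>))) \<le> \<bar>\<tau>\<bar> * exp (- (y * \<bar>\<tau>\<bar>))"
  using e by (intro mult_left_mono) auto
 ultimately show "\<bar>\<tau> * sgn_exp y Y \<tau>\<bar> \<le> 1 / y" unfolding s using n by simp
qed

text \<open>The right-hand side equals \<open>e Ft Ft - e F F\<close>, in a form in which each summand contains the small
 difference \<open>G\<close>.\<close>

lemma energy_form_difference:
 fixes F :: "'a::euclidean_space \<times> 'a => complex" and t :: real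
 assumes F: "tame R M F" and b: "b \<in> Basis" and R: "R \<ge> 0" and y: "0 < y" "y < Y" and \<delta>: "\<delta> > 0"
  and K2m[measurable]: "K2 \<in> borel_fun" and K2: "\<And>z. \<bar>K2 z\<bar> \<le> k"
 defines "Ft \<equiv> \<lambda>u. F (shear t u)"
 defines "G \<equiv> \<lambda>u. Ft u - F u"
 defines "e \<equiv> energy_form (conj_poisson_diff y Y) K2 (gaussian \<delta>) b"
 shows "(LBINT \<xi>. of_real (exp (- (\<delta> * norm \<xi>)\<^sup>2 / 2)) * (\<i> * of_real (sgn_exp y Y (\<xi> \<bullet> b)))
     * (LBINT z. of_real (K2 z) * (cis (t * z * (\<xi> \<bullet> b)) - 1) * line_correlation F F b \<xi> z))
  = of_real ((2 * pi) ^ DIM('a)) * (e G Ft + e F G)"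
proof -
 have M0: "M \<ge> 0" by (rule tameD(5)[OF F])
 have F2: "tame R (2 * M) F" using tame_mono[OF F] M0 by simp
 have Ft1: "tame R M Ft" unfolding Ft_def by (rule tame_shear[OF F])
 have Ft2: "tame R (2 * M) Ft" using tame_mono[OF Ft1] M0 by simp
 have G2: "tame R (2 * M) G" unfolding G_def by (rule tame_diff[OF F Ft1])
 let ?m = "\<lambda>\<xi>::'a. of_real (exp (- (\<delta> * norm \<xi>)\<^sup>2 / 2)) * (\<i> * of_real (sgn_exp y Y (\<xi> \<bullet> b))) :: complex"
 define I where "I G F \<xi> = (LBINT z. of_real (K2 z) * line_correlation G F b \<xi> z)" for G F :: "'a \<times> 'a => complex" and \<xi>
 have k: "cmod (of_real (K2 z)) \<le> k" for z using K2 by simp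
 have Ii: "L1 (\<lambda>z. of_real (K2 z) * line_correlation G F b \<xi> z)" if "tame R (2 * M) G" "tame R (2 * M) F" for G F \<xi>
  by (rule line_correlation_integrable(1)[OF that b R _ k]) measurable
 have mI: "L1 (\<lambda>\<xi>. ?m \<xi> * I G F \<xi>)" if G: "tame R (2 * M) G" and F: "tame R (2 * M) F" for G F
 proof -
  define B where "B = k * ((2 * M)\<^sup>2 * measure lborel (cball (0::'a) R)) * (4 * R)"
  have [measurable]: "case_prod (line_correlation G F b) \<in> borel_measurable (borel \<Otimes>\<^sub>M borel)"
   using line_correlation_facts(1)[OF G F b R] by (simp add: case_prod_beta')
  have IB: "cmod (I G F \<xi>) \<le> B" for \<xi>
   unfolding I_def B_def by (rule line_correlation_integrable(2)[OF G F b R _ k]) measurable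
  show ?thesis
  proof (rule integrable_dominated)
   show "L1 (\<lambda>\<xi>::'a. exp (- (\<delta> * norm \<xi>)\<^sup>2 / 2) * B)"
    using gaussian_multiplier_integrable[OF \<delta>, where 'a='a] by (rule integrable_mult_left)
   show "(\<lambda>\<xi>. ?m \<xi> * I G F \<xi>) \<in> borel_measurable lborel" unfolding I_def by measurable
   show "cmod (?m \<xi> * I G F \<xi>) \<le> exp (- (\<delta> * norm \<xi>)\<^sup>2 / 2) * B" for \<xi>
   proof -
    have "cmod (?m \<xi> * I G F \<xi>) = exp (- (\<delta> * norm \<xi>)\<^sup>2 / 2) * (\<bar>sgn_exp y Y (\<xi> \<bullet> b)\<bar> * cmod (I G F \<xi>))"
     by (simp add: norm_mult)
    also have "... \<le> exp (- (\<delta> * norm \<xi>)\<^sup>2 / 2) * (1 * B)"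
     by (intro mult_left_mono mult_mono abs_sgn_exp_le[OF y] IB) auto
    finally show ?thesis by simp
   qed
  qed
 qed
 have fe: "of_real ((2 * pi) ^ DIM('a)) * e G F = (LBINT \<xi>. ?m \<xi> * I G F \<xi>)"
  if "tame R (2 * M) G" "tame R (2 * M) F" for G F
  using energy_form_fourier[OF that b R y \<delta> K2m K2] unfolding e_def I_def by (simp add: scaleR_conv_of_real)
 have split: "(LBINT z. of_real (K2 z) * (cis (t * z * (\<xi> \<bullet> b)) - 1) * line_correlation F F b \<xi> z) = I G Ft \<xi> + I F G \<xi>" for \<xi>
 proof -
  have lc: "(cis (t * z * (\<xi> \<bullet> b)) - 1) * line_correlation F F b \<xi> z = line_correlation G Ft b \<xi> z + line_correlation F G b \<xi> z" for z
  proof -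
   have mm: "L1 (\<lambda>v. xFT A v \<xi> * cnj (xFT B (v - z *\<^sub>R b) \<xi>))" if A: "tame R (2 * M) A" and B: "tame R (2 * M) B" for A B
   proof (rule integrable_dominated[OF integrable_indicator_cball[of "(2 * M)\<^sup>2" 0 R]])
    have [measurable]: "case_prod (xFT A) \<in> borel_measurable (borel \<Otimes>\<^sub>M borel)" "case_prod (xFT B) \<in> borel_measurable (borel \<Otimes>\<^sub>M borel)"
     using xFT_facts(1)[OF A] xFT_facts(1)[OF B] by (simp_all add: case_prod_beta')
    show "(\<lambda>v. xFT A v \<xi> * cnj (xFT B (v - z *\<^sub>R b) \<xi>)) \<in> borel_measurable lborel" by measurable
    show "cmod (xFT A v \<xi> * cnj (xFT B (v - z *\<^sub>R b) \<xi>)) \<le> (2 * M)\<^sup>2 * indicator (cball 0 R) v" for v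
    proof (cases "norm v > R")
     case True then show ?thesis using xFT_facts(3)[OF A True] by simp
    next
     case False
     have "cmod (xFT A v \<xi>) * cmod (xFT B (v - z *\<^sub>R b) \<xi>) \<le> (2 * M) * (2 * M)"
      using xFT_facts(2)[OF A] xFT_facts(2)[OF B] M0 by (intro mult_mono) auto
     then show ?thesis using False by (simp add: norm_mult power2_eq_square)
    qed
   qed
   have "(cis (t * z * (\<xi> \<bullet> b)) - 1) * line_correlation F F b \<xi> z = line_correlation Ft Ft b \<xi> z - line_correlation F F b \<xi> z"
    unfolding Ft_def line_correlation_facts(4)[OF F F b R] by (simp add: algebra_simps)
   also have "... = (LBINT v. xFT Ft v \<xi> * cnj (xFT Ft (v - z *\<^sub>R b) \<xi>) - xFT F v \<xi> * cnj (xFT F (v - z *\<^sub>R b) \<xi>))"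
    unfolding line_correlation_def by (rule integral_diff[symmetric]) (rule mm Ft2 F2)+
   also have "... = (LBINT v. xFT G v \<xi> * cnj (xFT Ft (v - z *\<^sub>R b) \<xi>) + xFT F v \<xi> * cnj (xFT G (v - z *\<^sub>R b) \<xi>))"
    unfolding G_def xFT_diff[OF F Ft1] by (simp add: algebra_simps)
   also have "... = line_correlation G Ft b \<xi> z + line_correlation F G b \<xi> z"
    unfolding line_correlation_def by (rule integral_add) (rule mm Ft2 F2 G2)+
   finally show ?thesis .
  qed
  have "of_real (K2 z) * (cis (t * z * (\<xi> \<bullet> b)) - 1) * line_correlation F F b \<xi> z
   = of_real (K2 z) * line_correlation G Ft b \<xi> z + of_real (K2 z) * line_correlation F G b \<xi> z" for z
   by (simp only: mult.assoc[of "of_real (K2 z)"] lc distrib_left)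
  then have "(LBINT z. of_real (K2 z) * (cis (t * z * (\<xi> \<bullet> b)) - 1) * line_correlation F F b \<xi> z)
    = (LBINT z. of_real (K2 z) * line_correlation G Ft b \<xi> z + of_real (K2 z) * line_correlation F G b \<xi> z)"
   by (simp only:)
  also have "... = I G Ft \<xi> + I F G \<xi>"
   unfolding I_def by (rule integral_add) (rule Ii G2 Ft2 F2)+
  finally show ?thesis .
 qed
 have "(LBINT \<xi>. ?m \<xi> * (I G Ft \<xi> + I F G \<xi>)) = (LBINT \<xi>. ?m \<xi> * I G Ft \<xi> + ?m \<xi> * I F G \<xi>)"
  by (simp only: distrib_left)
 also have "... = (LBINT \<xi>. ?m \<xi> * I G Ft \<xi>) + (LBINT \<xi>. ?m \<xi> * I F G \<xi>)"
  by (rule integral_add) (rule mI G2 Ft2 F2)+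
 also have "... = of_real ((2 * pi) ^ DIM('a)) * (e G Ft + e F G)"
  unfolding fe[OF G2 Ft2, symmetric] fe[OF F2 G2, symmetric] by (simp only: distrib_left)
 finally show ?thesis unfolding split .
qed

lemma FT_velocity_integral:
 fixes F :: "'a::euclidean_space \<times> 'a => complex"
 assumes F: "tame R M F"
 shows "FT (\<lambda>x. LBINT v. F (x, v)) \<xi> = (LBINT v. xFT F v \<xi>)"
proof -
 note [measurable] = tameD(1)[OF F]
 have fin: "(NBINT x. NBINT v. ecmod (F (x, v))) < \<infinity>"
 proof -
  have m: "(\<lambda>u. ecmod (F u)) \<in> borel_measurable (lborel \<Otimes>\<^sub>M lborel)" by (simp add: lborel_prod)
  show ?thesis
   using tame_integrable(1)[OF F] lborel.nn_integral_fst[OF m] by (simp add: lborel_prod integrable_iff_bounded)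
 qed
 have "FT (\<lambda>x. LBINT v. F (x, v)) \<xi> = (LBINT x. LBINT v. cis (- (x \<bullet> \<xi>)) * F (x, v))"
  unfolding FT_def by (simp only: integral_mult_right_zero)
 also have "... = (LBINT v. LBINT x. cis (- (x \<bullet> \<xi>)) * F (x, v))"
 proof (rule Fubini_swap(1))
  show "(NBINT x. NBINT v. ecmod (cis (- (x \<bullet> \<xi>)) * F (x, v))) < \<infinity>"
   using fin by (simp add: norm_mult)
 qed measurable
 finally show ?thesis by (simp add: xFT_def FT_def)
qed

text \<open>Divide the preceding identity by \<open>t\<close> and let \<open>t\<close> and the height \<open>\<epsilon>\<close> of the velocity kernel tend to
 0 together, along \<open>t = \<epsilon>\<close>. The factor \<open>exp (i t z \<xi> \<cdot> b) - 1\<close> is at most \<open>|t z \<xi> \<cdot> b|\<close>, and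
 \<open>|z|\<close> times the kernel is at most 1, so dominated convergence applies; the kernel and the phase together tend
 to \<open>i \<xi> \<cdot> b / \<pi>\<close>, which does not depend on \<open>z\<close>.\<close>

lemma regularized_energy_bound:
 fixes F :: "'a::euclidean_space \<times> 'a => complex"
 assumes F: "tame R M F" and b: "b \<in> Basis" and R: "R \<ge> 0" and y: "0 < y" "y < Y" and \<delta>: "\<delta> > 0"
  and bound: "\<And>t \<epsilon>. t > 0 ==> \<epsilon> > 0 ==>
   cmod (energy_form (conj_poisson_diff y Y) (conj_poisson \<epsilon>) (gaussian \<delta>) b (\<lambda>u. F (shear t u) - F u) (\<lambda>u. F (shear t u))
    + energy_form (conj_poisson_diff y Y) (conj_poisson \<epsilon>) (gaussian \<delta>) b F (\<lambda>u. F (shear t u) - F u)) \<le> t * B"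
 shows "(NBINT \<xi>. ennreal (exp (- (\<delta> * norm \<xi>)\<^sup>2 / 2) * ((\<xi> \<bullet> b) * sgn_exp y Y (\<xi> \<bullet> b)) * (cmod (FT (\<lambda>x. LBINT v. F (x, v)) \<xi>))\<^sup>2))
  \<le> ennreal (pi * (2 * pi) ^ DIM('a) * measure lborel (cball (0::'a) (R + 1)) * B)"
proof -
 let ?a = "\<lambda>\<xi>. (\<xi> \<bullet> b) * sgn_exp y Y (\<xi> \<bullet> b)"
 have M0: "M \<ge> 0" by (rule tameD(5)[OF F])
 let ?E = "\<lambda>\<xi>::'a. exp (- (\<delta> * norm \<xi>)\<^sup>2 / 2)"
 let ?m = "\<lambda>\<xi>::'a. of_real (?E \<xi>) * (\<i> * of_real (sgn_exp y Y (\<xi> \<bullet> b))) :: complex"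
 define L where "L = line_correlation F F b"
 note lc = line_correlation_facts[OF F F b R, folded L_def]
 have [measurable]: "case_prod L \<in> borel_measurable (borel \<Otimes>\<^sub>M borel)"
  using lc(1) by (simp add: case_prod_beta')
 define s where "s k = 1 / real (Suc k)" for k
 have s: "s k > 0" for k by (simp add: s_def)
 have s0: "s \<longlonglongrightarrow> 0" unfolding s_def by real_asymp
 \<comment> \<open>The difference quotient in time, at \<open>t = s k\<close>, with a velocity kernel of the same height \<open>s k\<close>.\<close>
 define W where "W k \<xi> z = (1 / s k) *\<^sub>R (of_real (conj_poisson (s k) z) * (cis (s k * z * (\<xi> \<bullet> b)) - 1))" for k \<xi> z
 have [measurable]: "W k \<xi> \<in> borel_fun" for k \<xi> unfolding W_def by measurable
 have Wb: "cmod (W k \<xi> z) \<le> \<bar>\<xi> \<bullet> b\<bar>" for k \<xi> z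
 proof -
  have "cmod (W k \<xi> z) = (1 / s k) * (\<bar>conj_poisson (s k) z\<bar> * cmod (cis (s k * z * (\<xi> \<bullet> b)) - 1))"
   using s[of k] by (simp add: W_def norm_mult)
  also have "... \<le> (1 / s k) * (\<bar>conj_poisson (s k) z\<bar> * \<bar>s k * z * (\<xi> \<bullet> b)\<bar>)"
   using s[of k] by (intro mult_left_mono cmod_cis_minus_1_le) auto
  also have "... = \<bar>conj_poisson (s k) z * z\<bar> * \<bar>\<xi> \<bullet> b\<bar>" using s[of k] by (simp add: abs_mult)
  also have "\<bar>conj_poisson (s k) z * z\<bar> \<le> 1"
  proof -
   have D: "z\<^sup>2 + (s k)\<^sup>2 > 0" using s[of k] by (intro add_nonneg_pos) auto
   have "z\<^sup>2 \<le> 1 * (z\<^sup>2 + (s k)\<^sup>2)" by simp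
   also have "... \<le> pi * (z\<^sup>2 + (s k)\<^sup>2)" using D pi_ge_two by (intro mult_right_mono) auto
   finally have "z\<^sup>2 / (pi * (z\<^sup>2 + (s k)\<^sup>2)) \<le> 1" using D by (simp add: divide_le_eq)
   then show ?thesis using D by (simp add: conj_poisson_def power2_eq_square abs_mult)
  qed
  then have "\<bar>conj_poisson (s k) z * z\<bar> * \<bar>\<xi> \<bullet> b\<bar> \<le> 1 * \<bar>\<xi> \<bullet> b\<bar>" by (intro mult_right_mono) auto
  finally show ?thesis by simp
 qed
 have Wlim: "(\<lambda>k. W k \<xi> z) \<longlonglongrightarrow> \<i> * of_real ((\<xi> \<bullet> b) / pi)" if z: "z \<noteq> 0" for \<xi> z
 proof -
  have "(\<lambda>k. conj_poisson (s k) z) \<longlonglongrightarrow> z / (pi * (z\<^sup>2 + 0\<^sup>2))"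
   unfolding conj_poisson_def using z by (intro tendsto_intros s0) auto
  then have 1: "(\<lambda>k. complex_of_real (conj_poisson (s k) z)) \<longlonglongrightarrow> of_real (1 / (pi * z))"
   using z by (intro tendsto_of_real) (simp add: power2_eq_square)
  have 2: "(\<lambda>k. (1 / s k) *\<^sub>R (cis (s k * (z * (\<xi> \<bullet> b))) - 1)) \<longlonglongrightarrow> \<i> * of_real (z * (\<xi> \<bullet> b))"
   by (rule cis_difference_quotient_tendsto[OF s0]) (use s in \<open>simp add: less_imp_neq[symmetric]\<close>)
  have "(\<lambda>k. of_real (conj_poisson (s k) z) * ((1 / s k) *\<^sub>R (cis (s k * (z * (\<xi> \<bullet> b))) - 1)))
    \<longlonglongrightarrow> of_real (1 / (pi * z)) * (\<i> * of_real (z * (\<xi> \<bullet> b)))" by (rule tendsto_mult[OF 1 2])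
  then show ?thesis using z by (simp add: W_def mult.assoc)
 qed
 define BL where "BL = M\<^sup>2 * measure lborel (cball (0::'a) R)"
 have BL0: "BL \<ge> 0" by (simp add: BL_def)
 define J where "J k \<xi> = (LBINT z. W k \<xi> z * L \<xi> z)" for k \<xi>
 define Q where "Q \<xi> = (LBINT z. L \<xi> z)" for \<xi>
 have JB: "cmod (J k \<xi>) \<le> \<bar>\<xi> \<bullet> b\<bar> * BL * (4 * R)" for k \<xi>
  unfolding J_def L_def BL_def
  by (rule line_correlation_integrable(2)[OF F F b R]) (auto simp: Wb)
 have Ji: "L1 (\<lambda>z. W k \<xi> z * L \<xi> z)" for k \<xi>
  unfolding L_def by (rule line_correlation_integrable(1)[OF F F b R, of _ "\<bar>\<xi> \<bullet> b\<bar>"]) (auto simp: Wb)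
 have Li: "L1 (\<lambda>z. L \<xi> z)" for \<xi>
  unfolding L_def using line_correlation_integrable(1)[OF F F b R, of "\<lambda>_. 1" 1 \<xi>] by simp
 have QB: "cmod (Q \<xi>) \<le> BL * (4 * R)" for \<xi>
  unfolding Q_def L_def BL_def using line_correlation_integrable(2)[OF F F b R, of "\<lambda>_. 1" 1 \<xi>] by simp
 have Jlim: "(\<lambda>k. J k \<xi>) \<longlonglongrightarrow> \<i> * of_real ((\<xi> \<bullet> b) / pi) * Q \<xi>" for \<xi>
 proof -
  have "(\<lambda>k. J k \<xi>) \<longlonglongrightarrow> (LBINT z. \<i> * of_real ((\<xi> \<bullet> b) / pi) * L \<xi> z)"
   unfolding J_def
  proof (rule integral_dominated_convergence[where w="\<lambda>z. \<bar>\<xi> \<bullet> b\<bar> * cmod (L \<xi> z)"])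
   show "L1 (\<lambda>z. \<bar>\<xi> \<bullet> b\<bar> * cmod (L \<xi> z))" using Li by simp
   have "AE z in lborel. z \<noteq> (0::real)" by (rule AE_lborel_singleton)
   then show "AE z in lborel. (\<lambda>k. W k \<xi> z * L \<xi> z) \<longlonglongrightarrow> \<i> * of_real ((\<xi> \<bullet> b) / pi) * L \<xi> z"
    by eventually_elim (intro tendsto_mult Wlim tendsto_const)
   show "AE z in lborel. cmod (W k \<xi> z * L \<xi> z) \<le> \<bar>\<xi> \<bullet> b\<bar> * cmod (L \<xi> z)" for k
    using Wb by (intro AE_I2) (auto simp: norm_mult intro!: mult_right_mono)
  qed measurable
  then show ?thesis unfolding Q_def by (simp only: integral_mult_right_zero)
 qed
 have [measurable]: "Q \<in> borel_fun" unfolding Q_def by measurable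
 have Jm[measurable]: "J k \<in> borel_fun" for k unfolding J_def W_def by measurable
 have Jint: "(LBINT \<xi>. ?m \<xi> * J k \<xi>) = of_real ((1 / s k) * (2 * pi) ^ DIM('a)) *
   (energy_form (conj_poisson_diff y Y) (conj_poisson (s k)) (gaussian \<delta>) b (\<lambda>u. F (shear (s k) u) - F u) (\<lambda>u. F (shear (s k) u))
    + energy_form (conj_poisson_diff y Y) (conj_poisson (s k)) (gaussian \<delta>) b F (\<lambda>u. F (shear (s k) u) - F u))"
  (is "_ = _ * ?e k") for k
 proof -
  have "(LBINT \<xi>. ?m \<xi> * J k \<xi>) = (LBINT \<xi>. (1 / s k) *\<^sub>R (?m \<xi> * (LBINT z. of_real (conj_poisson (s k) z) * (cis (s k * z * (\<xi> \<bullet> b)) - 1) * L \<xi> z)))"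
   unfolding J_def W_def by (simp only: mult_scaleR_left mult_scaleR_right integral_scaleR_right)
  also have "... = (1 / s k) *\<^sub>R (of_real ((2 * pi) ^ DIM('a)) * ?e k)"
   unfolding integral_scaleR_right L_def
   by (subst energy_form_difference[OF F b R y \<delta> kernel_measurable(2) abs_conj_poisson_le(1)[OF s]]) simp
  finally show ?thesis by (simp only: scaleR_conv_of_real of_real_mult mult.assoc)
 qed
 have bJ: "cmod (LBINT \<xi>. ?m \<xi> * J k \<xi>) \<le> (2 * pi) ^ DIM('a) * B" for k
 proof -
  have "cmod (LBINT \<xi>. ?m \<xi> * J k \<xi>) = ((1 / s k) * (2 * pi) ^ DIM('a)) * cmod (?e k)"
   unfolding Jint norm_mult norm_of_real using s[of k] by simp
  also have "... \<le> ((1 / s k) * (2 * pi) ^ DIM('a)) * (s k * B)"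
   using s[of k] by (intro mult_left_mono bound) auto
  finally show ?thesis using s[of k] by simp
 qed
 have lim: "(\<lambda>k. LBINT \<xi>. ?m \<xi> * J k \<xi>) \<longlonglongrightarrow> (LBINT \<xi>. ?m \<xi> * (\<i> * of_real ((\<xi> \<bullet> b) / pi) * Q \<xi>))"
 proof (rule integral_dominated_convergence[where w="\<lambda>\<xi>. ?E \<xi> * ((1 / y) * (BL * (4 * R)))"])
  show "L1 (\<lambda>\<xi>. ?E \<xi> * ((1 / y) * (BL * (4 * R))))"
   using gaussian_multiplier_integrable[OF \<delta>, where 'a='a] by (rule integrable_mult_left)
  show "AE \<xi> in lborel. (\<lambda>k. ?m \<xi> * J k \<xi>) \<longlonglongrightarrow> ?m \<xi> * (\<i> * of_real ((\<xi> \<bullet> b) / pi) * Q \<xi>)"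
   by (intro AE_I2 tendsto_mult_left Jlim)
  show "AE \<xi> in lborel. cmod (?m \<xi> * J k \<xi>) \<le> ?E \<xi> * ((1 / y) * (BL * (4 * R)))" for k
  proof (rule AE_I2, goal_cases)
   case (1 \<xi>)
   have "cmod (?m \<xi> * J k \<xi>) = ?E \<xi> * (\<bar>sgn_exp y Y (\<xi> \<bullet> b)\<bar> * cmod (J k \<xi>))" by (simp add: norm_mult)
   also have "... \<le> ?E \<xi> * (\<bar>sgn_exp y Y (\<xi> \<bullet> b)\<bar> * (\<bar>\<xi> \<bullet> b\<bar> * BL * (4 * R)))"
    by (intro mult_left_mono JB) auto
   also have "... = ?E \<xi> * (\<bar>(\<xi> \<bullet> b) * sgn_exp y Y (\<xi> \<bullet> b)\<bar> * (BL * (4 * R)))" by (simp add: abs_mult)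
   also have "... \<le> ?E \<xi> * ((1 / y) * (BL * (4 * R)))"
    using abs_mult_sgn_exp_le[OF y] BL0 R by (intro mult_left_mono mult_right_mono) auto
   finally show ?case .
  qed
 qed measurable
 define h where "h \<xi> = FT (\<lambda>x. LBINT v. F (x, v)) \<xi>" for \<xi>
 define V where "V = measure lborel (cball (0::'a) (R + 1))"
 have V0: "V \<ge> 0" by (simp add: V_def)
 have Q: "Im (Q \<xi>) = 0" "(cmod (h \<xi>))\<^sup>2 \<le> V * Re (Q \<xi>)" for \<xi>
 proof -
  have xm: "(\<lambda>v. xFT F v \<xi>) \<in> borel_fun"
   using measurable_compose[OF measurable_Pair2' xFT_facts(1)[OF F], of \<xi>] by simp
  note LM = line_mass_inequality[OF xm xFT_facts(2)[OF F] xFT_facts(3)[OF F] R b]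
  show "Im (Q \<xi>) = 0" using LM(1) by (simp add: Q_def L_def line_correlation_def)
  show "(cmod (h \<xi>))\<^sup>2 \<le> V * Re (Q \<xi>)" using LM(2)
   by (simp add: Q_def L_def line_correlation_def h_def FT_velocity_integral[OF F] V_def)
 qed
 define P where "P \<xi> = ?E \<xi> * ?a \<xi> * Re (Q \<xi>)" for \<xi>
 have nn: "(\<xi> \<bullet> b) * sgn_exp y Y (\<xi> \<bullet> b) \<ge> 0" for \<xi>
  unfolding sgn_exp_sign[OF y] using exp_diff_nonneg[OF y] by simp
 have mQ: "?m \<xi> * (\<i> * of_real ((\<xi> \<bullet> b) / pi) * Q \<xi>) = - of_real (P \<xi> / pi)" for \<xi>
  using Q(1)[of \<xi>] by (simp add: complex_eq_iff P_def)
 have "cmod (LBINT \<xi>. - of_real (P \<xi> / pi)) \<le> (2 * pi) ^ DIM('a) * B"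
  by (rule LIMSEQ_le_const2[OF tendsto_norm[OF lim[unfolded mQ]]]) (use bJ in auto)
 then have "\<bar>(LBINT \<xi>. P \<xi> / pi)\<bar> \<le> (2 * pi) ^ DIM('a) * B"
  by (simp only: integral_minus integral_complex_of_real norm_minus_cancel norm_of_real)
 then have "\<bar>(LBINT \<xi>. P \<xi>)\<bar> / pi \<le> (2 * pi) ^ DIM('a) * B" by simp
 then have IP: "\<bar>(LBINT \<xi>. P \<xi>)\<bar> \<le> pi * (2 * pi) ^ DIM('a) * B" by (simp add: divide_le_eq mult_ac)
 have Pi: "L1 P"
 proof (rule integrable_dominated[where g="\<lambda>\<xi>. ?E \<xi> * ((1 / y) * (BL * (4 * R)))"])
  show "L1 (\<lambda>\<xi>. ?E \<xi> * ((1 / y) * (BL * (4 * R))))"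
   using gaussian_multiplier_integrable[OF \<delta>, where 'a='a] by (rule integrable_mult_left)
  show "P \<in> borel_measurable lborel" unfolding P_def by measurable
  show "norm (P \<xi>) \<le> ?E \<xi> * ((1 / y) * (BL * (4 * R)))" for \<xi>
  proof -
   have "\<bar>Re (Q \<xi>)\<bar> \<le> BL * (4 * R)" using QB[of \<xi>] abs_Re_le_cmod[of "Q \<xi>"] by linarith
   then have "\<bar>(\<xi> \<bullet> b) * sgn_exp y Y (\<xi> \<bullet> b)\<bar> * \<bar>Re (Q \<xi>)\<bar> \<le> (1 / y) * (BL * (4 * R))"
    using abs_mult_sgn_exp_le[OF y, of "\<xi> \<bullet> b"] y by (intro mult_mono) auto
   then have "?E \<xi> * (\<bar>(\<xi> \<bullet> b) * sgn_exp y Y (\<xi> \<bullet> b)\<bar> * \<bar>Re (Q \<xi>)\<bar>) \<le> ?E \<xi> * ((1 / y) * (BL * (4 * R)))"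
    by (intro mult_left_mono) auto
   moreover have "norm (P \<xi>) = ?E \<xi> * (\<bar>(\<xi> \<bullet> b) * sgn_exp y Y (\<xi> \<bullet> b)\<bar> * \<bar>Re (Q \<xi>)\<bar>)"
    by (simp add: P_def abs_mult)
   ultimately have "norm (P \<xi>) \<le> ?E \<xi> * ((1 / y) * (BL * (4 * R)))" by (simp only:)
   then show ?thesis
    by (rule order_trans) (simp only: real_norm_def abs_ge_self)
  qed
 qed
 have "(NBINT \<xi>. ennreal (?E \<xi> * ?a \<xi> * (cmod (h \<xi>))\<^sup>2)) \<le> (NBINT \<xi>. ennreal (V * P \<xi>))"
 proof (intro nn_integral_mono ennreal_leI)
  fix \<xi>
  have "?E \<xi> * ?a \<xi> * (cmod (h \<xi>))\<^sup>2 \<le> ?E \<xi> * ?a \<xi> * (V * Re (Q \<xi>))"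
   by (rule mult_left_mono[OF Q(2)]) (rule mult_nonneg_nonneg[OF exp_ge_zero nn])
  then show "?E \<xi> * ?a \<xi> * (cmod (h \<xi>))\<^sup>2 \<le> V * P \<xi>"
   by (simp add: P_def mult_ac)
 qed
 also have "... = ennreal (LBINT \<xi>. V * P \<xi>)"
 proof (rule nn_integral_eq_integral)
  show "L1 (\<lambda>\<xi>. V * P \<xi>)" using Pi by simp
  show "AE \<xi> in lborel. 0 \<le> V * P \<xi>"
  proof (rule AE_I2, goal_cases)
   case (1 \<xi>)
   have "0 \<le> V * Re (Q \<xi>)" by (rule order_trans[OF zero_le_power2 Q(2)])
   then have "0 \<le> (?E \<xi> * ?a \<xi>) * (V * Re (Q \<xi>))"
    by (rule mult_nonneg_nonneg[OF mult_nonneg_nonneg[OF exp_ge_zero nn]])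
   then show ?case by (simp add: P_def mult_ac)
  qed
 qed
 also have "... \<le> ennreal (pi * (2 * pi) ^ DIM('a) * V * B)"
 proof (rule ennreal_leI)
  have "V * (LBINT \<xi>. P \<xi>) \<le> V * (pi * (2 * pi) ^ DIM('a) * B)" using IP V0 by (intro mult_left_mono) auto
  then show "(LBINT \<xi>. V * P \<xi>) \<le> pi * (2 * pi) ^ DIM('a) * V * B" by (simp add: mult_ac)
 qed
 finally show ?thesis unfolding h_def V_def .
qed

text \<open>Remove the regularisation: \<open>y\<close> tends to 0, \<open>Y\<close> to infinity and the width of the Gaussian to 0. Since
 the integrands on the left are nonnegative, Fatou's lemma is enough.\<close>

proposition velocity_average_energy:
 fixes p q R :: real
 assumes p: "1 < p" and pq: "1 / p + 1 / q = 1" and R: "R \<ge> 0"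
 obtains C where "C > 0"
  "\<And>(F :: 'a::euclidean_space \<times> 'a => complex) M A b. tame R M F ==> A \<ge> 0 ==> b \<in> Basis ==>
   (\<And>t. t > 0 ==> Lpn q (\<lambda>u. F (shear t u) - F u) \<le> t * A) ==>
   (NBINT \<xi>. ennreal (\<bar>\<xi> \<bullet> b\<bar> * (cmod (FT (\<lambda>x. LBINT v. F (x, v)) \<xi>))\<^sup>2)) \<le> ennreal (C * A * Lpn p F)"
proof -
 show ?thesis
 proof (rule energy_form_bound[OF p pq, where 'a='a], goal_cases)
 case (1 C0)
 note C0 = 1(1) and EB = 1(2)
 \<comment> \<open>The summand 1 only makes \<open>C\<close> positive without computing the volume of the ball.\<close>
 define C where "C = pi * (2 * pi) ^ DIM('a) * (measure lborel (cball (0::'a) (R + 1)) + 1) * (2 * C0)"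
 have C: "C > 0" unfolding C_def using C0 by (intro mult_pos_pos add_nonneg_pos) auto
 have main: "(NBINT \<xi>. ennreal (\<bar>\<xi> \<bullet> b\<bar> * (cmod (FT (\<lambda>x. LBINT v. F (x, v)) \<xi>))\<^sup>2)) \<le> ennreal (C * A * Lpn p F)"
  if F: "tame R M F" and A: "A \<ge> 0" and b: "b \<in> Basis" and dq: "\<And>t. t > 0 ==> Lpn q (\<lambda>u. F (shear t u) - F u) \<le> t * A"
  for F :: "'a \<times> 'a => complex" and M A b
 proof -
  note [measurable] = tameD(1)[OF F]
  have M0: "M \<ge> 0" by (rule tameD(5)[OF F])
  have F2: "tame R (2 * M) F" using tame_mono[OF F] M0 by simp
  have L0: "Lpn p F \<ge> 0" by (simp add: Lpn_def)
  define h where "h \<xi> = FT (\<lambda>x. LBINT v. F (x, v)) \<xi>" for \<xi>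
  have [measurable]: "h \<in> borel_fun" unfolding h_def FT_def by measurable
  define B where "B = 2 * C0 * A * Lpn p F"
  have bound: "cmod (energy_form (conj_poisson_diff y Y) (conj_poisson \<epsilon>) (gaussian \<delta>) b (\<lambda>u. F (shear t u) - F u) (\<lambda>u. F (shear t u))
    + energy_form (conj_poisson_diff y Y) (conj_poisson \<epsilon>) (gaussian \<delta>) b F (\<lambda>u. F (shear t u) - F u)) \<le> t * B"
   if y: "0 < y" "y < Y" and \<delta>: "\<delta> > 0" and t: "t > 0" and \<epsilon>: "\<epsilon> > 0" for y Y \<delta> t \<epsilon>
  proof -
   define Ft where "Ft u = F (shear t u)" for u
   define G where "G u = Ft u - F u" for u
   have Ft1: "tame R M Ft" unfolding Ft_def by (rule tame_shear[OF F])
   have Ft2: "tame R (2 * M) Ft" using tame_mono[OF Ft1] M0 by simp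
   have G2: "tame R (2 * M) G" unfolding G_def by (rule tame_diff[OF F Ft1])
   have LFt: "Lpn p Ft = Lpn p F"
    using integral_shear[of "\<lambda>u. cmod (F u) powr p" t] by (simp add: Lpn_def Ft_def)
   note \<rho> = gaussian_integral(1)[OF \<delta>, where 'a='a] gaussian_nonneg gaussian_integral(2)[OF \<delta>] gaussian_even
   have "cmod (energy_form (conj_poisson_diff y Y) (conj_poisson \<epsilon>) (gaussian \<delta>) b G Ft) \<le> C0 * Lpn q G * Lpn p Ft"
    using EB[OF tame_integrable(1)[OF Ft2] tameD(2)[OF Ft2] tameD(3)[OF Ft2] tame_integrable(1)[OF G2] tameD(2)[OF G2] tameD(3)[OF G2]
      R b y \<epsilon> \<rho>] by blast
   moreover have "cmod (energy_form (conj_poisson_diff y Y) (conj_poisson \<epsilon>) (gaussian \<delta>) b F G) \<le> C0 * Lpn q G * Lpn p F"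
    using EB[OF tame_integrable(1)[OF F2] tameD(2)[OF F2] tameD(3)[OF F2] tame_integrable(1)[OF G2] tameD(2)[OF G2] tameD(3)[OF G2]
      R b y \<epsilon> \<rho>] by blast
   moreover have "C0 * Lpn q G * Lpn p F \<le> C0 * (t * A) * Lpn p F"
    using dq[OF t] C0 L0 unfolding G_def Ft_def by (intro mult_right_mono mult_left_mono) auto
   ultimately have "cmod (energy_form (conj_poisson_diff y Y) (conj_poisson \<epsilon>) (gaussian \<delta>) b G Ft
     + energy_form (conj_poisson_diff y Y) (conj_poisson \<epsilon>) (gaussian \<delta>) b F G) \<le> C0 * (t * A) * Lpn p F + C0 * (t * A) * Lpn p F"
    unfolding LFt by (intro norm_triangle_le) linarith
   also have "... = t * B" by (simp add: B_def)
   finally show ?thesis unfolding G_def Ft_def .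
  qed
  define s where "s k = 1 / real (Suc k)" for k
  have s: "s k > 0" for k by (simp add: s_def)
  have s0: "s \<longlonglongrightarrow> 0" unfolding s_def by real_asymp
  \<comment> \<open>Starting at 2 ensures \<open>s k < Y k\<close> already for \<open>k = 0\<close>.\<close>
  define Y where "Y k = 2 + real k" for k
  have sY: "s k < Y k" for k
  proof -
   have "s k \<le> 1" by (simp add: s_def)
   then show ?thesis by (simp add: Y_def)
  qed
  have Ylim: "filterlim Y at_top sequentially" unfolding Y_def by real_asymp
  define g where "g k \<xi> = exp (- (s k * norm \<xi>)\<^sup>2 / 2) * ((\<xi> \<bullet> b) * sgn_exp (s k) (Y k) (\<xi> \<bullet> b)) * (cmod (h \<xi>))\<^sup>2" for k \<xi>
  have [measurable]: "g k \<in> borel_fun" for k unfolding g_def by measurable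
  have gl: "(\<lambda>k. g k \<xi>) \<longlonglongrightarrow> \<bar>\<xi> \<bullet> b\<bar> * (cmod (h \<xi>))\<^sup>2" for \<xi>
  proof -
   have 1: "(\<lambda>k. exp (- (s k * norm \<xi>)\<^sup>2 / 2)) \<longlonglongrightarrow> exp (- (0 * norm \<xi>)\<^sup>2 / 2)"
    by (intro tendsto_intros s0) auto
   have 2: "(\<lambda>k. (\<xi> \<bullet> b) * sgn_exp (s k) (Y k) (\<xi> \<bullet> b)) \<longlonglongrightarrow> \<bar>\<xi> \<bullet> b\<bar>"
   proof (cases "\<xi> \<bullet> b = 0")
    case False
    have "(\<lambda>k. exp (- (s k * \<bar>\<xi> \<bullet> b\<bar>))) \<longlonglongrightarrow> exp (- (0 * \<bar>\<xi> \<bullet> b\<bar>))" by (intro tendsto_intros s0)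
    moreover have "(\<lambda>k. exp (- (Y k * \<bar>\<xi> \<bullet> b\<bar>))) \<longlonglongrightarrow> 0"
    proof -
     have "\<bar>\<xi> \<bullet> b\<bar> > 0" using False by simp
     then show ?thesis unfolding Y_def by real_asymp
    qed
    ultimately have "(\<lambda>k. \<bar>\<xi> \<bullet> b\<bar> * (exp (- (s k * \<bar>\<xi> \<bullet> b\<bar>)) - exp (- (Y k * \<bar>\<xi> \<bullet> b\<bar>)))) \<longlonglongrightarrow> \<bar>\<xi> \<bullet> b\<bar> * (exp (- (0 * \<bar>\<xi> \<bullet> b\<bar>)) - 0)"
     by (intro tendsto_mult tendsto_diff tendsto_const)
    then show ?thesis unfolding sgn_exp_sign[OF s sY] by simp
   qed simp
   show ?thesis unfolding g_def using tendsto_mult[OF tendsto_mult[OF 1 2] tendsto_const[of "(cmod (h \<xi>))\<^sup>2"]] by simp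
  qed
  have gb: "(NBINT \<xi>. ennreal (g k \<xi>)) \<le> ennreal (C * A * Lpn p F)" for k
  proof -
   have "(NBINT \<xi>. ennreal (g k \<xi>)) \<le> ennreal (pi * (2 * pi) ^ DIM('a) * measure lborel (cball (0::'a) (R + 1)) * B)"
    unfolding g_def h_def by (rule regularized_energy_bound[OF F b R s sY s bound[OF s sY s]])
   also have "... \<le> ennreal (C * A * Lpn p F)"
   proof (rule ennreal_leI)
    have "pi * (2 * pi) ^ DIM('a) * measure lborel (cball (0::'a) (R + 1)) * B
     \<le> pi * (2 * pi) ^ DIM('a) * (measure lborel (cball (0::'a) (R + 1)) + 1) * B"
     using C0 A L0 by (intro mult_right_mono mult_left_mono) (auto simp: B_def)
    also have "... = C * A * Lpn p F" by (simp add: B_def C_def)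
    finally show "pi * (2 * pi) ^ DIM('a) * measure lborel (cball (0::'a) (R + 1)) * B \<le> C * A * Lpn p F" .
   qed
   finally show ?thesis .
  qed
  have "(NBINT \<xi>. ennreal (\<bar>\<xi> \<bullet> b\<bar> * (cmod (h \<xi>))\<^sup>2)) = (NBINT \<xi>. liminf (\<lambda>k. ennreal (g k \<xi>)))"
   by (intro nn_integral_cong lim_imp_Liminf[symmetric] tendsto_ennrealI gl) auto
  also have "... \<le> liminf (\<lambda>k. NBINT \<xi>. ennreal (g k \<xi>))"
   by (rule nn_integral_liminf) measurable
  also have "... \<le> ennreal (C * A * Lpn p F)"
   by (rule Liminf_le) (use gb in auto)
  finally show ?thesis unfolding h_def .
 qed
 show ?thesis by (rule that[OF C main])
 qed
qed

section \<open>Test functions\<close>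

abbreviation partial_deriv :: "'a::euclidean_space => ('a => complex) => 'a => complex" where
 "partial_deriv b f x \<equiv> frechet_derivative f (at x) b"

lemma partial_deriv_eqI: "(f has_derivative D) (at x) ==> partial_deriv b f x = D b"
 by (drule frechet_derivative_at) simp

lemma Ck_SucD: "Ck (Suc k) f ==> Ck k f"
proof (induction k arbitrary: f)
 case 0
 then have "\<forall>x. f differentiable (at x)" by simp
 then show ?case
  by (auto intro!: continuous_at_imp_continuous_on differentiable_imp_continuous_within)
next
 case (Suc k)
 then have d: "\<forall>x. f differentiable (at x)" "\<forall>b\<in>Basis. Ck (Suc k) (partial_deriv b f)" by simp_all
 then show ?case using Suc.IH by auto
qed

lemma Ck_const: "Ck k (\<lambda>x. c)"
proof (induction k arbitrary: c)
 case (Suc k)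
 have "partial_deriv b (\<lambda>x. c) = (\<lambda>x. 0)" for b :: 'a
  by (rule ext) (simp add: frechet_derivative_const)
 then show ?case using Suc by simp
qed simp

lemma Ck_add: "Ck k f ==> Ck k g ==> Ck k (\<lambda>x. f x + g x)"
proof (induction k arbitrary: f g)
 case 0 then show ?case by (auto intro: continuous_on_add)
next
 case (Suc k)
 have d: "\<And>x. f differentiable (at x)" "\<And>x. g differentiable (at x)" using Suc.prems by auto
 have "partial_deriv b (\<lambda>x. f x + g x) = (\<lambda>x. partial_deriv b f x + partial_deriv b g x)" for b
 proof
  fix x
  have "((\<lambda>x. f x + g x) has_derivative (\<lambda>h. frechet_derivative f (at x) h + frechet_derivative g (at x) h)) (at x)"
   by (intro has_derivative_add frechet_derivative_works[THEN iffD1] d)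
  then show "partial_deriv b (\<lambda>x. f x + g x) x = partial_deriv b f x + partial_deriv b g x"
   by (rule partial_deriv_eqI)
 qed
 moreover have "Ck k (\<lambda>x. partial_deriv b f x + partial_deriv b g x)" if "b \<in> Basis" for b
  using Suc.prems that by (intro Suc.IH) simp_all
 ultimately show ?case using d by (simp add: differentiable_add)
qed

lemma partial_deriv_mult:
 fixes f g :: "'a::euclidean_space => complex"
 assumes "f differentiable (at x)" "g differentiable (at x)"
 shows "partial_deriv b (\<lambda>x. f x * g x) x = f x * partial_deriv b g x + partial_deriv b f x * g x"
proof -
 have "((\<lambda>x. f x * g x) has_derivative (\<lambda>h. f x * frechet_derivative g (at x) h + frechet_derivative f (at x) h * g x)) (at x)"
  by (intro has_derivative_mult frechet_derivative_works[THEN iffD1] assms)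
 then show ?thesis by (rule partial_deriv_eqI)
qed

lemma Ck_mult: "Ck k f ==> Ck k g ==> Ck k (\<lambda>x. f x * g x)"
proof (induction k arbitrary: f g)
 case 0 then show ?case by (auto intro: continuous_on_mult)
next
 case (Suc k)
 have d: "\<And>x. f differentiable (at x)" "\<And>x. g differentiable (at x)" using Suc.prems by auto
 have p: "\<And>b. b \<in> Basis ==> Ck k (partial_deriv b f)" "\<And>b. b \<in> Basis ==> Ck k (partial_deriv b g)"
  using Suc.prems by auto
 have "partial_deriv b (\<lambda>x. f x * g x) = (\<lambda>x. f x * partial_deriv b g x + partial_deriv b f x * g x)" for b
  using partial_deriv_mult[OF d] by blast
 moreover have "Ck k (\<lambda>x. f x * partial_deriv b g x + partial_deriv b f x * g x)" if "b \<in> Basis" for b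
  by (intro Ck_add Suc.IH p[OF that] Ck_SucD[OF Suc.prems(1)] Ck_SucD[OF Suc.prems(2)])
 ultimately show ?case using d by (simp add: differentiable_mult)
qed

lemma Ck_cmult: "Ck k f ==> Ck k (\<lambda>x. c * f x)"
 using Ck_mult[OF Ck_const] .

lemma Ck_sum: "finite A ==> (\<And>a. a \<in> A ==> Ck k (f a)) ==> Ck k (\<lambda>x. \<Sum>a\<in>A. f a x)"
 by (induction A rule: finite_induct) (auto intro: Ck_add Ck_const)

lemma Ck_prod: "finite A ==> (\<And>a. a \<in> A ==> Ck k (f a)) ==> Ck k (\<lambda>x. \<Prod>a\<in>A. f a x)"
 by (induction A rule: finite_induct) (auto intro: Ck_mult Ck_const)

lemma frechet_derivative_Basis_sum:
 fixes f :: "'a::euclidean_space => complex"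
 assumes "f differentiable (at x)"
 shows "frechet_derivative f (at x) h = (\<Sum>b\<in>Basis. of_real (h \<bullet> b) * partial_deriv b f x)"
proof -
 have l: "linear (frechet_derivative f (at x))"
  using assms frechet_derivative_works has_derivative_linear by blast
 have "frechet_derivative f (at x) h = frechet_derivative f (at x) (\<Sum>b\<in>Basis. (h \<bullet> b) *\<^sub>R b)"
  by (simp add: euclidean_representation)
 also have "... = (\<Sum>b\<in>Basis. (h \<bullet> b) *\<^sub>R partial_deriv b f x)"
  using l by (simp add: linear_sum linear_scale)
 finally show ?thesis by (simp add: scaleR_conv_of_real)
qed

text \<open>The partial derivatives of \<open>f \<circ> L\<close> are linear combinations of those of \<open>f\<close>, composed with \<open>L\<close>; induction
 on the order.\<close>

lemma Ck_compose_linear: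
 fixes f :: "'a::euclidean_space => complex" and L :: "'b::euclidean_space => 'a"
 assumes L: "bounded_linear L"
 shows "Ck k f ==> Ck k (\<lambda>x. f (L x))"
proof (induction k arbitrary: f)
 case 0
 then have "continuous_on UNIV f" by simp
 then have "continuous_on UNIV (\<lambda>x. f (L x))"
  by (rule continuous_on_compose2) (use L in \<open>auto intro: linear_continuous_on\<close>)
 then show ?case by simp
next
 case (Suc k)
 have d: "\<And>x. f differentiable (at x)" using Suc.prems by auto
 have hd: "((\<lambda>x. f (L x)) has_derivative (\<lambda>h. frechet_derivative f (at (L x)) (L h))) (at x)" for x
 proof -
  have 1: "(L has_derivative L) (at x)" using L by (rule bounded_linear_imp_has_derivative)
  have 2: "(f has_derivative frechet_derivative f (at (L x))) (at (L x))"
   using d frechet_derivative_works by blast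
  show ?thesis using diff_chain_at[OF 1 2] by (simp add: o_def)
 qed
 have "partial_deriv b (\<lambda>x. f (L x)) = (\<lambda>x. \<Sum>i\<in>Basis. of_real (L b \<bullet> i) * partial_deriv i f (L x))" for b
 proof
  fix x
  have "partial_deriv b (\<lambda>x. f (L x)) x = frechet_derivative f (at (L x)) (L b)"
   by (rule partial_deriv_eqI[OF hd])
  also have "... = (\<Sum>i\<in>Basis. of_real (L b \<bullet> i) * partial_deriv i f (L x))"
   by (rule frechet_derivative_Basis_sum[OF d])
  finally show "partial_deriv b (\<lambda>x. f (L x)) x = (\<Sum>i\<in>Basis. of_real (L b \<bullet> i) * partial_deriv i f (L x))" .
 qed
 moreover have "Ck k (\<lambda>x. \<Sum>i\<in>Basis. of_real (L b \<bullet> i) * partial_deriv i f (L x))" for b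
  using Suc.prems by (intro Ck_sum Ck_cmult Suc.IH) simp_all
 moreover have "(\<lambda>x. f (L x)) differentiable (at x)" for x using hd unfolding differentiable_def by blast
 ultimately show ?case by simp
qed

lemma test_functionsD:
 assumes "\<phi> \<in> test_functions"
 shows "\<And>k. Ck k \<phi>" "continuous_on UNIV \<phi>" "\<And>x. \<phi> differentiable (at x)" "\<phi> \<in> borel_fun"
  "\<exists>R>0. \<forall>x. norm x \<ge> R \<longrightarrow> \<phi> x = 0"
proof -
 show 1: "\<And>k. Ck k \<phi>" using assms by (simp add: test_functions_def)
 show c: "continuous_on UNIV \<phi>" using 1[of 0] by simp
 show "\<And>x. \<phi> differentiable (at x)" using 1[of "Suc 0"] by (simp only: Ck.simps)
 show "\<phi> \<in> borel_fun" using c by (rule borel_measurable_continuous_onI)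
 have "bounded (closure {x. \<phi> x \<noteq> 0})" using assms by (simp add: test_functions_def compact_imp_bounded)
 then obtain R where R: "R > 0" "\<And>x. x \<in> closure {x. \<phi> x \<noteq> 0} ==> norm x < R"
  using bounded_pos_less by blast
 have "\<phi> x = 0" if "norm x \<ge> R" for x
  using R(2)[of x] that closure_subset[of "{x. \<phi> x \<noteq> 0}"] by fastforce
 then show "\<exists>R>0. \<forall>x. norm x \<ge> R \<longrightarrow> \<phi> x = 0" using R(1) by blast
qed

lemma test_functionsI:
 assumes "\<And>k. Ck k \<phi>" and "\<And>x. norm x > R ==> \<phi> x = 0"
 shows "\<phi> \<in> test_functions"
proof -
 have "{x. \<phi> x \<noteq> 0} \<subseteq> cball 0 R" using assms(2) by (auto simp: not_less) (meson linorder_not_le)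
 then have "bounded {x. \<phi> x \<noteq> 0}" using bounded_cball bounded_subset by blast
 then show ?thesis using assms(1) by (simp add: test_functions_def compact_closure)
qed

lemma test_functions_add:
 assumes "\<phi> \<in> test_functions" "\<psi> \<in> test_functions"
 shows "(\<lambda>x. \<phi> x + \<psi> x) \<in> test_functions"
proof -
 obtain R1 R2 where R: "\<And>x. norm x \<ge> R1 ==> \<phi> x = 0" "\<And>x. norm x \<ge> R2 ==> \<psi> x = 0"
  using test_functionsD(5)[OF assms(1)] test_functionsD(5)[OF assms(2)] by blast
 show ?thesis
  by (rule test_functionsI[where R="max R1 R2"], intro Ck_add test_functionsD(1) assms) (use R in auto)
qed

lemma test_functions_cmult:
 assumes "\<phi> \<in> test_functions"
 shows "(\<lambda>x. c * \<phi> x) \<in> test_functions"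
proof -
 obtain R1 where R: "\<And>x. norm x \<ge> R1 ==> \<phi> x = 0" using test_functionsD(5)[OF assms(1)] by blast
 show ?thesis
  by (rule test_functionsI[where R=R1], intro Ck_cmult test_functionsD(1) assms) (use R in auto)
qed

lemma partial_deriv_test:
 assumes \<phi>: "\<phi> \<in> test_functions" and b: "b \<in> Basis"
 shows "partial_deriv b \<phi> \<in> test_functions"
proof -
 obtain R where R: "\<And>x. norm x \<ge> R ==> \<phi> x = 0" using test_functionsD(5)[OF \<phi>] by blast
 show ?thesis
 proof (rule test_functionsI[where R=R])
  show "Ck k (partial_deriv b \<phi>)" for k using test_functionsD(1)[OF \<phi>, of "Suc k"] b by simp
  fix x :: 'a assume x: "norm x > R"
  have "((\<lambda>x. 0) has_derivative (\<lambda>h. 0)) (at x)" by simp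
  moreover have "open {x::'a. norm x > R}" by (intro open_Collect_less continuous_intros)
  ultimately have "(\<phi> has_derivative (\<lambda>h. 0)) (at x)"
   by (rule has_derivative_transform_within_open) (use R x in auto)
  then show "partial_deriv b \<phi> x = 0" by (rule partial_deriv_eqI)
 qed
qed

lemma test_functions_shear:
 fixes \<phi> :: "'a::euclidean_space \<times> 'a => complex"
 assumes \<phi>: "\<phi> \<in> test_functions"
 shows "(\<lambda>z. \<phi> (shear t z)) \<in> test_functions"
proof -
 have L: "bounded_linear (shear t :: 'a \<times> 'a => 'a \<times> 'a)"
  unfolding shear_def[abs_def]
  by (intro bounded_linear_Pair bounded_linear_add bounded_linear_fst bounded_linear_snd
    bounded_linear_scaleR_right[THEN bounded_linear_compose] bounded_linear_snd)
 have inv: "shear t (shear (- t) z) = z" "shear (- t) (shear t z) = z" for z :: "'a \<times> 'a"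
  by (simp_all add: shear_def)
 have c: "compact (closure {x. \<phi> x \<noteq> 0})" using \<phi> by (simp add: test_functions_def)
 have "{z. \<phi> (shear t z) \<noteq> 0} \<subseteq> shear (- t) ` closure {x. \<phi> x \<noteq> 0}"
 proof
  fix z assume "z \<in> {z. \<phi> (shear t z) \<noteq> 0}"
  then have "shear t z \<in> closure {x. \<phi> x \<noteq> 0}" using closure_subset by fastforce
  then show "z \<in> shear (- t) ` closure {x. \<phi> x \<noteq> 0}" using inv(2)[of z] by (metis image_eqI)
 qed
 moreover have "continuous_on S (shear (- t) :: 'a \<times> 'a => 'a \<times> 'a)" for S
  unfolding shear_def[abs_def] by (intro continuous_intros)
 then have "compact (shear (- t) ` closure {x. \<phi> x \<noteq> 0})" using c compact_continuous_image by blast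
 ultimately have "bounded {z. \<phi> (shear t z) \<noteq> 0}" using compact_imp_bounded bounded_subset by blast
 then show ?thesis
  using Ck_compose_linear[OF L] test_functionsD(1)[OF \<phi>] by (simp add: test_functions_def compact_closure)
qed

lemma test_function_bounded:
 fixes \<phi> :: "'a::euclidean_space => complex"
 assumes \<phi>: "\<phi> \<in> test_functions"
 obtains B R where "B > 0" "R > 0" "\<And>x. cmod (\<phi> x) \<le> B * indicator (cball 0 R) x"
proof -
 obtain R where R: "R > 0" "\<And>x. norm x \<ge> R ==> \<phi> x = 0" using test_functionsD(5)[OF \<phi>] by blast
 have "compact (\<phi> ` cball 0 R)"
  by (intro compact_continuous_image continuous_on_subset[OF test_functionsD(2)[OF \<phi>]]) auto
 then have "bounded (\<phi> ` cball 0 R)" by (rule compact_imp_bounded)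
 then obtain B where B: "B > 0" "\<And>x. x \<in> cball 0 R ==> cmod (\<phi> x) \<le> B"
  unfolding bounded_pos by blast
 have "cmod (\<phi> x) \<le> B * indicator (cball 0 R) x" for x
  using B(2)[of x] R(2)[of x] by (cases "x \<in> cball 0 R") auto
 then show ?thesis using that B R by blast
qed

lemma test_function_integrable:
 fixes \<phi> :: "'a::euclidean_space => complex"
 assumes \<phi>: "\<phi> \<in> test_functions"
 shows "L1 \<phi>"
proof -
 obtain B R where B: "B > 0" "\<And>x. cmod (\<phi> x) \<le> B * indicator (cball 0 R) x"
  using test_function_bounded[OF \<phi>] by metis
 show ?thesis
  by (rule integrable_bound[OF integrable_indicator_cball[of B 0 R]])
    (use B test_functionsD(4)[OF \<phi>] in \<open>auto intro!: AE_I2 order_trans[OF B(2)]\<close>)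
qed

text \<open>The powers of \<open>1 / t\<close> make the family closed under differentiation up to linear combinations, so that
 smoothness of all members follows by a single induction.\<close>

definition exp_bump :: "nat => real => real" where
 "exp_bump j t = (if t > 0 then (1 / t) ^ j * exp (- (1 / t)) else 0)"

lemma exp_bump_tendsto_0: "(exp_bump j \<longlongrightarrow> 0) (at 0)"
proof -
 have "((\<lambda>t. (1 / t) ^ j / exp (1 / t)) \<longlongrightarrow> 0) (at_right (0::real))"
  by (rule filterlim_compose[OF tendsto_power_div_exp_0]) real_asymp
 then have r: "(exp_bump j \<longlongrightarrow> 0) (at_right 0)"
 proof (rule Lim_transform_eventually)
  show "\<forall>\<^sub>F t in at_right 0. (1 / t) ^ j / exp (1 / t) = exp_bump j t"
   using eventually_at_right_less[of 0] by eventually_elim (simp add: exp_bump_def exp_minus field_simps)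
 qed
 have l: "(exp_bump j \<longlongrightarrow> 0) (at_left 0)"
 proof (rule tendsto_eventually)
  show "\<forall>\<^sub>F t in at_left 0. exp_bump j t = 0"
   using eventually_at_left_real[of "-1" 0] by (auto elim!: eventually_mono simp: exp_bump_def)
 qed
 show ?thesis using r l by (simp add: filterlim_split_at)
qed

lemma exp_bump_deriv:
 "(exp_bump j has_field_derivative (exp_bump (j + 2) t - of_nat j * exp_bump (Suc j) t)) (at t)"
proof -
 consider "t > 0" | "t < 0" | "t = 0" by linarith
 then show ?thesis
 proof cases
  case 1
  have "((\<lambda>t. (1 / t) ^ j * exp (- (1 / t))) has_field_derivative
    ((1 / t) ^ j * (exp (- (1 / t)) * (1 / t\<^sup>2)) + of_nat j * (- (1 / t\<^sup>2) * (1 / t) ^ (j - Suc 0)) * exp (- (1 / t)))) (at t)"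
   using 1 by (auto intro!: derivative_eq_intros simp: power2_eq_square)
  also have "(1 / t) ^ j * (exp (- (1 / t)) * (1 / t\<^sup>2)) + of_nat j * (- (1 / t\<^sup>2) * (1 / t) ^ (j - Suc 0)) * exp (- (1 / t))
    = exp_bump (j + 2) t - of_nat j * exp_bump (Suc j) t"
   using 1 by (cases j) (simp_all add: exp_bump_def power2_eq_square field_simps)
  finally show ?thesis
  proof (rule has_field_derivative_transform_within_open[where S="{0<..}"])
   show "(1 / x) ^ j * exp (- (1 / x)) = exp_bump j x" if "x \<in> {0<..}" for x using that by (simp add: exp_bump_def)
  qed (use 1 in auto)
 next
  case 2
  have "((\<lambda>t. 0) has_field_derivative 0) (at t)" by simp
  then have "(exp_bump j has_field_derivative 0) (at t)"
  proof (rule has_field_derivative_transform_within_open[where S="{..<0}"])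
   show "0 = exp_bump j x" if "x \<in> {..<0}" for x using that by (simp add: exp_bump_def)
  qed (use 2 in auto)
  then show ?thesis using 2 by (simp add: exp_bump_def)
 next
  case 3
  have "((\<lambda>h. (exp_bump j (0 + h) - exp_bump j 0) / h) \<longlongrightarrow> 0) (at 0)"
  proof (rule Lim_transform_eventually[OF exp_bump_tendsto_0[of "Suc j"]])
   show "\<forall>\<^sub>F h in at 0. exp_bump (Suc j) h = (exp_bump j (0 + h) - exp_bump j 0) / h"
    by (intro always_eventually allI) (simp add: exp_bump_def)
  qed
  then have "(exp_bump j has_field_derivative 0) (at 0)" unfolding DERIV_def .
  then show ?thesis using 3 by (simp add: exp_bump_def)
 qed
qed

lemma Ck_exp_bump: "Ck k (\<lambda>x::'a::euclidean_space. of_real (exp_bump j (x \<bullet> a + c)) :: complex)"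
proof (induction k arbitrary: j)
 case 0
 have "isCont (exp_bump j) t" for t using exp_bump_deriv DERIV_isCont by blast
 then have "continuous_on UNIV (exp_bump j)" by (simp add: continuous_at_imp_continuous_on)
 then have "continuous_on UNIV (\<lambda>x::'a. exp_bump j (x \<bullet> a + c))"
  by (rule continuous_on_compose2) (auto intro!: continuous_intros)
 then show ?case by (auto intro: continuous_on_of_real)
next
 case (Suc k)
 let ?d = "\<lambda>x::'a. exp_bump (j + 2) (x \<bullet> a + c) - of_nat j * exp_bump (Suc j) (x \<bullet> a + c)"
 have hd: "((\<lambda>x::'a. complex_of_real (exp_bump j (x \<bullet> a + c))) has_derivative (\<lambda>h. of_real ((h \<bullet> a) * ?d x))) (at x)" for x
 proof -
  have 1: "((\<lambda>x. x \<bullet> a + c) has_derivative (\<lambda>h. h \<bullet> a)) (at x)" by (auto intro!: derivative_eq_intros)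
  have 2: "(exp_bump j has_derivative (\<lambda>h. h * ?d x)) (at (x \<bullet> a + c))"
   using exp_bump_deriv[of j "x \<bullet> a + c"] by (simp add: has_field_derivative_def mult.commute[of "_ - _"] mult_commute_abs)
  have 3: "((\<lambda>x. exp_bump j (x \<bullet> a + c)) has_derivative (\<lambda>h. (h \<bullet> a) * ?d x)) (at x)"
   using diff_chain_at[OF 1 2] by (simp add: o_def)
  show ?thesis using has_derivative_of_real[OF 3] .
 qed
 have "partial_deriv b (\<lambda>x::'a. complex_of_real (exp_bump j (x \<bullet> a + c)))
   = (\<lambda>x. of_real (b \<bullet> a) * (of_real (exp_bump (j + 2) (x \<bullet> a + c)) + (- of_nat j) * of_real (exp_bump (Suc j) (x \<bullet> a + c))))" for b
 proof
  fix x
  have "partial_deriv b (\<lambda>x::'a. complex_of_real (exp_bump j (x \<bullet> a + c))) x = of_real ((b \<bullet> a) * ?d x)"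
   by (rule partial_deriv_eqI[OF hd])
  then show "partial_deriv b (\<lambda>x::'a. complex_of_real (exp_bump j (x \<bullet> a + c))) x
   = of_real (b \<bullet> a) * (of_real (exp_bump (j + 2) (x \<bullet> a + c)) + (- of_nat j) * of_real (exp_bump (Suc j) (x \<bullet> a + c)))" by simp
 qed
 moreover have "Ck k (\<lambda>x::'a. of_real (b \<bullet> a) * (complex_of_real (exp_bump (j + 2) (x \<bullet> a + c)) + (- of_nat j) * of_real (exp_bump (Suc j) (x \<bullet> a + c))))" for b
  by (intro Ck_cmult Ck_add Suc.IH)
 moreover have "(\<lambda>x::'a. complex_of_real (exp_bump j (x \<bullet> a + c))) differentiable (at x)" for x
  using hd unfolding differentiable_def by blast
 ultimately show ?case by simp
qed

text \<open>Smooth, supported in the box, and convergent to its indicator as \<open>n\<close> tends to infinity.\<close>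

definition box_bump :: "real => 'a::euclidean_space => 'a => 'a => real" where
 "box_bump n a c x = (\<Prod>b\<in>Basis. exp_bump 0 (n * (x \<bullet> b - a \<bullet> b)) * exp_bump 0 (n * (c \<bullet> b - x \<bullet> b)))"

lemma exp_bump_0_range: "0 \<le> exp_bump 0 t" "exp_bump 0 t \<le> 1"
 by (auto simp: exp_bump_def)

lemma box_bump_range: "0 \<le> box_bump n a c x" "box_bump n a c x \<le> 1"
 unfolding box_bump_def using exp_bump_0_range
 by (auto intro!: prod_nonneg prod_le_1 mult_le_one)

lemma box_bump_zero:
 assumes n: "n > 0" and x: "x \<notin> box a c"
 shows "box_bump n a c x = 0"
proof -
 obtain b where b: "b \<in> Basis" "\<not> (a \<bullet> b < x \<bullet> b \<and> x \<bullet> b < c \<bullet> b)" using x by (auto simp: mem_box)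
 then have "exp_bump 0 (n * (x \<bullet> b - a \<bullet> b)) * exp_bump 0 (n * (c \<bullet> b - x \<bullet> b)) = 0"
  using n by (auto simp: exp_bump_def zero_less_mult_iff)
 then show ?thesis unfolding box_bump_def using b(1) by (intro prod_zero) auto
qed

lemma box_bump_test:
 assumes n: "n > 0"
 shows "(\<lambda>x. of_real (box_bump n a c x)) \<in> test_functions"
proof -
 obtain R where R: "\<And>x. x \<in> box a c ==> norm x \<le> R" using bounded_box[of a c] unfolding bounded_iff by blast
 have e: "complex_of_real (box_bump n a c x) = (\<Prod>b\<in>Basis. of_real (exp_bump 0 (x \<bullet> (n *\<^sub>R b) + (- n * (a \<bullet> b))))
   * of_real (exp_bump 0 (x \<bullet> (- n *\<^sub>R b) + n * (c \<bullet> b))))" for x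
  by (simp add: box_bump_def algebra_simps)
 show ?thesis
 proof (rule test_functionsI[where R=R])
  show "Ck k (\<lambda>x. complex_of_real (box_bump n a c x))" for k
   unfolding e by (intro Ck_prod Ck_mult Ck_exp_bump) auto
  show "complex_of_real (box_bump n a c x) = 0" if "norm x > R" for x
   using box_bump_zero[OF n, of x a c] R[of x] that by auto
 qed
qed

lemma box_bump_tendsto: "(\<lambda>n. box_bump (real (Suc n)) a c x) \<longlonglongrightarrow> indicator (box a c) x"
proof (cases "x \<in> box a c")
 case True
 have "(\<lambda>n. exp_bump 0 (real (Suc n) * t)) \<longlonglongrightarrow> 1" if t: "t > 0" for t
 proof -
  have "(\<lambda>n. exp (- (1 / (real (Suc n) * t)))) \<longlonglongrightarrow> 1" using t by real_asymp
  then show ?thesis using t by (simp add: exp_bump_def)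
 qed
 then have "(\<lambda>n. box_bump (real (Suc n)) a c x) \<longlonglongrightarrow> (\<Prod>b\<in>(Basis :: 'a set). 1 * 1)"
  unfolding box_bump_def using True by (intro tendsto_prod tendsto_mult) (auto simp: mem_box)
 then show ?thesis using True by simp
next
 case False
 then show ?thesis using box_bump_zero[of _ x a c] by simp
qed

lemma AE_zero_if_box_integrals_zero:
 fixes r :: "'a::euclidean_space => real"
 assumes [measurable]: "r \<in> borel_fun"
  and loc: "\<And>a c. L1 (\<lambda>x. indicator (box a c) x * r x)"
  and zero: "\<And>a c. (LBINT x. indicator (box a c) x * r x) = 0"
 shows "AE x in lborel. r x = 0"
proof -
 define f where "f x = ennreal (max 0 (r x))" for x
 define g where "g x = ennreal (max 0 (- r x))" for x
 have [measurable]: "f \<in> borel_fun" "g \<in> borel_fun" unfolding f_def g_def by measurable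
 have ed: "emeasure (density lborel f) (box a c) = ennreal (LBINT x. max 0 (indicator (box a c) x * r x))"
  "emeasure (density lborel g) (box a c) = ennreal (LBINT x. max 0 (- (indicator (box a c) x * r x)))" for a c
 proof -
  have "emeasure (density lborel f) (box a c) = (NBINT x. ennreal (max 0 (indicator (box a c) x * r x)))"
   by (subst emeasure_density) (auto simp: f_def indicator_def intro!: nn_integral_cong)
  also have "... = ennreal (LBINT x. max 0 (indicator (box a c) x * r x))"
   using loc by (intro nn_integral_eq_integral integrable_max) auto
  finally show "emeasure (density lborel f) (box a c) = ennreal (LBINT x. max 0 (indicator (box a c) x * r x))" .
  have "emeasure (density lborel g) (box a c) = (NBINT x. ennreal (max 0 (- (indicator (box a c) x * r x))))"
   by (subst emeasure_density) (auto simp: g_def indicator_def intro!: nn_integral_cong)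
  also have "... = ennreal (LBINT x. max 0 (- (indicator (box a c) x * r x)))"
   using loc by (intro nn_integral_eq_integral integrable_max integrable_minus) auto
  finally show "emeasure (density lborel g) (box a c) = ennreal (LBINT x. max 0 (- (indicator (box a c) x * r x)))" .
 qed
 have eq: "emeasure (density lborel f) (box a c) = emeasure (density lborel g) (box a c)" for a c
 proof -
  have i: "L1 (\<lambda>x. max 0 (indicator (box a c) x * r x))" "L1 (\<lambda>x. max 0 (- (indicator (box a c) x * r x)))"
   using loc by (auto intro!: integrable_max)
  have "(LBINT x. max 0 (indicator (box a c) x * r x)) - (LBINT x. max 0 (- (indicator (box a c) x * r x)))
    = (LBINT x. max 0 (indicator (box a c) x * r x) - max 0 (- (indicator (box a c) x * r x)))"
   using i by simp
  also have "... = (LBINT x. indicator (box a c) x * r x)"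
   by (intro integral_cong refl) (auto simp: max_def)
  also have "... = 0" by (rule zero)
  finally show ?thesis unfolding ed by simp
 qed
 let ?E = "range (\<lambda>(a, b). box a b :: 'a set)"
 let ?\<Omega> = "\<lambda>n::nat. box (- (real n *\<^sub>R One)) (real n *\<^sub>R One) :: 'a set"
 have "density lborel f = density lborel g"
 proof (rule measure_eqI_generator_eq)
  show "Int_stable ?E" by (auto simp: Int_stable_def box_Int_box)
  show "?E \<subseteq> Pow UNIV" "sets (density lborel f) = sigma_sets UNIV ?E" "sets (density lborel g) = sigma_sets UNIV ?E"
   by (simp_all add: borel_eq_box)
  show "range ?\<Omega> \<subseteq> ?E" "(\<Union>i. ?\<Omega> i) = UNIV"
   unfolding UN_box_eq_UNIV by auto
  show "emeasure (density lborel f) (?\<Omega> i) \<noteq> \<infinity>" for i unfolding ed by simp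
  show "emeasure (density lborel f) X = emeasure (density lborel g) X" if "X \<in> ?E" for X using that eq by auto
 qed
 then have "AE x in lborel. f x = g x"
  by (intro sigma_finite_measure.density_unique[OF sigma_finite_lborel]) auto
 then show ?thesis
 proof eventually_elim
  case (elim x)
  then have "max 0 (r x) = max 0 (- r x)"
   unfolding f_def g_def by (subst (asm) ennreal_inj) auto
  then show ?case by (auto simp: max_def split: if_splits)
 qed
qed

text \<open>Dominated convergence with \<open>box_bump\<close> shows that \<open>u\<close> has zero integral over every box, and boxes
 generate the Borel sets.\<close>

theorem du_Bois_Reymond:
 fixes u :: "'a::euclidean_space => complex"
 assumes um[measurable]: "u \<in> borel_fun"
  and loc: "\<And>a c. L1 (\<lambda>x. indicator (box a c) x *\<^sub>R u x)"
  and zero: "\<And>\<phi>. \<phi> \<in> test_functions ==> (LBINT x. u x * \<phi> x) = 0"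
 shows "AE x in lborel. u x = 0"
proof -
 have box: "(LBINT x. indicator (box a c) x *\<^sub>R u x) = 0" for a c
 proof -
  have bm: "(\<lambda>x. complex_of_real (box_bump (real (Suc n)) a c x)) \<in> borel_fun" for n
   by (rule test_functionsD(4)[OF box_bump_test]) simp
  have m: "(\<lambda>x. box_bump (real (Suc n)) a c x *\<^sub>R u x) \<in> borel_measurable lborel" for n
   unfolding scaleR_conv_of_real using bm[of n] by measurable
  have "(\<lambda>n. LBINT x. box_bump (real (Suc n)) a c x *\<^sub>R u x) \<longlonglongrightarrow> (LBINT x. indicator (box a c) x *\<^sub>R u x)"
  proof (rule integral_dominated_convergence[where w="\<lambda>x. cmod (indicator (box a c) x *\<^sub>R u x)"])
   show "L1 (\<lambda>x. cmod (indicator (box a c) x *\<^sub>R u x))" using loc by (rule integrable_norm)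
   show "AE x in lborel. (\<lambda>n. box_bump (real (Suc n)) a c x *\<^sub>R u x) \<longlonglongrightarrow> indicator (box a c) x *\<^sub>R u x"
    by (intro AE_I2 tendsto_scaleR box_bump_tendsto tendsto_const)
   show "AE x in lborel. norm (box_bump (real (Suc n)) a c x *\<^sub>R u x) \<le> cmod (indicator (box a c) x *\<^sub>R u x)" for n
   proof (rule AE_I2, goal_cases)
    case (1 x)
    have "box_bump (real (Suc n)) a c x \<le> indicator (box a c) x"
     using box_bump_range(2)[of "real (Suc n)" a c x] box_bump_zero[of "real (Suc n)" x a c] by (cases "x \<in> box a c") auto
    then show ?case
     using box_bump_range(1)[of "real (Suc n)" a c x] by (auto intro!: mult_right_mono)
   qed
  qed (use m in auto)
  moreover have "(LBINT x. box_bump (real (Suc n)) a c x *\<^sub>R u x) = 0" for n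
   using zero[OF box_bump_test[of "real (Suc n)" a c]] by (simp add: scaleR_conv_of_real mult.commute)
  ultimately have "(\<lambda>n::nat. 0) \<longlonglongrightarrow> (LBINT x. indicator (box a c) x *\<^sub>R u x)" by simp
  then show ?thesis using LIMSEQ_unique tendsto_const by metis
 qed
 have "AE x in lborel. Re (u x) = 0"
 proof (rule AE_zero_if_box_integrals_zero)
  fix a c
  show "L1 (\<lambda>x. indicator (box a c) x * Re (u x))" using integrable_Re[OF loc[of a c]] by simp
  show "(LBINT x. indicator (box a c) x * Re (u x)) = 0"
   using arg_cong[OF box[of a c], of Re] loc[of a c] by (simp flip: integral_Re)
 qed measurable
 moreover have "AE x in lborel. Im (u x) = 0"
 proof (rule AE_zero_if_box_integrals_zero)
  fix a c
  show "L1 (\<lambda>x. indicator (box a c) x * Im (u x))" using integrable_Im[OF loc[of a c]] by simp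
  show "(LBINT x. indicator (box a c) x * Im (u x)) = 0"
   using arg_cong[OF box[of a c], of Im] loc[of a c] by (simp flip: integral_Im)
 qed measurable
 ultimately show ?thesis by eventually_elim (simp add: complex_eq_iff)
qed

section \<open>The operator \<open>|D|\<^sup>1\<^sup>/\<^sup>2\<close> on test functions\<close>

lemma ennreal_norm_integral_le:
 fixes f :: "'a => 'b::{banach, second_countable_topology}"
 shows "ennreal (norm (\<integral>x. f x \<partial>M)) \<le> (\<integral>\<^sup>+x. ennreal (norm (f x)) \<partial>M)"
proof (cases "integrable M f")
 case True then show ?thesis by (rule integral_norm_bound_ennreal)
qed (simp add: not_integrable_integral_eq)

lemma test_function_Lipschitz:
 fixes \<phi> :: "'a::euclidean_space => complex"
 assumes \<phi>: "\<phi> \<in> test_functions"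
 obtains C where "C > 0" "\<And>x y. cmod (\<phi> x - \<phi> y) \<le> C * norm (x - y)"
proof -
 have "\<exists>B. \<forall>x. cmod (partial_deriv b \<phi> x) \<le> B" if b: "b \<in> Basis" for b
 proof -
  obtain B R where B: "B > 0" "\<And>x. cmod (partial_deriv b \<phi> x) \<le> B * indicator (cball 0 R) x"
   using test_function_bounded[OF partial_deriv_test[OF \<phi> b]] by metis
  have "cmod (partial_deriv b \<phi> x) \<le> B" for x
   using B(2)[of x] B(1) by (cases "x \<in> cball 0 R") auto
  then show ?thesis by blast
 qed
 then obtain B where B: "\<And>b x. b \<in> Basis ==> cmod (partial_deriv b \<phi> x) \<le> B b" by metis
 define C where "C = (\<Sum>b\<in>(Basis :: 'a set). \<bar>B b\<bar>) + 1"
 have C: "C > 0" unfolding C_def by (intro add_nonneg_pos sum_nonneg) auto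
 have "cmod (\<phi> x - \<phi> y) \<le> C * norm (x - y)" for x y
 proof (rule differentiable_bound[of UNIV \<phi> "\<lambda>x. frechet_derivative \<phi> (at x)"])
  fix z
  show "(\<phi> has_derivative frechet_derivative \<phi> (at z)) (at z within UNIV)"
   using frechet_derivative_works[THEN iffD1, OF test_functionsD(3)[OF \<phi>]] by simp
  show "onorm (frechet_derivative \<phi> (at z)) \<le> C"
  proof (rule onorm_le)
   fix h
   have "cmod (frechet_derivative \<phi> (at z) h) \<le> (\<Sum>b\<in>Basis. cmod (of_real (h \<bullet> b) * partial_deriv b \<phi> z))"
    by (subst frechet_derivative_Basis_sum[OF test_functionsD(3)[OF \<phi>]]) (rule norm_sum)
   also have "... \<le> (\<Sum>b\<in>(Basis :: 'a set). norm h * \<bar>B b\<bar>)"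
   proof (rule sum_mono)
    fix b :: 'a assume b: "b \<in> Basis"
    show "cmod (of_real (h \<bullet> b) * partial_deriv b \<phi> z) \<le> norm h * \<bar>B b\<bar>"
     unfolding norm_mult using Basis_le_norm[OF b, of h] B[OF b, of z] by (intro mult_mono) auto
   qed
   also have "... \<le> C * norm h" unfolding C_def by (simp add: sum_distrib_left[symmetric] algebra_simps)
   finally show "norm (frechet_derivative \<phi> (at z) h) \<le> C * norm h" .
  qed
 qed auto
 then show ?thesis using that C by blast
qed

lemma test_function_translation_L1:
 fixes \<phi> :: "'a::euclidean_space => complex"
 assumes \<phi>: "\<phi> \<in> test_functions"
 obtains C where "C > 0" "\<And>h. (NBINT x. ecmod (\<phi> x - \<phi> (x - h))) \<le> ennreal (C * min 1 (norm h))"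
proof -
 note [measurable] = test_functionsD(4)[OF \<phi>]
 obtain L where L: "L > 0" "\<And>x y. cmod (\<phi> x - \<phi> y) \<le> L * norm (x - y)"
  using test_function_Lipschitz[OF \<phi>] by metis
 obtain B R where B: "B > 0" "R > 0" "\<And>x. cmod (\<phi> x) \<le> B * indicator (cball 0 R) x"
  using test_function_bounded[OF \<phi>] by metis
 define V where "V = measure lborel (cball (0::'a) (R + 1))"
 define N where "N = (LBINT x. cmod (\<phi> x))"
 have NN: "(NBINT x. ecmod (\<phi> x)) = ennreal N"
  unfolding N_def using test_function_integrable[OF \<phi>] by (intro nn_integral_eq_integral) auto
 have N0: "N \<ge> 0" by (simp add: N_def)
 define C where "C = L * V + 2 * N + 1"
 have C: "C > 0" using L N0 by (auto simp: C_def V_def intro!: add_nonneg_pos)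
 have "(NBINT x. ecmod (\<phi> x - \<phi> (x - h))) \<le> ennreal (C * min 1 (norm h))" for h
 proof (cases "norm h \<le> 1")
  case True
  have "ecmod (\<phi> x - \<phi> (x - h)) \<le> ennreal (L * norm h) * indicator (cball 0 (R + 1)) x" for x
  proof (cases "x \<in> cball 0 (R + 1)")
   case True then show ?thesis using L(2)[of x "x - h"] by (simp add: ennreal_leI)
  next
   case False
   then have "norm x > R + 1" by simp
   moreover have "norm (x - h) \<ge> norm x - norm h" by (rule norm_triangle_ineq2)
   ultimately have "norm (x - h) > R" "norm x > R" using True by linarith+
   then show ?thesis using B(3)[of x] B(3)[of "x - h"] by simp
  qed
  then have "(NBINT x. ecmod (\<phi> x - \<phi> (x - h))) \<le> (\<integral>\<^sup>+x. ennreal (L * norm h) * indicator (cball 0 (R + 1)) x \<partial>(lborel :: 'a measure))"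
   by (rule nn_integral_mono)
  also have "... = ennreal (L * norm h) * emeasure lborel (cball (0::'a) (R + 1))" by (rule nn_integral_cmult_indicator) simp
  also have "emeasure lborel (cball (0::'a) (R + 1)) = ennreal V"
   unfolding V_def using emeasure_lborel_cball_finite[of "0::'a" "R + 1"] by (intro emeasure_eq_ennreal_measure) auto
  also have "ennreal (L * norm h) * ennreal V = ennreal (L * norm h * V)"
   using L by (simp add: ennreal_mult V_def)
  also have "... \<le> ennreal (C * min 1 (norm h))"
  proof (rule ennreal_leI)
   have "(L * V) * norm h \<le> C * norm h" using N0 by (intro mult_right_mono) (auto simp: C_def)
   then show "L * norm h * V \<le> C * min 1 (norm h)" using True by (simp add: mult_ac min_def)
  qed
  finally show ?thesis .
 next
  case False
  have "(NBINT x. ecmod (\<phi> x - \<phi> (x - h))) \<le> (NBINT x. ecmod (\<phi> x) + ecmod (\<phi> (x - h)))"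
   using norm_triangle_ineq4 by (intro nn_integral_mono) (simp add: ennreal_plus[symmetric] ennreal_leI del: ennreal_plus)
  also have "... = (NBINT x. ecmod (\<phi> x)) + (NBINT x. ecmod (\<phi> (x - h)))"
   by (rule nn_integral_add) measurable
  also have "(NBINT x. ecmod (\<phi> (x - h))) = (NBINT x. ecmod (\<phi> x))"
   using nn_integral_translate[of "\<lambda>x. ecmod (\<phi> x)" "- h"] by simp
  also have "(NBINT x. ecmod (\<phi> x)) + (NBINT x. ecmod (\<phi> x)) = ennreal (2 * N)"
   unfolding NN using N0 by (simp add: ennreal_plus[symmetric] del: ennreal_plus)
  also have "... \<le> ennreal (C * min 1 (norm h))"
   using False L by (intro ennreal_leI) (auto simp: C_def min_def V_def)
  finally show ?thesis .
 qed
 then show ?thesis using that C by blast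
qed

lemma FT_translate:
 fixes \<phi> :: "'a::euclidean_space => complex"
 assumes [measurable]: "\<phi> \<in> borel_fun"
 shows "FT (\<lambda>x. \<phi> (x + h)) \<xi> = cis (h \<bullet> \<xi>) * FT \<phi> \<xi>"
proof -
 have "FT (\<lambda>x. \<phi> (x + h)) \<xi> = (LBINT x. cis (- ((x + h - h) \<bullet> \<xi>)) * \<phi> (x + h))"
  by (simp add: FT_def)
 also have "... = (LBINT x. cis (- ((x - h) \<bullet> \<xi>)) * \<phi> x)"
  by (rule integral_translate[of "\<lambda>x. cis (- ((x - h) \<bullet> \<xi>)) * \<phi> x" h]) measurable
 also have "... = (LBINT x. cis (h \<bullet> \<xi>) * (cis (- (x \<bullet> \<xi>)) * \<phi> x))"
  by (simp add: inner_diff_left cis_mult flip: mult.assoc)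
 also have "... = cis (h \<bullet> \<xi>) * FT \<phi> \<xi>"
  unfolding FT_def by (rule integral_mult_right_zero)
 finally show ?thesis .
qed

lemma FT_partial_deriv:
 fixes \<phi> :: "'a::euclidean_space => complex"
 assumes \<phi>: "\<phi> \<in> test_functions" and b: "b \<in> Basis"
 shows "FT (partial_deriv b \<phi>) \<xi> = \<i> * of_real (b \<bullet> \<xi>) * FT \<phi> \<xi>"
proof -
 note m[measurable] = test_functionsD(4)[OF \<phi>] test_functionsD(4)[OF partial_deriv_test[OF \<phi> b]]
 obtain L where L: "L > 0" "\<And>x y. cmod (\<phi> x - \<phi> y) \<le> L * norm (x - y)"
  using test_function_Lipschitz[OF \<phi>] by metis
 obtain B R where B: "B > 0" "R > 0" "\<And>x. cmod (\<phi> x) \<le> B * indicator (cball 0 R) x"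
  using test_function_bounded[OF \<phi>] by metis
 define s where "s k = 1 / real (Suc k)" for k
 have s: "s k > 0" "s k \<le> 1" "s k \<noteq> 0" for k by (simp_all add: s_def)
 have s0: "s \<longlonglongrightarrow> 0" unfolding s_def by real_asymp
 have q: "cmod ((1 / s k) *\<^sub>R (\<phi> (x + s k *\<^sub>R b) - \<phi> x)) \<le> L * indicator (cball 0 (R + 1)) x" for k x
 proof (cases "x \<in> cball 0 (R + 1)")
  case True
  have "cmod (\<phi> (x + s k *\<^sub>R b) - \<phi> x) \<le> L * s k" using L(2)[of "x + s k *\<^sub>R b" x] b s[of k] by simp
  then have "(1 / s k) * cmod (\<phi> (x + s k *\<^sub>R b) - \<phi> x) \<le> (1 / s k) * (L * s k)" using s[of k] by (intro mult_left_mono) auto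
  then show ?thesis using True s[of k] by simp
 next
  case False
  then have "norm x > R + 1" by simp
  moreover have "norm (x + s k *\<^sub>R b) \<ge> norm x - norm (s k *\<^sub>R b)" by (rule norm_diff_ineq)
  moreover have "norm (s k *\<^sub>R b) \<le> 1" using b s[of k] by simp
  ultimately have "norm (x + s k *\<^sub>R b) > R" "norm x > R" by linarith+
  then show ?thesis using B(3)[of x] B(3)[of "x + s k *\<^sub>R b"] L(1) by simp
 qed
 have "(\<lambda>k. LBINT x. cis (- (x \<bullet> \<xi>)) * ((1 / s k) *\<^sub>R (\<phi> (x + s k *\<^sub>R b) - \<phi> x))) \<longlonglongrightarrow> FT (partial_deriv b \<phi>) \<xi>"
  unfolding FT_def
 proof (rule integral_dominated_convergence[OF _ _ integrable_indicator_cball])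
  show "AE x in lborel. (\<lambda>k. cis (- (x \<bullet> \<xi>)) * ((1 / s k) *\<^sub>R (\<phi> (x + s k *\<^sub>R b) - \<phi> x))) \<longlonglongrightarrow> cis (- (x \<bullet> \<xi>)) * partial_deriv b \<phi> x"
  proof (intro AE_I2 tendsto_mult_left)
   fix x
   have hd: "(\<phi> has_derivative frechet_derivative \<phi> (at x)) (at x)"
    using test_functionsD(3)[OF \<phi>] frechet_derivative_works by blast
   then have bl: "bounded_linear (frechet_derivative \<phi> (at x))"
    and L0: "((\<lambda>h. norm (\<phi> (x + h) - \<phi> x - frechet_derivative \<phi> (at x) h) / norm h) \<longlongrightarrow> 0) (at 0)"
    unfolding has_derivative_at by auto
   have h0: "(\<lambda>k. s k *\<^sub>R b) \<longlonglongrightarrow> 0 *\<^sub>R b" by (intro tendsto_scaleR s0 tendsto_const)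
   have "b \<noteq> 0" using b by auto
   then have "filterlim (\<lambda>k. s k *\<^sub>R b) (at 0) sequentially"
    unfolding filterlim_at using h0 s(3) by auto
   from filterlim_compose[OF L0 this]
   have "(\<lambda>k. norm (\<phi> (x + s k *\<^sub>R b) - \<phi> x - frechet_derivative \<phi> (at x) (s k *\<^sub>R b)) / norm (s k *\<^sub>R b)) \<longlonglongrightarrow> 0" .
   moreover have "norm (\<phi> (x + s k *\<^sub>R b) - \<phi> x - frechet_derivative \<phi> (at x) (s k *\<^sub>R b)) / norm (s k *\<^sub>R b)
     = norm ((1 / s k) *\<^sub>R (\<phi> (x + s k *\<^sub>R b) - \<phi> x) - partial_deriv b \<phi> x)" for k
   proof -
    have "(1 / s k) *\<^sub>R (\<phi> (x + s k *\<^sub>R b) - \<phi> x) - partial_deriv b \<phi> x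
      = (1 / s k) *\<^sub>R (\<phi> (x + s k *\<^sub>R b) - \<phi> x - frechet_derivative \<phi> (at x) (s k *\<^sub>R b))"
     using s[of k] bl by (simp add: bounded_linear.linear linear_scale scaleR_diff_right)
    then show ?thesis using s[of k] b by simp
   qed
   ultimately have "(\<lambda>k. norm ((1 / s k) *\<^sub>R (\<phi> (x + s k *\<^sub>R b) - \<phi> x) - partial_deriv b \<phi> x)) \<longlonglongrightarrow> 0" by simp
   then show "(\<lambda>k. (1 / s k) *\<^sub>R (\<phi> (x + s k *\<^sub>R b) - \<phi> x)) \<longlonglongrightarrow> partial_deriv b \<phi> x"
    by (rule tendsto_norm_zero_cancel[THEN LIM_zero_cancel])
  qed
  show "AE x in lborel. cmod (cis (- (x \<bullet> \<xi>)) * ((1 / s k) *\<^sub>R (\<phi> (x + s k *\<^sub>R b) - \<phi> x))) \<le> L * indicator (cball 0 (R + 1)) x" for k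
   by (rule AE_I2) (use q[of k] in \<open>simp add: norm_mult\<close>)
 qed measurable
 moreover have "(LBINT x. cis (- (x \<bullet> \<xi>)) * ((1 / s k) *\<^sub>R (\<phi> (x + s k *\<^sub>R b) - \<phi> x)))
   = (1 / s k) *\<^sub>R (cis (s k * (b \<bullet> \<xi>)) - 1) * FT \<phi> \<xi>" for k
 proof -
  have i: "L1 (\<lambda>x. cis (- (x \<bullet> \<xi>)) * \<phi> (x + s k *\<^sub>R b))" "L1 (\<lambda>x. cis (- (x \<bullet> \<xi>)) * \<phi> x)"
   by (intro cis_mult_integrable integrable_translate test_function_integrable[OF \<phi>]; measurable)+
  have "(LBINT x. cis (- (x \<bullet> \<xi>)) * ((1 / s k) *\<^sub>R (\<phi> (x + s k *\<^sub>R b) - \<phi> x)))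
   = (1 / s k) *\<^sub>R (LBINT x. cis (- (x \<bullet> \<xi>)) * \<phi> (x + s k *\<^sub>R b) - cis (- (x \<bullet> \<xi>)) * \<phi> x)"
   by (simp only: mult_scaleR_right integral_scaleR_right right_diff_distrib)
  also have "... = (1 / s k) *\<^sub>R (FT (\<lambda>x. \<phi> (x + s k *\<^sub>R b)) \<xi> - FT \<phi> \<xi>)"
   unfolding FT_def by (subst integral_diff[OF i]) simp
  also have "... = (1 / s k) *\<^sub>R (cis (s k * (b \<bullet> \<xi>)) - 1) * FT \<phi> \<xi>"
   by (simp add: FT_translate algebra_simps)
  finally show ?thesis .
 qed
 moreover have "(\<lambda>k. (1 / s k) *\<^sub>R (cis (s k * (b \<bullet> \<xi>)) - 1) * FT \<phi> \<xi>) \<longlonglongrightarrow> \<i> * of_real (b \<bullet> \<xi>) * FT \<phi> \<xi>"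
  by (intro tendsto_mult_right cis_difference_quotient_tendsto s0 s)
 ultimately show ?thesis by (simp only:) (rule LIMSEQ_unique)
qed

text \<open>Each factor \<open>1 + |\<xi>|\<^sup>2\<close> is absorbed by \<open>1 - \<Delta>\<close> acting on \<open>\<phi>\<close>, which is again a test function.\<close>

lemma FT_test_decay:
 fixes \<phi> :: "'a::euclidean_space => complex"
 shows "\<phi> \<in> test_functions ==> \<exists>C. \<forall>\<xi>. (1 + (norm \<xi>)\<^sup>2) ^ N * cmod (FT \<phi> \<xi>) \<le> C"
proof (induction N arbitrary: \<phi>)
 case 0
 then show ?case using norm_FT_le[of \<phi>] by auto
next
 case (Suc N)
 define \<psi> where "\<psi> x = \<phi> x + (\<Sum>b\<in>Basis. - 1 * partial_deriv b (partial_deriv b \<phi>) x)" for x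
 have t2: "partial_deriv b (partial_deriv b \<phi>) \<in> test_functions" if "b \<in> Basis" for b
  by (intro partial_deriv_test Suc.prems that)
 have sumt: "(\<lambda>x. \<Sum>b\<in>A. - 1 * partial_deriv b (partial_deriv b \<phi>) x) \<in> test_functions" if "A \<subseteq> Basis" for A :: "'a set"
 proof -
  have "finite A" by (rule finite_subset[OF that finite_Basis])
  then show ?thesis using that
  proof (induction A rule: finite_induct)
   case empty
   show ?case using test_functions_cmult[OF Suc.prems, of 0] by simp
  next
   case (insert b A)
   have "(\<lambda>x. - 1 * partial_deriv b (partial_deriv b \<phi>) x + (\<Sum>b\<in>A. - 1 * partial_deriv b (partial_deriv b \<phi>) x)) \<in> test_functions"
    using insert.prems by (intro test_functions_add[OF test_functions_cmult[OF t2] insert.IH]) blast+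
   then show ?case by (simp only: sum.insert[OF insert.hyps] if_False)
  qed
 qed
 have \<psi>: "\<psi> \<in> test_functions" unfolding \<psi>_def by (rule test_functions_add[OF Suc.prems sumt[OF subset_refl]])
 have FT\<psi>: "FT \<psi> \<xi> = of_real (1 + (norm \<xi>)\<^sup>2) * FT \<phi> \<xi>" for \<xi>
 proof -
  have i: "L1 (\<lambda>x. cis (- (x \<bullet> \<xi>)) * \<phi> x)"
   by (intro cis_mult_integrable test_function_integrable Suc.prems) measurable
  have i2: "L1 (\<lambda>x. cis (- (x \<bullet> \<xi>)) * partial_deriv b (partial_deriv b \<phi>) x)" if "b \<in> Basis" for b
   by (intro cis_mult_integrable test_function_integrable t2 that) measurable
  have "FT \<psi> \<xi> = (LBINT x. cis (- (x \<bullet> \<xi>)) * \<phi> x - (\<Sum>b\<in>Basis. cis (- (x \<bullet> \<xi>)) * partial_deriv b (partial_deriv b \<phi>) x))"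
  proof -
   have "cis (- (x \<bullet> \<xi>)) * \<psi> x = cis (- (x \<bullet> \<xi>)) * \<phi> x - (\<Sum>b\<in>Basis. cis (- (x \<bullet> \<xi>)) * partial_deriv b (partial_deriv b \<phi>) x)" for x
    unfolding \<psi>_def by (simp only: distrib_left sum_distrib_left[symmetric] mult_minus_left mult_minus_right mult_1 sum_negf diff_conv_add_uminus)
   then show ?thesis unfolding FT_def by (simp only:)
  qed
  also have "... = FT \<phi> \<xi> - (\<Sum>b\<in>Basis. FT (partial_deriv b (partial_deriv b \<phi>)) \<xi>)"
   unfolding FT_def using i i2 by (subst integral_diff) (auto intro!: integrable_sum)
  also have "(\<Sum>b\<in>Basis. FT (partial_deriv b (partial_deriv b \<phi>)) \<xi>) = (\<Sum>b\<in>Basis. - of_real ((\<xi> \<bullet> b)\<^sup>2) * FT \<phi> \<xi>)"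
  proof (rule sum.cong[OF refl])
   fix b :: 'a assume b: "b \<in> Basis"
   show "FT (partial_deriv b (partial_deriv b \<phi>)) \<xi> = - of_real ((\<xi> \<bullet> b)\<^sup>2) * FT \<phi> \<xi>"
   proof -
    have "FT (partial_deriv b (partial_deriv b \<phi>)) \<xi> = \<i> * of_real (b \<bullet> \<xi>) * (\<i> * of_real (b \<bullet> \<xi>) * FT \<phi> \<xi>)"
     by (simp only: FT_partial_deriv[OF partial_deriv_test[OF Suc.prems b] b] FT_partial_deriv[OF Suc.prems b])
    also have "... = (\<i> * \<i>) * (of_real (b \<bullet> \<xi>) * of_real (b \<bullet> \<xi>)) * FT \<phi> \<xi>" by (simp only: mult_ac)
    finally show ?thesis by (simp add: inner_commute[of b] power2_eq_square)
   qed
  qed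
  also have "... = - of_real ((norm \<xi>)\<^sup>2) * FT \<phi> \<xi>"
   by (simp only: sum_distrib_right[symmetric] sum_negf of_real_sum[symmetric] sum_Basis_inner_square)
  finally show ?thesis by (simp add: algebra_simps)
 qed
 obtain C where C: "\<And>\<xi>. (1 + (norm \<xi>)\<^sup>2) ^ N * cmod (FT \<psi> \<xi>) \<le> C" using Suc.IH[OF \<psi>] by blast
 have "(1 + (norm \<xi>)\<^sup>2) ^ Suc N * cmod (FT \<phi> \<xi>) \<le> C" for \<xi>
 proof -
  have "cmod (FT \<psi> \<xi>) = (1 + (norm \<xi>)\<^sup>2) * cmod (FT \<phi> \<xi>)"
   unfolding FT\<psi> norm_mult norm_of_real by simp
  then show ?thesis using C[of \<xi>] by (simp add: mult_ac)
 qed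
 then show ?case by blast
qed

lemma integrable_inverse_power:
 "L1 (\<lambda>\<xi>::'a::euclidean_space. 1 / (1 + (norm \<xi>)\<^sup>2) ^ DIM('a))"
proof -
 have I: "L1 (\<lambda>x::real. inverse (1 + x\<^sup>2))"
  using integrable_inverse_1_plus_square by (simp add: set_integrable_def einterval_def)
 have "L1 (\<lambda>x::'a. \<Prod>b\<in>Basis. complex_of_real (inverse (1 + (x \<bullet> b)\<^sup>2)))"
  by (rule lborel_integral_prod_Basis(1)) (rule integrable_of_real[OF I])
 then have "L1 (\<lambda>x::'a. norm (\<Prod>b\<in>Basis. complex_of_real (inverse (1 + (x \<bullet> b)\<^sup>2))))"
  by (rule integrable_norm)
 then have P: "L1 (\<lambda>x::'a. \<Prod>b\<in>Basis. inverse (1 + (x \<bullet> b)\<^sup>2))"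
  unfolding of_real_prod[symmetric] norm_of_real by (simp add: abs_prod)
 show ?thesis
 proof (rule integrable_dominated[OF P])
  show "norm (1 / (1 + (norm \<xi>)\<^sup>2) ^ DIM('a)) \<le> (\<Prod>b\<in>Basis. inverse (1 + (\<xi> \<bullet> b)\<^sup>2))" for \<xi> :: 'a
  proof -
   have "1 / (1 + (norm \<xi>)\<^sup>2) ^ DIM('a) = (\<Prod>b\<in>(Basis :: 'a set). inverse (1 + (norm \<xi>)\<^sup>2))"
    by (simp add: power_one_over inverse_eq_divide)
   also have "... \<le> (\<Prod>b\<in>Basis. inverse (1 + (\<xi> \<bullet> b)\<^sup>2))"
   proof -
    have sq: "(\<xi> \<bullet> b)\<^sup>2 \<le> (norm \<xi>)\<^sup>2" if "b \<in> Basis" for b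
     using Basis_le_norm[OF that, of \<xi>] by (metis abs_ge_zero power2_abs power_mono)
    show ?thesis by (rule prod_mono) (auto intro!: le_imp_inverse_le add_pos_nonneg sq)
   qed
   finally show ?thesis
    by (simp add: prod_nonneg)
  qed
 qed measurable
qed

lemma FT_test_integrable:
 fixes \<phi> :: "'a::euclidean_space => complex"
 assumes \<phi>: "\<phi> \<in> test_functions"
 shows "L1 (\<lambda>\<xi>. of_real (norm \<xi> powr (1/2)) * FT \<phi> \<xi>)" "L1 (FT \<phi>)"
proof -
 note [measurable] = test_functionsD(4)[OF \<phi>]
 have [measurable]: "FT \<phi> \<in> borel_fun" by (rule FT_measurable) measurable
 obtain C where C: "\<And>\<xi>. (1 + (norm \<xi>)\<^sup>2) ^ Suc DIM('a) * cmod (FT \<phi> \<xi>) \<le> C" using FT_test_decay[OF \<phi>] by blast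
 have w: "(1 + (norm \<xi>)\<^sup>2) * cmod (FT \<phi> \<xi>) \<le> C * (1 / (1 + (norm \<xi>)\<^sup>2) ^ DIM('a))" for \<xi> :: 'a
 proof -
  have "(1 + (norm \<xi>)\<^sup>2) ^ DIM('a) > 0" by (intro zero_less_power add_pos_nonneg) auto
  then show ?thesis using C[of \<xi>] by (simp add: field_simps)
 qed
 have "0 \<le> (1 + (norm (0::'a))\<^sup>2) ^ Suc DIM('a) * cmod (FT \<phi> 0)" by simp
 then have C0: "C \<ge> 0" using C[of 0] by linarith
 have i: "L1 (\<lambda>\<xi>::'a. C * (1 / (1 + (norm \<xi>)\<^sup>2) ^ DIM('a)))"
  by (intro integrable_mult_right integrable_inverse_power)
 show "L1 (FT \<phi>)"
 proof (rule integrable_dominated[OF i])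
  show "cmod (FT \<phi> \<xi>) \<le> C * (1 / (1 + (norm \<xi>)\<^sup>2) ^ DIM('a))" for \<xi>
  proof -
   have "1 * cmod (FT \<phi> \<xi>) \<le> (1 + (norm \<xi>)\<^sup>2) * cmod (FT \<phi> \<xi>)" by (intro mult_right_mono) auto
   then show ?thesis using w[of \<xi>] C0 by simp
  qed
 qed measurable
 show "L1 (\<lambda>\<xi>. of_real (norm \<xi> powr (1/2)) * FT \<phi> \<xi>)"
 proof (rule integrable_dominated[OF i])
  show "cmod (of_real (norm \<xi> powr (1/2)) * FT \<phi> \<xi>) \<le> C * (1 / (1 + (norm \<xi>)\<^sup>2) ^ DIM('a))" for \<xi>
  proof -
   have "norm \<xi> powr (1/2) \<le> 1 + (norm \<xi>)\<^sup>2"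
   proof (cases "norm \<xi> \<le> 1")
    case True
    then have "norm \<xi> powr (1/2) \<le> 1 powr (1/2)" by (intro powr_mono2) auto
    then show ?thesis using zero_le_power2[of "norm \<xi>"] unfolding powr_one_eq_one by linarith
   next
    case False
    then have "norm \<xi> powr (1/2) \<le> norm \<xi> powr 2" by (intro powr_mono) auto
    then show ?thesis using False by (simp add: powr_numeral)
   qed
   then have "norm \<xi> powr (1/2) * cmod (FT \<phi> \<xi>) \<le> (1 + (norm \<xi>)\<^sup>2) * cmod (FT \<phi> \<xi>)" by (intro mult_right_mono) auto
   then show ?thesis
    using w[of \<xi>] C0 by (simp add: norm_mult)
  qed
 qed measurable
qed

lemma FT_test_inversion:
 fixes \<phi> :: "'a::euclidean_space => complex"
 assumes \<phi>: "\<phi> \<in> test_functions"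
 shows "(LBINT \<xi>. cis (x \<bullet> \<xi>) * FT \<phi> \<xi>) = of_real ((2 * pi) ^ DIM('a)) * \<phi> x"
proof -
 obtain B R where B: "B > 0" "\<And>x. cmod (\<phi> x) \<le> B * indicator (cball 0 R) x"
  using test_function_bounded[OF \<phi>] by metis
 have "cmod (\<phi> x) \<le> B" for x using B(2)[of x] B(1) by (cases "x \<in> cball 0 R") auto
 then show ?thesis
  using FT_inversion[OF test_function_integrable[OF \<phi>] test_functionsD(2)[OF \<phi>] _ FT_test_integrable(2)[OF \<phi>]] by blast
qed

lemma Plancherel_test:
 fixes \<phi> :: "'a::euclidean_space => complex"
 assumes \<phi>: "\<phi> \<in> test_functions"
 shows "L1 (\<lambda>\<xi>. (cmod (FT \<phi> \<xi>))\<^sup>2)"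
  and "(LBINT \<xi>. (cmod (FT \<phi> \<xi>))\<^sup>2) = (2 * pi) ^ DIM('a) * (LBINT x. (cmod (\<phi> x))\<^sup>2)"
proof -
 note [measurable] = test_functionsD(4)[OF \<phi>]
 have [measurable]: "FT \<phi> \<in> borel_fun" by (rule FT_measurable) measurable
 have fi: "(NBINT \<xi>. ecmod (FT \<phi> \<xi>)) < \<infinity>"
  using FT_test_integrable(2)[OF \<phi>] by (simp add: integrable_iff_bounded)
 have pi: "(NBINT x. ecmod (\<phi> x)) < \<infinity>"
  using test_function_integrable[OF \<phi>] by (simp add: integrable_iff_bounded)
 have e: "of_real ((cmod (FT \<phi> \<xi>))\<^sup>2) = (LBINT x. FT \<phi> \<xi> * (cis (x \<bullet> \<xi>) * cnj (\<phi> x)))" for \<xi>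
 proof -
  have "cnj (FT \<phi> \<xi>) = (LBINT x. cis (x \<bullet> \<xi>) * cnj (\<phi> x))"
   unfolding FT_def by (simp add: cis_cnj flip: integral_cnj)
  then show ?thesis
   by (simp only: complex_norm_square integral_mult_right_zero)
 qed
 have f1: "(NBINT \<xi>. NBINT x. ecmod (FT \<phi> \<xi> * (cis (x \<bullet> \<xi>) * cnj (\<phi> x)))) < \<infinity>"
  using fi pi by (simp add: norm_mult ennreal_mult nn_integral_cmult nn_integral_multc ennreal_mult_less_top)
 have m: "(\<lambda>z. FT \<phi> (fst z) * (cis (snd z \<bullet> fst z) * cnj (\<phi> (snd z)))) \<in> borel_measurable (borel \<Otimes>\<^sub>M borel)" by measurable
 have "L1 (\<lambda>\<xi>. complex_of_real ((cmod (FT \<phi> \<xi>))\<^sup>2))"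
  unfolding e by (rule Fubini_swap(3)[OF m f1])
 from integrable_Re[OF this] show "L1 (\<lambda>\<xi>. (cmod (FT \<phi> \<xi>))\<^sup>2)" by (simp only: Re_complex_of_real)
 have "complex_of_real (LBINT \<xi>. (cmod (FT \<phi> \<xi>))\<^sup>2) = (LBINT \<xi>. LBINT x. FT \<phi> \<xi> * (cis (x \<bullet> \<xi>) * cnj (\<phi> x)))"
  unfolding e[symmetric] by (rule integral_complex_of_real[symmetric])
 also have "... = (LBINT x. LBINT \<xi>. FT \<phi> \<xi> * (cis (x \<bullet> \<xi>) * cnj (\<phi> x)))"
  by (rule Fubini_swap(1)[OF m f1])
 also have "... = (LBINT x. of_real ((2 * pi) ^ DIM('a)) * of_real ((cmod (\<phi> x))\<^sup>2))"
 proof (rule integral_cong[OF refl], goal_cases)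
  case (1 x)
  have "(LBINT \<xi>. FT \<phi> \<xi> * (cis (x \<bullet> \<xi>) * cnj (\<phi> x))) = (LBINT \<xi>. cis (x \<bullet> \<xi>) * FT \<phi> \<xi> * cnj (\<phi> x))"
   by (simp add: mult_ac)
  also have "... = of_real ((2 * pi) ^ DIM('a)) * \<phi> x * cnj (\<phi> x)"
   by (simp only: integral_mult_left_zero FT_test_inversion[OF \<phi>])
  finally show ?case
   by (simp only: complex_norm_square mult.assoc)
 qed
 also have "... = complex_of_real ((2 * pi) ^ DIM('a) * (LBINT x. (cmod (\<phi> x))\<^sup>2))"
  by (simp only: integral_mult_right_zero integral_complex_of_real of_real_mult)
 finally show "(LBINT \<xi>. (cmod (FT \<phi> \<xi>))\<^sup>2) = (2 * pi) ^ DIM('a) * (LBINT x. (cmod (\<phi> x))\<^sup>2)"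
  by (simp only: of_real_eq_iff)
qed

text \<open>\<open>|D|\<^sup>1\<^sup>/\<^sup>2 \<phi>\<close>, written with integrals over Borel measure.\<close>

definition Lambda :: "('a::euclidean_space => complex) => 'a => complex" where
 "Lambda \<phi> x = (LBINT \<xi>. cis (x \<bullet> \<xi>) * (of_real (norm \<xi> powr (1/2)) * FT \<phi> \<xi>)) / of_real ((2 * pi) ^ DIM('a))"

lemma frac_laplacian_eq_Lambda:
 fixes \<phi> :: "'a::euclidean_space => complex"
 assumes \<phi>: "\<phi> \<in> test_functions"
 shows "frac_laplacian (1 / 2 / 2) \<phi> = Lambda \<phi>"
proof
 note [measurable] = test_functionsD(4)[OF \<phi>]
 have f: "fourier \<phi> \<xi> = FT \<phi> \<xi>" for \<xi> unfolding fourier_def FT_def by (rule integral_completion) measurable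
 have [measurable]: "FT \<phi> \<in> borel_fun" by (rule FT_measurable) measurable
 fix x
 have "(\<integral>\<xi>. cis (x \<bullet> \<xi>) * of_real (norm \<xi> powr (2 * (1 / 2 / 2))) * FT \<phi> \<xi> \<partial>lebesgue)
   = (LBINT \<xi>. cis (x \<bullet> \<xi>) * of_real (norm \<xi> powr (2 * (1 / 2 / 2))) * FT \<phi> \<xi>)"
  by (rule integral_completion) measurable
 then show "frac_laplacian (1 / 2 / 2) \<phi> x = Lambda \<phi> x"
  unfolding frac_laplacian_def Lambda_def f by (simp add: mult.assoc)
qed

lemma Lambda_measurable:
 assumes "\<phi> \<in> test_functions"
 shows "Lambda \<phi> \<in> borel_fun"
proof -
 note [measurable] = test_functionsD(4)[OF assms]
 have [measurable]: "FT \<phi> \<in> borel_fun" by (rule FT_measurable) measurable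
 show ?thesis unfolding Lambda_def[abs_def] by measurable
qed

lemma Lambda_bounded:
 fixes \<phi> :: "'a::euclidean_space => complex"
 assumes \<phi>: "\<phi> \<in> test_functions"
 shows "\<exists>B. \<forall>x. cmod (Lambda \<phi> x) \<le> B"
proof -
 have "cmod (LBINT \<xi>. cis (x \<bullet> \<xi>) * (of_real (norm \<xi> powr (1/2)) * FT \<phi> \<xi>))
   \<le> (LBINT \<xi>. cmod (of_real (norm \<xi> powr (1/2)) * FT \<phi> \<xi>))" for x
  using integral_norm_bound[of lborel "\<lambda>\<xi>. cis (x \<bullet> \<xi>) * (of_real (norm \<xi> powr (1/2)) * FT \<phi> \<xi>)"] by (simp add: norm_mult)
 then have "cmod (Lambda \<phi> x) \<le> (LBINT \<xi>. cmod (of_real (norm \<xi> powr (1/2)) * FT \<phi> \<xi>)) / \<bar>(2 * pi) ^ DIM('a)\<bar>" for x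
  unfolding Lambda_def norm_divide norm_of_real by (intro divide_right_mono) auto
 then show ?thesis by blast
qed

text \<open>The weight of the formula \<open>r\<^sup>1\<^sup>/\<^sup>2 = c \<integral> \<sigma>\<^sup>-\<^sup>3\<^sup>/\<^sup>2 (1 - exp (- \<sigma>\<^sup>2 r\<^sup>2 / 2)) d\<sigma>\<close> over \<open>\<sigma> > 0\<close>, where \<open>1/c\<close> is
 \<open>subord_const\<close>.\<close>

definition subord_weight :: "real => real" where
 "subord_weight \<sigma> = indicator {0<..} \<sigma> * \<sigma> powr (-3/2)"

lemma subord_weight_measurable [measurable]: "subord_weight \<in> borel_fun"
 unfolding subord_weight_def[abs_def] by measurable

lemma subord_weight_nonneg: "0 \<le> subord_weight \<sigma>"
 by (simp add: subord_weight_def)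

lemma subord_weight_finite: "(NBINT \<sigma>. ennreal (subord_weight \<sigma> * min 1 \<sigma>)) < \<infinity>"
proof -
 have a: "((\<lambda>x. x powr (-1/2)) has_integral (1 powr (-1/2 + 1) / (-1/2 + 1))) {0..1::real}"
  by (rule has_integral_powr_from_0) auto
 have b: "((\<lambda>x. x powr (-3/2)) has_integral - (1 powr (-3/2 + 1)) / (-3/2 + 1)) {1::real..}"
  by (rule has_integral_powr_to_inf) auto
 have ia: "(NBINT x. ennreal (indicator {0..1} x * x powr (-1/2))) = ennreal (1 powr (-1/2 + 1) / (-1/2 + 1))"
 proof (rule nn_integral_has_integral_lborel)
  have "(\<lambda>x::real. indicator {0..1} x * x powr (-1/2)) = (\<lambda>x. if x \<in> {0..1} then x powr (-1/2) else 0)"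
   by (auto simp: indicator_def fun_eq_iff)
  then show "((\<lambda>x::real. indicator {0..1} x * x powr (-1/2)) has_integral (1 powr (-1/2 + 1) / (-1/2 + 1))) UNIV"
   using a by (simp only: has_integral_restrict_UNIV)
 qed auto
 have ib: "(NBINT x. ennreal (indicator {1..} x * x powr (-3/2))) = ennreal (- (1 powr (-3/2 + 1)) / (-3/2 + 1))"
 proof (rule nn_integral_has_integral_lborel)
  have "(\<lambda>x::real. indicator {1..} x * x powr (-3/2)) = (\<lambda>x. if x \<in> {1..} then x powr (-3/2) else 0)"
   by (auto simp: indicator_def fun_eq_iff)
  then show "((\<lambda>x::real. indicator {1..} x * x powr (-3/2)) has_integral (- (1 powr (-3/2 + 1)) / (-3/2 + 1))) UNIV"
   using b by (simp only: has_integral_restrict_UNIV)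
 qed auto
 have pt: "subord_weight \<sigma> * min 1 \<sigma> \<le> indicator {0..1} \<sigma> * \<sigma> powr (-1/2) + indicator {1..} \<sigma> * \<sigma> powr (-3/2)" for \<sigma>
 proof -
  have "\<sigma> powr (-3/2) * \<sigma> = \<sigma> powr (-1/2)" if "\<sigma> > 0"
   using that powr_add[of \<sigma> "-3/2" 1] by simp
  then show ?thesis by (auto simp: subord_weight_def indicator_def min_def)
 qed
 have "(NBINT \<sigma>. ennreal (subord_weight \<sigma> * min 1 \<sigma>))
   \<le> (NBINT \<sigma>. ennreal (indicator {0..1} \<sigma> * \<sigma> powr (-1/2)) + ennreal (indicator {1..} \<sigma> * \<sigma> powr (-3/2)))"
 proof (rule nn_integral_mono, goal_cases)
  case (1 \<sigma>)
  have "ennreal (subord_weight \<sigma> * min 1 \<sigma>) \<le> ennreal (indicator {0..1} \<sigma> * \<sigma> powr (-1/2) + indicator {1..} \<sigma> * \<sigma> powr (-3/2))"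
   by (rule ennreal_leI[OF pt])
  then show ?case
   by (subst ennreal_plus[symmetric]) auto
 qed
 also have "... = (NBINT \<sigma>. ennreal (indicator {0..1} \<sigma> * \<sigma> powr (-1/2))) + (NBINT \<sigma>. ennreal (indicator {1..} \<sigma> * \<sigma> powr (-3/2)))"
  by (rule nn_integral_add) auto
 also have "... < \<infinity>" unfolding ia ib by simp
 finally show ?thesis .
qed

lemma one_minus_gaussian_le: "\<sigma> > 0 ==> 1 - exp (- (\<sigma> * 1)\<^sup>2 / 2) \<le> min 1 (\<sigma>::real)"
proof -
 assume s: "\<sigma> > 0"
 have "1 - exp (- (\<sigma> * 1)\<^sup>2 / 2) \<le> \<sigma>\<^sup>2 / 2" using exp_ge_add_one_self[of "- (\<sigma>)\<^sup>2 / 2"] by simp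
 moreover have "\<sigma>\<^sup>2 / 2 \<le> \<sigma>" if "\<sigma> \<le> 1"
 proof -
  have "\<sigma> * \<sigma> \<le> \<sigma> * 1" using s that by (intro mult_left_mono) auto
  then show ?thesis using s by (simp add: power2_eq_square)
 qed
 moreover have "1 - exp (- (\<sigma> * 1)\<^sup>2 / 2) \<le> 1" by simp
 ultimately show ?thesis by (cases "\<sigma> \<le> 1") auto
qed

definition subord_const :: real where
 "subord_const = (LBINT \<sigma>. subord_weight \<sigma> * (1 - exp (- (\<sigma> * 1)\<^sup>2 / 2)))"

lemma subord_one:
 "L1 (\<lambda>\<sigma>. subord_weight \<sigma> * (1 - exp (- (\<sigma> * 1)\<^sup>2 / 2)))" "subord_const > 0"
proof -
 have i0: "L1 (\<lambda>\<sigma>. subord_weight \<sigma> * min 1 \<sigma>)"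
 proof (rule integrableI_nonneg)
  show "AE \<sigma> in lborel. 0 \<le> subord_weight \<sigma> * min 1 \<sigma>" by (intro AE_I2) (auto simp: subord_weight_def indicator_def)
 qed (use subord_weight_finite in auto)
 show i: "L1 (\<lambda>\<sigma>. subord_weight \<sigma> * (1 - exp (- (\<sigma> * 1)\<^sup>2 / 2)))"
 proof (rule integrable_dominated[OF i0])
  show "norm (subord_weight \<sigma> * (1 - exp (- (\<sigma> * 1)\<^sup>2 / 2))) \<le> subord_weight \<sigma> * min 1 \<sigma>" for \<sigma>
  proof (cases "\<sigma> > 0")
   case True
   have "0 \<le> 1 - exp (- (\<sigma> * 1)\<^sup>2 / 2)" by simp
   then show ?thesis using one_minus_gaussian_le[OF True] True
    by (auto simp: abs_mult subord_weight_nonneg intro!: mult_left_mono)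
  qed (simp add: subord_weight_def)
 qed measurable
 have nn: "0 \<le> subord_weight \<sigma> * (1 - exp (- (\<sigma> * 1)\<^sup>2 / 2))" for \<sigma>
  by (intro mult_nonneg_nonneg subord_weight_nonneg) simp
 have "subord_const \<noteq> 0"
 proof
  assume "subord_const = 0"
  then have "AE \<sigma> in lborel. subord_weight \<sigma> * (1 - exp (- (\<sigma> * 1)\<^sup>2 / 2)) = 0"
   unfolding subord_const_def using integral_nonneg_eq_0_iff_AE[OF i] nn by simp
  then have "AE \<sigma> in lborel. \<not> (\<sigma> \<in> {0<..(1::real)})"
   by eventually_elim (auto simp: subord_weight_def)
  then have "emeasure lborel {0<..(1::real)} = 0"
   by (subst (asm) AE_iff_measurable[OF _ refl]) (auto simp: greaterThanAtMost_def Int_def)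
  then show False by simp
 qed
 moreover have "subord_const \<ge> 0" unfolding subord_const_def by (rule integral_nonneg) (rule nn)
 ultimately show "subord_const > 0" by simp
qed

text \<open>Substitute \<open>\<sigma> r\<close> for \<open>\<sigma>\<close>.\<close>

lemma subordination:
 assumes r: "r \<ge> 0"
 shows "L1 (\<lambda>\<sigma>. subord_weight \<sigma> * (1 - exp (- (\<sigma> * r)\<^sup>2 / 2)))"
  and "(LBINT \<sigma>. subord_weight \<sigma> * (1 - exp (- (\<sigma> * r)\<^sup>2 / 2))) = subord_const * r powr (1/2)"
proof -
 have "L1 (\<lambda>\<sigma>. subord_weight \<sigma> * (1 - exp (- (\<sigma> * r)\<^sup>2 / 2))) \<and>
  (LBINT \<sigma>. subord_weight \<sigma> * (1 - exp (- (\<sigma> * r)\<^sup>2 / 2))) = subord_const * r powr (1/2)"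
 proof (cases "r = 0")
  case False
  then have r: "r > 0" using assms by simp
  have e: "subord_weight \<sigma> * (1 - exp (- (\<sigma> * r)\<^sup>2 / 2)) = r powr (3/2) * (subord_weight (r * \<sigma>) * (1 - exp (- ((r * \<sigma>) * 1)\<^sup>2 / 2)))" for \<sigma>
  proof (cases "\<sigma> > 0")
   case True
   then have "subord_weight (r * \<sigma>) = r powr (-3/2) * subord_weight \<sigma>" using r by (simp add: subord_weight_def powr_mult)
   moreover have "r powr (3/2) * r powr (-3/2) = 1" using r by (simp flip: powr_add)
   ultimately show ?thesis by (simp add: mult.commute[of \<sigma>] mult.assoc[symmetric])
  next
   case False
   then show ?thesis using r by (simp add: subord_weight_def zero_less_mult_iff)
  qed
  define g where "g \<sigma> = subord_weight \<sigma> * (1 - exp (- (\<sigma> * 1)\<^sup>2 / 2))" for \<sigma>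
  have gi: "L1 g" "(LBINT \<sigma>. g \<sigma>) = subord_const"
   using subord_one(1) by (simp_all add: g_def[abs_def] subord_const_def)
  have i: "L1 (\<lambda>\<sigma>. g (r * \<sigma>))"
   using lborel_integrable_real_affine[OF gi(1), of r 0] r by simp
  have I: "(LBINT \<sigma>. g (r * \<sigma>)) = subord_const / r"
   using lborel_integral_real_affine[of r g 0] r gi(2) by (simp add: field_simps)
  have "r powr (3/2) / r = r powr (1/2)" using r powr_diff[of r "3/2" 1] by simp
  then have "r powr (3/2) * (subord_const / r) = subord_const * r powr (1/2)"
   by (metis mult.commute times_divide_eq_left times_divide_eq_right)
  moreover have "L1 (\<lambda>\<sigma>. r powr (3/2) * g (r * \<sigma>))" by (rule integrable_mult_right[OF i])
  ultimately show ?thesis unfolding e g_def[symmetric] integral_mult_right_zero I by blast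
 qed simp
 then show "L1 (\<lambda>\<sigma>. subord_weight \<sigma> * (1 - exp (- (\<sigma> * r)\<^sup>2 / 2)))"
  "(LBINT \<sigma>. subord_weight \<sigma> * (1 - exp (- (\<sigma> * r)\<^sup>2 / 2))) = subord_const * r powr (1/2)" by auto
qed

text \<open>Apply the subordination formula to \<open>r = |\<xi>|\<close> under the Fourier integral. The multiplier
 \<open>1 - exp (- (\<sigma> |\<xi>|)\<^sup>2 / 2)\<close> is the difference of \<open>\<phi>\<close> and its Gaussian average.\<close>

lemma Lambda_subordination:
 fixes \<phi> :: "'a::euclidean_space => complex"
 assumes \<phi>: "\<phi> \<in> test_functions"
 shows "of_real subord_const * Lambda \<phi> x
  = (LBINT \<sigma>. subord_weight \<sigma> *\<^sub>R (\<phi> x - (LBINT r. gaussian \<sigma> r *\<^sub>R \<phi> (x - r))))"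
proof -
 note [measurable] = test_functionsD(4)[OF \<phi>]
 have [measurable]: "FT \<phi> \<in> borel_fun" by (rule FT_measurable) measurable
 let ?w = "\<lambda>\<sigma> \<xi>::'a. subord_weight \<sigma> * (1 - exp (- (\<sigma> * norm \<xi>)\<^sup>2 / 2))"
 have w0: "0 \<le> ?w \<sigma> \<xi>" for \<sigma> \<xi> by (intro mult_nonneg_nonneg subord_weight_nonneg) simp
 have m: "(\<lambda>z. ?w (snd z) (fst z) *\<^sub>R (cis (x \<bullet> fst z) * FT \<phi> (fst z))) \<in> borel_measurable (borel \<Otimes>\<^sub>M borel)" by measurable
 have fin: "(NBINT \<xi>. NBINT \<sigma>. ecmod (?w \<sigma> \<xi> *\<^sub>R (cis (x \<bullet> \<xi>) * FT \<phi> \<xi>))) < \<infinity>"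
 proof -
  have "(NBINT \<sigma>. ecmod (?w \<sigma> \<xi> *\<^sub>R (cis (x \<bullet> \<xi>) * FT \<phi> \<xi>))) = ennreal subord_const * ecmod (of_real (norm \<xi> powr (1/2)) * FT \<phi> \<xi>)" for \<xi>
  proof -
   have "(NBINT \<sigma>. ecmod (?w \<sigma> \<xi> *\<^sub>R (cis (x \<bullet> \<xi>) * FT \<phi> \<xi>))) = (NBINT \<sigma>. ennreal (?w \<sigma> \<xi>) * ecmod (FT \<phi> \<xi>))"
    by (intro nn_integral_cong) (simp only: norm_scaleR norm_mult norm_cis mult_1 abs_of_nonneg[OF w0] ennreal_mult[OF w0 norm_ge_zero])
   also have "... = (NBINT \<sigma>. ennreal (?w \<sigma> \<xi>)) * ecmod (FT \<phi> \<xi>)" by (rule nn_integral_multc) measurable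
   also have "(NBINT \<sigma>. ennreal (?w \<sigma> \<xi>)) = ennreal (subord_const * norm \<xi> powr (1/2))"
    using subordination[of "norm \<xi>"] w0 by (subst nn_integral_eq_integral) auto
   finally show ?thesis using subord_one(2) by (simp add: norm_mult ennreal_mult mult.assoc)
  qed
  then have "(NBINT \<xi>. NBINT \<sigma>. ecmod (?w \<sigma> \<xi> *\<^sub>R (cis (x \<bullet> \<xi>) * FT \<phi> \<xi>)))
   = ennreal subord_const * (NBINT \<xi>. ecmod (of_real (norm \<xi> powr (1/2)) * FT \<phi> \<xi>))"
   by (simp only:) (rule nn_integral_cmult, measurable)
  also have "... < \<infinity>"
   using FT_test_integrable(1)[OF \<phi>] by (simp add: integrable_iff_bounded ennreal_mult_less_top)
  finally show ?thesis .
 qed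
 have "of_real subord_const * Lambda \<phi> x * of_real ((2 * pi) ^ DIM('a))
   = of_real subord_const * (LBINT \<xi>. cis (x \<bullet> \<xi>) * (of_real (norm \<xi> powr (1/2)) * FT \<phi> \<xi>))"
  unfolding Lambda_def by simp
 also have "... = (LBINT \<xi>. of_real subord_const * (cis (x \<bullet> \<xi>) * (of_real (norm \<xi> powr (1/2)) * FT \<phi> \<xi>)))"
  by (rule integral_mult_right_zero[symmetric])
 also have "... = (LBINT \<xi>. LBINT \<sigma>. ?w \<sigma> \<xi> *\<^sub>R (cis (x \<bullet> \<xi>) * FT \<phi> \<xi>))"
 proof (rule integral_cong[OF refl], goal_cases)
  case (1 \<xi>)
  have "(LBINT \<sigma>. ?w \<sigma> \<xi> *\<^sub>R (cis (x \<bullet> \<xi>) * FT \<phi> \<xi>)) = (LBINT \<sigma>. ?w \<sigma> \<xi>) *\<^sub>R (cis (x \<bullet> \<xi>) * FT \<phi> \<xi>)"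
   by (rule integral_scaleR_left) (rule subordination(1), simp)
  also have "(LBINT \<sigma>. ?w \<sigma> \<xi>) = subord_const * norm \<xi> powr (1/2)" by (rule subordination(2)) simp
  finally have X: "(LBINT \<sigma>. ?w \<sigma> \<xi> *\<^sub>R (cis (x \<bullet> \<xi>) * FT \<phi> \<xi>)) = (subord_const * norm \<xi> powr (1/2)) *\<^sub>R (cis (x \<bullet> \<xi>) * FT \<phi> \<xi>)" .
  show ?case
   unfolding X by (simp add: scaleR_conv_of_real mult_ac)
 qed
 also have "... = (LBINT \<sigma>. LBINT \<xi>. ?w \<sigma> \<xi> *\<^sub>R (cis (x \<bullet> \<xi>) * FT \<phi> \<xi>))"
  by (rule Fubini_swap(1)[OF m fin])
 also have "... = (LBINT \<sigma>. subord_weight \<sigma> *\<^sub>R (\<phi> x - (LBINT r. gaussian \<sigma> r *\<^sub>R \<phi> (x - r))) * of_real ((2 * pi) ^ DIM('a)))"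
 proof (rule integral_cong[OF refl], goal_cases)
  case (1 \<sigma>)
  show ?case
  proof (cases "\<sigma> > 0")
   case False
   then show ?thesis by (simp add: subord_weight_def)
  next
   case True
   let ?E = "\<lambda>\<xi>::'a. exp (- (\<sigma> * norm \<xi>)\<^sup>2 / 2)"
   have i1: "L1 (\<lambda>\<xi>. cis (x \<bullet> \<xi>) * FT \<phi> \<xi>)"
    by (rule cis_mult_integrable[OF FT_test_integrable(2)[OF \<phi>]]) measurable
   have i2: "L1 (\<lambda>\<xi>. cis (x \<bullet> \<xi>) * (of_real (?E \<xi>) * FT \<phi> \<xi>))"
   proof (rule integrable_bound[OF FT_test_integrable(2)[OF \<phi>]])
    show "AE \<xi> in lborel. cmod (cis (x \<bullet> \<xi>) * (of_real (?E \<xi>) * FT \<phi> \<xi>)) \<le> cmod (FT \<phi> \<xi>)"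
     by (intro AE_I2) (auto simp: norm_mult intro!: mult_left_le_one_le)
   qed measurable
   have "(LBINT \<xi>. ?w \<sigma> \<xi> *\<^sub>R (cis (x \<bullet> \<xi>) * FT \<phi> \<xi>))
    = (LBINT \<xi>. subord_weight \<sigma> *\<^sub>R (cis (x \<bullet> \<xi>) * FT \<phi> \<xi> - cis (x \<bullet> \<xi>) * (of_real (?E \<xi>) * FT \<phi> \<xi>)))"
    by (intro integral_cong refl) (simp add: scaleR_conv_of_real algebra_simps)
   also have "... = subord_weight \<sigma> *\<^sub>R ((LBINT \<xi>. cis (x \<bullet> \<xi>) * FT \<phi> \<xi>) - (LBINT \<xi>. cis (x \<bullet> \<xi>) * (of_real (?E \<xi>) * FT \<phi> \<xi>)))"
    by (simp only: integral_scaleR_right integral_diff[OF i1 i2])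
   also have "... = subord_weight \<sigma> *\<^sub>R (\<phi> x - (LBINT r. gaussian \<sigma> r *\<^sub>R \<phi> (x - r))) * of_real ((2 * pi) ^ DIM('a))"
    unfolding FT_test_inversion[OF \<phi>] FT_gaussian_regularized_inversion[OF test_function_integrable[OF \<phi>] True]
    by (simp add: scaleR_conv_of_real algebra_simps)
   finally show ?thesis .
  qed
 qed
 also have "... = (LBINT \<sigma>. subord_weight \<sigma> *\<^sub>R (\<phi> x - (LBINT r. gaussian \<sigma> r *\<^sub>R \<phi> (x - r)))) * of_real ((2 * pi) ^ DIM('a))"
  by (rule integral_mult_left_zero)
 finally show ?thesis by simp
qed

lemma gaussian_first_moment:
 "(\<integral>\<^sup>+r. ennreal (gaussian 1 r * (1 + norm r)) \<partial>(lborel :: 'a::euclidean_space measure)) < \<infinity>"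
proof -
 define c where "c = (1 / (sqrt (2 * pi) * 1)) ^ DIM('a)"
 have c: "c \<ge> 0" by (simp add: c_def)
 define s where "s = 1 / sqrt 2"
 have s: "s > 0" "s\<^sup>2 = 1 / 2" by (simp_all add: s_def power_divide)
 have "gaussian 1 r * (1 + norm r) \<le> 2 * c * exp (- (s * norm r)\<^sup>2 / 2)" for r :: 'a
 proof -
  have g: "gaussian 1 r = c * exp (- (norm r)\<^sup>2 / 2)"
   unfolding c_def using gaussian_eq_exp[of 1 r] by simp
  have "1 + (norm r)\<^sup>2 / 4 \<le> exp ((norm r)\<^sup>2 / 4)" by (rule exp_ge_add_one_self)
  moreover have "norm r \<le> 1 + (norm r)\<^sup>2 / 4"
   using zero_le_power2[of "norm r / 2 - 1"] by (simp add: power2_eq_square algebra_simps)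
  moreover have "1 \<le> exp ((norm r)\<^sup>2 / 4)" by simp
  ultimately have "1 + norm r \<le> 2 * exp ((norm r)\<^sup>2 / 4)" by linarith
  then have "exp (- (norm r)\<^sup>2 / 2) * (1 + norm r) \<le> exp (- (norm r)\<^sup>2 / 2) * (2 * exp ((norm r)\<^sup>2 / 4))"
   by (intro mult_left_mono) auto
  also have "... = 2 * exp (- (norm r)\<^sup>2 / 4)" by (simp add: exp_add[symmetric])
  also have "- (norm r)\<^sup>2 / 4 = - (s * norm r)\<^sup>2 / 2" by (simp add: power_mult_distrib s(2))
  finally have "c * (exp (- (norm r)\<^sup>2 / 2) * (1 + norm r)) \<le> c * (2 * exp (- (s * norm r)\<^sup>2 / 2))"
   using c by (rule mult_left_mono)
  then show ?thesis unfolding g by (simp add: mult_ac)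
 qed
 then have "(\<integral>\<^sup>+r. ennreal (gaussian 1 r * (1 + norm r)) \<partial>(lborel :: 'a measure)) \<le> (\<integral>\<^sup>+r. ennreal (2 * c * exp (- (s * norm r)\<^sup>2 / 2)) \<partial>(lborel :: 'a measure))"
  by (intro nn_integral_mono ennreal_leI)
 also have "... < \<infinity>"
  by (subst nn_integral_eq_integral[OF integrable_mult_right[OF gaussian_multiplier_integrable[OF s(1)]]])
    (use c in auto)
 finally show ?thesis .
qed

text \<open>The symbol \<open>|\<xi>|\<^sup>1\<^sup>/\<^sup>2\<close> is not smooth at 0, so decay cannot be obtained by integrating by parts in
 frequency. Subordination works in position: a Gaussian average of width \<open>\<sigma>\<close> moves \<open>\<phi>\<close> by at most
 \<open>C min 1 \<sigma>\<close> in \<open>L\<^sup>1\<close>, and the weight integrates \<open>min 1 \<sigma>\<close>.\<close>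

lemma Lambda_integrable:
 fixes \<phi> :: "'a::euclidean_space => complex"
 assumes \<phi>: "\<phi> \<in> test_functions"
 shows "L1 (Lambda \<phi>)"
proof -
 let ?df = "\<lambda>\<sigma> x r. \<phi> x - \<phi> (x - \<sigma> *\<^sub>R r)"
 let ?m = "\<integral>\<^sup>+r. ennreal (gaussian 1 r * (1 + norm r)) \<partial>(lborel :: 'a measure)"
 note [measurable] = test_functionsD(4)[OF \<phi>] Lambda_measurable[OF \<phi>]
 obtain C where C: "C > 0" "\<And>h. (NBINT x. ecmod (\<phi> x - \<phi> (x - h))) \<le> ennreal (C * min 1 (norm h))"
  using test_function_translation_L1[OF \<phi>] by metis
 define A where "A \<sigma> x = (NBINT r. ennreal (gaussian 1 r) * ecmod (?df \<sigma> x r))" for \<sigma> x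
 have A: "ecmod (\<phi> x - (LBINT r. gaussian \<sigma> r *\<^sub>R \<phi> (x - r))) \<le> A \<sigma> x" if \<sigma>: "\<sigma> > 0" for \<sigma> x
 proof -
  obtain B R where B: "B > 0" "\<And>x. cmod (\<phi> x) \<le> B * indicator (cball 0 R) x"
   using test_function_bounded[OF \<phi>] by metis
  have Bb: "cmod (\<phi> x) \<le> B" for x using B(2)[of x] B(1) by (cases "x \<in> cball 0 R") auto
  have i1: "L1 (\<lambda>r::'a. gaussian 1 r *\<^sub>R \<phi> x)"
   using gaussian_integral(1)[of 1, where 'a='a] by simp
  have i2: "L1 (\<lambda>r. gaussian 1 r *\<^sub>R \<phi> (x - \<sigma> *\<^sub>R r))"
  proof (rule integrable_bound)
   show "L1 (\<lambda>r::'a. gaussian 1 r * B)" using gaussian_integral(1)[of 1, where 'a='a] by simp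
   show "AE r in lborel. norm (gaussian 1 r *\<^sub>R \<phi> (x - \<sigma> *\<^sub>R r)) \<le> norm (gaussian 1 r * B)"
    using Bb B(1) by (intro AE_I2) (auto simp: abs_mult intro!: mult_left_mono)
  qed measurable
  have "\<phi> x - (LBINT r. gaussian \<sigma> r *\<^sub>R \<phi> (x - r)) = (\<integral>r. gaussian 1 r *\<^sub>R \<phi> x \<partial>(lborel :: 'a measure)) - (LBINT r. gaussian 1 r *\<^sub>R \<phi> (x - \<sigma> *\<^sub>R r))"
   using gaussian_integral[of 1, where 'a='a] by (simp add: gaussian_average_scale[OF _ \<sigma>])
  also have "... = (LBINT r. gaussian 1 r *\<^sub>R (?df \<sigma> x r))"
   by (simp only: integral_diff[OF i1 i2, symmetric] scaleR_diff_right)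
  finally have e: "\<phi> x - (LBINT r. gaussian \<sigma> r *\<^sub>R \<phi> (x - r)) = (LBINT r. gaussian 1 r *\<^sub>R (?df \<sigma> x r))" .
  have i3: "L1 (\<lambda>r. gaussian 1 r *\<^sub>R (?df \<sigma> x r))"
   unfolding scaleR_diff_right by (rule integrable_diff[OF i1 i2])
  show ?thesis unfolding e A_def using integral_norm_bound_ennreal[OF i3]
   by (simp add: ennreal_mult gaussian_nonneg)
 qed
 have pt: "ecmod (of_real subord_const * Lambda \<phi> x) \<le> (NBINT \<sigma>. ennreal (subord_weight \<sigma>) * A \<sigma> x)" for x
 proof -
  have "ecmod (of_real subord_const * Lambda \<phi> x)
    \<le> (NBINT \<sigma>. ennreal (norm (subord_weight \<sigma> *\<^sub>R (\<phi> x - (LBINT r. gaussian \<sigma> r *\<^sub>R \<phi> (x - r))))))"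
   unfolding Lambda_subordination[OF \<phi>] by (rule ennreal_norm_integral_le)
  also have "... \<le> (NBINT \<sigma>. ennreal (subord_weight \<sigma>) * A \<sigma> x)"
  proof (rule nn_integral_mono, goal_cases)
   case (1 \<sigma>)
   show ?case
   proof (cases "\<sigma> > 0")
    case True
    then show ?thesis using A[OF True, of x]
     by (simp add: ennreal_mult subord_weight_nonneg mult_left_mono)
   qed (simp add: subord_weight_def)
  qed
  finally show ?thesis .
 qed
 have "ennreal subord_const * (NBINT x. ecmod (Lambda \<phi> x)) = (NBINT x. ecmod (of_real subord_const * Lambda \<phi> x))"
  using subord_one(2) by (subst nn_integral_cmult[symmetric]) (auto simp: norm_mult ennreal_mult)
 also have "... \<le> (NBINT x. NBINT \<sigma>. ennreal (subord_weight \<sigma>) * A \<sigma> x)"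
  by (rule nn_integral_mono[OF pt])
 also have "... = (NBINT \<sigma>. NBINT x. ennreal (subord_weight \<sigma>) * A \<sigma> x)"
  unfolding A_def by (rule lborel_pair.Fubini') measurable
 also have "... \<le> (NBINT \<sigma>. ennreal (subord_weight \<sigma> * min 1 \<sigma>) * (ennreal C * ?m))"
 proof (rule nn_integral_mono, goal_cases)
  case (1 \<sigma>)
  show ?case
  proof (cases "\<sigma> > 0")
   case False
   then show ?thesis by (simp add: subord_weight_def)
  next
   case True
   have [measurable]: "A \<sigma> \<in> borel_fun" unfolding A_def by measurable
   have "(NBINT x. A \<sigma> x) = (NBINT r. NBINT x. ennreal (gaussian 1 r) * ecmod (?df \<sigma> x r))"
    unfolding A_def by (rule lborel_pair.Fubini') measurable
   also have "... = (NBINT r. ennreal (gaussian 1 r) * (NBINT x. ecmod (?df \<sigma> x r)))"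
    by (simp add: nn_integral_cmult)
   also have "... \<le> (\<integral>\<^sup>+r. ennreal (C * min 1 \<sigma>) * ennreal (gaussian 1 r * (1 + norm r)) \<partial>(lborel :: 'a measure))"
   proof (rule nn_integral_mono, goal_cases)
    case (1 r)
    have "min 1 (norm (\<sigma> *\<^sub>R r)) \<le> min 1 \<sigma> * (1 + norm r)"
    proof (cases "\<sigma> \<le> 1")
     case True
     then show ?thesis using \<open>\<sigma> > 0\<close> by (simp add: min_def algebra_simps)
    next
     case False
     have "min 1 (norm (\<sigma> *\<^sub>R r)) \<le> 1" by simp
     also have "1 \<le> min 1 \<sigma> * (1 + norm r)" using False by simp
     finally show ?thesis .
    qed
    then have "C * min 1 (norm (\<sigma> *\<^sub>R r)) \<le> C * (min 1 \<sigma> * (1 + norm r))" using C by (intro mult_left_mono) auto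
    then have "gaussian 1 r * (C * min 1 (norm (\<sigma> *\<^sub>R r))) \<le> gaussian 1 r * (C * (min 1 \<sigma> * (1 + norm r)))"
     by (rule mult_left_mono[OF _ gaussian_nonneg])
    then have le: "ennreal (gaussian 1 r * (C * min 1 (norm (\<sigma> *\<^sub>R r)))) \<le> ennreal ((C * min 1 \<sigma>) * (gaussian 1 r * (1 + norm r)))"
     by (intro ennreal_leI) (simp add: mult_ac)
    have "ennreal (gaussian 1 r) * (NBINT x. ecmod (?df \<sigma> x r))
      \<le> ennreal (gaussian 1 r) * ennreal (C * min 1 (norm (\<sigma> *\<^sub>R r)))"
     by (intro mult_left_mono C) auto
    also have "... = ennreal (gaussian 1 r * (C * min 1 (norm (\<sigma> *\<^sub>R r))))"
     using C by (intro ennreal_mult[symmetric] gaussian_nonneg mult_nonneg_nonneg) auto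
    also note le
    also have "ennreal ((C * min 1 \<sigma>) * (gaussian 1 r * (1 + norm r))) = ennreal (C * min 1 \<sigma>) * ennreal (gaussian 1 r * (1 + norm r))"
     using C \<open>\<sigma> > 0\<close> by (intro ennreal_mult mult_nonneg_nonneg gaussian_nonneg) auto
    finally show ?case .
   qed
   also have "... = ennreal (C * min 1 \<sigma>) * ?m"
    by (rule nn_integral_cmult) measurable
   finally have "ennreal (subord_weight \<sigma>) * (NBINT x. A \<sigma> x)
    \<le> ennreal (subord_weight \<sigma>) * (ennreal (C * min 1 \<sigma>) * ?m)"
    by (intro mult_left_mono) auto
   moreover have "ennreal (C * min 1 \<sigma>) = ennreal C * ennreal (min 1 \<sigma>)" using C True by (intro ennreal_mult) auto
   moreover have "ennreal (subord_weight \<sigma> * min 1 \<sigma>) = ennreal (subord_weight \<sigma>) * ennreal (min 1 \<sigma>)"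
    using True by (intro ennreal_mult subord_weight_nonneg) auto
   moreover have "(NBINT x. ennreal (subord_weight \<sigma>) * A \<sigma> x) = ennreal (subord_weight \<sigma>) * (NBINT x. A \<sigma> x)"
    by (rule nn_integral_cmult) measurable
   ultimately show ?thesis by (simp add: mult_ac)
  qed
 qed
 also have "... = (NBINT \<sigma>. ennreal (subord_weight \<sigma> * min 1 \<sigma>)) * (ennreal C * ?m)"
  by (rule nn_integral_multc) measurable
 also have "... < \<infinity>"
  using subord_weight_finite gaussian_first_moment[where 'a='a] by (simp add: ennreal_mult_less_top)
 finally have "(NBINT x. ecmod (Lambda \<phi> x)) < \<infinity>"
  using subord_one(2) by (auto simp: ennreal_mult_less_top)
 then show ?thesis by (intro integrableI_bounded) auto
qed

lemma Lambda_powr_integrable: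
 assumes "\<phi> \<in> test_functions" "q > 1"
 shows "L1 (\<lambda>x. cmod (Lambda \<phi> x) powr q)"
 using Lambda_bounded[OF assms(1)] integrable_powr_bounded[OF Lambda_integrable[OF assms(1)] _ assms(2)] by blast

text \<open>Parseval, the Cauchy-Schwarz inequality with the weight split as \<open>|\<xi>|\<^sup>1\<^sup>/\<^sup>2 \<cdot> 1\<close>, and
 \<open>|\<xi>| \<le> \<Sum> |\<xi> \<cdot> b|\<close>. The powers of \<open>2 \<pi>\<close> from inversion and from Plancherel's formula combine
 to a factor below 1, which is dropped.\<close>

lemma Lambda_pairing_bound:
 fixes \<phi> h :: "'a::euclidean_space => complex"
 assumes \<phi>: "\<phi> \<in> test_functions" and h: "L1 h" and E: "E \<ge> 0"
  and en: "\<And>b. b \<in> Basis ==> (NBINT \<xi>. ennreal (\<bar>\<xi> \<bullet> b\<bar> * (cmod (FT h \<xi>))\<^sup>2)) \<le> ennreal E"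
 shows "(cmod (LBINT x. h x * Lambda \<phi> x))\<^sup>2 \<le> real DIM('a) * E * (LBINT x. (cmod (\<phi> x))\<^sup>2)"
proof -
 have [measurable]: "h \<in> borel_fun" using h by auto
 note [measurable] = test_functionsD(4)[OF \<phi>]
 have [measurable]: "FT \<phi> \<in> borel_fun" "FT h \<in> borel_fun" by (rule FT_measurable, measurable)+
 define P where "P = (2 * pi) ^ DIM('a)"
 have P: "P > 0" by (simp add: P_def)
 have P1: "P \<ge> 1" unfolding P_def using pi_ge_two by (intro one_le_power) auto
 let ?g = "\<lambda>\<xi>. of_real (norm \<xi> powr (1/2)) * FT \<phi> \<xi>"
 have "of_real P * (LBINT x. h x * Lambda \<phi> x) = (LBINT x. LBINT \<xi>. h x * (cis (x \<bullet> \<xi>) * ?g \<xi>))"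
 proof -
  have "of_real P * (h x * Lambda \<phi> x) = (LBINT \<xi>. h x * (cis (x \<bullet> \<xi>) * ?g \<xi>))" for x
  proof -
   have "of_real P * Lambda \<phi> x = (LBINT \<xi>. cis (x \<bullet> \<xi>) * ?g \<xi>)"
    unfolding Lambda_def P_def[symmetric] using P by simp
   then have "h x * (of_real P * Lambda \<phi> x) = (LBINT \<xi>. h x * (cis (x \<bullet> \<xi>) * ?g \<xi>))"
    by (simp only: integral_mult_right_zero)
   then show ?thesis by (simp only: mult.left_commute)
  qed
  then show ?thesis by (simp only: integral_mult_right_zero[symmetric])
 qed
 also have "... = (LBINT \<xi>. LBINT x. h x * (cis (x \<bullet> \<xi>) * ?g \<xi>))"
 proof (rule Fubini_swap(1))
  have "(NBINT x. NBINT \<xi>. ecmod (h x * (cis (x \<bullet> \<xi>) * ?g \<xi>)))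
   = (NBINT x. ecmod (h x)) * (NBINT \<xi>. ecmod (?g \<xi>))"
   by (simp add: norm_mult ennreal_mult nn_integral_cmult nn_integral_multc)
  also have "... < \<infinity>"
   using h FT_test_integrable(1)[OF \<phi>] by (simp add: integrable_iff_bounded ennreal_mult_less_top)
  finally show "(NBINT x. NBINT \<xi>. ecmod (h x * (cis (x \<bullet> \<xi>) * ?g \<xi>))) < \<infinity>" .
 qed measurable
 also have "... = (LBINT \<xi>. FT h (- \<xi>) * ?g \<xi>)"
 proof (rule integral_cong[OF refl], goal_cases)
  case (1 \<xi>)
  have "(LBINT x. h x * (cis (x \<bullet> \<xi>) * ?g \<xi>)) = (LBINT x. cis (- (x \<bullet> (- \<xi>))) * h x * ?g \<xi>)"
   by (simp add: mult_ac)
  also have "... = FT h (- \<xi>) * ?g \<xi>" unfolding FT_def by (rule integral_mult_left_zero)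
  finally show ?case .
 qed
 finally have e: "of_real P * (LBINT x. h x * Lambda \<phi> x) = (LBINT \<xi>. FT h (- \<xi>) * ?g \<xi>)" .
 define k where "k \<xi> = norm \<xi> powr (1/2) * cmod (FT h (- \<xi>))" for \<xi>
 have [measurable]: "k \<in> borel_fun" unfolding k_def by measurable
 have k0: "0 \<le> k \<xi>" for \<xi> by (simp add: k_def)
 have kfin: "(NBINT \<xi>. ennreal (k \<xi> powr 2)) \<le> ennreal (real DIM('a) * E)"
 proof -
  have k2: "k \<xi> powr 2 = norm \<xi> * (cmod (FT h (- \<xi>)))\<^sup>2" for \<xi>
  proof -
   have "k \<xi> powr 2 = (k \<xi>)\<^sup>2" using k0 by (simp add: powr_numeral)
   also have "... = (norm \<xi> powr (1/2))\<^sup>2 * (cmod (FT h (- \<xi>)))\<^sup>2" by (simp add: k_def power_mult_distrib)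
   also have "(norm \<xi> powr (1/2))\<^sup>2 = norm \<xi>" by (simp add: powr_half_sqrt)
   finally show ?thesis .
  qed
  have "(NBINT \<xi>. ennreal (k \<xi> powr 2)) = (NBINT \<xi>. ennreal (norm \<xi> * (cmod (FT h \<xi>))\<^sup>2))"
   unfolding k2 using nn_integral_reflect[of "\<lambda>\<xi>. ennreal (norm \<xi> * (cmod (FT h \<xi>))\<^sup>2)"] by simp
  also have "... \<le> (NBINT \<xi>. (\<Sum>b\<in>Basis. ennreal (\<bar>\<xi> \<bullet> b\<bar> * (cmod (FT h \<xi>))\<^sup>2)))"
  proof (rule nn_integral_mono, goal_cases)
   case (1 \<xi>)
   have "norm \<xi> * (cmod (FT h \<xi>))\<^sup>2 \<le> (\<Sum>b\<in>Basis. \<bar>\<xi> \<bullet> b\<bar>) * (cmod (FT h \<xi>))\<^sup>2"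
    by (intro mult_right_mono norm_le_l1) auto
   then have "ennreal (norm \<xi> * (cmod (FT h \<xi>))\<^sup>2) \<le> ennreal (\<Sum>b\<in>Basis. \<bar>\<xi> \<bullet> b\<bar> * (cmod (FT h \<xi>))\<^sup>2)"
    by (intro ennreal_leI) (simp add: sum_distrib_right)
   then show ?case
    by (subst sum_ennreal) auto
  qed
  also have "... = (\<Sum>b\<in>Basis. NBINT \<xi>. ennreal (\<bar>\<xi> \<bullet> b\<bar> * (cmod (FT h \<xi>))\<^sup>2))"
   by (rule nn_integral_sum) measurable
  also have "... \<le> (\<Sum>b\<in>(Basis :: 'a set). ennreal E)" by (rule sum_mono[OF en])
  also have "... = ennreal (real DIM('a) * E)" using E by (simp add: ennreal_mult ennreal_of_nat_eq_real_of_nat)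
  finally show ?thesis .
 qed
 have ki: "L1 (\<lambda>\<xi>. k \<xi> powr 2)"
  using kfin by (intro integrableI_nonneg) (auto intro: le_less_trans)
 have kle: "(LBINT \<xi>. k \<xi> powr 2) \<le> real DIM('a) * E"
 proof -
  have "ennreal (LBINT \<xi>. k \<xi> powr 2) \<le> ennreal (real DIM('a) * E)"
   using kfin by (subst (asm) nn_integral_eq_integral[OF ki]) auto
  then show ?thesis using E by (simp only: ennreal_le_iff[OF mult_nonneg_nonneg[OF of_nat_0_le_iff E]])
 qed
 have Fi: "L1 (\<lambda>\<xi>. cmod (FT \<phi> \<xi>) powr 2)"
  using Plancherel_test(1)[OF \<phi>] by (simp add: powr_numeral)
 define N where "N = (LBINT x. (cmod (\<phi> x))\<^sup>2)"
 have N0: "N \<ge> 0" by (simp add: N_def)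
 have FN: "(LBINT \<xi>. cmod (FT \<phi> \<xi>) powr 2) = P * N"
  using Plancherel_test(2)[OF \<phi>] by (simp add: powr_numeral P_def N_def)
 have "P * cmod (LBINT x. h x * Lambda \<phi> x) = cmod (LBINT \<xi>. FT h (- \<xi>) * ?g \<xi>)"
  unfolding e[symmetric] norm_mult norm_of_real using P by simp
 also have "... \<le> (LBINT \<xi>. cmod (FT h (- \<xi>) * ?g \<xi>))" by (rule integral_norm_bound)
 also have "... = (LBINT \<xi>. k \<xi> * cmod (FT \<phi> \<xi>))"
  by (intro integral_cong refl) (simp add: norm_mult k_def)
 also have "... \<le> (LBINT \<xi>. k \<xi> powr 2) powr (1/2) * (LBINT \<xi>. cmod (FT \<phi> \<xi>) powr 2) powr (1/2)"
  by (rule Holder_inequality(2)[OF _ _ _ _ k0 _ ki Fi]) auto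
 also have "... \<le> (real DIM('a) * E) powr (1/2) * (P * N) powr (1/2)"
  unfolding FN using kle by (intro mult_right_mono powr_mono2) auto
 also have "... = sqrt (real DIM('a) * E * (P * N))"
  using E N0 P by (simp add: powr_half_sqrt real_sqrt_mult)
 finally have "(P * cmod (LBINT x. h x * Lambda \<phi> x))\<^sup>2 \<le> (sqrt (real DIM('a) * E * (P * N)))\<^sup>2"
  using P by (intro power_mono) auto
 then have "P * (P * (cmod (LBINT x. h x * Lambda \<phi> x))\<^sup>2) \<le> P * (real DIM('a) * E * N)"
  using E N0 P by (simp add: power_mult_distrib power2_eq_square mult_ac)
 then have "P * (cmod (LBINT x. h x * Lambda \<phi> x))\<^sup>2 \<le> real DIM('a) * E * N"
  using P by (simp only: mult_le_cancel_left_pos)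
 moreover have "1 * (cmod (LBINT x. h x * Lambda \<phi> x))\<^sup>2 \<le> P * (cmod (LBINT x. h x * Lambda \<phi> x))\<^sup>2"
  using P1 by (intro mult_right_mono) auto
 ultimately show ?thesis unfolding N_def by simp
qed

section \<open>Riesz representation in \<open>L\<^sup>2\<close>\<close>

definition square_integrable :: "('a::euclidean_space => complex) => bool" where
 "square_integrable f \<longleftrightarrow> f \<in> borel_fun \<and> L1 (\<lambda>x. (cmod (f x))\<^sup>2)"

abbreviation sq_norm :: "('a::euclidean_space => complex) => real" where
 "sq_norm f \<equiv> (LBINT x. (cmod (f x))\<^sup>2)"

lemma square_integrable_mult:
 assumes f: "square_integrable f" and g: "square_integrable g"
 shows "L1 (\<lambda>x. f x * g x)"
proof -
 note [measurable] = f[unfolded square_integrable_def, THEN conjunct1] g[unfolded square_integrable_def, THEN conjunct1]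
 show ?thesis
 proof (rule integrable_dominated)
  show "L1 (\<lambda>x. (cmod (f x))\<^sup>2 + (cmod (g x))\<^sup>2)"
   using f g by (simp add: square_integrable_def)
  show "cmod (f x * g x) \<le> (cmod (f x))\<^sup>2 + (cmod (g x))\<^sup>2" for x
  proof -
   have "2 * cmod (f x) * cmod (g x) \<le> (cmod (f x))\<^sup>2 + (cmod (g x))\<^sup>2"
    by (rule sum_squares_bound)
   moreover have "0 \<le> cmod (f x) * cmod (g x)" by simp
   ultimately have "cmod (f x) * cmod (g x) \<le> (cmod (f x))\<^sup>2 + (cmod (g x))\<^sup>2" by linarith
   then show ?thesis by (simp add: norm_mult)
  qed
 qed measurable
qed

lemma square_integrable_cnj: "square_integrable f ==> square_integrable (\<lambda>x. cnj (f x))"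
 unfolding square_integrable_def by (auto intro: measurable_compose[OF _ cnj_measurable])

lemma square_integrable_lin:
 assumes f: "square_integrable f" and g: "square_integrable g"
 shows "square_integrable (\<lambda>x. f x + c * g x)"
proof -
 note [measurable] = f[unfolded square_integrable_def, THEN conjunct1] g[unfolded square_integrable_def, THEN conjunct1]
 have "L1 (\<lambda>x. (cmod (f x + c * g x))\<^sup>2)"
 proof (rule integrable_dominated)
  show "L1 (\<lambda>x. 2 * (cmod (f x))\<^sup>2 + 2 * (cmod c)\<^sup>2 * (cmod (g x))\<^sup>2)"
   using f g by (simp add: square_integrable_def)
  show "norm ((cmod (f x + c * g x))\<^sup>2) \<le> 2 * (cmod (f x))\<^sup>2 + 2 * (cmod c)\<^sup>2 * (cmod (g x))\<^sup>2" for x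
  proof -
   have "(cmod (f x + c * g x))\<^sup>2 \<le> (cmod (f x) + cmod (c * g x))\<^sup>2" by (intro power_mono norm_triangle_ineq) auto
   also have "... \<le> 2 * (cmod (f x))\<^sup>2 + 2 * (cmod (c * g x))\<^sup>2"
    using sum_squares_bound[of "cmod (f x)" "cmod (c * g x)"] by (simp add: power2_sum)
   finally show ?thesis
    by (simp add: norm_mult power_mult_distrib)
  qed
 qed measurable
 then show ?thesis by (simp add: square_integrable_def)
qed

lemma square_integrable_diff: "square_integrable f ==> square_integrable g ==> square_integrable (\<lambda>x. f x - g x)"
 using square_integrable_lin[of f g "- 1"] by simp

lemma Cauchy_Schwarz_L2:
 assumes f: "square_integrable f" and g: "square_integrable g"
 shows "cmod (LBINT x. f x * g x) \<le> sqrt (sq_norm f) * sqrt (sq_norm g)"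
proof -
 note [measurable] = f[unfolded square_integrable_def, THEN conjunct1] g[unfolded square_integrable_def, THEN conjunct1]
 have "cmod (LBINT x. f x * g x) \<le> (LBINT x. cmod (f x) * cmod (g x))"
  using integral_norm_bound[of lborel "\<lambda>x. f x * g x"] by (simp add: norm_mult)
 also have "... \<le> (LBINT x. cmod (f x) powr 2) powr (1/2) * (LBINT x. cmod (g x) powr 2) powr (1/2)"
  by (rule Holder_inequality(2)) (use f g in \<open>auto simp: square_integrable_def powr_numeral\<close>)
 finally show ?thesis by (simp add: powr_numeral powr_half_sqrt)
qed

lemma sq_norm_expand:
 assumes f: "square_integrable f" and g: "square_integrable g"
 shows "sq_norm (\<lambda>x. f x + c * g x) = sq_norm f + 2 * Re (cnj c * (LBINT x. f x * cnj (g x))) + (cmod c)\<^sup>2 * sq_norm g"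
proof -
 have i: "L1 (\<lambda>x. f x * cnj (g x))" by (rule square_integrable_mult[OF f square_integrable_cnj[OF g]])
 have ic: "L1 (\<lambda>x. cnj c * (f x * cnj (g x)))" by (rule integrable_mult_right[OF i])
 have iR: "L1 (\<lambda>x. 2 * Re (cnj c * (f x * cnj (g x))))" by (rule integrable_mult_right[OF integrable_Re[OF ic]])
 have if': "L1 (\<lambda>x. (cmod (f x))\<^sup>2)" "L1 (\<lambda>x. (cmod c)\<^sup>2 * (cmod (g x))\<^sup>2)"
  using f g by (simp_all add: square_integrable_def)
 have "(cmod (f x + c * g x))\<^sup>2 = (cmod (f x))\<^sup>2 + 2 * Re (cnj c * (f x * cnj (g x))) + (cmod c)\<^sup>2 * (cmod (g x))\<^sup>2" for x
  unfolding cmod_power2 by (simp add: algebra_simps power2_eq_square)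
 then have "sq_norm (\<lambda>x. f x + c * g x) = (LBINT x. (cmod (f x))\<^sup>2 + 2 * Re (cnj c * (f x * cnj (g x))) + (cmod c)\<^sup>2 * (cmod (g x))\<^sup>2)"
  by (simp only:)
 also have "... = sq_norm f + (LBINT x. 2 * Re (cnj c * (f x * cnj (g x)))) + (LBINT x. (cmod c)\<^sup>2 * (cmod (g x))\<^sup>2)"
  by (simp only: integral_add[OF integrable_add[OF if'(1) iR] if'(2)]
    integral_add[OF if'(1) iR])
 also have "(LBINT x. 2 * Re (cnj c * (f x * cnj (g x)))) = 2 * Re (cnj c * (LBINT x. f x * cnj (g x)))"
  by (simp only: integral_mult_right_zero integral_Re[OF ic])
 finally show ?thesis by simp
qed

lemma test_square_integrable:
 fixes \<phi> :: "'a::euclidean_space => complex"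
 assumes \<phi>: "\<phi> \<in> test_functions"
 shows "square_integrable \<phi>"
proof -
 obtain B R where B: "B > 0" "\<And>x. cmod (\<phi> x) \<le> B * indicator (cball 0 R) x"
  using test_function_bounded[OF \<phi>] by metis
 have "cmod (\<phi> x) \<le> B" for x using B(2)[of x] B(1) by (cases "x \<in> cball 0 R") auto
 then have "L1 (\<lambda>x. cmod (\<phi> x) powr 2)"
  by (intro integrable_powr_bounded test_function_integrable \<phi>) auto
 then show ?thesis using test_functionsD(4)[OF \<phi>] by (simp add: square_integrable_def powr_numeral)
qed

text \<open>Completeness of \<open>L\<^sup>2\<close> for rapidly converging sequences. The factor \<open>2\<^sup>k\<close> in the series makes its
 finiteness imply geometric decay of the increments, hence convergence almost everywhere; Fatou's lemma
 then gives convergence in norm.\<close>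

lemma L2_limit:
 fixes \<phi> :: "nat => 'a::euclidean_space => complex"
 assumes \<phi>: "\<And>k. square_integrable (\<phi> k)"
  and cauchy: "\<And>j k. sq_norm (\<lambda>x. \<phi> j x - \<phi> k x) \<le> 2 * (1/8) ^ j + 2 * (1/8) ^ k"
 obtains u where "square_integrable u" "(\<lambda>k. sq_norm (\<lambda>x. \<phi> k x - u x)) \<longlonglongrightarrow> 0"
proof -
 let ?e = "\<lambda>k j x. ennreal ((cmod (\<phi> (j + k) x - \<phi> k x))\<^sup>2)"
 let ?d = "\<lambda>k x. 2 ^ k * (cmod (\<phi> (Suc k) x - \<phi> k x))\<^sup>2 :: real"
 have [measurable]: "\<phi> k \<in> borel_fun" for k using \<phi> by (simp add: square_integrable_def)
 have di: "L1 (\<lambda>x. (cmod (\<phi> j x - \<phi> k x))\<^sup>2)" for j k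
  using square_integrable_diff[OF \<phi> \<phi>, of j k] by (simp add: square_integrable_def)
 have dn: "(NBINT x. ennreal ((cmod (\<phi> j x - \<phi> k x))\<^sup>2)) \<le> ennreal (2 * (1/8) ^ j + 2 * (1/8) ^ k)" for j k
  using ennreal_leI[OF cauchy[of j k]] by (simp only: nn_integral_eq_integral[OF di] zero_le_power2 AE_I2)
 have "(NBINT x. (\<Sum>k. ennreal (?d k x)))
   = (\<Sum>k. NBINT x. ennreal (?d k x))"
  by (rule nn_integral_suminf) measurable
 also have "... \<le> (\<Sum>k. ennreal (4 * (1/4) ^ k))"
 proof (rule suminf_le)
  fix k
  have "(NBINT x. ennreal (?d k x)) = ennreal (2 ^ k) * (NBINT x. ennreal ((cmod (\<phi> (Suc k) x - \<phi> k x))\<^sup>2))"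
   by (subst nn_integral_cmult[symmetric]) (auto simp: ennreal_mult)
  also have "... \<le> ennreal (2 ^ k) * ennreal (2 * (1/8) ^ Suc k + 2 * (1/8) ^ k)"
   by (intro mult_left_mono dn) auto
  also have "... = ennreal (2 ^ k * (2 * (1/8) ^ Suc k + 2 * (1/8) ^ k))" by (rule ennreal_mult[symmetric]) auto
  also have "... \<le> ennreal (4 * (1/4) ^ k)"
  proof (rule ennreal_leI)
   have "2 ^ k * (1/8) ^ k = (1/4 :: real) ^ k" by (simp flip: power_mult_distrib)
   then have "2 ^ k * (2 * (1/8) ^ Suc k + 2 * (1/8) ^ k) = (9/4) * (1/4 :: real) ^ k" by (simp add: algebra_simps)
   also have "... \<le> 4 * (1/4) ^ k" by (rule mult_right_mono) auto
   finally show "2 ^ k * (2 * (1/8) ^ Suc k + 2 * (1/8) ^ k) \<le> 4 * (1/4 :: real) ^ k" .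
  qed
  finally show "(NBINT x. ennreal (?d k x)) \<le> ennreal (4 * (1/4) ^ k)" .
 qed auto
 also have "... < \<infinity>"
 proof -
  have "(\<lambda>k. 4 * (1/4 :: real) ^ k) sums (4 * (1 / (1 - 1/4)))" by (intro sums_mult geometric_sums) simp
  then have "(\<Sum>k. ennreal (4 * (1/4) ^ k)) = ennreal (4 * (1 / (1 - 1/4)))"
   by (intro sums_unique[symmetric] sums_ennreal[THEN iffD2]) auto
  then show ?thesis by simp
 qed
 finally have "(NBINT x. (\<Sum>k. ennreal (?d k x))) < \<infinity>" .
 then have ae: "AE x in lborel. (\<Sum>k. ennreal (?d k x)) \<noteq> \<infinity>"
  by (intro nn_integral_PInf_AE) auto
 have conv: "AE x in lborel. convergent (\<lambda>k. \<phi> k x)"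
  using ae
 proof eventually_elim
  case (elim x)
  define d where "d k = cmod (\<phi> (Suc k) x - \<phi> k x)" for k
  obtain S where S: "S \<ge> 0" "(\<Sum>k. ennreal (2 ^ k * (d k)\<^sup>2)) = ennreal S"
  proof -
   from elim have "(\<Sum>k. ennreal (2 ^ k * (d k)\<^sup>2)) < top" unfolding d_def by (simp only: less_top infinity_ennreal_def)
   then show ?thesis using that unfolding less_top_ennreal by (elim exE conjE)
  qed
  have db: "2 ^ k * (d k)\<^sup>2 \<le> S" for k
  proof -
   have term_le: "f k \<le> suminf f" for f :: "nat => ennreal"
    using sum_le_suminf[of f "{k}"] by simp
   have "ennreal (2 ^ k * (d k)\<^sup>2) \<le> ennreal S"
    using term_le[of "\<lambda>k. ennreal (2 ^ k * (d k)\<^sup>2)"] by (simp only: S(2))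
   then show ?thesis using S(1) by simp
  qed
  have dle: "d k \<le> sqrt S * (sqrt (1/2)) ^ k" for k
  proof -
   have "(d k)\<^sup>2 \<le> S * (1/2) ^ k" using db[of k] by (simp add: field_simps power_one_over)
   then have "sqrt ((d k)\<^sup>2) \<le> sqrt (S * (1/2) ^ k)" by (rule real_sqrt_le_mono)
   then show ?thesis by (simp add: d_def real_sqrt_mult real_sqrt_power)
  qed
  have "sqrt (1/2) < (1 :: real)" by (simp add: real_sqrt_divide)
  then have "summable (\<lambda>k. sqrt S * (sqrt (1/2)) ^ k)"
   by (intro summable_mult summable_geometric) simp
  then have "summable (\<lambda>k. norm (\<phi> (Suc k) x - \<phi> k x))"
  proof (rule summable_comparison_test'[where N=0])
   fix k :: nat
   show "norm (norm (\<phi> (Suc k) x - \<phi> k x)) \<le> sqrt S * (sqrt (1/2)) ^ k"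
    using dle[of k] unfolding d_def by (simp only: real_norm_def abs_norm_cancel)
  qed
  then have "summable (\<lambda>k. \<phi> (Suc k) x - \<phi> k x)" by (rule summable_norm_cancel)
  then have "convergent (\<lambda>n. \<Sum>k<n. \<phi> (Suc k) x - \<phi> k x)" by (simp add: summable_iff_convergent)
  then have "convergent (\<lambda>n. \<phi> n x - \<phi> 0 x)" by (simp only: sum_lessThan_telescope[of "\<lambda>k. \<phi> k x"])
  then have "convergent (\<lambda>n. (\<phi> n x - \<phi> 0 x) + \<phi> 0 x)" by (intro convergent_add convergent_const)
  then show ?case by simp
 qed
 define u where "u x = lim (\<lambda>k. \<phi> k x)" for x
 have [measurable]: "u \<in> borel_fun" unfolding u_def by measurable
 have lim: "AE x in lborel. (\<lambda>k. \<phi> k x) \<longlonglongrightarrow> u x"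
  using conv by eventually_elim (simp add: u_def convergent_LIMSEQ_iff)
 have fatou: "(NBINT x. ennreal ((cmod (\<phi> k x - u x))\<^sup>2)) \<le> ennreal (2 * (1/8) ^ k + 2 * (1/8) ^ k)" for k
 proof -
  have "(NBINT x. ennreal ((cmod (\<phi> k x - u x))\<^sup>2)) = (NBINT x. liminf (\<lambda>j. ?e k j x))"
  proof (rule nn_integral_cong_AE)
   show "AE x in lborel. ennreal ((cmod (\<phi> k x - u x))\<^sup>2) = liminf (\<lambda>j. ?e k j x)"
    using lim
   proof eventually_elim
    case (elim x)
    have "(\<lambda>j. \<phi> (j + k) x) \<longlonglongrightarrow> u x" using elim by (rule LIMSEQ_ignore_initial_segment)
    then have "(\<lambda>j. ?e k j x) \<longlonglongrightarrow> ennreal ((cmod (u x - \<phi> k x))\<^sup>2)"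
     by (intro tendsto_intros)
    then show ?case by (subst norm_minus_commute) (intro lim_imp_Liminf[symmetric], auto)
   qed
  qed
  also have "... \<le> liminf (\<lambda>j. NBINT x. ?e k j x)"
   by (rule nn_integral_liminf) measurable
  also have "... \<le> ennreal (2 * (1/8) ^ k + 2 * (1/8) ^ k)"
  proof (rule Liminf_le)
   show "\<forall>\<^sub>F j in sequentially. (NBINT x. ?e k j x) \<le> ennreal (2 * (1/8) ^ k + 2 * (1/8) ^ k)"
   proof (intro always_eventually allI)
    fix j
    have "(1/8 :: real) ^ (j + k) \<le> (1/8) ^ k" by (rule power_decreasing) auto
    then have "ennreal (2 * (1/8) ^ (j + k) + 2 * (1/8) ^ k) \<le> ennreal (2 * (1/8) ^ k + 2 * (1/8) ^ k)"
     by (intro ennreal_leI) simp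
    with dn[of "j + k" k] show "(NBINT x. ?e k j x) \<le> ennreal (2 * (1/8) ^ k + 2 * (1/8) ^ k)"
     by (rule order_trans)
   qed
  qed auto
  finally show ?thesis .
 qed
 have ui: "L1 (\<lambda>x. (cmod (\<phi> k x - u x))\<^sup>2)" for k
  using fatou[of k] by (intro integrableI_nonneg) (auto intro: le_less_trans)
 have un: "sq_norm (\<lambda>x. \<phi> k x - u x) \<le> 4 * (1/8) ^ k" for k
 proof -
  have "ennreal (sq_norm (\<lambda>x. \<phi> k x - u x)) \<le> ennreal (2 * (1/8) ^ k + 2 * (1/8) ^ k)"
   using fatou[of k] by (subst (asm) nn_integral_eq_integral[OF ui]) auto
  then have "sq_norm (\<lambda>x. \<phi> k x - u x) \<le> 2 * (1/8) ^ k + 2 * (1/8) ^ k" by (subst (asm) ennreal_le_iff) auto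
  then show ?thesis by simp
 qed
 have "square_integrable (\<lambda>x. \<phi> 0 x - (\<phi> 0 x - u x))"
  by (rule square_integrable_diff[OF \<phi>]) (use ui in \<open>auto simp: square_integrable_def\<close>)
 then have u: "square_integrable u" by simp
 have "(\<lambda>k. 4 * (1/8 :: real) ^ k) \<longlonglongrightarrow> 0" by real_asymp
 then have "(\<lambda>k. sq_norm (\<lambda>x. \<phi> k x - u x)) \<longlonglongrightarrow> 0"
  by (rule tendsto_sandwich[OF _ _ tendsto_const, rotated 2]) (use un in auto)
 then show ?thesis using that u by blast
qed

lemma nonneg_quadratic_imp_zero:
 fixes a c :: real
 assumes "\<And>t. 0 \<le> a * t + c * t\<^sup>2"
 shows "a = 0"
proof (rule ccontr)
 assume a: "a \<noteq> 0"
 define K where "K = \<bar>c\<bar> + 1"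
 have K: "K > 0" by (simp add: K_def)
 define t where "t = - a / (2 * K)"
 have "c * t\<^sup>2 \<le> K * t\<^sup>2" unfolding K_def by (intro mult_right_mono) auto
 then have "0 \<le> a * t + K * t\<^sup>2" using assms[of t] by linarith
 also have "a * t + K * t\<^sup>2 = - (a\<^sup>2 / (4 * K))" using K by (simp add: t_def power2_eq_square field_simps)
 finally have "a\<^sup>2 / (4 * K) \<le> 0" by simp
 then show False using a K by (simp add: divide_le_0_iff)
qed

text \<open>The classical variational proof. Minimise \<open>J \<phi> = \<parallel>\<phi>\<parallel>\<^sup>2 - 2 Re (l \<phi>)\<close> over test functions; by the
 parallelogram law a minimising sequence is a Cauchy sequence, and the first variation at its limit \<open>u\<close>
 vanishes. Then \<open>w\<close> is the complex conjugate of \<open>u\<close>. As \<open>u\<close> is itself a limit of test functions, the bound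
 on \<open>l\<close> passes to \<open>w\<close>.\<close>

theorem Riesz_representation_test:
 fixes l :: "('a::euclidean_space => complex) => complex"
 assumes add: "\<And>\<phi> \<psi>. \<phi> \<in> test_functions ==> \<psi> \<in> test_functions ==> l (\<lambda>x. \<phi> x + \<psi> x) = l \<phi> + l \<psi>"
  and scale: "\<And>c \<phi>. \<phi> \<in> test_functions ==> l (\<lambda>x. c * \<phi> x) = c * l \<phi>"
  and bound: "\<And>\<phi>. \<phi> \<in> test_functions ==> (cmod (l \<phi>))\<^sup>2 \<le> B * sq_norm \<phi>" and B: "B \<ge> 0"
 obtains w where "square_integrable w" "\<And>\<phi>. \<phi> \<in> test_functions ==> l \<phi> = (LBINT x. w x * \<phi> x)" "sq_norm w \<le> B"
proof -
 note sq = test_square_integrable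
 define J where "J \<phi> = sq_norm \<phi> - 2 * Re (l \<phi>)" for \<phi>
 have Jlow: "- B \<le> J \<phi>" if \<phi>: "\<phi> \<in> test_functions" for \<phi>
 proof -
  define n where "n = sqrt (sq_norm \<phi>)"
  have n: "n\<^sup>2 = sq_norm \<phi>" "n \<ge> 0" by (simp_all add: n_def)
  have "cmod (l \<phi>) \<le> sqrt B * n"
  proof (rule power2_le_imp_le)
   show "(cmod (l \<phi>))\<^sup>2 \<le> (sqrt B * n)\<^sup>2" using bound[OF \<phi>] B n by (simp add: power_mult_distrib)
  qed (use B n in simp)
  then have "Re (l \<phi>) \<le> sqrt B * n" using complex_Re_le_cmod[of "l \<phi>"] by linarith
  moreover have "0 \<le> (n - sqrt B)\<^sup>2" by simp
  moreover have "(n - sqrt B)\<^sup>2 = n\<^sup>2 - 2 * (sqrt B * n) + B" using B by (simp add: power2_diff)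
  ultimately show ?thesis unfolding J_def n(1)[symmetric] by linarith
 qed
 define m where "m = Inf (J ` test_functions)"
 have zt: "(\<lambda>x. 0) \<in> (test_functions :: ('a => complex) set)" by (rule test_functionsI[where R=0]) (auto intro: Ck_const)
 have bdd: "bdd_below (J ` test_functions)" using Jlow by (auto intro!: bdd_belowI[where m="- B"])
 have mJ: "m \<le> J \<phi>" if "\<phi> \<in> test_functions" for \<phi>
  unfolding m_def by (rule cINF_lower[OF bdd that])
 have "\<exists>\<phi>. \<phi> \<in> test_functions \<and> J \<phi> < m + (1/8) ^ k" for k :: nat
 proof -
  have "m < m + (1/8) ^ k" by simp
  then show ?thesis unfolding m_def using zt by (subst (asm) cINF_less_iff[OF _ bdd]) auto
 qed
 then obtain \<phi> where \<phi>: "\<And>k. \<phi> k \<in> test_functions" and J\<phi>: "\<And>k. J (\<phi> k) < m + (1/8) ^ k" by metis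
 have lin: "(\<lambda>x. \<psi> x + c * \<eta> x) \<in> test_functions" "l (\<lambda>x. \<psi> x + c * \<eta> x) = l \<psi> + c * l \<eta>"
  if "\<psi> \<in> test_functions" "\<eta> \<in> test_functions" for \<psi> \<eta> c
  using test_functions_add[OF that(1) test_functions_cmult[OF that(2)], of c] add[OF that(1) test_functions_cmult[OF that(2)], of c] scale[OF that(2)]
  by simp_all
 have cauchy: "sq_norm (\<lambda>x. \<phi> j x - \<phi> k x) \<le> 2 * (1/8) ^ j + 2 * (1/8) ^ k" for j k
 proof -
  \<comment> \<open>At the midpoint \<open>J\<close> is still at least the infimum \<open>m\<close>.\<close>
  define c where "c x = (1/2) * (\<phi> j x + 1 * \<phi> k x)" for x
  have ct: "c \<in> test_functions" unfolding c_def by (intro test_functions_cmult lin \<phi>)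
  have lc: "l c = (1/2) * (l (\<phi> j) + l (\<phi> k))"
   unfolding c_def using scale[OF lin(1)[OF \<phi> \<phi>, of j 1 k], of "1/2"] lin(2)[OF \<phi> \<phi>, of j 1 k] by simp
  have nc: "sq_norm c = (1/4) * sq_norm (\<lambda>x. \<phi> j x + 1 * \<phi> k x)"
   unfolding c_def norm_mult power_mult_distrib integral_mult_right_zero by (simp add: power2_eq_square)
  have p: "sq_norm (\<lambda>x. \<phi> j x + 1 * \<phi> k x) + sq_norm (\<lambda>x. \<phi> j x + (- 1) * \<phi> k x) = 2 * sq_norm (\<phi> j) + 2 * sq_norm (\<phi> k)"
   unfolding sq_norm_expand[OF sq[OF \<phi>] sq[OF \<phi>]] by simp
  have "sq_norm (\<lambda>x. \<phi> j x - \<phi> k x) = sq_norm (\<lambda>x. \<phi> j x + (- 1) * \<phi> k x)" by simp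
  also have "... = 2 * J (\<phi> j) + 2 * J (\<phi> k) - 4 * J c"
   using p unfolding J_def nc lc by (simp add: field_simps)
  also have "... \<le> 2 * (m + (1/8) ^ j) + 2 * (m + (1/8) ^ k) - 4 * m"
   by (intro diff_mono add_mono mult_left_mono less_imp_le[OF J\<phi>] mJ[OF ct]) auto
  finally show ?thesis by simp
 qed
 obtain u where u: "square_integrable u" and ulim: "(\<lambda>k. sq_norm (\<lambda>x. \<phi> k x - u x)) \<longlonglongrightarrow> 0"
  using L2_limit[OF sq[OF \<phi>] cauchy] by blast
 have weak: "(\<lambda>k. LBINT x. \<phi> k x * v x) \<longlonglongrightarrow> (LBINT x. u x * v x)" if v: "square_integrable v" for v
 proof (rule LIM_zero_cancel, rule Lim_null_comparison)
  have "(\<lambda>k. sqrt (sq_norm (\<lambda>x. \<phi> k x - u x)) * sqrt (sq_norm v)) \<longlonglongrightarrow> sqrt 0 * sqrt (sq_norm v)"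
   by (intro tendsto_intros ulim)
  then show "(\<lambda>k. sqrt (sq_norm (\<lambda>x. \<phi> k x - u x)) * sqrt (sq_norm v)) \<longlonglongrightarrow> 0" by simp
  show "\<forall>\<^sub>F k in sequentially. norm ((LBINT x. \<phi> k x * v x) - (LBINT x. u x * v x)) \<le> sqrt (sq_norm (\<lambda>x. \<phi> k x - u x)) * sqrt (sq_norm v)"
  proof (intro always_eventually allI)
   fix k
   have "(LBINT x. \<phi> k x * v x) - (LBINT x. u x * v x) = (LBINT x. (\<phi> k x - u x) * v x)"
    using square_integrable_mult[OF sq[OF \<phi>] v] square_integrable_mult[OF u v] by (simp add: left_diff_distrib)
   then show "norm ((LBINT x. \<phi> k x * v x) - (LBINT x. u x * v x)) \<le> sqrt (sq_norm (\<lambda>x. \<phi> k x - u x)) * sqrt (sq_norm v)"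
    using Cauchy_Schwarz_L2[OF square_integrable_diff[OF sq[OF \<phi>] u] v] by simp
  qed
 qed
 have Re: "Re (LBINT x. u x * cnj (\<psi> x)) = Re (l \<psi>)" if \<psi>: "\<psi> \<in> test_functions" for \<psi>
 proof -
  have "0 \<le> (2 * (Re (LBINT x. u x * cnj (\<psi> x)) - Re (l \<psi>))) * t + sq_norm \<psi> * t\<^sup>2" for t
  proof -
   have lim: "(\<lambda>k. (1/8) ^ k + (2 * (Re (LBINT x. \<phi> k x * cnj (\<psi> x)) - Re (l \<psi>))) * t + sq_norm \<psi> * t\<^sup>2)
    \<longlonglongrightarrow> 0 + (2 * (Re (LBINT x. u x * cnj (\<psi> x)) - Re (l \<psi>))) * t + sq_norm \<psi> * t\<^sup>2"
    by (intro tendsto_intros weak square_integrable_cnj sq \<psi> LIMSEQ_power_zero) auto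
   have "0 \<le> (1/8) ^ k + (2 * (Re (LBINT x. \<phi> k x * cnj (\<psi> x)) - Re (l \<psi>))) * t + sq_norm \<psi> * t\<^sup>2" for k
   proof -
    have "m \<le> J (\<lambda>x. \<phi> k x + of_real t * \<psi> x)" by (rule mJ[OF lin(1)[OF \<phi> \<psi>]])
    also have "... = J (\<phi> k) + (2 * (Re (LBINT x. \<phi> k x * cnj (\<psi> x)) - Re (l \<psi>))) * t + sq_norm \<psi> * t\<^sup>2"
     unfolding J_def sq_norm_expand[OF sq[OF \<phi>] sq[OF \<psi>]] lin(2)[OF \<phi> \<psi>] by (simp add: algebra_simps)
    finally show ?thesis using J\<phi>[of k] by linarith
   qed
   then show ?thesis using LIMSEQ_le_const[OF lim] by auto
  qed
  from nonneg_quadratic_imp_zero[OF this] show ?thesis by simp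
 qed
 have full: "(LBINT x. u x * cnj (\<psi> x)) = cnj (l \<psi>)" if \<psi>: "\<psi> \<in> test_functions" for \<psi>
 proof (rule complex_eqI)
  show "Re (LBINT x. u x * cnj (\<psi> x)) = Re (cnj (l \<psi>))" using Re[OF \<psi>] by simp
  have "(LBINT x. u x * cnj (\<i> * \<psi> x)) = - \<i> * (LBINT x. u x * cnj (\<psi> x))"
   by (subst integral_mult_right_zero[symmetric]) (simp add: mult_ac)
  then show "Im (LBINT x. u x * cnj (\<psi> x)) = Im (cnj (l \<psi>))"
   using Re[OF test_functions_cmult[OF \<psi>, of "\<i>"]] scale[OF \<psi>, of "\<i>"] by simp
 qed
 define w where "w x = cnj (u x)" for x
 have w: "square_integrable w" unfolding w_def by (rule square_integrable_cnj[OF u])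
 have rep: "l \<psi> = (LBINT x. w x * \<psi> x)" if \<psi>: "\<psi> \<in> test_functions" for \<psi>
 proof -
  have "l \<psi> = cnj (LBINT x. u x * cnj (\<psi> x))" using full[OF \<psi>] by simp
  also have "... = (LBINT x. w x * \<psi> x)"
   unfolding w_def by (subst integral_cnj[symmetric]) simp
  finally show ?thesis .
 qed
 have wu: "(LBINT x. u x * w x) = of_real (sq_norm u)"
  unfolding w_def by (subst integral_complex_of_real[symmetric]) (simp only: complex_norm_square)
 have L1: "(\<lambda>k. l (\<phi> k)) \<longlonglongrightarrow> of_real (sq_norm u)"
  using weak[OF w] unfolding wu rep[OF \<phi>] by (simp add: mult.commute)
 have L2: "(\<lambda>k. sq_norm (\<phi> k)) \<longlonglongrightarrow> sq_norm u"
 proof -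
  have e: "sq_norm (\<phi> k) = sq_norm (\<lambda>x. \<phi> k x - u x) + 2 * Re (LBINT x. \<phi> k x * w x) - sq_norm u" for k
  proof -
   have "sq_norm (\<lambda>x. \<phi> k x - u x) = sq_norm (\<lambda>x. \<phi> k x + (- 1) * u x)" by simp
   also have "... = sq_norm (\<phi> k) - 2 * Re (LBINT x. \<phi> k x * w x) + sq_norm u"
    unfolding sq_norm_expand[OF sq[OF \<phi>] u] w_def by simp
   finally show ?thesis by simp
  qed
  have "(\<lambda>k. sq_norm (\<lambda>x. \<phi> k x - u x) + 2 * Re (LBINT x. \<phi> k x * w x) - sq_norm u) \<longlonglongrightarrow> 0 + 2 * Re (of_real (sq_norm u)) - sq_norm u"
   using weak[OF w] unfolding wu by (intro tendsto_intros ulim)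
  then show ?thesis unfolding e by simp
 qed
 have "(cmod (of_real (sq_norm u)))\<^sup>2 \<le> B * sq_norm u"
  by (rule LIMSEQ_le[OF tendsto_power[OF tendsto_norm[OF L1]] tendsto_mult_left[OF L2]]) (use bound[OF \<phi>] in auto)
 then have "sq_norm u * sq_norm u \<le> B * sq_norm u" by (simp add: power2_eq_square)
 moreover have "sq_norm u \<ge> 0" by simp
 ultimately have "sq_norm u \<le> B" using B by (metis mult_le_cancel_right_pos order_le_less)
 then have "sq_norm w \<le> B" by (simp add: w_def)
 then show ?thesis using that w rep by blast
qed

section \<open>Transport along the free flow\<close>

definition locally_integrable :: "('a::euclidean_space => complex) => bool" where
 "locally_integrable u \<longleftrightarrow> u \<in> borel_fun \<and> (\<forall>R. L1 (\<lambda>z. indicator (cball 0 R) z *\<^sub>R u z))"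

lemma locally_integrable_powr:
 assumes [measurable]: "u \<in> borel_fun" and i: "L1 (\<lambda>z. cmod (u z) powr p)" and p: "p > 1"
 shows "locally_integrable u"
 unfolding locally_integrable_def
proof (intro conjI allI)
 fix R
 have [measurable]: "cball 0 R \<in> sets (borel :: 'a measure)" by simp
 show "L1 (\<lambda>z. indicator (cball 0 R) z *\<^sub>R u z)"
 proof (rule integrable_dominated)
  show "L1 (\<lambda>z. 1 * indicator (cball 0 R) z + cmod (u z) powr p)"
   by (intro integrable_add integrable_indicator_cball i)
  show "norm (indicator (cball 0 R) z *\<^sub>R u z) \<le> 1 * indicator (cball 0 R) z + cmod (u z) powr p" for z
  proof -
   have "cmod (u z) \<le> 1 + cmod (u z) powr p"
   proof (cases "cmod (u z) \<le> 1")
    case False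
    then have "cmod (u z) powr 1 \<le> cmod (u z) powr p" using p by (intro powr_mono) auto
    then show ?thesis by simp
   qed (simp add: add_increasing2)
   then show ?thesis
    by (auto simp: indicator_def)
  qed
 qed measurable
qed simp

lemma locally_integrable_mult:
 assumes u: "locally_integrable u" and [measurable]: "\<psi> \<in> borel_fun"
  and \<psi>: "\<And>z. cmod (\<psi> z) \<le> B * indicator (cball 0 R) z"
 shows "L1 (\<lambda>z. u z * \<psi> z)"
proof (rule integrable_bound)
 have [measurable]: "u \<in> borel_fun" using u by (simp add: locally_integrable_def)
 show "L1 (\<lambda>z. B *\<^sub>R (indicator (cball 0 R) z *\<^sub>R u z))"
  using u unfolding locally_integrable_def by (intro integrable_scaleR_right) auto
 show "AE z in lborel. norm (u z * \<psi> z) \<le> norm (B *\<^sub>R (indicator (cball 0 R) z *\<^sub>R u z))"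
 proof (rule AE_I2, goal_cases)
  case (1 z)
  have "cmod (\<psi> z) * cmod (u z) \<le> (B * indicator (cball 0 R) z) * cmod (u z)"
   by (intro mult_right_mono \<psi>) auto
  also have "... \<le> \<bar>B * indicator (cball 0 R) z\<bar> * cmod (u z)" by (intro mult_right_mono) auto
  finally show ?case
   by (simp add: norm_mult abs_mult mult_ac)
 qed
 show "(\<lambda>z. u z * \<psi> z) \<in> borel_measurable lborel" by measurable
qed

lemma shear_inverse: "shear (- s) (shear s z) = z" "shear s (shear (- s) z) = z"
 by (simp_all add: shear_def)

lemma norm_shear_le:
 fixes z :: "'a::euclidean_space \<times> 'a"
 shows "norm (shear s z) \<le> (1 + \<bar>s\<bar>) * norm z"
proof -
 have "shear s z = z + s *\<^sub>R (snd z, 0)" by (simp add: shear_def prod_eq_iff)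
 then have "norm (shear s z) \<le> norm z + \<bar>s\<bar> * norm (snd z)"
  using norm_triangle_ineq[of z "s *\<^sub>R (snd z, 0)"] by (simp add: norm_Pair)
 also have "... \<le> norm z + \<bar>s\<bar> * norm z"
  by (intro add_left_mono mult_left_mono) (auto simp: norm_prod_def intro: real_le_rsqrt)
 finally show ?thesis by (simp add: algebra_simps)
qed

text \<open>Absolute convergence of the double integrals below: for \<open>s\<close> in \<open>[0, t]\<close> the flow maps a ball into the
 ball with radius \<open>1 + t\<close> times as large.\<close>

lemma sheared_pairing_finite:
 fixes u \<psi> :: "'a::euclidean_space \<times> 'a => complex"
 assumes u: "locally_integrable u" and [measurable]: "\<psi> \<in> borel_fun"
  and \<psi>: "\<And>z. cmod (\<psi> z) \<le> B * indicator (cball 0 R) z" and t: "t > 0" and B: "B > 0"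
 shows "(NBINT s. NBINT z. ennreal (norm (indicator {0..t} s *\<^sub>R (u z * \<psi> (shear (- s) z))))) < \<infinity>"
  and "(NBINT s. NBINT z. ennreal (norm (indicator {0..t} s *\<^sub>R (u (shear s z) * \<psi> z)))) < \<infinity>"
proof -
 let ?N = "\<lambda>s z. norm (indicator {0..t} s *\<^sub>R (u z * \<psi> (shear (- s) z)))"
 have [measurable]: "u \<in> borel_fun" using u by (simp add: locally_integrable_def)
 have [measurable]: "cball 0 ((1 + t) * R) \<in> sets (borel :: ('a \<times> 'a) measure)" by simp
 define I where "I = (NBINT z. ennreal (norm (indicator (cball 0 ((1 + t) * R)) z *\<^sub>R u z)))"
 have I: "I < \<infinity>"
  using u unfolding locally_integrable_def I_def by (simp add: integrable_iff_bounded)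
 have "(NBINT s. NBINT z. ennreal (?N s z))
   \<le> (NBINT s. (ennreal B * I) * indicator {0..t} s)"
 proof (rule nn_integral_mono, goal_cases)
  case (1 s)
  show ?case
  proof (cases "s \<in> {0..t}")
   case True
   have "(NBINT z. ennreal (?N s z))
    \<le> (NBINT z. ennreal B * ennreal (norm (indicator (cball 0 ((1 + t) * R)) z *\<^sub>R u z)))"
   proof (rule nn_integral_mono, goal_cases)
    case (1 z)
    have "norm (u z * \<psi> (shear (- s) z)) \<le> B * norm (indicator (cball 0 ((1 + t) * R)) z *\<^sub>R u z)"
    proof (cases "shear (- s) z \<in> cball 0 R")
     case in_ball: True
     have "z = shear s (shear (- s) z)" by (simp add: shear_def)
     then have "norm z \<le> (1 + \<bar>s\<bar>) * norm (shear (- s) z)" using norm_shear_le[of s "shear (- s) z"] by simp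
     also have "... \<le> (1 + t) * R" using True in_ball by (intro mult_mono) auto
     finally have "indicator (cball 0 ((1 + t) * R)) z = (1 :: real)" by simp
     moreover have "cmod (\<psi> (shear (- s) z)) * cmod (u z) \<le> B * cmod (u z)"
      using \<psi>[of "shear (- s) z"] in_ball by (intro mult_right_mono) auto
     ultimately show ?thesis by (simp add: norm_mult mult_ac)
    next
     case False
     then show ?thesis using \<psi>[of "shear (- s) z"] B by simp
    qed
    then show ?case
     using True B by (simp only: ennreal_mult[symmetric] less_imp_le norm_ge_zero) (auto intro!: ennreal_leI)
   qed
   also have "... = ennreal B * I" unfolding I_def by (rule nn_integral_cmult) measurable
   finally show ?thesis using True by simp
  qed simp
 qed
 also have "... = (ennreal B * I) * ennreal t" using t by (simp add: nn_integral_cmult_indicator)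
 also have "... < \<infinity>" using I by (simp add: ennreal_mult_less_top)
 finally show *: "(NBINT s. NBINT z. ennreal (?N s z)) < \<infinity>" .
 have "(NBINT z. ennreal (norm (indicator {0..t} s *\<^sub>R (u (shear s z) * \<psi> z))))
   = (NBINT z. ennreal (?N s z))" for s
  using nn_integral_shear[where f="\<lambda>z. ennreal (?N s z)" and t=s]
  by (simp only: shear_inverse) measurable
 then show "(NBINT s. NBINT z. ennreal (norm (indicator {0..t} s *\<^sub>R (u (shear s z) * \<psi> z)))) < \<infinity>"
  using * by simp
qed

text \<open>\<open>has_transport_derivative\<close> with integrals over Borel measure, in any Euclidean space.\<close>

definition weak_transport :: "('a::euclidean_space \<times> 'a => complex) => ('a \<times> 'a => complex) => bool" where
 "weak_transport f g \<longleftrightarrow> (\<forall>\<phi>\<in>test_functions.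
   (LBINT z. f z * frechet_derivative \<phi> (at z) (snd z, 0)) = - (LBINT z. g z * \<phi> z))"

lemma transport_field_test:
 fixes \<phi> :: "'a::euclidean_space \<times> 'a => complex"
 assumes \<phi>: "\<phi> \<in> test_functions"
 shows "continuous_on UNIV (\<lambda>z. frechet_derivative \<phi> (at z) (snd z, 0))"
  and "\<exists>B R. B > 0 \<and> (\<forall>z. cmod (frechet_derivative \<phi> (at z) (snd z, 0)) \<le> B * indicator (cball 0 R) z)"
proof -
 have e: "frechet_derivative \<phi> (at z) (snd z, 0) = (\<Sum>b\<in>Basis. of_real ((snd z, 0) \<bullet> b) * partial_deriv b \<phi> z)" for z
  by (rule frechet_derivative_Basis_sum[OF test_functionsD(3)[OF \<phi>]])
 have "continuous_on UNIV (\<lambda>z. \<Sum>b\<in>Basis. of_real ((snd z, 0) \<bullet> b) * partial_deriv b \<phi> z)"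
  by (intro continuous_on_sum continuous_on_mult continuous_intros test_functionsD(2) partial_deriv_test \<phi>)
 then show c: "continuous_on UNIV (\<lambda>z. frechet_derivative \<phi> (at z) (snd z, 0))" by (simp only: e)
 obtain R where R: "R > 0" "\<And>z. norm z \<ge> R ==> \<phi> z = 0" using test_functionsD(5)[OF \<phi>] by blast
 have "compact ((\<lambda>z. frechet_derivative \<phi> (at z) (snd z, 0)) ` cball 0 R)"
  by (intro compact_continuous_image continuous_on_subset[OF c]) auto
 then have "bounded ((\<lambda>z. frechet_derivative \<phi> (at z) (snd z, 0)) ` cball 0 R)" by (rule compact_imp_bounded)
 then obtain B where B: "B > 0" "\<forall>z\<in>cball 0 R. cmod (frechet_derivative \<phi> (at z) (snd z, 0)) \<le> B"
  unfolding bounded_pos by auto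
 have "cmod (frechet_derivative \<phi> (at z) (snd z, 0)) \<le> B * indicator (cball 0 R) z" for z
 proof (cases "z \<in> cball 0 R")
  case False
  have "(\<phi> has_derivative (\<lambda>_. 0)) (at z)"
  proof (rule has_derivative_transform_within_open[OF has_derivative_const[of 0]])
   show "open (- cball 0 R :: ('a \<times> 'a) set)" by auto
  qed (use False R in auto)
  then show ?thesis using False by (simp add: partial_deriv_eqI)
 qed (use B in simp)
 then show "\<exists>B R. B > 0 \<and> (\<forall>z. cmod (frechet_derivative \<phi> (at z) (snd z, 0)) \<le> B * indicator (cball 0 R) z)" using B(1) by blast
qed

text \<open>The transport field \<open>(v, 0)\<close> is invariant under its own flow.\<close>

lemma test_function_along_flow:
 fixes \<phi> :: "'a::euclidean_space \<times> 'a => complex"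
 assumes \<phi>: "\<phi> \<in> test_functions"
 defines "\<psi> \<equiv> \<lambda>z. frechet_derivative \<phi> (at z) (snd z, 0)"
 shows "frechet_derivative (\<lambda>z. \<phi> (shear s z)) (at z) (snd z, 0) = \<psi> (shear s z)"
  and "((\<lambda>s. \<phi> (shear (- s) z)) has_vector_derivative - \<psi> (shear (- s) z)) (at s)"
proof -
 have d: "(\<phi> has_derivative frechet_derivative \<phi> (at w)) (at w)" for w
  using test_functionsD(3)[OF \<phi>] by (simp add: frechet_derivative_works)
 have "(shear s has_derivative shear s) (at z)"
  unfolding shear_def[abs_def] by (auto intro!: derivative_eq_intros)
 from has_derivative_compose[OF this d]
 have "((\<lambda>z. \<phi> (shear s z)) has_derivative (\<lambda>h. frechet_derivative \<phi> (at (shear s z)) (shear s h))) (at z)" by simp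
 from partial_deriv_eqI[OF this]
 show "frechet_derivative (\<lambda>z. \<phi> (shear s z)) (at z) (snd z, 0) = \<psi> (shear s z)"
  by (simp add: \<psi>_def shear_def)
 have "((\<lambda>s. shear (- s) z) has_derivative (\<lambda>h. (- h) *\<^sub>R (snd z, 0))) (at s)"
  unfolding shear_def[abs_def] by (auto intro!: derivative_eq_intros)
 from has_derivative_compose[OF this d]
 have "((\<lambda>s. \<phi> (shear (- s) z)) has_derivative (\<lambda>h. frechet_derivative \<phi> (at (shear (- s) z)) ((- h) *\<^sub>R (snd z, 0)))) (at s)" .
 moreover have "frechet_derivative \<phi> (at (shear (- s) z)) ((- h) *\<^sub>R (snd z, 0)) = h *\<^sub>R (- \<psi> (shear (- s) z))" for h
  unfolding linear_scale[OF has_derivative_linear[OF d]] by (simp add: \<psi>_def shear_def)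
 ultimately show "((\<lambda>s. \<phi> (shear (- s) z)) has_vector_derivative - \<psi> (shear (- s) z)) (at s)"
  unfolding has_vector_derivative_def by simp
qed

text \<open>Test the weak equation with \<open>\<phi> \<circ> S\<^sub>-\<^sub>s\<close> and integrate over \<open>s\<close> from 0 to \<open>t\<close>: the left side becomes the
 integral of an \<open>s\<close>-derivative, and the invariance of Lebesgue measure under the flow moves \<open>S\<^sub>-\<^sub>s\<close> from
 \<open>\<phi>\<close> to \<open>f\<close> and \<open>g\<close>. The result holds for all \<open>\<phi>\<close>, so du Bois-Reymond's lemma applies.\<close>

lemma weak_transport_mild:
 fixes f g :: "'a::euclidean_space \<times> 'a => complex"
 assumes f: "locally_integrable f" and g: "locally_integrable g" and fg: "weak_transport f g" and t: "t > 0"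
 shows "AE z in lborel. f (shear t z) - f z = (LBINT s. indicator {0..t} s *\<^sub>R g (shear s z))"
proof -
 have [measurable]: "f \<in> borel_fun" "g \<in> borel_fun"
  using f g by (simp_all add: locally_integrable_def)
 define G where "G z = (LBINT s. indicator {0..t} s *\<^sub>R g (shear s z))" for z
 have [measurable]: "G \<in> borel_fun" unfolding G_def by measurable
 have G_pair: "L1 (\<lambda>z. G z * \<psi> z)"
   "(LBINT z. G z * \<psi> z) = (LBINT s. LBINT z. indicator {0..t} s *\<^sub>R (g (shear s z) * \<psi> z))"
  if [measurable]: "\<psi> \<in> borel_fun" and \<psi>: "\<And>z. cmod (\<psi> z) \<le> B * indicator (cball 0 R) z" and B: "B > 0"
  for \<psi> B R
 proof -
  note F = Fubini_swap[OF _ sheared_pairing_finite(2)[OF g that(1) \<psi> t B]]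
  have e: "(LBINT s. indicator {0..t} s *\<^sub>R (g (shear s z) * \<psi> z)) = G z * \<psi> z" for z
   unfolding G_def by (subst integral_mult_left_zero[symmetric]) simp
  show "L1 (\<lambda>z. G z * \<psi> z)" unfolding e[symmetric] by (rule F(4)) measurable
  show "(LBINT z. G z * \<psi> z) = (LBINT s. LBINT z. indicator {0..t} s *\<^sub>R (g (shear s z) * \<psi> z))"
   unfolding e[symmetric] by (rule F(1)[symmetric]) measurable
 qed
 define u where "u z = f (shear t z) - f z - G z" for z
 have "AE z in lborel. u z = 0"
 proof (rule du_Bois_Reymond)
  show "u \<in> borel_fun" unfolding u_def by measurable
  have pair: "L1 (\<lambda>z. f (shear t z) * \<psi> z)" "(LBINT z. f (shear t z) * \<psi> z) = (LBINT z. f z * \<psi> (shear (- t) z))"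
   "L1 (\<lambda>z. f z * \<psi> (shear (- t) z))"
   if [measurable]: "\<psi> \<in> borel_fun" and \<psi>: "\<And>z. cmod (\<psi> z) \<le> B * indicator (cball 0 R) z" and B: "B > 0"
   for \<psi> B R
  proof -
   show i: "L1 (\<lambda>z. f z * \<psi> (shear (- t) z))"
   proof (rule locally_integrable_mult[OF f])
    fix z :: "'a \<times> 'a"
    have "cmod (\<psi> (shear (- t) z)) \<le> B * indicator (cball 0 R) (shear (- t) z)" by (rule \<psi>)
    also have "... \<le> B * indicator (cball 0 ((1 + t) * R)) z"
    proof (cases "shear (- t) z \<in> cball 0 R")
     case True
     have "z = shear t (shear (- t) z)" by (simp add: shear_def)
     then have "norm z \<le> (1 + \<bar>t\<bar>) * norm (shear (- t) z)" using norm_shear_le[of t "shear (- t) z"] by simp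
     also have "... \<le> (1 + t) * R" using True t by (intro mult_mono) auto
     finally show ?thesis using B by (simp add: indicator_def)
    qed (use B in simp)
    finally show "cmod (\<psi> (shear (- t) z)) \<le> B * indicator (cball 0 ((1 + t) * R)) z" .
   qed measurable
   show "L1 (\<lambda>z. f (shear t z) * \<psi> z)"
    using integrable_shear[OF i, of t] by (simp add: shear_def)
   show "(LBINT z. f (shear t z) * \<psi> z) = (LBINT z. f z * \<psi> (shear (- t) z))"
    using integral_shear[where f="\<lambda>z. f z * \<psi> (shear (- t) z)" and t=t] by (simp only: shear_inverse) measurable
  qed
  show "L1 (\<lambda>z. indicator (box a c) z *\<^sub>R u z)" for a c
  proof -
   obtain R where R: "\<forall>z\<in>box a c. norm z \<le> R" using bounded_box[of a c] unfolding bounded_iff by auto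
   have b: "cmod (indicator (box a c) z) \<le> 1 * indicator (cball 0 R) z" for z
    using R by (auto simp: indicator_def)
   have "L1 (\<lambda>z. f (shear t z) * indicator (box a c) z - f z * indicator (box a c) z - G z * indicator (box a c) z)"
    by (intro integrable_diff pair(1)[OF _ b] G_pair(1)[OF _ b] locally_integrable_mult[OF f _ b]) auto
   moreover have "f (shear t z) * indicator (box a c) z - f z * indicator (box a c) z - G z * indicator (box a c) z
     = indicator (box a c) z *\<^sub>R u z" for z
    by (simp add: u_def indicator_def)
   ultimately show ?thesis by simp
  qed
  fix \<phi> :: "'a \<times> 'a => complex"
  assume \<phi>: "\<phi> \<in> test_functions"
  note [measurable] = test_functionsD(4)[OF \<phi>]
  obtain B R where B: "B > 0" "\<And>z. cmod (\<phi> z) \<le> B * indicator (cball 0 R) z" using test_function_bounded[OF \<phi>] by metis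
  define \<psi> where "\<psi> = (\<lambda>z. frechet_derivative \<phi> (at z) (snd z, 0))"
  note \<psi>c = transport_field_test(1)[OF \<phi>, folded \<psi>_def]
  have [measurable]: "\<psi> \<in> borel_fun" using \<psi>c by (rule borel_measurable_continuous_onI)
  obtain B' R' where B': "B' > 0" "\<And>z. cmod (\<psi> z) \<le> B' * indicator (cball 0 R') z"
   using transport_field_test(2)[OF \<phi>] unfolding \<psi>_def by blast
  have ftc: "\<phi> (shear (- t) z) - \<phi> z = (LBINT s. indicator {0..t} s *\<^sub>R (- \<psi> (shear (- s) z)))" for z
  proof -
   have "continuous_on {0..t} (\<lambda>s. - \<psi> (shear (- s) z))"
    unfolding shear_def by (intro continuous_intros continuous_on_compose2[OF \<psi>c]) auto
   moreover have "\<And>s. ((\<lambda>s. \<phi> (shear (- s) z)) has_vector_derivative - \<psi> (shear (- s) z)) (at s within {0..t})"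
    unfolding \<psi>_def by (rule has_vector_derivative_at_within[OF test_function_along_flow(2)[OF \<phi>]])
   ultimately have "(LBINT s. indicator {0..t} s *\<^sub>R (- \<psi> (shear (- s) z))) = \<phi> (shear (- t) z) - \<phi> (shear (- 0) z)"
    using t by (intro integral_FTC_Icc) auto
   then show ?thesis by (simp add: shear_def)
  qed
  have shift: "(LBINT z. g (shear s z) * \<phi> z) = - (LBINT z. f z * \<psi> (shear (- s) z))" for s
  proof -
   have "(LBINT z. g (shear s z) * \<phi> z) = (LBINT z. g z * \<phi> (shear (- s) z))"
    using integral_shear[where f="\<lambda>z. g z * \<phi> (shear (- s) z)" and t=s] by (simp only: shear_inverse) measurable
   also have "... = - (LBINT z. f z * frechet_derivative (\<lambda>z. \<phi> (shear (- s) z)) (at z) (snd z, 0))"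
    by (simp only: bspec[OF fg[unfolded weak_transport_def] test_functions_shear[OF \<phi>]] minus_minus)
   finally show ?thesis unfolding test_function_along_flow(1)[OF \<phi>] \<psi>_def .
  qed
  have "(LBINT z. f z * \<phi> (shear (- t) z)) - (LBINT z. f z * \<phi> z) = (LBINT z. f z * (\<phi> (shear (- t) z) - \<phi> z))"
   unfolding right_diff_distrib
   by (rule integral_diff[symmetric, OF pair(3)[OF _ B(2,1)] locally_integrable_mult[OF f _ B(2)]]) measurable
  also have "... = (LBINT z. LBINT s. - (indicator {0..t} s *\<^sub>R (f z * \<psi> (shear (- s) z))))"
   unfolding ftc by (subst integral_mult_right_zero[symmetric]) simp
  also have "... = - (LBINT z. LBINT s. indicator {0..t} s *\<^sub>R (f z * \<psi> (shear (- s) z)))"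
   by (simp only: integral_minus)
  also have "(LBINT z. LBINT s. indicator {0..t} s *\<^sub>R (f z * \<psi> (shear (- s) z)))
    = (LBINT s. LBINT z. indicator {0..t} s *\<^sub>R (f z * \<psi> (shear (- s) z)))"
   by (rule Fubini_swap(1)[symmetric, OF _ sheared_pairing_finite(1)[OF f _ B'(2) t B'(1)]]) measurable
  also have "- \<dots> = (LBINT s. LBINT z. indicator {0..t} s *\<^sub>R (g (shear s z) * \<phi> z))"
   unfolding integral_scaleR_right shift scaleR_minus_right integral_minus ..
  also have "... = (LBINT z. G z * \<phi> z)"
   by (rule G_pair(2)[symmetric, OF _ B(2,1)]) measurable
  finally have "(LBINT z. f (shear t z) * \<phi> z) - (LBINT z. f z * \<phi> z) - (LBINT z. G z * \<phi> z) = 0"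
   using pair(2)[OF _ B(2,1)] by simp
  moreover have "(LBINT z. u z * \<phi> z) = (LBINT z. f (shear t z) * \<phi> z) - (LBINT z. f z * \<phi> z) - (LBINT z. G z * \<phi> z)"
   unfolding u_def left_diff_distrib
   using pair(1)[OF _ B(2,1)] locally_integrable_mult[OF f _ B(2)] G_pair(1)[OF _ B(2,1)] by simp
  ultimately show "(LBINT z. u z * \<phi> z) = 0" by simp
 qed
 then show ?thesis unfolding u_def G_def by simp
qed

text \<open>Jensen's inequality in \<open>s\<close> and invariance of the measure under the flow.\<close>

lemma transport_difference_bound:
 fixes f g :: "'a::euclidean_space \<times> 'a => complex"
 assumes f: "locally_integrable f" and gm[measurable]: "g \<in> borel_fun"
  and gi: "L1 (\<lambda>z. cmod (g z) powr q)" and q: "q > 1" and fg: "weak_transport f g" and t: "t > 0"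
 shows "L1 (\<lambda>z. cmod (f (shear t z) - f z) powr q)" "Lpn q (\<lambda>z. f (shear t z) - f z) \<le> t * Lpn q g"
proof -
 have [measurable]: "f \<in> borel_fun" using f by (simp add: locally_integrable_def)
 define J where "J = (LBINT z. cmod (g z) powr q)"
 have J: "(NBINT z. ennreal (cmod (g z) powr q)) = ennreal J" "J \<ge> 0"
  unfolding J_def by (rule nn_integral_eq_integral[OF gi]) auto
 define M where "M = density lborel (indicator {0..t} :: real => ennreal)"
 have [measurable_cong]: "sets M = sets borel" by (simp add: M_def)
 have eM: "emeasure M (space M) = ennreal t"
  using t by (simp add: M_def emeasure_density)
 then have fin: "finite_measure M" by (intro finite_measureI) simp
 have mM: "measure M (space M) = t" using eM t by (simp add: measure_def)
 have "AE z in lborel. ennreal (cmod (f (shear t z) - f z) powr q)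
   \<le> ennreal (t powr (q - 1)) * (NBINT s. indicator {0..t} s * ennreal (cmod (g (shear s z)) powr q))"
  using weak_transport_mild[OF f locally_integrable_powr[OF gm gi q] fg t]
 proof eventually_elim
  case (elim z)
  have "cmod (f (shear t z) - f z) \<le> (LBINT s. norm (indicator {0..t} s *\<^sub>R g (shear s z)))"
   unfolding elim by (rule integral_norm_bound)
  also have "... = (\<integral>s. cmod (g (shear s z)) \<partial>M)"
   unfolding M_def by (subst integral_real_density[of "indicator {0..t}", unfolded ennreal_indicator]) auto
  finally have "ennreal (cmod (f (shear t z) - f z) powr q) \<le> ennreal ((\<integral>s. cmod (g (shear s z)) \<partial>M) powr q)"
   using q by (intro ennreal_leI powr_mono2) auto
  also have "... \<le> ennreal (t powr (q - 1)) * (\<integral>\<^sup>+s. ennreal (cmod (g (shear s z)) powr q) \<partial>M)"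
   unfolding mM[symmetric] by (rule Jensen_powr[OF q fin]) auto
  also have "(\<integral>\<^sup>+s. ennreal (cmod (g (shear s z)) powr q) \<partial>M) = (NBINT s. indicator {0..t} s * ennreal (cmod (g (shear s z)) powr q))"
   unfolding M_def by (rule nn_integral_density) measurable
  finally show ?case .
 qed
 then have "(NBINT z. ennreal (cmod (f (shear t z) - f z) powr q))
   \<le> (NBINT z. ennreal (t powr (q - 1)) * (NBINT s. indicator {0..t} s * ennreal (cmod (g (shear s z)) powr q)))"
  by (rule nn_integral_mono_AE)
 also have "... = ennreal (t powr (q - 1)) * (NBINT z. NBINT s. indicator {0..t} s * ennreal (cmod (g (shear s z)) powr q))"
  by (rule nn_integral_cmult) measurable
 also have "(NBINT z. NBINT s. indicator {0..t} s * ennreal (cmod (g (shear s z)) powr q))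
   = (NBINT s. NBINT z. indicator {0..t} s * ennreal (cmod (g (shear s z)) powr q))"
  by (rule lborel_pair.Fubini') measurable
 also have "... = (NBINT s. ennreal J * indicator {0..t} s)"
 proof (rule nn_integral_cong, goal_cases)
  case (1 s)
  show ?case
   using nn_integral_shear[of "\<lambda>z. ennreal (cmod (g z) powr q)" s] J(1)
   by (simp add: nn_integral_cmult mult.commute)
 qed
 also have "... = ennreal J * ennreal t" using t by (simp add: nn_integral_cmult_indicator)
 also have "ennreal (t powr (q - 1)) * (ennreal J * ennreal t) = ennreal (t powr q * J)"
 proof -
  have "t powr q = t powr (q - 1) * t powr 1" by (subst powr_add[symmetric]) simp
  then have "t powr q * J = t powr (q - 1) * (J * t)" using t by simp
  then show ?thesis using J(2) t by (simp only: ennreal_mult powr_ge_zero less_imp_le mult_nonneg_nonneg)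
 qed
 finally have n: "(NBINT z. ennreal (cmod (f (shear t z) - f z) powr q)) \<le> ennreal (t powr q * J)" .
 show i: "L1 (\<lambda>z. cmod (f (shear t z) - f z) powr q)"
  by (rule integrableI_nonneg) (use n in \<open>auto intro: le_less_trans\<close>)
 have "(LBINT z. cmod (f (shear t z) - f z) powr q) \<le> t powr q * J"
  using n J(2) by (simp add: nn_integral_eq_integral[OF i])
 then have "Lpn q (\<lambda>z. f (shear t z) - f z) \<le> (t powr q * J) powr (1 / q)"
  unfolding Lpn_def using q by (intro powr_mono2) (auto intro!: integral_nonneg)
 also have "... = t * Lpn q g"
  using t q J(2) by (simp add: powr_mult powr_powr Lpn_def J_def)
 finally show "Lpn q (\<lambda>z. f (shear t z) - f z) \<le> t * Lpn q g" .
qed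

text \<open>Small values are sent to 0, which makes truncations of \<open>L\<^sup>p\<close> functions integrable, and large values are
 projected to a ball. Projections to convex sets are Lipschitz, hence so is the truncation: differences
 along the flow stay under control.\<close>

definition truncation :: "nat => complex => complex" where
 "truncation k z = closest_point (cball 0 (real (Suc k))) (z - closest_point (cball 0 (1 / real (Suc k))) z)"

lemma truncation:
 shows truncation_Lipschitz: "cmod (truncation k z - truncation k w) \<le> 2 * cmod (z - w)"
  and truncation_bounded: "cmod (truncation k z) \<le> real (Suc k)"
  and truncation_zero: "cmod z \<le> 1 / real (Suc k) ==> truncation k z = 0"
  and truncation_le: "cmod (truncation k z) \<le> cmod z"
  and truncation_tendsto: "(\<lambda>k. truncation k z) \<longlonglongrightarrow> z"
proof -
 have lip: "cmod (closest_point (cball 0 r) z - closest_point (cball 0 r) w) \<le> cmod (z - w)" if "r \<ge> 0" for r z w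
  using closest_point_lipschitz[of "cball 0 r" z w] that by (simp add: dist_norm)
 have le: "cmod (closest_point (cball 0 r) z) \<le> r" if "r \<ge> 0" for r z
  using closest_point_in_set[of "cball 0 r" z] that by simp
 have self: "closest_point (cball 0 r) z = z" if "cmod z \<le> r" for r z
  by (rule closest_point_self) (use that in simp)
 have rest: "cmod (z - closest_point (cball 0 r) z) \<le> cmod z" if "r \<ge> 0" for r z
  using closest_point_le[of "cball 0 r" 0 z] that by (simp add: dist_norm)
 have "cmod (truncation k z - truncation k w)
   \<le> cmod ((z - closest_point (cball 0 (1 / real (Suc k))) z) - (w - closest_point (cball 0 (1 / real (Suc k))) w))"
  unfolding truncation_def by (rule lip) simp
 also have "... = cmod ((z - w) - (closest_point (cball 0 (1 / real (Suc k))) z - closest_point (cball 0 (1 / real (Suc k))) w))"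
  by (simp add: algebra_simps)
 also have "... \<le> cmod (z - w) + cmod (z - w)"
  by (rule order_trans[OF norm_triangle_ineq4 add_left_mono[OF lip]]) simp
 finally show "cmod (truncation k z - truncation k w) \<le> 2 * cmod (z - w)" by simp
 show "cmod (truncation k z) \<le> real (Suc k)" unfolding truncation_def by (rule le) simp
 show "truncation k z = 0" if "cmod z \<le> 1 / real (Suc k)"
  unfolding truncation_def self[OF that] by (simp add: self)
 have "cmod (truncation k z - closest_point (cball 0 (real (Suc k))) 0) \<le> cmod ((z - closest_point (cball 0 (1 / real (Suc k))) z) - 0)"
  unfolding truncation_def by (rule lip) simp
 then have "cmod (truncation k z) \<le> cmod (z - closest_point (cball 0 (1 / real (Suc k))) z)" by (simp add: self)
 also have "... \<le> cmod z" by (rule rest) simp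
 finally show "cmod (truncation k z) \<le> cmod z" .
 show "(\<lambda>k. truncation k z) \<longlonglongrightarrow> z"
 proof (rule LIM_zero_cancel, rule Lim_null_comparison[OF _ lim_inverse_n'[THEN LIMSEQ_Suc]])
  obtain N where N: "cmod z \<le> real N" using real_arch_simple by blast
  show "\<forall>\<^sub>F k in sequentially. norm (truncation k z - z) \<le> 1 / real (Suc k)"
  proof (rule eventually_sequentiallyI[of N])
   fix k assume "N \<le> k"
   then have "cmod z \<le> real (Suc k)" using N by linarith
   then have "truncation k z = z - closest_point (cball 0 (1 / real (Suc k))) z"
    unfolding truncation_def by (intro self order_trans[OF rest]) auto
   then show "norm (truncation k z - z) \<le> 1 / real (Suc k)" using le[of "1 / real (Suc k)" z] by simp
  qed
 qed
qed

lemma truncation_measurable [measurable]: "truncation k \<in> borel_fun"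
proof (rule borel_measurable_continuous_onI)
 have "2-lipschitz_on UNIV (truncation k)"
  by (rule lipschitz_onI) (use truncation_Lipschitz in \<open>auto simp: dist_norm\<close>)
 then show "continuous_on UNIV (truncation k)" by (rule lipschitz_on_continuous_on)
qed

text \<open>Velocities at which the \<open>L\<^sup>p\<close> norm in position exceeds \<open>k\<close> are discarded, which yields a bound uniform in
 the velocity. The flow does not change the velocity, so this cut-off does not affect differences along it.\<close>

lemma truncated_tame:
 fixes f :: "'a::euclidean_space \<times> 'a => complex"
 assumes [measurable]: "f \<in> borel_fun" and p: "p > 1"
  and supp: "\<And>x v. norm v > R ==> f (x, v) = 0"
 defines "S \<equiv> \<lambda>v. (NBINT x. ennreal (cmod (f (x, v)) powr p))"
 defines "F \<equiv> \<lambda>k z. if S (snd z) \<le> of_nat k then truncation k (f z) else 0"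
 shows "\<exists>M. tame R M (F k)"
proof -
 have [measurable]: "S \<in> borel_fun" unfolding S_def by measurable
 have [measurable]: "snd \<in> borel_measurable (borel :: ('a \<times> 'a) measure)"
  by (intro borel_measurable_continuous_onI continuous_intros)
 have [measurable]: "F k \<in> borel_fun" unfolding F_def by measurable
 define c where "c = real (Suc k)"
 have c: "c \<ge> 1" by (simp add: c_def)
 have pt: "cmod (truncation k z) \<le> c powr (1 + p) * cmod z powr p" for z
 proof (cases "cmod z \<le> 1 / c")
  case True
  then show ?thesis by (simp add: truncation_zero c_def)
 next
  case False
  then have "1 \<le> c * cmod z" using c by (simp add: field_simps)
  then have "1 \<le> (c * cmod z) powr p" using p by (intro ge_one_powr_ge_zero) auto
  then have "c * 1 \<le> c * (c * cmod z) powr p" using c by (intro mult_left_mono) auto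
  also have "... = c powr (1 + p) * cmod z powr p" using c by (simp add: powr_mult powr_add)
  finally show ?thesis using truncation_bounded[of k z] unfolding c_def[symmetric] by linarith
 qed
 have "(NBINT x. ecmod (F k (x, v))) \<le> ennreal (c powr (1 + p) * c)" for v
 proof (cases "S v \<le> of_nat k")
  case True
  have "(NBINT x. ecmod (F k (x, v))) \<le> (NBINT x. ennreal (c powr (1 + p)) * ennreal (cmod (f (x, v)) powr p))"
  proof (rule nn_integral_mono, goal_cases)
   case (1 x)
   show ?case
    using ennreal_leI[OF pt[of "f (x, v)"]] True by (simp add: F_def ennreal_mult)
  qed
  also have "... = ennreal (c powr (1 + p)) * S v" unfolding S_def by (rule nn_integral_cmult) measurable
  also have "... \<le> ennreal (c powr (1 + p)) * ennreal c"
   using True by (intro mult_left_mono order_trans[OF True]) (auto simp: c_def ennreal_of_nat_eq_real_of_nat intro!: ennreal_leI)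
  finally show ?thesis using c by (simp add: ennreal_mult)
 qed (simp add: F_def)
 moreover have "cmod (F k z) \<le> c" for z using truncation_bounded[of k "f z"] c by (simp add: F_def c_def)
 moreover have "F k (x, v) = 0" if "norm v > R" for x v using supp[OF that] by (simp add: F_def truncation_zero)
 moreover have "c \<le> c powr (1 + p) * c"
 proof -
  have "1 \<le> c powr (1 + p)" using c p by (intro ge_one_powr_ge_zero) auto
  then have "1 * c \<le> c powr (1 + p) * c" using c by (intro mult_right_mono) auto
  then show ?thesis by simp
 qed
 ultimately have "tame R (c powr (1 + p) * c) (F k)" unfolding tame_def by (auto intro: order_trans)
 then show ?thesis by blast
qed

lemma Lpn_mono:
 assumes "\<And>z. cmod (F z) \<le> B * cmod (G z)" and [measurable]: "F \<in> borel_fun" and p: "p > 1" and B: "B > 0"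
  and i: "L1 (\<lambda>z. cmod (G z) powr p)"
 shows "Lpn p F \<le> B * Lpn p G"
proof -
 have "(LBINT z. cmod (F z) powr p) \<le> (LBINT z. B powr p * cmod (G z) powr p)"
 proof (rule integral_mono')
  show "cmod (F z) powr p \<le> B powr p * cmod (G z) powr p" for z
   using powr_mono2[of p, OF _ _ assms(1)[of z]] p B by (simp add: powr_mult)
 qed (use i in auto)
 then have "Lpn p F \<le> (B powr p * (LBINT z. cmod (G z) powr p)) powr (1 / p)"
  unfolding Lpn_def using p by (intro powr_mono2) (auto intro!: integral_nonneg)
 also have "... = B * Lpn p G" using p B by (simp add: powr_mult powr_powr Lpn_def)
 finally show ?thesis .
qed

text \<open>The bounds for tame functions apply to the truncations of \<open>f\<close>, with constants that do not depend on the
 truncation, and dominated convergence gives the pairing for \<open>f\<close>. The majorant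
 \<open>|f (x, v)| |Lambda \<phi> x|\<close>, restricted to \<open>|v| \<le> R\<close>, is integrable by Hoelder's inequality.\<close>

proposition velocity_average_pairing:
 fixes p q R :: real
 assumes p: "1 < p" and q: "1 < q" and pq: "1 / p + 1 / q = 1" and R: "R \<ge> 0"
 obtains C where "C > 0"
  "\<And>(f :: 'a::euclidean_space \<times> 'a => complex) g \<phi>. f \<in> borel_fun ==> g \<in> borel_fun ==>
   L1 (\<lambda>z. cmod (f z) powr p) ==> L1 (\<lambda>z. cmod (g z) powr q) ==>
   (\<And>x v. norm v > R ==> f (x, v) = 0) ==> weak_transport f g ==> \<phi> \<in> test_functions ==>
   L1 (\<lambda>x. (LBINT v. f (x, v)) * Lambda \<phi> x) \<and>
   (cmod (LBINT x. (LBINT v. f (x, v)) * Lambda \<phi> x))\<^sup>2 \<le> C * Lpn p f * Lpn q g * sq_norm \<phi>"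
proof (rule velocity_average_energy[OF p pq R, where 'a='a], goal_cases)
 case (1 C)
 note C = 1(2) and energy = 1(3)
 show ?thesis
 proof (rule that[of "real DIM('a) * (C * 2)"])
  show "real DIM('a) * (C * 2) > 0" using C by simp
  fix f g :: "'a \<times> 'a => complex" and \<phi> :: "'a => complex"
  assume f[measurable]: "f \<in> borel_fun" and g: "g \<in> borel_fun"
   and fi: "L1 (\<lambda>z. cmod (f z) powr p)" and gi: "L1 (\<lambda>z. cmod (g z) powr q)"
   and supp: "\<And>x v. norm v > R ==> f (x, v) = 0" and fg: "weak_transport f g" and \<phi>: "\<phi> \<in> test_functions"
  have floc: "locally_integrable f" by (rule locally_integrable_powr[OF f fi p])
  define S where "S v = (NBINT x. ennreal (cmod (f (x, v)) powr p))" for v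
  define F where "F k z = (if S (snd z) \<le> of_nat k then truncation k (f z) else 0)" for k z
  have [measurable]: "S \<in> borel_fun" unfolding S_def by measurable
  have [measurable]: "snd \<in> borel_measurable (borel :: ('a \<times> 'a) measure)" "fst \<in> borel_measurable (borel :: ('a \<times> 'a) measure)"
   by (intro borel_measurable_continuous_onI continuous_intros)+
  have [measurable]: "F k \<in> borel_fun" for k unfolding F_def by measurable
  note [measurable] = Lambda_measurable[OF \<phi>]
  have F_le: "cmod (F k z) \<le> cmod (f z)" for k z using truncation_le[of k "f z"] by (simp add: F_def)
  have F_lip: "cmod (F k (shear t z) - F k z) \<le> 2 * cmod (f (shear t z) - f z)" for k t z
   using truncation_Lipschitz[of k "f (shear t z)" "f z"] by (simp add: F_def shear_def)
  have "\<forall>k. \<exists>M. tame R M (F k)"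
   using truncated_tame[OF f p supp] unfolding F_def[abs_def] S_def by (rule allI)
  then obtain M where "\<forall>k. tame R (M k) (F k)" by (rule choice[THEN exE])
  then have tame: "\<And>k. tame R (M k) (F k)" by simp
  define h where "h k x = (LBINT v. F k (x, v))" for k x
  define H where "H x = (LBINT v. f (x, v))" for x
  have Fint: "integrable (lborel \<Otimes>\<^sub>M lborel) (F k)" for k
   using tame_integrable(1)[OF tame[of k]] by (simp add: lborel_prod)
  have hint: "L1 (h k)" for k
   unfolding h_def by (rule lborel_pair.integrable_fst'[OF Fint])
  have bound_k: "(cmod (LBINT x. h k x * Lambda \<phi> x))\<^sup>2 \<le> real DIM('a) * (C * 2) * Lpn p f * Lpn q g * sq_norm \<phi>" for k
  proof -
   have e: "(NBINT \<xi>. ennreal (\<bar>\<xi> \<bullet> b\<bar> * (cmod (FT (h k) \<xi>))\<^sup>2)) \<le> ennreal (C * (2 * Lpn q g) * Lpn p (F k))" if b: "b \<in> Basis" for b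
    unfolding h_def
   proof (rule energy[OF tame _ b])
    show "0 \<le> 2 * Lpn q g" by (simp add: Lpn_def)
    fix t :: real assume t: "t > 0"
    note d = transport_difference_bound[OF floc g gi q fg t]
    have "Lpn q (\<lambda>u. F k (shear t u) - F k u) \<le> 2 * Lpn q (\<lambda>z. f (shear t z) - f z)"
     by (rule Lpn_mono[OF F_lip _ q _ d(1)]) auto
    also have "... \<le> 2 * (t * Lpn q g)" using d(2) by simp
    finally show "Lpn q (\<lambda>u. F k (shear t u) - F k u) \<le> t * (2 * Lpn q g)" by simp
   qed
   have "(cmod (LBINT x. h k x * Lambda \<phi> x))\<^sup>2 \<le> real DIM('a) * (C * (2 * Lpn q g) * Lpn p (F k)) * sq_norm \<phi>"
    by (rule Lambda_pairing_bound[OF \<phi> hint _ e]) (use C in \<open>auto simp: Lpn_def\<close>)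
   also have "... \<le> real DIM('a) * (C * (2 * Lpn q g) * Lpn p f) * sq_norm \<phi>"
    using Lpn_mono[of "F k" 1 f p] F_le p fi C
    by (intro mult_right_mono mult_left_mono) (auto simp: Lpn_def)
   finally show ?thesis by (simp add: mult_ac)
  qed
  define G where "G z = cmod (Lambda \<phi> (fst z)) * indicator (cball 0 R) (snd z)" for z :: "'a \<times> 'a"
  have [measurable]: "cball 0 R \<in> sets (borel :: 'a measure)" by simp
  have [measurable]: "G \<in> borel_fun" unfolding G_def by measurable
  have Gi: "L1 (\<lambda>z. G z powr q)"
  proof -
   have G_eq: "G (x, v) powr q = cmod (Lambda \<phi> x) powr q * (1 * indicator (cball 0 R) v)" for x v
    by (simp add: G_def indicator_def)
   have "integrable (lborel \<Otimes>\<^sub>M lborel) (\<lambda>z. G z powr q)"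
   proof (rule lborel_pair.Fubini_integrable)
    show "L1 (\<lambda>x. LBINT v. norm (G (x, v) powr q))"
     unfolding G_eq by (simp add: norm_mult Lambda_powr_integrable[OF \<phi> q])
    show "AE x in lborel. L1 (\<lambda>v. G (x, v) powr q)"
     unfolding G_eq by (intro AE_I2 integrable_mult_right integrable_indicator_cball)
   qed (simp add: lborel_prod)
   then show ?thesis by (simp add: lborel_prod)
  qed
  have dom: "integrable (lborel \<Otimes>\<^sub>M lborel) (\<lambda>z. cmod (f z) * G z)"
   unfolding lborel_prod by (rule Holder_inequality(1)[OF p pq _ _ _ _ fi Gi]) (auto simp: G_def)
  have domG: "cmod (w * Lambda \<phi> (fst z)) \<le> cmod (f z) * G z" if "cmod w \<le> cmod (f z)" for w z
  proof (cases "norm (snd z) > R")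
   case True
   then have "f z = 0" using supp[of "snd z" "fst z"] by simp
   then show ?thesis using that by simp
  next
   case False
   then show ?thesis using that by (simp add: G_def norm_mult mult_right_mono)
  qed
  have pairing: "L1 (\<lambda>x. (LBINT v. u (x, v)) * Lambda \<phi> x)"
    "(LBINT x. (LBINT v. u (x, v)) * Lambda \<phi> x) = (\<integral>z. u z * Lambda \<phi> (fst z) \<partial>(lborel \<Otimes>\<^sub>M lborel))"
   if [measurable]: "u \<in> borel_fun" and u: "\<And>z. cmod (u z) \<le> cmod (f z)" for u
  proof -
   have i: "integrable (lborel \<Otimes>\<^sub>M lborel) (\<lambda>z. u z * Lambda \<phi> (fst z))"
   proof (rule integrable_bound[OF dom])
    show "AE z in lborel \<Otimes>\<^sub>M lborel. norm (u z * Lambda \<phi> (fst z)) \<le> norm (cmod (f z) * G z)"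
    proof (rule AE_I2, goal_cases)
     case (1 z)
     show ?case
      using order_trans[OF domG[OF u[of z]] abs_ge_self] by simp
    qed
    show "(\<lambda>z. u z * Lambda \<phi> (fst z)) \<in> borel_measurable (lborel \<Otimes>\<^sub>M lborel)" unfolding lborel_prod by measurable
   qed
   show "L1 (\<lambda>x. (LBINT v. u (x, v)) * Lambda \<phi> x)"
    using lborel_pair.integrable_fst'[OF i] by simp
   show "(LBINT x. (LBINT v. u (x, v)) * Lambda \<phi> x) = (\<integral>z. u z * Lambda \<phi> (fst z) \<partial>(lborel \<Otimes>\<^sub>M lborel))"
    using lborel_pair.integral_fst'[OF i] by simp
  qed
  have "(\<lambda>k. \<integral>z. F k z * Lambda \<phi> (fst z) \<partial>(lborel \<Otimes>\<^sub>M lborel)) \<longlonglongrightarrow> (\<integral>z. f z * Lambda \<phi> (fst z) \<partial>(lborel \<Otimes>\<^sub>M lborel))"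
  proof (rule integral_dominated_convergence[where w="\<lambda>z. cmod (f z) * G z"])
   have "(NBINT v. S v) = (\<integral>\<^sup>+z. ennreal (cmod (f z) powr p) \<partial>(lborel \<Otimes>\<^sub>M lborel))"
    unfolding S_def by (subst lborel_pair.nn_integral_snd[symmetric]) (simp_all add: case_prod_beta lborel_prod)
   also have "... < \<infinity>" using fi by (simp add: integrable_iff_bounded lborel_prod)
   finally have "AE v in lborel. S v \<noteq> \<infinity>" by (intro nn_integral_PInf_AE) auto
   then have "AE x in lborel. AE v in lborel. S (snd (x :: 'a, v)) \<noteq> \<infinity>" by simp
   then have "AE z in lborel \<Otimes>\<^sub>M (lborel :: 'a measure). S (snd (z :: 'a \<times> 'a)) \<noteq> \<infinity>"
   proof (rule lborel_pair.AE_pair_measure[rotated])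
    show "{z \<in> space (lborel \<Otimes>\<^sub>M (lborel :: 'a measure)). S (snd (z :: 'a \<times> 'a)) \<noteq> \<infinity>} \<in> sets (lborel \<Otimes>\<^sub>M lborel)"
     unfolding lborel_prod by measurable
   qed
   then show "AE z in lborel \<Otimes>\<^sub>M lborel. (\<lambda>k. F k z * Lambda \<phi> (fst z)) \<longlonglongrightarrow> f z * Lambda \<phi> (fst z)"
   proof eventually_elim
    case (elim z)
    then have "S (snd z) < top" by (simp add: less_top)
    then obtain N :: nat where N: "S (snd z) < of_nat N" using ennreal_Ex_less_of_nat by blast
    have "\<forall>\<^sub>F k in sequentially. truncation k (f z) = F k z"
    proof (rule eventually_sequentiallyI[of N])
     fix k assume "N \<le> k"
     then have "of_nat N \<le> (of_nat k :: ennreal)" by (simp only: of_nat_le_iff)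
     then have "S (snd z) \<le> of_nat k" using N by (auto intro: order_trans less_imp_le)
     then show "truncation k (f z) = F k z" by (simp add: F_def)
    qed
    from Lim_transform_eventually[OF truncation_tendsto this]
    show ?case by (intro tendsto_mult tendsto_const)
   qed
   show "AE z in lborel \<Otimes>\<^sub>M lborel. norm (F k z * Lambda \<phi> (fst z)) \<le> cmod (f z) * G z" for k
    by (rule AE_I2) (rule domG[OF F_le])
  qed (use dom in \<open>auto simp: lborel_prod\<close>)
  then have "(\<lambda>k. LBINT x. h k x * Lambda \<phi> x) \<longlonglongrightarrow> (LBINT x. H x * Lambda \<phi> x)"
   unfolding h_def H_def by (simp add: pairing(2) F_le)
  then have "(cmod (LBINT x. H x * Lambda \<phi> x))\<^sup>2 \<le> real DIM('a) * (C * 2) * Lpn p f * Lpn q g * sq_norm \<phi>"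
   by (intro LIMSEQ_le_const2[OF tendsto_power[OF tendsto_norm]]) (use bound_k in auto)
  then show "L1 (\<lambda>x. (LBINT v. f (x, v)) * Lambda \<phi> x) \<and>
   (cmod (LBINT x. (LBINT v. f (x, v)) * Lambda \<phi> x))\<^sup>2 \<le> real DIM('a) * (C * 2) * Lpn p f * Lpn q g * sq_norm \<phi>"
   using pairing(1)[of f] unfolding H_def by simp
 qed
qed

section \<open>Velocity averages\<close>

lemma lebesgue_eq_borel:
 fixes u u' :: "'a::euclidean_space => 'b::{banach, second_countable_topology}"
 assumes [measurable]: "u' \<in> borel_fun" and ae: "AE x in lborel. u x = u' x"
 shows "u \<in> borel_measurable lebesgue" "(\<integral>x. u x \<partial>lebesgue) = (LBINT x. u' x)"
  "integrable lebesgue u \<longleftrightarrow> L1 u'"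
proof -
 have ae': "AE x in lebesgue. u x = u' x" by (rule AE_completion[OF ae])
 have m': "u' \<in> borel_measurable lborel" by measurable
 have ml: "u' \<in> borel_measurable lebesgue" by (rule measurable_completion[OF m'])
 show m: "u \<in> borel_measurable lebesgue"
 proof (rule measurableI)
  fix A :: "'b set" assume A: "A \<in> sets borel"
  show "u -` A \<inter> space lebesgue \<in> sets lebesgue"
  proof (rule completion.in_sets_AE)
   show "u' -` A \<inter> space lebesgue \<in> sets lebesgue" by (rule measurable_sets[OF ml A])
   show "AE x in lebesgue. x \<in> u' -` A \<inter> space lebesgue \<longleftrightarrow> x \<in> u -` A \<inter> space lebesgue"
    using ae' by eventually_elim auto
  qed simp
 qed simp
 have "(\<integral>x. u x \<partial>lebesgue) = (\<integral>x. u' x \<partial>lebesgue)"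
  by (rule integral_cong_AE[OF m ml ae'])
 also have "... = (LBINT x. u' x)" by (rule integral_completion[OF m'])
 finally show "(\<integral>x. u x \<partial>lebesgue) = (LBINT x. u' x)" .
 have "integrable lebesgue u \<longleftrightarrow> integrable lebesgue u'" by (rule integrable_cong_AE[OF m ml ae'])
 also have "... \<longleftrightarrow> L1 u'" by (rule integrable_completion[OF m'])
 finally show "integrable lebesgue u \<longleftrightarrow> L1 u'" .
qed

lemma lebesgue_borel_version:
 fixes u :: "'a::euclidean_space => complex"
 assumes "u \<in> borel_measurable lebesgue"
 obtains u' where "u' \<in> borel_fun" "AE x in lborel. u x = u' x"
proof -
 have R: "(\<lambda>x. Re (u x)) \<in> borel_measurable lebesgue" and I: "(\<lambda>x. Im (u x)) \<in> borel_measurable lebesgue"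
  using assms by measurable
 obtain r where r: "r \<in> borel_measurable lborel" "AE x in lborel. Re (u x) = r x"
  using completion_ex_borel_measurable_real[OF R] by (elim bexE)
 obtain i where i: "i \<in> borel_measurable lborel" "AE x in lborel. Im (u x) = i x"
  using completion_ex_borel_measurable_real[OF I] by (elim bexE)
 note [measurable] = r(1) i(1)
 show ?thesis
 proof (rule that)
  have "(\<lambda>x. complex_of_real (r x) + \<i> * complex_of_real (i x)) \<in> borel_measurable lborel" by measurable
  then show "(\<lambda>x. complex_of_real (r x) + \<i> * complex_of_real (i x)) \<in> borel_fun" by simp
  show "AE x in lborel. u x = complex_of_real (r x) + \<i> * complex_of_real (i x)"
   using r(2) i(2) by eventually_elim (simp add: complex_eq_iff)
 qed
qed

lemma Lp_borel_version:
 assumes "f \<in> Lp p"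
 obtains f' where "f' \<in> borel_fun" "AE x in lborel. f x = f' x"
  "L1 (\<lambda>x. cmod (f' x) powr p)" "Lp_norm p f = Lpn p f'"
proof -
 obtain f' where [measurable]: "f' \<in> borel_fun" and ae: "AE x in lborel. f x = f' x"
  using lebesgue_borel_version[of f] assms unfolding Lp_def by auto
 have m: "(\<lambda>x. cmod (f' x) powr p) \<in> borel_fun" by measurable
 have "AE x in lborel. cmod (f x) powr p = cmod (f' x) powr p" using ae by eventually_elim simp
 note e = lebesgue_eq_borel(2,3)[OF m this]
 show ?thesis
  by (rule that[of f']) (use assms ae e in \<open>auto simp: Lp_def Lp_norm_def Lpn_def\<close>)
qed

lemma Lambda_linear:
 assumes \<phi>: "\<phi> \<in> test_functions" and \<psi>: "\<psi> \<in> test_functions"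
 shows "Lambda (\<lambda>x. \<phi> x + \<psi> x) = (\<lambda>x. Lambda \<phi> x + Lambda \<psi> x)" "Lambda (\<lambda>x. c * \<phi> x) = (\<lambda>x. c * Lambda \<phi> x)"
proof -
 have i: "L1 (\<lambda>x. cis (- (x \<bullet> \<xi>)) * \<phi> x)" if "\<phi> \<in> test_functions" for \<phi> and \<xi> :: 'a
  by (rule cis_mult_integrable[OF test_function_integrable[OF that]]) measurable
 have j: "L1 (\<lambda>\<xi>. cis (x \<bullet> \<xi>) * (of_real (norm \<xi> powr (1/2)) * FT \<phi> \<xi>))" if "\<phi> \<in> test_functions" for \<phi> and x :: 'a
  by (rule cis_mult_integrable[OF FT_test_integrable(1)[OF that]]) measurable
 have "FT (\<lambda>x. \<phi> x + \<psi> x) \<xi> = FT \<phi> \<xi> + FT \<psi> \<xi>" for \<xi>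
  unfolding FT_def by (simp add: distrib_left i \<phi> \<psi>)
 then show "Lambda (\<lambda>x. \<phi> x + \<psi> x) = (\<lambda>x. Lambda \<phi> x + Lambda \<psi> x)"
  unfolding Lambda_def[abs_def] by (simp add: distrib_left j \<phi> \<psi> add_divide_distrib)
 have "FT (\<lambda>x. c * \<phi> x) \<xi> = c * FT \<phi> \<xi>" for \<xi>
  unfolding FT_def by (simp only: mult.left_commute[of _ c] integral_mult_right_zero)
 then show "Lambda (\<lambda>x. c * \<phi> x) = (\<lambda>x. c * Lambda \<phi> x)"
  unfolding Lambda_def[abs_def] by (simp only: mult.left_commute[of _ c] integral_mult_right_zero times_divide_eq_right)
qed

lemma Lpn_2_sq: "(Lpn 2 w)\<^sup>2 = sq_norm w"
proof -
 have "0 \<le> sq_norm w" by (rule integral_nonneg) simp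
 then show ?thesis by (simp add: Lpn_def powr_numeral powr_half_sqrt)
qed

text \<open>Two such functions have the same integrals against all test functions, so they agree almost everywhere.
 Hence \<open>Hdot_norm\<close> can be computed from any of them.\<close>

lemma frac_laplacian_unique:
 fixes h w w' :: "'a::euclidean_space => complex"
 assumes w: "w \<in> Lp 2" "has_frac_laplacian a h w" and w': "w' \<in> Lp 2" "has_frac_laplacian a h w'"
 shows "Lp_norm 2 w = Lp_norm 2 w'"
proof -
 obtain v where v[measurable]: "v \<in> borel_fun" and av: "AE x in lborel. w x = v x" and iv: "L1 (\<lambda>x. cmod (v x) powr 2)" and nv: "Lp_norm 2 w = Lpn 2 v"
  using w(1) by (rule Lp_borel_version)
 obtain v' where v'[measurable]: "v' \<in> borel_fun" and av': "AE x in lborel. w' x = v' x" and iv': "L1 (\<lambda>x. cmod (v' x) powr 2)" and nv': "Lp_norm 2 w' = Lpn 2 v'"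
  using w'(1) by (rule Lp_borel_version)
 have loc: "locally_integrable v" "locally_integrable v'"
  using locally_integrable_powr[OF v iv] locally_integrable_powr[OF v' iv'] by simp_all
 have "AE x in lborel. v x - v' x = 0"
 proof (rule du_Bois_Reymond)
  fix a c :: 'a
  obtain R where R: "\<forall>z\<in>box a c. norm z \<le> R" using bounded_box[of a c] unfolding bounded_iff by auto
  have b: "cmod (indicator (box a c) z) \<le> 1 * indicator (cball 0 R) z" for z
   using R by (auto simp: indicator_def)
  have "L1 (\<lambda>z. v z * indicator (box a c) z - v' z * indicator (box a c) z)"
   by (intro integrable_diff locally_integrable_mult[OF loc(1) _ b] locally_integrable_mult[OF loc(2) _ b]) auto
  moreover have "v z * indicator (box a c) z - v' z * indicator (box a c) z = indicator (box a c) z *\<^sub>R (v z - v' z)" for z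
   by (simp add: indicator_def)
  ultimately show "L1 (\<lambda>z. indicator (box a c) z *\<^sub>R (v z - v' z))" by simp
 next
  fix \<phi> :: "'a => complex" assume \<phi>: "\<phi> \<in> test_functions"
  note [measurable] = test_functionsD(4)[OF \<phi>]
  have m: "(\<lambda>x. v x * \<phi> x) \<in> borel_fun" "(\<lambda>x. v' x * \<phi> x) \<in> borel_fun" by measurable
  have "AE x in lborel. w x * \<phi> x = v x * \<phi> x" using av by eventually_elim simp
  note e = lebesgue_eq_borel(2,3)[OF m(1) this]
  have "AE x in lborel. w' x * \<phi> x = v' x * \<phi> x" using av' by eventually_elim simp
  note e' = lebesgue_eq_borel(2,3)[OF m(2) this]
  have "L1 (\<lambda>x. v x * \<phi> x)" "L1 (\<lambda>x. v' x * \<phi> x)" "(LBINT x. v x * \<phi> x) = (LBINT x. v' x * \<phi> x)"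
   using w(2) w'(2) \<phi> unfolding has_frac_laplacian_def e[symmetric] e'[symmetric] by auto
  then show "(LBINT x. (v x - v' x) * \<phi> x) = 0" by (simp add: left_diff_distrib)
 qed measurable
 then have "AE x in lborel. cmod (v x) powr 2 = cmod (v' x) powr 2" by eventually_elim simp
 then have "(LBINT x. cmod (v x) powr 2) = (LBINT x. cmod (v' x) powr 2)"
  by (intro integral_cong_AE) auto
 then show ?thesis unfolding nv nv' Lpn_def by simp
qed

lemma velocity_average_borel_version:
 fixes f f' :: "(real^'n) \<times> (real^'n) => complex"
 assumes [measurable]: "f' \<in> borel_fun" and ae: "AE z in lborel. f z = f' z"
 shows "AE x in lborel. velocity_average f x = (LBINT v. f' (x, v))"
proof -
 have "AE z in lborel \<Otimes>\<^sub>M lborel. f z = f' z" unfolding lborel_prod by (rule ae)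
 then have "AE x in lborel. AE v in lborel. f (x, v) = f' (x, v)" by (rule lborel_pair.AE_pair)
 then show ?thesis
 proof eventually_elim
  case (elim x)
  have m: "(\<lambda>v. f' (x, v)) \<in> borel_fun" by measurable
  show ?case unfolding velocity_average_def by (rule lebesgue_eq_borel(2)[OF m elim])
 qed
qed

text \<open>After passing to Borel functions, with \<open>f\<close> equal to 0 for all \<open>|v| > R\<close>, the functional
 \<open>\<phi> \<mapsto> \<integral> h |D|\<^sup>1\<^sup>/\<^sup>2 \<phi>\<close> is bounded in the \<open>L\<^sup>2\<close> norm and so is represented by an \<open>L\<^sup>2\<close> function.\<close>

theorem velocity_average_half_derivative:
 fixes p q R :: real
 assumes p: "1 < p" and q: "1 < q" and pq: "1 / p + 1 / q = 1" and R: "R \<ge> 0"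
 obtains C where "C > 0"
  "\<And>(f :: (real^'n) \<times> (real^'n) => complex) g. f \<in> Lp p ==> vanishes_outside (cball 0 R) f ==>
   has_transport_derivative f g ==> g \<in> Lp q ==>
   \<exists>w\<in>Lp 2. has_frac_laplacian (1 / 2 / 2) (velocity_average f) w \<and> (Lp_norm 2 w)\<^sup>2 \<le> C * Lp_norm p f * Lp_norm q g"
proof (rule velocity_average_pairing[OF p q pq R, where 'a="real^'n"], goal_cases)
 case (1 C)
 note C = 1(2) and pairing = 1(3)
 show ?thesis
 proof (rule that[OF C])
  fix f g :: "(real^'n) \<times> (real^'n) => complex"
  assume f: "f \<in> Lp p" and K: "vanishes_outside (cball 0 R) f" and fg: "has_transport_derivative f g" and g: "g \<in> Lp q"
  obtain g' where g'[measurable]: "g' \<in> borel_fun" and ag: "AE x in lborel. g x = g' x" and ig: "L1 (\<lambda>x. cmod (g' x) powr q)" and ng: "Lp_norm q g = Lpn q g'"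
   using g by (rule Lp_borel_version)
  obtain f0 where [measurable]: "f0 \<in> borel_fun" and af0: "AE x in lborel. f x = f0 x" and if0: "L1 (\<lambda>x. cmod (f0 x) powr p)" and nf: "Lp_norm p f = Lpn p f0"
   using f by (rule Lp_borel_version)
  define f' where "f' z = (if norm (snd z) \<le> R then f0 z else 0)" for z
  have [measurable]: "snd \<in> borel_measurable (borel :: ((real^'n) \<times> (real^'n)) measure)"
   by (intro borel_measurable_continuous_onI continuous_intros)
  have f'[measurable]: "f' \<in> borel_fun" unfolding f'_def by measurable
  have "AE z in lborel. snd z \<notin> cball 0 R \<longrightarrow> f z = 0"
   using K unfolding vanishes_outside_def AE_completion_iff .
  then have af0': "AE z in lborel. f0 z = f' z" and af: "AE z in lborel. f z = f' z"
   using af0 by (eventually_elim, simp add: f'_def)+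
  have ap: "AE z in lborel. cmod (f0 z) powr p = cmod (f' z) powr p" using af0' by eventually_elim simp
  have if': "L1 (\<lambda>z. cmod (f' z) powr p)"
   using if0 by (subst (asm) integrable_cong_AE[OF _ _ ap]) auto
  have "(LBINT z. cmod (f0 z) powr p) = (LBINT z. cmod (f' z) powr p)"
   by (rule integral_cong_AE[OF _ _ ap]) auto
  then have nf': "Lp_norm p f = Lpn p f'" unfolding nf Lpn_def by simp
  have wt: "weak_transport f' g'"
   unfolding weak_transport_def
  proof
   fix \<phi> :: "(real^'n) \<times> (real^'n) => complex" assume \<phi>: "\<phi> \<in> test_functions"
   note [measurable] = test_functionsD(4)[OF \<phi>] borel_measurable_continuous_onI[OF transport_field_test(1)[OF \<phi>]]
   have m: "(\<lambda>z. f' z * frechet_derivative \<phi> (at z) (snd z, 0)) \<in> borel_fun" "(\<lambda>z. g' z * \<phi> z) \<in> borel_fun" by measurable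
   have a1: "AE z in lborel. f z * frechet_derivative \<phi> (at z) (snd z, 0) = f' z * frechet_derivative \<phi> (at z) (snd z, 0)"
    using af by eventually_elim simp
   have a2: "AE z in lborel. g z * \<phi> z = g' z * \<phi> z" using ag by eventually_elim simp
   show "(LBINT z. f' z * frechet_derivative \<phi> (at z) (snd z, 0)) = - (LBINT z. g' z * \<phi> z)"
    unfolding lebesgue_eq_borel(2)[OF m(1) a1, symmetric] lebesgue_eq_borel(2)[OF m(2) a2, symmetric]
    using fg \<phi> unfolding has_transport_derivative_def by (rule bspec)
  qed
  have supp: "f' (x, v) = 0" if "norm v > R" for x v using that by (simp add: f'_def)
  define H where "H x = (LBINT v. f' (x, v))" for x
  have [measurable]: "H \<in> borel_fun" unfolding H_def by measurable
  have aH: "AE x in lborel. velocity_average f x = H x"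
   unfolding H_def by (rule velocity_average_borel_version[OF f' af])
  define l where "l \<phi> = (LBINT x. H x * Lambda \<phi> x)" for \<phi>
  define B where "B = C * Lpn p f' * Lpn q g'"
  have B: "B \<ge> 0" unfolding B_def using C by (simp add: Lpn_def)
  have pr: "L1 (\<lambda>x. H x * Lambda \<phi> x) \<and> (cmod (LBINT x. H x * Lambda \<phi> x))\<^sup>2 \<le> B * sq_norm \<phi>"
   if "\<phi> \<in> test_functions" for \<phi>
   unfolding H_def B_def by (rule pairing[OF f' g' if' ig supp wt that])
  have li: "L1 (\<lambda>x. H x * Lambda \<phi> x)" if "\<phi> \<in> test_functions" for \<phi> using pr[OF that] by simp
  show "\<exists>w\<in>Lp 2. has_frac_laplacian (1 / 2 / 2) (velocity_average f) w \<and> (Lp_norm 2 w)\<^sup>2 \<le> C * Lp_norm p f * Lp_norm q g"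
  proof (rule Riesz_representation_test[where l=l and B=B])
   fix \<phi> \<psi> :: "real^'n => complex" assume \<phi>: "\<phi> \<in> test_functions" and \<psi>: "\<psi> \<in> test_functions"
   show "l (\<lambda>x. \<phi> x + \<psi> x) = l \<phi> + l \<psi>"
    unfolding l_def Lambda_linear(1)[OF \<phi> \<psi>] distrib_left
    by (rule integral_add[OF li[OF \<phi>] li[OF \<psi>]])
  next
   fix c and \<phi> :: "real^'n => complex" assume \<phi>: "\<phi> \<in> test_functions"
   show "l (\<lambda>x. c * \<phi> x) = c * l \<phi>"
    unfolding l_def Lambda_linear(2)[OF \<phi> \<phi>] mult.left_commute[of _ c] by (rule integral_mult_right_zero)
   show "(cmod (l \<phi>))\<^sup>2 \<le> B * sq_norm \<phi>" using pr[OF \<phi>] unfolding l_def by simp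
  next
   show "0 \<le> B" by (rule B)
  next
   fix w :: "real^'n => complex"
   assume w: "square_integrable w" and rep: "\<And>\<phi>. \<phi> \<in> test_functions ==> l \<phi> = (LBINT x. w x * \<phi> x)" and wB: "sq_norm w \<le> B"
   have wm[measurable]: "w \<in> borel_fun" using w by (simp add: square_integrable_def)
   have m2: "(\<lambda>x. cmod (w x) powr 2) \<in> borel_fun" by measurable
   note e2 = lebesgue_eq_borel(2,3)[OF m2 AE_I2[OF refl]]
   have "w \<in> Lp 2"
    using w lebesgue_eq_borel(1)[OF wm AE_I2[OF refl]] unfolding Lp_def mem_Collect_eq e2 by (simp add: square_integrable_def powr_numeral)
   moreover have "has_frac_laplacian (1 / 2 / 2) (velocity_average f) w"
    unfolding has_frac_laplacian_def
   proof (intro ballI conjI)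
    fix \<phi> :: "real^'n => complex" assume \<phi>: "\<phi> \<in> test_functions"
    note [measurable] = test_functionsD(4)[OF \<phi>] Lambda_measurable[OF \<phi>]
    have m: "(\<lambda>x. H x * Lambda \<phi> x) \<in> borel_fun" "(\<lambda>x. w x * \<phi> x) \<in> borel_fun" by measurable
    have "AE x in lborel. velocity_average f x * Lambda \<phi> x = H x * Lambda \<phi> x" using aH by eventually_elim simp
    note e = lebesgue_eq_borel(2,3)[OF m(1) this] lebesgue_eq_borel(2,3)[OF m(2) AE_I2[OF refl]]
    show "integrable lebesgue (\<lambda>x. velocity_average f x * frac_laplacian (1 / 2 / 2) \<phi> x)"
     unfolding frac_laplacian_eq_Lambda[OF \<phi>] e by (rule li[OF \<phi>])
    show "integrable lebesgue (\<lambda>x. w x * \<phi> x)"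
     unfolding e by (rule square_integrable_mult[OF w test_square_integrable[OF \<phi>]])
    show "(\<integral>x. velocity_average f x * frac_laplacian (1 / 2 / 2) \<phi> x \<partial>lebesgue) = (\<integral>x. w x * \<phi> x \<partial>lebesgue)"
     unfolding frac_laplacian_eq_Lambda[OF \<phi>] e using rep[OF \<phi>] unfolding l_def .
   qed
   moreover have "(Lp_norm 2 w)\<^sup>2 \<le> C * Lp_norm p f * Lp_norm q g"
   proof -
    have "Lp_norm 2 w = Lpn 2 w" unfolding Lp_norm_def Lpn_def e2 ..
    moreover have "(Lpn 2 w)\<^sup>2 = sq_norm w" by (rule Lpn_2_sq)
    ultimately show ?thesis using wB unfolding B_def nf' ng by simp
   qed
   ultimately show ?thesis by blast
  qed
 qed
qed

theorem theorem2p2: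
 fixes p p' :: real
 assumes "1 < p" and "1 / p + 1 / p' = 1"
 shows "(\<forall>(f :: (real^'n) \<times> (real^'n) \<Rightarrow> complex) g.
      f \<in> Lp p \<and> (\<exists>K. compact K \<and> vanishes_outside K f) \<and>
      has_transport_derivative f g \<and> g \<in> Lp p'
      \<longrightarrow> velocity_average f \<in> Hdot (1 / 2)) \<and>
     (\<forall>K :: (real^'n) set. compact K \<longrightarrow>
      (\<exists>C > 0. \<forall>(f :: (real^'n) \<times> (real^'n) \<Rightarrow> complex) g.
        f \<in> Lp p \<and> vanishes_outside K f \<and>
        has_transport_derivative f g \<and> g \<in> Lp p'
        \<longrightarrow> (Hdot_norm (1 / 2) (velocity_average f))\<^sup>2 \<le> C * Lp_norm p f * Lp_norm p' g))"
proof -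
 have p': "1 < p'"
 proof -
  have "1 / p < 1" "0 < 1 / p" using assms(1) by simp_all
  then have "0 < 1 / p'" "1 / p' < 1" using assms(2) by linarith+
  then show ?thesis by (simp add: divide_less_eq zero_less_divide_iff split: if_splits)
 qed
 have key: "\<exists>C>0. \<forall>(f :: (real^'n) \<times> (real^'n) \<Rightarrow> complex) g. f \<in> Lp p \<longrightarrow> vanishes_outside K f \<longrightarrow>
   has_transport_derivative f g \<longrightarrow> g \<in> Lp p' \<longrightarrow>
   (\<exists>w\<in>Lp 2. has_frac_laplacian (1 / 2 / 2) (velocity_average f) w \<and> (Lp_norm 2 w)\<^sup>2 \<le> C * Lp_norm p f * Lp_norm p' g)"
  if K: "compact K" for K :: "(real^'n) set"
 proof -
  obtain R where R: "R > 0" "\<forall>v\<in>K. norm v \<le> R"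
   using compact_imp_bounded[OF K] unfolding bounded_pos by auto
  have van: "vanishes_outside (cball 0 R) f" if "vanishes_outside K f" for f :: "(real^'n) \<times> (real^'n) \<Rightarrow> complex"
   using that unfolding vanishes_outside_def by eventually_elim (use R in auto)
  show ?thesis
  proof (rule velocity_average_half_derivative[OF assms(1) p' assms(2) less_imp_le[OF R(1)], where 'n='n], goal_cases)
   case (1 C)
   show ?case by (intro exI[of _ C] conjI allI impI 1 van)
  qed
 qed
 show ?thesis
 proof (intro conjI allI impI, goal_cases)
  case (1 f g)
  then obtain K where K: "compact K" "vanishes_outside K f" by blast
  show ?case using key[OF K(1)] K(2) 1 unfolding Hdot_def by blast
 next
  case (2 K)
  obtain C where C: "C > 0" "\<forall>(f :: (real^'n) \<times> (real^'n) \<Rightarrow> complex) g. f \<in> Lp p \<longrightarrow> vanishes_outside K f \<longrightarrow>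
   has_transport_derivative f g \<longrightarrow> g \<in> Lp p' \<longrightarrow>
   (\<exists>w\<in>Lp 2. has_frac_laplacian (1 / 2 / 2) (velocity_average f) w \<and> (Lp_norm 2 w)\<^sup>2 \<le> C * Lp_norm p f * Lp_norm p' g)"
   using key[OF 2] by (elim exE conjE)
  show ?case
  proof (intro exI[of _ C] conjI allI impI C(1))
   fix f g :: "(real^'n) \<times> (real^'n) \<Rightarrow> complex"
   assume fg: "f \<in> Lp p \<and> vanishes_outside K f \<and> has_transport_derivative f g \<and> g \<in> Lp p'"
   then obtain w where w: "w \<in> Lp 2" "has_frac_laplacian (1 / 2 / 2) (velocity_average f) w"
     "(Lp_norm 2 w)\<^sup>2 \<le> C * Lp_norm p f * Lp_norm p' g"
    using C(2) by blast
   define w' where "w' = (SOME w. w \<in> Lp 2 \<and> has_frac_laplacian (1 / 2 / 2) (velocity_average f) w)"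
   have "w' \<in> Lp 2 \<and> has_frac_laplacian (1 / 2 / 2) (velocity_average f) w'"
    unfolding w'_def by (rule someI[of _ w]) (use w in simp)
   then have "Lp_norm 2 w' = Lp_norm 2 w" using frac_laplacian_unique w(1,2) by blast
   then show "(Hdot_norm (1 / 2) (velocity_average f))\<^sup>2 \<le> C * Lp_norm p f * Lp_norm p' g"
    using w(3) unfolding Hdot_norm_def w'_def by simp
  qed
 qed
qed

end
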